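(* Assume $n=1$ or $n=2$, and let $X=X_n$. Then any spherical function on $X$ is a constant multiple of $\Psi(x;z_0)$ for some $z_0\in\mathbb C^n/S_n$.
   Context: $k$ is a $\mathfrak p$-adic field of odd residual characteristic with ring of integers $\mathfrak o$, prime element $\pi$, $q=\#(\mathfrak o/\pi\mathfrak o)$, absolute value $|\cdot|$ with $|\pi|=q^{-1}$. $D$ is the division quaternion algebra over $k$ with canonical involution $*$ and maximal order $\mathcal O$; $N_{rd}$ is the reduced norm. For $A=(a_{ij})$, $A^*=(a_{ji}^* )$. $G=GL_n(D)$, $K=GL_n(\mathcal O)$, $X_n=\{A\in G:A^*=A\}$, $g\cdot A=gAg^*$. For $x\in X$, $x^{(i)}$ is the upper left $i\times i$ block, $N_{rd}(x^{(i)})$ is a square in $k$, and $d_i(x)\in k$ satisfies $d_i(x)^2=N_{rd}(x^{(i)})$. $\omega(x;s)=\int_K|\mathbf d(k\cdot x)|^s\,dk$, where $|\mathbf d(y)|^s=\prod_i|d_i(y)|^{s_i}$ if all $d_i(y)\ne0$ and $0$ otherwise ($dk$ Haar, total mass 1); it converges absolutely for $\mathrm{Re}(s_i)\ge0$ $(1\le i\le n-1)$ and continues to a rational function of $q^{s_1},\ldots,q^{s_n}$. Put $s_i=-z_i+z_{i+1}-2$ $(1\le i\le n-1)$, $s_n=-z_n+n-1$, $\omega(x;z)=\omega(x;s)$, and $\Psi(x;z)=\prod_{1\le i<j\le n}(q^{z_j}-q^{z_i+1})\cdot\omega(x;z)$, which lies in $\mathbb C[q^{\pm z_1},\ldots,q^{\pm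 z_n}]^{S_n}$ ($S_n$ permuting the $z_i$), so that $\Psi(x;z_0)$ is defined for every $z_0\in\mathbb C^n/S_n$. $\mathcal H(G,K)$ is the Hecke algebra of $G$ with respect to $K$, acting on $K$-invariant functions on $X$ by $(f*\Phi)(x)=\int_Gf(g)\Phi(g^{-1}\cdot x)\,dg$ ($\mathrm{vol}(K)=1$). A spherical function on $X$ is a nonzero $K$-invariant function $X\to\mathbb C$ that is a common eigenfunction for $\mathcal H(G,K)$. *)

theory Defs
  imports
    "HOL-Analysis.Bochner_Integration"
    "HOL-Analysis.Function_Topology"
    "HOL-Analysis.Complex_Transcendental"
    "HOL-Algebra.Algebraic_Closure_Type"
    "Jordan_Normal_Form.Determinant"
begin

section \<open>The base field and the quaternion algebra\<close>

text \<open>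
  \<open>'k\<close> carries the field \<open>k\<close> and \<open>'d\<close> the quaternion algebra \<open>D\<close>; \<open>emb\<close> is the
  structure map \<open>k \<rightarrow> D\<close>.
\<close>

record ('k, 'd) quat_datum =
  absv :: "'k \<Rightarrow> real"
  unif :: "'k"
  emb :: "'k \<Rightarrow> 'd"
  star :: "'d \<Rightarrow> 'd"
  maxord :: "'d set"

definition int_ring :: "('k :: field, 'd) quat_datum \<Rightarrow> 'k set" where
  "int_ring Q = {x. absv Q x \<le> 1}"

definition residue_classes :: "('k :: field, 'd) quat_datum \<Rightarrow> 'k set set" where
  "residue_classes Q = int_ring Q //
     {(x, y). x \<in> int_ring Q \<and> y \<in> int_ring Q \<and> (\<exists>t \<in> int_ring Q. x - y = unif Q * t)}"

definition resq :: "('k :: field, 'd) quat_datum \<Rightarrow> nat" where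
  "resq Q = card (residue_classes Q)"

text \<open>
  Finite extensions of the \<open>p\<close>-adic numbers are the fields of characteristic zero (imposed by
  the sort of \<open>'k\<close>) that are complete for a discrete absolute value with finite residue field.
  The condition on \<open>unif\<close> says that it generates the maximal ideal, which includes discreteness.
\<close>

definition padic_field :: "('k :: field_char_0, 'd) quat_datum \<Rightarrow> bool" where
  "padic_field Q \<longleftrightarrow>
     (\<forall>x. absv Q x \<ge> 0) \<and>
     (\<forall>x. absv Q x = 0 \<longleftrightarrow> x = 0) \<and>
     (\<forall>x y. absv Q (x * y) = absv Q x * absv Q y) \<and>
     (\<forall>x y. absv Q (x + y) \<le> max (absv Q x) (absv Q y)) \<and>
     unif Q \<noteq> 0 \<and>
     {x. absv Q x < 1} = (\<lambda>t. unif Q * t) ` int_ring Q \<and>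
     finite (residue_classes Q) \<and>
     absv Q (unif Q) = 1 / real (resq Q) \<and>
     (\<forall>u :: nat \<Rightarrow> 'k.
        (\<forall>e > 0. \<exists>N. \<forall>i \<ge> N. \<forall>j \<ge> N. absv Q (u i - u j) < e) \<longrightarrow>
        (\<exists>l. (\<lambda>i. absv Q (u i - l)) \<longlonglongrightarrow> 0))"

definition kscale :: "('k :: field, 'd :: division_ring) quat_datum \<Rightarrow> 'k \<Rightarrow> 'd \<Rightarrow> 'd" where
  "kscale Q c x = emb Q c * x"

text \<open>A quaternion division algebra is a central division algebra of dimension 4.\<close>

definition quaternion_division_algebra ::
    "('k :: field, 'd :: division_ring) quat_datum \<Rightarrow> bool" where
  "quaternion_division_algebra Q \<longleftrightarrow>
     emb Q 1 = 1 \<and>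
     (\<forall>a b. emb Q (a + b) = emb Q a + emb Q b) \<and>
     (\<forall>a b. emb Q (a * b) = emb Q a * emb Q b) \<and>
     range (emb Q) = {x. \<forall>y. x * y = y * x} \<and>
     vector_space.dim (kscale Q) UNIV = 4"

text \<open>
  The canonical involution is the only \<open>k\<close>-linear anti-involution \<open>*\<close> with \<open>x * x\<^sup>*\<close> central
  for all \<open>x\<close>; replacing \<open>x\<close> by \<open>x + 1\<close> shows that \<open>x + x\<^sup>*\<close> is central as well.
\<close>

definition canonical_involution ::
    "('k :: field, 'd :: division_ring) quat_datum \<Rightarrow> bool" where
  "canonical_involution Q \<longleftrightarrow>
     (\<forall>x y. star Q (x + y) = star Q x + star Q y) \<and>
     (\<forall>c x. star Q (kscale Q c x) = kscale Q c (star Q x)) \<and>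
     (\<forall>x y. star Q (x * y) = star Q y * star Q x) \<and>
     (\<forall>x. star Q (star Q x) = x) \<and>
     (\<forall>x. x * star Q x \<in> range (emb Q))"

definition is_order ::
    "('k :: field, 'd :: division_ring) quat_datum \<Rightarrow> 'd set \<Rightarrow> bool" where
  "is_order Q R \<longleftrightarrow>
     1 \<in> R \<and> (\<forall>x \<in> R. \<forall>y \<in> R. x - y \<in> R \<and> x * y \<in> R) \<and>
     (\<exists>S. finite S \<and>
        R = {x. \<exists>c. (\<forall>s \<in> S. c s \<in> int_ring Q) \<and> x = (\<Sum>s\<in>S. kscale Q (c s) s)}) \<and>
     module.span (kscale Q) R = UNIV"

definition is_maximal_order ::
    "('k :: field, 'd :: division_ring) quat_datum \<Rightarrow> 'd set \<Rightarrow> bool" where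
  "is_maximal_order Q R \<longleftrightarrow> is_order Q R \<and> (\<forall>R'. is_order Q R' \<and> R \<subseteq> R' \<longrightarrow> R' = R)"

definition padic_quaternion ::
    "('k :: field_char_0, 'd :: division_ring) quat_datum \<Rightarrow> bool" where
  "padic_quaternion Q \<longleftrightarrow>
     padic_field Q \<and> odd (resq Q) \<and> quaternion_division_algebra Q \<and>
     canonical_involution Q \<and> is_maximal_order Q (maxord Q)"


section \<open>Reduced norms\<close>

text \<open>
  A homomorphism of \<open>k\<close>-algebras from \<open>D\<close> to the \<open>2 \<times> 2\<close> matrices over the algebraic closure;
  by dimension it induces an isomorphism after extension of scalars, that is, a splitting.
\<close>

definition splitting ::
    "('k :: field, 'd :: division_ring) quat_datum \<Rightarrow> ('d \<Rightarrow> 'k alg_closure mat) \<Rightarrow> bool" where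
  "splitting Q \<rho> \<longleftrightarrow>
     (\<forall>x. \<rho> x \<in> carrier_mat 2 2) \<and>
     (\<forall>x y. \<rho> (x + y) = \<rho> x + \<rho> y) \<and>
     (\<forall>x y. \<rho> (x * y) = \<rho> x * \<rho> y) \<and>
     (\<forall>c. \<rho> (emb Q c) = to_ac c \<cdot>\<^sub>m 1\<^sub>m 2)"

definition split_mat :: "('d \<Rightarrow> 'e mat) \<Rightarrow> 'd mat \<Rightarrow> 'e mat" where
  "split_mat \<rho> A = Matrix.mat (2 * dim_row A) (2 * dim_col A)
     (\<lambda>(i, j). \<rho> (A $$ (i div 2, j div 2)) $$ (i mod 2, j mod 2))"

text \<open>The value does not depend on the splitting and lies in \<open>k\<close>.\<close>

definition Nrd ::
    "('k :: field, 'd :: division_ring) quat_datum \<Rightarrow> 'd mat \<Rightarrow> 'k" where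
  "Nrd Q A = (THE c. \<exists>\<rho>. splitting Q \<rho> \<and> to_ac c = Determinant.det (split_mat \<rho> A))"


section \<open>Groups and hermitian matrices\<close>

definition GLD :: "('k, 'd :: division_ring) quat_datum \<Rightarrow> nat \<Rightarrow> 'd mat monoid" where
  "GLD Q n = units_of (ring_mat TYPE('d) n ())"

definition GLO :: "('k, 'd :: division_ring) quat_datum \<Rightarrow> nat \<Rightarrow> 'd mat set" where
  "GLO Q n = {A \<in> carrier (GLD Q n).
     elements_mat A \<subseteq> maxord Q \<and> elements_mat (inv\<^bsub>GLD Q n\<^esub> A) \<subseteq> maxord Q}"

definition adj :: "('k, 'd) quat_datum \<Rightarrow> 'd mat \<Rightarrow> 'd mat" where
  "adj Q A = map_mat (star Q) (transpose_mat A)"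

definition herm :: "('k, 'd :: division_ring) quat_datum \<Rightarrow> nat \<Rightarrow> 'd mat set" where
  "herm Q n = {A \<in> carrier (GLD Q n). adj Q A = A}"

definition act :: "('k, 'd :: division_ring) quat_datum \<Rightarrow> 'd mat \<Rightarrow> 'd mat \<Rightarrow> 'd mat" where
  "act Q g A = g * A * adj Q g"

text \<open>
  The topology of \<open>G\<close> as a subspace of the matrices over \<open>D\<close>, where the sets
  \<open>a + \<pi>\<^sup>m \<O>\<close> form a base of the topology of \<open>D\<close>.
\<close>

definition GL_ball ::
    "('k :: field, 'd :: division_ring) quat_datum \<Rightarrow> nat \<Rightarrow> 'd mat \<Rightarrow> nat \<Rightarrow> 'd mat set" where
  "GL_ball Q n A m = {B \<in> carrier (GLD Q n).
     \<forall>i < n. \<forall>j < n. \<exists>t \<in> maxord Q. B $$ (i, j) - A $$ (i, j) = emb Q (unif Q ^ m) * t}"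

definition GL_topology ::
    "('k :: field, 'd :: division_ring) quat_datum \<Rightarrow> nat \<Rightarrow> 'd mat topology" where
  "GL_topology Q n = topology_generated_by {GL_ball Q n A m | A m. A \<in> carrier (GLD Q n)}"

text \<open>
  Regularity need not be required: the groups considered here are second countable and
  locally compact.
\<close>

definition haar_measure :: "'g monoid \<Rightarrow> 'g topology \<Rightarrow> 'g measure \<Rightarrow> bool" where
  "haar_measure H T M \<longleftrightarrow>
     space M = carrier H \<and>
     sets M = sigma_sets (carrier H) {U. openin T U} \<and>
     (\<forall>g \<in> carrier H. \<forall>A \<in> sets M. emeasure M ((\<lambda>h. g \<otimes>\<^bsub>H\<^esub> h) ` A) = emeasure M A) \<and>
     (\<forall>C \<in> sets M. compactin T C \<longrightarrow> emeasure M C < \<infinity>) \<and>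
     (\<forall>U. openin T U \<and> U \<noteq> {} \<longrightarrow> emeasure M U > 0)"

definition haar_G ::
    "('k :: field, 'd :: division_ring) quat_datum \<Rightarrow> nat \<Rightarrow> 'd mat measure \<Rightarrow> bool" where
  "haar_G Q n M \<longleftrightarrow> haar_measure (GLD Q n) (GL_topology Q n) M \<and> emeasure M (GLO Q n) = 1"

definition haar_K ::
    "('k :: field, 'd :: division_ring) quat_datum \<Rightarrow> nat \<Rightarrow> 'd mat measure \<Rightarrow> bool" where
  "haar_K Q n M \<longleftrightarrow>
     haar_measure ((GLD Q n)\<lparr>carrier := GLO Q n\<rparr>)
       (subtopology (GL_topology Q n) (GLO Q n)) M \<and>
     emeasure M (GLO Q n) = 1"


section \<open>The functions \<open>\<omega>\<close> and \<open>\<Psi>\<close>\<close>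

text \<open>The choice of the square root is irrelevant, since only its absolute value is used.\<close>

definition dpf ::
    "('k :: field, 'd :: division_ring) quat_datum \<Rightarrow> nat \<Rightarrow> 'd mat \<Rightarrow> 'k" where
  "dpf Q i x = (SOME d. d ^ 2 = Nrd Q (Matrix.mat i i (\<lambda>ab. x $$ ab)))"

definition dpow ::
    "('k :: field, 'd :: division_ring) quat_datum \<Rightarrow> nat \<Rightarrow> 'd mat \<Rightarrow> (nat \<Rightarrow> complex) \<Rightarrow> complex"
  where
  "dpow Q n y s =
     (if \<forall>i \<in> {1..n}. dpf Q i y \<noteq> 0
      then \<Prod>i = 1..n. complex_of_real (absv Q (dpf Q i y)) powr s i
      else 0)"

definition omega_int ::
    "('k :: field, 'd :: division_ring) quat_datum \<Rightarrow> nat \<Rightarrow> 'd mat measure \<Rightarrow> 'd mat \<Rightarrow>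
     (nat \<Rightarrow> complex) \<Rightarrow> complex" where
  "omega_int Q n \<nu> x s = (\<integral>h. dpow Q n (act Q h x) s \<partial>\<nu>)"

text \<open>Laurent polynomials in \<open>q\<^bsup>w\<^sub>1\<^esup>, \<dots>, q\<^bsup>w\<^sub>n\<^esup>\<close>, as functions of the exponents \<open>w\<close>.\<close>

definition laurent_fun :: "nat \<Rightarrow> nat \<Rightarrow> ((nat \<Rightarrow> complex) \<Rightarrow> complex) \<Rightarrow> bool" where
  "laurent_fun q n P \<longleftrightarrow>
     (\<exists>(F :: (nat \<Rightarrow> int) set) c. finite F \<and>
        (\<forall>w. P w = (\<Sum>a\<in>F. c a * (\<Prod>i = 1..n. (of_nat q powr w i) powi a i))))"

text \<open>
  The rational function \<open>A / B\<close> in the \<open>q\<^bsup>s\<^sub>i\<^esup>\<close> continues \<open>\<omega>(x;s)\<close> from the domain where the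
  integral converges.
\<close>

definition omega_rational ::
    "('k :: field, 'd :: division_ring) quat_datum \<Rightarrow> nat \<Rightarrow> 'd mat measure \<Rightarrow> 'd mat \<Rightarrow>
     ((nat \<Rightarrow> complex) \<Rightarrow> complex) \<Rightarrow> ((nat \<Rightarrow> complex) \<Rightarrow> complex) \<Rightarrow> bool" where
  "omega_rational Q n \<nu> x A B \<longleftrightarrow>
     laurent_fun (resq Q) n A \<and> laurent_fun (resq Q) n B \<and> (\<exists>s. B s \<noteq> 0) \<and>
     (\<forall>s. (\<forall>i. 1 \<le> i \<and> i < n \<longrightarrow> Re (s i) \<ge> 0) \<longrightarrow> B s * omega_int Q n \<nu> x s = A s)"

definition s_of_z :: "nat \<Rightarrow> (nat \<Rightarrow> complex) \<Rightarrow> nat \<Rightarrow> complex" where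
  "s_of_z n z i = (if i = n then - z n + of_nat n - 1 else - z i + z (i + 1) - 2)"

text \<open>
  \<open>\<Psi>(x; \<cdot>)\<close> is the Laurent polynomial in the \<open>q\<^bsup>z\<^sub>i\<^esup>\<close> that equals
  \<open>\<Prod>\<^bsub>i<j\<^esub> (q\<^bsup>z\<^sub>j\<^esup> - q\<^bsup>z\<^sub>i + 1\<^esup>) \<cdot> \<omega>(x;z)\<close> as a rational function. Being symmetric in
  \<open>z\<^sub>1, \<dots>, z\<^sub>n\<close>, it takes the same value at all representatives of a point of \<open>\<complex>\<^sup>n / S\<^sub>n\<close>.
\<close>

definition Psi ::
    "('k :: field, 'd :: division_ring) quat_datum \<Rightarrow> nat \<Rightarrow> 'd mat measure \<Rightarrow> 'd mat \<Rightarrow>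
     (nat \<Rightarrow> complex) \<Rightarrow> complex" where
  "Psi Q n \<nu> x = (THE P. laurent_fun (resq Q) n P \<and>
     (\<exists>A B. omega_rational Q n \<nu> x A B \<and>
        (\<forall>z. P z * B (s_of_z n z) =
           (\<Prod>j = 1..n. \<Prod>i = 1..<j. of_nat (resq Q) powr z j - of_nat (resq Q) powr (z i + 1))
           * A (s_of_z n z))))"


section \<open>The Hecke algebra and spherical functions\<close>

definition hecke_algebra ::
    "('k :: field, 'd :: division_ring) quat_datum \<Rightarrow> nat \<Rightarrow> ('d mat \<Rightarrow> complex) set" where
  "hecke_algebra Q n = {f.
     (\<forall>h \<in> GLO Q n. \<forall>h' \<in> GLO Q n. \<forall>g \<in> carrier (GLD Q n). f (h * g * h') = f g) \<and>
     (\<exists>C. compactin (GL_topology Q n) C \<and> (\<forall>g \<in> carrier (GLD Q n) - C. f g = 0))}"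

definition hecke_act ::
    "('k :: field, 'd :: division_ring) quat_datum \<Rightarrow> nat \<Rightarrow> 'd mat measure \<Rightarrow>
     ('d mat \<Rightarrow> complex) \<Rightarrow> ('d mat \<Rightarrow> complex) \<Rightarrow> 'd mat \<Rightarrow> complex" where
  "hecke_act Q n \<mu> f \<Phi> x = (\<integral>g. f g * \<Phi> (act Q (inv\<^bsub>GLD Q n\<^esub> g) x) \<partial>\<mu>)"

text \<open>Functions on \<open>X\<close> are represented by functions on all matrices, used only on \<open>X\<close>.\<close>

definition spherical_function ::
    "('k :: field, 'd :: division_ring) quat_datum \<Rightarrow> nat \<Rightarrow> 'd mat measure \<Rightarrow>
     ('d mat \<Rightarrow> complex) \<Rightarrow> bool" where
  "spherical_function Q n \<mu> \<Phi> \<longleftrightarrow>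
     (\<exists>x \<in> herm Q n. \<Phi> x \<noteq> 0) \<and>
     (\<forall>h \<in> GLO Q n. \<forall>x \<in> herm Q n. \<Phi> (act Q h x) = \<Phi> x) \<and>
     (\<forall>f \<in> hecke_algebra Q n. \<exists>ev. \<forall>x \<in> herm Q n. hecke_act Q n \<mu> f \<Phi> x = ev * \<Phi> x)"

end

theory Submission
  imports Defs "HOL-Complex_Analysis.Conformal_Mappings"
begin

text \<open>
  For \<open>n = 2\<close> two Hecke operators suffice: the one of the scalar \<open>\<tau>\<close>, a uniformizer of \<open>D\<close>, and
  the one of the double coset of \<open>diag(1, \<tau>)\<close>. The \<open>K\<close>-orbits on \<open>X\<close> are represented by diagonal matrices
  \<open>diag(\<pi>\<^sup>i, \<pi>\<^sup>j)\<close> and by multiples of the antidiagonal matrix with entries \<open>\<tau>, \<tau>*\<close>, and the two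
  eigenvalue equations, for eigenvalues \<open>c\<close> and \<open>\<lambda>\<close>, are recurrences which determine an eigenfunction
  from its value at the antidiagonal matrix. For lower triangular coset representatives the integral
  \<open>\<omega>(x; s)\<close> satisfies the same recurrences with explicit eigenvalues, and it can be computed at the
  antidiagonal matrix because a single entry of \<open>k\<close> decides the size of \<open>d\<^sub>1\<close>. This makes \<open>\<Psi>(x; z)\<close> explicit in
  \<open>c = q\<^bsup>z1 + z2\<^esup>\<close> and \<open>\<lambda> = m q\<^bsup>z2 - 1\<^esup> + q\<^bsup>z1 + 1\<^esup>\<close>, \<open>m\<close> being the size of the residue field of \<open>\<O>\<close>, and every
  pair \<open>(c, \<lambda>)\<close> with \<open>c \<noteq> 0\<close> arises from some \<open>z\<close> by solving a quadratic equation.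
\<close>

section \<open>The \<open>p\<close>-adic field\<close>

text \<open>The delicate point is to show that an integral over K is a Hecke eigenfunction when only
  left invariance of the Haar measures is given. Right invariance of \<nu>, and the fact that K and
  its right translate by a coset representative have equal \<mu>-mass, come from counting balls: on
  unions of balls of one radius, a content constant on balls is determined by its total mass. The
  Hecke relation for \<omega> is then a double count of one subset of the double coset, along right
  and along left cosets of K.

  The counts m and \<open>zeros\<close> stay symbolic: a spherical function and \<omega> satisfy
  recurrences with the same counts, so the comparison holds whatever their values.

  The quadratic equation arises because lam = T + m c / T with T = q^(z1 + 1). The factor q^z2 -
  q^(z1 + 1) in \<Psi> cancels the denominator of the geometric series for \<omega> at the
  antidiagonal matrix, which leaves (q - 1) q^(z1 + z2) there. This is never 0, so \<Psi>(.; z) can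
  be rescaled to any prescribed value at that matrix.\<close>

locale local_field =
  fixes Q :: "('k :: field_char_0, 'd :: division_ring) quat_datum"
  assumes padic: "padic_field Q" and odd_resq: "odd (resq Q)"
begin

abbreviation "av \<equiv> absv Q"
abbreviation "q \<equiv> resq Q"
abbreviation "\<pi> \<equiv> unif Q"

section \<open>Elementary ultrametric estimates\<close>

lemma av_nonneg [simp]: "0 \<le> av x"
  and av_eq_0 [simp]: "av x = 0 \<longleftrightarrow> x = 0"
  and av_mult: "av (x * y) = av x * av y"
  and av_add: "av (x + y) \<le> max (av x) (av y)"
  and unif_nz [simp]: "\<pi> \<noteq> 0"
  and max_ideal: "{x. av x < 1} = (\<lambda>t. \<pi> * t) ` int_ring Q"
  and fin_res: "finite (residue_classes Q)"
  and av_unif: "av \<pi> = 1 / real q"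
  and complete: "(\<And>e. e > 0 \<Longrightarrow> \<exists>N. \<forall>i \<ge> N. \<forall>j \<ge> N. av (u i - u j) < e) \<Longrightarrow>
                   \<exists>l. (\<lambda>i. av (u i - l)) \<longlonglongrightarrow> 0"
  using padic unfolding padic_field_def by auto

lemma av_0 [simp]: "av 0 = 0"
  by simp

lemma av_1 [simp]: "av 1 = 1"
  using av_mult[of 1 1] by simp

lemma av_minus [simp]: "av (- x) = av x"
proof -
  have "av (-1) * av (-1) = 1" using av_mult[of "-1" "-1"] by simp
  hence "av (-1) = 1"
    using av_nonneg[of "-1"] by (metis abs_of_nonneg power2_eq_square power2_eq_1_iff abs_1 abs_minus_cancel)
  thus ?thesis using av_mult[of "-1" x] by simp
qed

lemma av_diff: "av (x - y) \<le> max (av x) (av y)"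
  using av_add[of x "-y"] by simp

lemma av_diff_commute: "av (x - y) = av (y - x)"
  using av_minus[of "x - y"] by simp

lemma av_add_le: "av x \<le> r \<Longrightarrow> av y \<le> r \<Longrightarrow> av (x + y) \<le> r"
  using av_add[of x y] by linarith

lemma av_diff_le: "av x \<le> r \<Longrightarrow> av y \<le> r \<Longrightarrow> av (x - y) \<le> r"
  using av_diff[of x y] by linarith

lemma av_add_less: "av x < r \<Longrightarrow> av y < r \<Longrightarrow> av (x + y) < r"
  using av_add[of x y] by linarith

lemma av_diff_less: "av x < r \<Longrightarrow> av y < r \<Longrightarrow> av (x - y) < r"
  using av_diff[of x y] by linarith

lemma av_add_eq: "av x < av y \<Longrightarrow> av (x + y) = av y"
  using av_add[of x y] av_diff[of "x + y" x] by auto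

lemma av_add_eq': "av x < av y \<Longrightarrow> av (y + x) = av y"
  using av_add_eq by (metis add.commute)

lemma av_inverse: "av (inverse x) = inverse (av x)"
proof (cases "x = 0")
  case False
  hence "av x * av (inverse x) = 1" using av_mult[of x "inverse x"] by simp
  thus ?thesis by (metis inverse_unique)
qed simp

lemma av_divide: "av (x / y) = av x / av y"
  by (simp add: divide_inverse av_mult av_inverse)

lemma av_power: "av (x ^ m) = av x ^ m"
  by (induction m) (auto simp: av_mult)

lemma av_power_int: "av (x powi m) = av x powi m"
  by (simp add: power_int_def av_power av_inverse)

lemma q_ge_3: "q \<ge> 3"
proof -
  have "\<pi> \<in> {x. av x < 1}"
    unfolding max_ideal by (rule image_eqI[of _ _ 1]) (auto simp: int_ring_def)
  hence "1 / real q < 1" using av_unif by simp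
  hence "q \<noteq> 1" by auto
  moreover have "q \<noteq> 0" "q \<noteq> 2" using odd_resq by (auto dest: odd_pos)
  ultimately show ?thesis by linarith
qed

lemma q_gt_1: "real q > 1" and q_pos: "real q > 0" and q_nz: "real q \<noteq> 0"
  using q_ge_3 by auto

text \<open>Because \<pi> generates the maximal ideal, no value of \<open>av\<close> lies strictly
  between 1/q and 1. Strict and non-strict bounds are exchanged through this gap throughout.\<close>

lemma av_lt_1_iff: "av x < 1 \<longleftrightarrow> av x \<le> 1 / real q"
proof
  assume "av x < 1"
  then obtain t where "av t \<le> 1" "x = \<pi> * t" using max_ideal by (auto simp: int_ring_def)
  thus "av x \<le> 1 / real q" using q_pos by (simp add: av_mult av_unif divide_right_mono)
next
  assume "av x \<le> 1 / real q"
  also have "\<dots> < 1" using q_gt_1 by simp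
  finally show "av x < 1" .
qed

text \<open>Multiplying by a power of \<pi>, with exponent the rounded logarithm of
  \<open>av x\<close> to base q, brings the value above 1/q and to at most 1; the gap in
  \<open>av_lt_1_iff\<close> leaves only 1.\<close>

lemma av_values:
  assumes "x \<noteq> 0"
  obtains m :: int where "av x = real q powi m"
proof -
  define m where "m = \<lceil>log (real q) (av x)\<rceil>"
  have pos: "av x > 0" using assms by (simp add: less_le)
  have "av x = real q powr log (real q) (av x)" using pos q_gt_1 by simp
  hence up: "av x \<le> real q powi m"
    using q_gt_1 unfolding m_def
    by (smt (verit, best) powr_mono powr_real_of_int' q_pos le_of_int_ceiling)
  have lo: "av x > real q powi (m - 1)"
  proof -
    have "real q powr (of_int (m - 1)) < real q powr log (real q) (av x)"
      using q_gt_1 unfolding m_def by (intro powr_less_mono) linarith+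
    moreover have "real q powr (of_int (m - 1)) = real q powi (m - 1)"
      using q_gt_1 by (intro powr_real_of_int') auto
    ultimately show ?thesis using pos q_gt_1 by simp
  qed
  define y where "y = x * \<pi> powi m"
  have avy: "av y = av x * (real q powi (-m))"
    by (simp add: y_def av_mult av_power_int av_unif power_int_minus power_int_inverse divide_inverse)
  have "av y \<le> 1"
    using up q_pos unfolding avy by (simp add: power_int_minus field_simps)
  moreover have "av y > 1 / real q"
  proof -
    have "real q powi (m - 1) * real q powi (-m) = 1 / real q"
      using q_pos by (simp add: power_int_diff power_int_minus)
    moreover have "real q powi (m - 1) * real q powi (-m) < av x * real q powi (-m)"
      using lo q_pos by (intro mult_strict_right_mono) auto
    ultimately show ?thesis unfolding avy by simp
  qed
  ultimately have "av y = 1" using av_lt_1_iff[of y] by force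
  hence "av x = real q powi m" using q_pos unfolding avy by (simp add: power_int_minus field_simps)
  thus thesis using that by blast
qed

section \<open>Representatives of the residue field of k\<close>

definition res_rel :: "('k \<times> 'k) set" where
  "res_rel = {(x, y). av x \<le> 1 \<and> av y \<le> 1 \<and> av (x - y) < 1}"

lemma residue_classes_eq: "residue_classes Q = {x. av x \<le> 1} // res_rel"
proof -
  have "(\<exists>t\<in>int_ring Q. x - y = \<pi> * t) \<longleftrightarrow> av (x - y) < 1" for x y
    using max_ideal by blast
  thus ?thesis by (simp add: residue_classes_def res_rel_def int_ring_def)
qed

lemma equiv_res_rel: "equiv {x. av x \<le> 1} res_rel"
proof (rule equivI)
  show "trans res_rel"
  proof (rule transI)
    fix x y z assume "(x, y) \<in> res_rel" "(y, z) \<in> res_rel"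
    moreover have "x - z = (x - y) + (y - z)" by simp
    ultimately show "(x, z) \<in> res_rel" unfolding res_rel_def using av_add_less by force
  qed
qed (auto simp: res_rel_def refl_on_def sym_def av_diff_commute)

lemma residue_eq_iff:
  assumes "av x \<le> 1" "av y \<le> 1"
  shows "res_rel `` {x} = res_rel `` {y} \<longleftrightarrow> av (x - y) < 1"
  using eq_equiv_class_iff[OF equiv_res_rel, of x y] assms by (auto simp: res_rel_def)

lemma residue_reps:
  obtains R where "finite R" "card R = q" "\<And>r. r \<in> R \<Longrightarrow> av r \<le> 1"
    "\<And>x. av x \<le> 1 \<Longrightarrow> \<exists>r \<in> R. av (x - r) < 1"
    "\<And>r r'. r \<in> R \<Longrightarrow> r' \<in> R \<Longrightarrow> av (r - r') < 1 \<Longrightarrow> r = r'"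
proof -
  let ?c = "\<lambda>x. res_rel `` {x}"
  have img: "residue_classes Q = ?c ` {x. av x \<le> 1}"
    by (auto simp: residue_classes_eq quotient_def)
  \<comment> \<open>A section of the class map: a set on which it is injective with full
    image.\<close>
  have "\<exists>R \<subseteq> {x. av x \<le> 1}. inj_on ?c R \<and> ?c ` {x. av x \<le> 1} = ?c ` R"
    by (subst subset_image_inj[symmetric]) (rule subset_refl)
  then obtain R where R: "R \<subseteq> {x. av x \<le> 1}" "inj_on ?c R" "residue_classes Q = ?c ` R"
    by (elim exE conjE) (rule that, simp_all add: img)
  show thesis
  proof (rule that[of R])
    show "finite R" using R fin_res by (metis finite_image_iff)
    show "card R = q" using R by (metis card_image resq_def)
    show "av r \<le> 1" if "r \<in> R" for r using that R by auto
    show "\<exists>r\<in>R. av (x - r) < 1" if "av x \<le> 1" for x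
    proof -
      have "?c x \<in> ?c ` R" using that R img by blast
      then obtain r where "r \<in> R" "?c x = ?c r" by blast
      thus ?thesis using residue_eq_iff[OF that, of r] R(1) by blast
    qed
    show "r = r'" if "r \<in> R" "r' \<in> R" "av (r - r') < 1" for r r'
      using that R residue_eq_iff[of r r'] by (metis (mono_tags, lifting) inj_on_def mem_Collect_eq subsetD)
  qed
qed

end

lemma even_card_involution:
  assumes "finite A" "\<And>x. x \<in> A \<Longrightarrow> f x \<in> A" "\<And>x. x \<in> A \<Longrightarrow> f (f x) = x" "\<And>x. x \<in> A \<Longrightarrow> f x \<noteq> x"
  shows "even (card A)"
  using assms
proof (induction "card A" arbitrary: A rule: less_induct)
  case less
  show ?case
  proof (cases "A = {}")
    case False
    then obtain x where x: "x \<in> A" by blast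
    let ?B = "A - {x, f x}"
    have c: "card A = card ?B + 2"
      using less.prems x card_Diff_subset[of "{x, f x}" A] card_mono[of A "{x, f x}"] by force
    have "even (card ?B)"
    proof (rule less.hyps)
      fix y assume "y \<in> ?B"
      thus "f y \<in> ?B" using less.prems(2,3) x by (metis Diff_iff insert_iff empty_iff)
    qed (use c less.prems in auto)
    thus ?thesis using c by simp
  qed simp
qed

section \<open>Squares in k and quadratic forms over the residue field\<close>

context local_field begin

text \<open>If 2 were not a unit, r \<mapsto> r + 1 would induce an involution without fixed points
  on the residue field, whose cardinality q is odd.\<close>

lemma av_2 [simp]: "av 2 = 1"
proof (rule ccontr)
  assume neq: "av 2 \<noteq> 1"
  have "av 2 \<le> 1" using av_add[of 1 1] by simp
  hence lt: "av 2 < 1" using neq by simp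
  obtain R where R: "finite R" "card R = q" "\<And>r. r \<in> R \<Longrightarrow> av r \<le> 1"
    "\<And>x. av x \<le> 1 \<Longrightarrow> \<exists>r \<in> R. av (x - r) < 1"
    "\<And>r r'. r \<in> R \<Longrightarrow> r' \<in> R \<Longrightarrow> av (r - r') < 1 \<Longrightarrow> r = r'" by (rule residue_reps) blast
  define f where "f r = (SOME r'. r' \<in> R \<and> av (r + 1 - r') < 1)" for r
  have f: "f r \<in> R" "av (r + 1 - f r) < 1" if "r \<in> R" for r
  proof -
    have "\<exists>r'. r' \<in> R \<and> av (r + 1 - r') < 1" using R(3,4) that av_add_le[of r 1 1] by force
    thus "f r \<in> R" "av (r + 1 - f r) < 1" unfolding f_def by (metis (mono_tags, lifting) someI_ex)+
  qed
  have "even (card R)"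
  proof (rule even_card_involution[of R f])
    fix r assume r: "r \<in> R"
    have "f (f r) - r = 2 - (r + 1 - f r) - (f r + 1 - f (f r))" by simp
    hence "av (f (f r) - r) < 1" using f[OF r] f(2)[OF f(1)[OF r]] lt av_diff_less by metis
    thus "f (f r) = r" using R(5) f r by blast
    show "f r \<noteq> r" using f(2)[OF r] by auto
  qed (use R f in auto)
  thus False using R(2) odd_resq by simp
qed

lemma av_half [simp]: "av (x / 2) = av x"
  by (simp add: av_divide)

lemma av_double [simp]: "av (2 * x) = av x"
  by (simp add: av_mult)

text \<open>Hensel's lemma for squares: \<open>y \<mapsto> (a - y\<^sup>2) / 2\<close> is a contraction of \<open>{y. |y| \<le> |a|}\<close>
  whose fixed point satisfies \<open>(1 + y)\<^sup>2 = 1 + a\<close>.\<close>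

lemma sqrt_one_plus:
  assumes a: "av a < 1"
  obtains r where "r * r = 1 + a" "av (r - 1) < 1"
proof -
  define u where "u = rec_nat 0 (\<lambda>_ y. (a - y * y) / 2)"
  have u0: "u 0 = 0" and us: "u (Suc i) = (a - u i * u i) / 2" for i by (simp_all add: u_def)
  have b: "av (u i) \<le> av a" for i
  proof (induction i)
    case (Suc i)
    have "av (u i) * av (u i) \<le> av a * 1" using Suc a by (intro mult_mono) auto
    thus ?case by (auto simp: us av_mult intro!: av_diff_le)
  qed (simp add: u0)
  have step: "av (u (Suc i) - u i) \<le> av a ^ Suc i" for i
  proof (induction i)
    case (Suc i)
    have "u (Suc (Suc i)) - u (Suc i) = - ((u (Suc i) - u i) * (u (Suc i) + u i) / 2)"
      unfolding us[of "Suc i"] us[of i] by (simp add: field_simps)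
    hence "av (u (Suc (Suc i)) - u (Suc i)) = av (u (Suc i) - u i) * av (u (Suc i) + u i)"
      by (simp add: av_mult)
    also have "\<dots> \<le> av a ^ Suc i * av a" using Suc b by (intro mult_mono av_add_le) auto
    finally show ?case by (simp add: mult.commute)
  qed (use b[of 1] in \<open>simp add: u0\<close>)
  have dist: "av (u (i + k) - u i) \<le> av a ^ Suc i" for i k
  proof (induction k)
    case (Suc k)
    have "av (u (Suc (i + k)) - u (i + k)) \<le> av a ^ Suc i"
      using step[of "i + k"] a power_decreasing[of "Suc i" "Suc (i + k)" "av a"] by force
    moreover have "u (i + Suc k) - u i = (u (Suc (i + k)) - u (i + k)) + (u (i + k) - u i)" by simp
    ultimately show ?case using Suc av_add_le by metis
  qed simp
  have "\<exists>l. (\<lambda>i. av (u i - l)) \<longlonglongrightarrow> 0"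
  proof (rule complete)
    fix e :: real assume "e > 0"
    then obtain N where N: "av a ^ N < e" using real_arch_pow_inv[of e "av a"] a by auto
    have aN: "av a ^ Suc i < e" if "i \<ge> N" for i
      using power_decreasing[of N "Suc i" "av a"] N a that by force
    have "av (u i - u j) < e" if "i \<ge> N" "j \<ge> N" for i j
    proof (cases "i \<le> j")
      case True
      then show ?thesis using dist[of i "j - i"] aN[of i] that by (simp add: av_diff_commute[of "u i"])
    next
      case False
      then show ?thesis using dist[of j "i - j"] aN[of j] that by simp
    qed
    thus "\<exists>N. \<forall>i\<ge>N. \<forall>j\<ge>N. av (u i - u j) < e" by blast
  qed
  then obtain l where l: "(\<lambda>i. av (u i - l)) \<longlonglongrightarrow> 0" by blast
  have near: "\<exists>i. av (u i - l) < e \<and> av (u (Suc i) - l) < e" if "e > 0" for e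
  proof -
    have "eventually (\<lambda>i. av (u i - l) < e) sequentially"
      using order_tendstoD(2)[OF l that] .
    then obtain N where "\<And>i. i \<ge> N \<Longrightarrow> av (u i - l) < e" by (auto simp: eventually_sequentially)
    hence "av (u N - l) < e \<and> av (u (Suc N) - l) < e" by simp
    thus ?thesis by blast
  qed
  have avl: "av l < 1"
  proof -
    obtain i where "av (u i - l) < 1" using near[of 1] by auto
    moreover have "l = u i - (u i - l)" by simp
    ultimately show ?thesis using av_diff_less b[of i] a by (metis le_less_trans)
  qed
  have "2 * l = a - l * l"
  proof (rule ccontr)
    assume "2 * l \<noteq> a - l * l"
    moreover have "2 * l - a + l * l = 2 * l - (a - l * l)" by simp
    ultimately have "2 * l - a + l * l \<noteq> 0" by (metis eq_iff_diff_eq_0)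
    hence e: "av (2 * l - a + l * l) > 0" by (simp add: less_le)
    then obtain i where i: "av (u i - l) < av (2 * l - a + l * l)" "av (u (Suc i) - l) < av (2 * l - a + l * l)"
      using near by blast
    \<comment> \<open>By the recursion the defect of the limit is a sum of two terms, both smaller
      than the defect itself for this index, which is impossible.\<close>
    have "2 * l - a + l * l = 2 * (l - u (Suc i)) + (l - u i) * (l + u i)"
      unfolding us by (simp add: field_simps)
    moreover have "av ((l - u i) * (l + u i)) < av (2 * l - a + l * l)"
    proof -
      have "av (l + u i) \<le> 1" using avl b[of i] a by (intro av_add_le) linarith+
      hence "av (l - u i) * av (l + u i) \<le> av (l - u i) * 1" by (intro mult_left_mono) auto
      thus ?thesis using i(1) by (simp add: av_mult av_diff_commute)
    qed
    moreover have "av (2 * (l - u (Suc i))) < av (2 * l - a + l * l)"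
      using i(2) av_double[of "l - u (Suc i)"] by (simp only: av_diff_commute)
    ultimately show False using av_add_less by (metis less_irrefl)
  qed
  hence "(1 + l) * (1 + l) = 1 + a" by (simp add: algebra_simps)
  thus thesis using that avl by force
qed

text \<open>Pigeonhole in the residue field: squaring has fibres of size at most 2, so the squares
  and the values \<alpha> y^2 + u each occupy more than half of the q classes and must meet.\<close>

lemma universal_form:
  assumes \<alpha>: "av \<alpha> = 1" and u: "av u = 1"
  obtains x y where "av x \<le> 1" "av y \<le> 1" "av (x * x - \<alpha> * (y * y) - u) < 1"
proof -
  obtain R where R: "finite R" "card R = q" "\<And>r. r \<in> R \<Longrightarrow> av r \<le> 1"
    "\<And>x. av x \<le> 1 \<Longrightarrow> \<exists>r \<in> R. av (x - r) < 1"
    "\<And>r r'. r \<in> R \<Longrightarrow> r' \<in> R \<Longrightarrow> av (r - r') < 1 \<Longrightarrow> r = r'" by (rule residue_reps) blast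
  let ?c = "\<lambda>x. res_rel `` {x}"
  have int1: "av (x * x) \<le> 1" if "av x \<le> 1" for x
    using that by (simp add: av_mult mult_le_one)
  have int2: "av (\<alpha> * (x * x) + u) \<le> 1" if "av x \<le> 1" for x
    using int1[OF that] \<alpha> u by (intro av_add_le) (auto simp: av_mult)
  have clos: "?c x \<in> residue_classes Q" if "av x \<le> 1" for x
    using that by (auto simp: residue_classes_eq intro: quotientI)
  define S1 where "S1 = (\<lambda>x. ?c (x * x)) ` R"
  define S2 where "S2 = (\<lambda>x. ?c (\<alpha> * (x * x) + u)) ` R"
  have pm: "av (x - y) < 1 \<or> av (x + y) < 1" if "av (x * x - y * y) < 1" "av x \<le> 1" "av y \<le> 1" for x y
  proof (rule ccontr)
    assume "\<not> ?thesis"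
    hence "1 * 1 \<le> av (x - y) * av (x + y)" by (intro mult_mono) auto
    also have "\<dots> = av (x * x - y * y)" by (simp add: av_mult[symmetric] algebra_simps)
    finally show False using that by simp
  qed
  have fibre: "card (R \<inter> f -` {c}) \<le> 2"
    if f: "\<And>x y. x \<in> R \<Longrightarrow> y \<in> R \<Longrightarrow> f x = f y \<Longrightarrow> av (x * x - y * y) < 1" for f :: "'k \<Rightarrow> 'k set" and c
  proof (cases "R \<inter> f -` {c} = {}")
    case False
    then obtain x where x: "x \<in> R" "f x = c" by auto
    obtain x' where x': "x' \<in> R" "av (- x - x') < 1" using R(4)[of "-x"] R(3) x by auto
    have "R \<inter> f -` {c} \<subseteq> {x, x'}"
    proof
      fix y assume y: "y \<in> R \<inter> f -` {c}"
      hence "av (y - x) < 1 \<or> av (y + x) < 1" using f[of y x] x pm[of y x] R(3) by auto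
      thus "y \<in> {x, x'}"
      proof
        assume "av (y + x) < 1"
        moreover have "y - x' = (y + x) + (- x - x')" by simp
        ultimately have "av (y - x') < 1" using x' av_add_less by metis
        thus ?thesis using R(5) y x' by blast
      qed (use R(5) y x in blast)
    qed
    hence "card (R \<inter> f -` {c}) \<le> card {x, x'}" by (intro card_mono) auto
    also have "\<dots> \<le> 2" by (simp add: card_insert_if)
    finally show ?thesis .
  qed simp
  have big: "2 * card (f ` R) > q"
    if f: "\<And>x y. x \<in> R \<Longrightarrow> y \<in> R \<Longrightarrow> f x = f y \<Longrightarrow> av (x * x - y * y) < 1" for f :: "'k \<Rightarrow> 'k set"
  proof -
    have "card R = (\<Sum>c\<in>f ` R. card (R \<inter> f -` {c}))"
      using sum.image_gen[OF R(1), of "\<lambda>_. 1::nat" f] by (simp add: Int_def vimage_def)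
    also have "\<dots> \<le> (\<Sum>c\<in>f ` R. 2)" by (intro sum_mono fibre f)
    finally have "q \<le> 2 * card (f ` R)" using R(2) by simp
    \<comment> \<open>q is odd, so the inequality is strict.\<close>
    thus ?thesis using odd_resq by (metis dvd_triv_left le_neq_implies_less)
  qed
  have b1: "2 * card S1 > q" unfolding S1_def
    by (rule big) (use R(3) int1 in \<open>auto simp: residue_eq_iff\<close>)
  have b2: "2 * card S2 > q" unfolding S2_def
  proof (rule big)
    fix x y assume xy: "x \<in> R" "y \<in> R" "?c (\<alpha> * (x * x) + u) = ?c (\<alpha> * (y * y) + u)"
    have "av ((\<alpha> * (x * x) + u) - (\<alpha> * (y * y) + u)) < 1"
      using xy R(3) int2 by (simp add: residue_eq_iff)
    moreover have "(\<alpha> * (x * x) + u) - (\<alpha> * (y * y) + u) = \<alpha> * (x * x - y * y)" by (simp add: algebra_simps)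
    ultimately show "av (x * x - y * y) < 1" using \<alpha> by (simp add: av_mult)
  qed
  have "S1 \<inter> S2 \<noteq> {}"
  proof
    assume "S1 \<inter> S2 = {}"
    hence "card S1 + card S2 = card (S1 \<union> S2)" using R(1) by (simp add: S1_def S2_def card_Un_disjoint)
    also have "\<dots> \<le> card (residue_classes Q)"
      using R(3) int1 int2 clos fin_res by (intro card_mono) (auto simp: S1_def S2_def)
    finally show False using b1 b2 by (simp add: resq_def)
  qed
  then obtain x y where xy: "x \<in> R" "y \<in> R" "?c (x * x) = ?c (\<alpha> * (y * y) + u)"
    by (auto simp: S1_def S2_def)
  hence "av (x * x - (\<alpha> * (y * y) + u)) < 1" using R(3) int1 int2 by (simp add: residue_eq_iff)
  hence "av (x * x - \<alpha> * (y * y) - u) < 1" by (simp add: algebra_simps)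
  thus thesis using that[of x y] R(3) xy by blast
qed

end

section \<open>The quaternion algebra\<close>

locale quaternion =
  fixes Q :: "('k :: field_char_0, 'd :: division_ring) quat_datum"
  assumes padic_quaternion: "padic_quaternion Q"

sublocale quaternion \<subseteq> local_field Q
  by unfold_locales (use padic_quaternion in \<open>auto simp: padic_quaternion_def\<close>)

context quaternion begin

abbreviation "em \<equiv> emb Q"
abbreviation "st \<equiv> star Q"

lemma quat_alg: "quaternion_division_algebra Q" and invol: "canonical_involution Q"
  using padic_quaternion by (auto simp: padic_quaternion_def)

lemma em_1 [simp]: "em 1 = 1"
  and em_add: "em (a + b) = em a + em b"
  and em_mult: "em (a * b) = em a * em b"
  and em_range: "range em = {x. \<forall>y. x * y = y * x}"
  and dim4: "vector_space.dim (kscale Q) UNIV = 4"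
  using quat_alg unfolding quaternion_division_algebra_def by auto

lemma em_commute: "em a * x = x * em a"
  using em_range by blast

lemma em_left_commute: "x * (em a * y) = em a * (x * y)"
  by (metis em_commute mult.assoc)

lemma em_0 [simp]: "em 0 = 0"
  using em_add[of 0 0] by simp

lemma em_minus: "em (- a) = - em a"
  using em_add[of a "- a"] by (simp add: eq_neg_iff_add_eq_0 add.commute)

lemma em_diff: "em (a - b) = em a - em b"
  using em_add[of a "- b"] by (simp add: em_minus)

lemma em_eq_0 [simp]: "em a = 0 \<longleftrightarrow> a = 0"
proof
  assume "em a = 0"
  hence "a \<noteq> 0 \<Longrightarrow> False" using em_mult[of a "inverse a"] by simp
  thus "a = 0" by blast
qed simp

lemma em_inject [simp]: "em a = em b \<longleftrightarrow> a = b"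
  using em_eq_0[of "a - b"] by (simp add: em_diff)

lemma em_2: "em 2 = 2"
  by (metis em_1 em_add one_add_one)

lemma st_add: "st (x + y) = st x + st y"
  and st_mult: "st (x * y) = st y * st x"
  and st_st [simp]: "st (st x) = x"
  and st_em_mult: "st (em c * x) = em c * st x"
  and st_norm: "x * st x \<in> range em"
  using invol unfolding canonical_involution_def kscale_def by auto

lemma st_0 [simp]: "st 0 = 0"
  using st_add[of 0 0] by simp

lemma st_eq_0 [simp]: "st x = 0 \<longleftrightarrow> x = 0"
  by (metis st_0 st_st)

lemma st_1 [simp]: "st 1 = 1"
  using st_mult[of 1 1] st_eq_0[of 1] by simp

lemma st_em [simp]: "st (em c) = em c"
  using st_em_mult[of c 1] by simp

lemma st_minus: "st (- x) = - st x"
  using st_add[of x "- x"] by (simp add: eq_neg_iff_add_eq_0 add.commute)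

lemma st_diff: "st (x - y) = st x - st y"
  using st_add[of x "- y"] by (simp add: st_minus)

section \<open>Reduced norm, reduced trace and the absolute value of D\<close>

definition N :: "'d \<Rightarrow> 'k" where "N x = (THE c. em c = x * st x)"
definition tr :: "'d \<Rightarrow> 'k" where "tr x = (THE c. em c = x + st x)"

lemma em_N: "em (N x) = x * st x"
proof -
  obtain c where "em c = x * st x" using st_norm[of x] by force
  thus ?thesis unfolding N_def by (metis (mono_tags, lifting) em_inject theI)
qed

lemma em_N': "em (N x) = st x * x"
proof (cases "x = 0")
  case False
  have "em (N x) * x = x * (st x * x)" by (simp add: em_N mult.assoc)
  thus ?thesis using False em_commute[of "N x" x] by (metis mult_left_cancel)
qed (simp add: em_N)

lemma em_tr: "em (tr x) = x + st x"
proof -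
  have "(x + 1) * st (x + 1) = x * st x + (x + st x) + 1" by (simp add: st_add algebra_simps)
  hence "x + st x = em (N (x + 1) - N x - 1)"
    by (simp add: em_diff em_N)
  thus ?thesis unfolding tr_def by (metis (mono_tags, lifting) em_inject theI)
qed

lemma N_I: "em c = x * st x \<Longrightarrow> N x = c"
  by (metis em_N em_inject)

lemma tr_I: "em c = x + st x \<Longrightarrow> tr x = c"
  by (metis em_tr em_inject)

lemma N_mult: "N (x * y) = N x * N y"
proof (rule N_I)
  have "x * y * st (x * y) = x * em (N y) * st x" by (simp add: st_mult em_N mult.assoc)
  also have "\<dots> = em (N y) * (x * st x)" by (simp add: em_commute mult.assoc em_left_commute)
  finally show "em (N x * N y) = x * y * st (x * y)" by (metis em_N em_commute em_mult)
qed

lemma N_em: "N (em c) = c * c"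
  by (rule N_I) (simp add: em_mult)

lemma N_0 [simp]: "N 0 = 0" and N_1 [simp]: "N 1 = 1"
  by (auto intro: N_I)

lemma N_eq_0 [simp]: "N x = 0 \<longleftrightarrow> x = 0"
  by (metis em_N em_eq_0 mult_eq_0_iff st_eq_0)

lemma N_st [simp]: "N (st x) = N x"
  by (rule N_I) (simp add: em_N')

lemma N_minus [simp]: "N (- x) = N x"
  by (rule N_I) (simp add: em_N st_minus)

lemma tr_add: "tr (x + y) = tr x + tr y"
  by (rule tr_I) (simp add: em_add em_tr st_add)

lemma tr_em_mult: "tr (em c * x) = c * tr x"
  by (rule tr_I) (simp add: em_mult em_tr st_em_mult distrib_left)

lemma tr_st [simp]: "tr (st x) = tr x"
  by (rule tr_I) (simp add: em_tr add.commute)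

lemma tr_em [simp]: "tr (em c) = 2 * c"
  by (rule tr_I) (simp add: em_add[symmetric])

lemma tr_0 [simp]: "tr 0 = 0"
  by (rule tr_I) simp

lemma tr_minus: "tr (- x) = - tr x"
  by (rule tr_I) (simp add: em_tr em_minus st_minus)

lemma N_add: "N (x + y) = N x + N y + tr (x * st y)"
  by (rule N_I) (simp add: em_N em_add em_tr st_add st_mult algebra_simps)

lemma quadratic_equation: "x * x = em (tr x) * x - em (N x)"
  by (simp add: em_tr em_N' distrib_right)

text \<open>The absolute value of D. On k it is the square of \<open>av\<close>, so \<pi> has
  \<open>w\<close> equal to 1/q^2 while a uniformizer of D has 1/q.\<close>

definition w :: "'d \<Rightarrow> real" where "w x = av (N x)"

lemma w_nonneg [simp]: "0 \<le> w x" and w_eq_0 [simp]: "w x = 0 \<longleftrightarrow> x = 0"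
  and w_0 [simp]: "w 0 = 0" and w_1 [simp]: "w 1 = 1"
  and w_mult: "w (x * y) = w x * w y"
  and w_em: "w (em c) = av c * av c"
  and w_st [simp]: "w (st x) = w x" and w_minus [simp]: "w (- x) = w x"
  by (simp_all add: w_def N_mult N_em av_mult)

lemma w_inverse: "w (inverse x) = inverse (w x)"
proof (cases "x = 0")
  case False
  hence "w x * w (inverse x) = 1" by (simp add: w_mult[symmetric])
  thus ?thesis by (metis inverse_unique)
qed simp

lemma w_divide: "w (x / y) = w x / w y"
  by (simp add: divide_inverse w_mult w_inverse)

lemma w_pos: "x \<noteq> 0 \<Longrightarrow> w x > 0"
  by (simp add: less_le)

lemma av_4: "av 4 = 1"
  using av_mult[of 2 2] by simp

text \<open>Suppose the norm is integral and the trace t is not. The discriminant t^2 - 4 N x is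
  then t^2 times an element of 1 + \<pi> o, hence a square, and the reduced characteristic
  polynomial splits over k. Since D has no zero divisors, x lies in k, where an integral norm forces
  an integral trace.\<close>

lemma av_tr_le_1:
  assumes "w x \<le> 1" shows "av (tr x) \<le> 1"
proof (rule ccontr)
  assume big: "\<not> ?thesis"
  let ?t = "tr x" let ?a = "- (2 * (2 * (N x / (?t * ?t))))"
  have t0: "?t \<noteq> 0" using big by auto
  have "1 < av ?t * av ?t" using big by (metis less_1_mult not_le)
  hence "av ?a < 1" using assms by (simp add: av_divide av_mult w_def av_4)
  then obtain r where r: "r * r = 1 + ?a" by (rule sqrt_one_plus)
  let ?c = "?t * (1 + r) / 2" let ?d = "?t * (1 - r) / 2"
  have sum: "?c + ?d = ?t" by (simp add: field_simps)
  have "?c * ?d = ?t * ?t * (1 - r * r) / 4" by (simp add: field_simps)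
  also have "\<dots> = N x" unfolding r using t0 by (simp add: field_simps)
  finally have prod: "?c * ?d = N x" .
  have "(x - em c) * (x - em d) = x * x - em (c + d) * x + em (c * d)" for c d
    using em_commute[of d x] by (simp add: em_add em_mult algebra_simps)
  hence "(x - em ?c) * (x - em ?d) = x * x - em (?c + ?d) * x + em (?c * ?d)" .
  also have "\<dots> = 0" unfolding sum prod quadratic_equation by simp
  finally have "x = em ?c \<or> x = em ?d" by simp
  then obtain e where e: "x = em e" by blast
  hence "av e * av e \<le> 1" using assms by (simp add: w_em)
  hence "av e \<le> 1" by (metis less_1_mult not_le)
  thus False using big e by simp
qed

lemma w_one_plus: "w x \<le> 1 \<Longrightarrow> w (1 + x) \<le> 1"
  using av_tr_le_1[of x] N_add[of 1 x] unfolding w_def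
  by (auto intro!: av_add_le)

text \<open>Dividing by the larger argument reduces the ultrametric inequality to
  \<open>w_one_plus\<close>, that is, to the integrality of the norm 1 + N x + tr x of 1 +
  x.\<close>

lemma w_add: "w (x + y) \<le> max (w x) (w y)"
proof -
  have *: "w (x + y) \<le> w y" if "w x \<le> w y" for x y
  proof (cases "y = 0")
    case False
    have "w (x * inverse y) \<le> 1" using that w_pos[OF False] by (simp add: w_divide flip: divide_inverse)
    hence "w (1 + x * inverse y) * w y \<le> 1 * w y" by (intro mult_right_mono w_one_plus) auto
    moreover have "(1 + x * inverse y) * y = x + y" using False by (simp add: distrib_right mult.assoc add.commute)
    ultimately show ?thesis by (metis w_mult mult_1)
  next
    case True
    hence "w x = 0" using that w_nonneg[of x] by (intro antisym) simp_all
    thus ?thesis using True by simp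
  qed
  show ?thesis using *[of x y] *[of y x, unfolded add.commute[of y x]] by linarith
qed

lemma w_diff: "w (x - y) \<le> max (w x) (w y)"
  using w_add[of x "- y"] by simp

lemma w_diff_commute: "w (x - y) = w (y - x)"
  using w_minus[of "x - y"] by simp

lemma w_add_le: "w x \<le> r \<Longrightarrow> w y \<le> r \<Longrightarrow> w (x + y) \<le> r"
  using w_add[of x y] by linarith

lemma w_diff_le: "w x \<le> r \<Longrightarrow> w y \<le> r \<Longrightarrow> w (x - y) \<le> r"
  using w_diff[of x y] by linarith

lemma w_add_less: "w x < r \<Longrightarrow> w y < r \<Longrightarrow> w (x + y) < r"
  using w_add[of x y] by linarith

lemma w_diff_less: "w x < r \<Longrightarrow> w y < r \<Longrightarrow> w (x - y) < r"
  using w_diff[of x y] by linarith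

lemma w_add_eq: "w x < w y \<Longrightarrow> w (x + y) = w y"
  using w_add[of x y] w_diff[of "x + y" x] by auto

lemma w_sum_le: "0 \<le> r \<Longrightarrow> (\<And>i. i \<in> S \<Longrightarrow> w (f i) \<le> r) \<Longrightarrow> w (sum f S) \<le> r"
  by (induction S rule: infinite_finite_induct) (auto intro: w_add_le)

lemma w_power: "w (x ^ m) = w x ^ m"
  by (induction m) (auto simp: w_mult)

text \<open>The trace is the sum of x and \<open>st x\<close>, which have the same \<open>w\<close>;
  on k, \<open>w\<close> is the square of \<open>av\<close>.\<close>

lemma av_tr_le: "av (tr x) * av (tr x) \<le> w x"
  using w_add[of x "st x"] by (simp add: em_tr[symmetric] w_em)

lemma w_lt_1_iff: "w x < 1 \<longleftrightarrow> w x \<le> 1 / real q"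
  by (simp add: w_def av_lt_1_iff)

lemma w_values:
  assumes "x \<noteq> 0" obtains m :: int where "w x = real q powi m"
  using av_values[of "N x"] assms by (auto simp: w_def)


section \<open>Standard generators of D\<close>

definition anticommuting :: "'d \<Rightarrow> 'd \<Rightarrow> bool" where
  "anticommuting i j \<longleftrightarrow> i \<noteq> 0 \<and> j \<noteq> 0 \<and> st i = - i \<and> st j = - j \<and> i * j = - (j * i)"

lemma skew_square: "st i = - i \<Longrightarrow> i * i = em (- N i)"
  by (simp add: em_minus em_N)

lemma vs: "vector_space (kscale Q)"
  by unfold_locales (auto simp: kscale_def em_add em_mult algebra_simps)

lemma finite_basis:
  obtains B where "finite_dimensional_vector_space (kscale Q) B"
proof -
  interpret vector_space "kscale Q" by (rule vs)
  obtain B where B: "independent B" "UNIV \<subseteq> span B" "card B = dim UNIV" by (rule basis_exists[of UNIV]) auto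
  have "finite B" using B(3) dim4 by (intro card_ge_0_finite) simp
  hence "finite_dimensional_vector_space (kscale Q) B"
    using B by unfold_locales auto
  thus thesis by (rule that)
qed

lemma not_spanned:
  assumes "finite S" "card S < 4" shows "\<exists>x. x \<notin> module.span (kscale Q) S"
proof (rule ccontr)
  assume *: "\<not> ?thesis"
  interpret vector_space "kscale Q" by (rule vs)
  have "dim UNIV \<le> card S" using * assms by (intro dim_le_card) auto
  thus False using assms dim4 by simp
qed

text \<open>Gram-Schmidt for the trace form: i is the skew part of an element outside k, and j is
  the skew part of an element outside the span of 1 and i, made orthogonal to i.\<close>

lemma anticommuting_exists: "\<exists>i j. anticommuting i j"
proof -
  interpret vector_space "kscale Q" by (rule vs)
  obtain x where x: "x \<notin> span {1}" using not_spanned[of "{1}"] by auto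
  define i where "i = x - st x"
  \<comment> \<open>\<open>y - st y\<close> is 2 y minus the trace of y, so a subspace containing 1
    contains y as soon as it contains the skew part.\<close>
  have half: "y \<in> span S" if "y - st y \<in> span S" "1 \<in> S" for y S
  proof -
    have "kscale Q (tr y / 2) 1 + kscale Q (1 / 2) (y - st y) \<in> span S"
      using that by (auto intro: span_add span_scale span_base)
    also have "kscale Q (tr y / 2) 1 + kscale Q (1 / 2) (y - st y) = em (1/2) * (em (tr y) + (y - st y))"
      by (simp add: kscale_def distrib_left em_mult[symmetric])
    also have "\<dots> = em (1/2 * 2) * y" unfolding em_mult by (simp add: em_tr em_2 mult.assoc mult_2)
    finally show ?thesis by simp
  qed
  have i: "i \<noteq> 0" "st i = - i" using half[of x "{1}"] x by (auto simp: i_def st_diff span_zero)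
  have "card {1, i} < 4" by (simp add: card_insert_if)
  then obtain y where y: "y \<notin> span {1, i}" using not_spanned[of "{1, i}"] by auto
  define y0 where "y0 = y - st y"
  have y0: "y0 \<notin> span {1, i}" "st y0 = - y0" using half[of y "{1, i}"] y by (auto simp: y0_def st_diff)
  define a where "a = - N i"
  have a: "i * i = em a" "a \<noteq> 0" using i skew_square by (auto simp: a_def)
  \<comment> \<open>The coefficient of the projection of \<open>y0\<close> to i: i y0 + y0 i is the
    trace of i y0, while i i + i i is 2 a.\<close>
  define c where "c = tr (i * y0) / (2 * a)"
  define j where "j = y0 - em c * i"
  have "j \<noteq> 0"
  proof
    assume "j = 0"
    hence "y0 = kscale Q c i" by (simp add: j_def kscale_def)
    thus False using y0 by (metis insertI1 insertI2 span_base span_scale)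
  qed
  moreover have "st j = - j" using y0 i by (simp add: j_def st_diff st_em_mult)
  moreover have "i * j + j * i = 0"
  proof -
    have "i * j + j * i = (i * y0 + y0 * i) - (em c * (i * i) + em c * (i * i))"
      by (simp add: j_def algebra_simps em_left_commute[of i])
    also have "i * y0 + y0 * i = em (tr (i * y0))" using y0 i by (simp add: em_tr st_mult)
    also have "em c * (i * i) + em c * (i * i) = em (2 * a * c)"
      unfolding a by (simp add: em_add[symmetric] em_mult[symmetric])
    also have "2 * a * c = tr (i * y0)" using a(2) by (simp add: c_def)
    finally show ?thesis by simp
  qed
  ultimately show ?thesis using i unfolding anticommuting_def by (metis eq_neg_iff_add_eq_0)
qed

text \<open>In a relation u + v j = 0 with u, v in k(i), left and right multiplication by i agree on
  u and differ by a sign on v j, which forces v = 0 and then u = 0. Four independent vectors span,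
  as the dimension is 4.\<close>

lemma anticommuting_spans:
  assumes "anticommuting i j"
  shows "\<exists>c0 c1 c2 c3. x = em c0 + em c1 * i + em c2 * j + em c3 * (i * j)"
    and "distinct [1, i, j, i * j]"
proof -
  note ij = assms[unfolded anticommuting_def]
  define a where "a = - N i"
  have a: "i * i = em a" "a \<noteq> 0" using ij skew_square by (auto simp: a_def)
  have noem: "c = 0" if "em c0 + em c * i = 0" for c c0
  proof (rule ccontr)
    assume "c \<noteq> 0"
    have "em c * i = em (- c0)" using that by (simp add: em_minus eq_neg_iff_add_eq_0 add.commute)
    hence "st (em c * i) = em c * i" by simp
    hence "em c * i + em c * i = 0"
      using ij st_em_mult[of c i] by (metis add.right_inverse mult_minus_right)
    hence "em (c + c) * i = 0" by (simp only: em_add distrib_right)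
    thus False using ij \<open>c \<noteq> 0\<close> by (simp add: mult_2[symmetric])
  qed
  have noem': "c0 = 0 \<and> c = 0" if "em c0 + em c * i = 0" for c c0
    using noem[OF that] that by simp
  have indep: "c0 = 0 \<and> c1 = 0 \<and> c2 = 0 \<and> c3 = 0"
    if z: "em c0 + em c1 * i + em c2 * j + em c3 * (i * j) = 0" for c0 c1 c2 c3
  proof -
    define u where "u = em c0 + em c1 * i"
    define v where "v = em c2 + em c3 * i"
    have uv: "u + v * j = 0" using z by (simp add: u_def v_def algebra_simps)
    have "i * (u + v * j) = u * i + v * (i * j)"
      by (simp add: u_def v_def algebra_simps em_left_commute[of i] em_commute[of _ i, symmetric])
    moreover have "(u + v * j) * i = u * i + v * (j * i)" by (simp add: algebra_simps)
    ultimately have "u * i - v * (j * i) = 0" "u * i + v * (j * i) = 0" using uv ij by auto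
    hence "v * (j * i) + v * (j * i) = 0" by (metis add_diff_cancel_left' diff_add_cancel diff_zero)
    hence "em 2 * (v * (j * i)) = 0" by (simp only: em_2 mult_2)
    hence "v = 0" using ij by simp
    moreover from this have "u = 0" using uv by simp
    ultimately show ?thesis using noem' unfolding u_def v_def by blast
  qed
  have e1: "i \<noteq> 1" using indep[of 1 "-1" 0 0] by (auto simp: em_minus)
  have e2: "j \<noteq> 1" using indep[of 1 0 "-1" 0] by (auto simp: em_minus)
  have e3: "i * j \<noteq> 1" using indep[of 1 0 0 "-1"] by (auto simp: em_minus)
  have e4: "i \<noteq> j" using indep[of 0 1 "-1" 0] by (auto simp: em_minus)
  have e5: "i * j \<noteq> i" using indep[of 0 1 0 "-1"] by (auto simp: em_minus)
  have e6: "i * j \<noteq> j" using indep[of 0 0 1 "-1"] by (auto simp: em_minus)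
  show dist: "distinct [1, i, j, i * j]" 
    using e1[symmetric] e2[symmetric] e3[symmetric] e4 e5[symmetric] e6[symmetric] by simp
  let ?S = "{1, i, j, i * j}"
  have card: "card ?S = 4" using distinct_card[OF dist] by simp
  obtain B where "finite_dimensional_vector_space (kscale Q) B" by (rule finite_basis)
  then interpret finite_dimensional_vector_space "kscale Q" B .
  have sumS: "(\<Sum>s\<in>?S. kscale Q (c s) s) = em (c 1) + em (c i) * i + em (c j) * j + em (c (i * j)) * (i * j)" for c
    using dist by (simp add: kscale_def add.assoc)
  have "independent ?S"
  proof (rule independent_if_scalars_zero)
    fix f x assume "(\<Sum>s\<in>?S. kscale Q (f s) s) = 0" "x \<in> ?S"
    thus "f x = 0" using indep[of "f 1" "f i" "f j" "f (i * j)"] unfolding sumS by auto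
  qed auto
  hence "UNIV \<subseteq> span ?S" using card dim4 by (intro card_ge_dim_independent) auto
  hence "x \<in> span ?S" by blast
  then obtain f where "x = (\<Sum>s\<in>?S. kscale Q (f s) s)" by (subst (asm) span_finite) auto
  thus "\<exists>c0 c1 c2 c3. x = em c0 + em c1 * i + em c2 * j + em c3 * (i * j)"
    unfolding sumS by blast
qed

lemma anticommuting_sym: "anticommuting i j \<Longrightarrow> anticommuting j i"
  by (auto simp: anticommuting_def)

lemma anticommuting_scale: "anticommuting i j \<Longrightarrow> c \<noteq> 0 \<Longrightarrow> anticommuting (em c * i) j"
  by (auto simp: anticommuting_def st_em_mult em_left_commute[of j] mult.assoc)

lemma anticommuting_mult:
  assumes "anticommuting i j" shows "anticommuting (i * j) j"
proof -
  have "i * j * j = - (j * i) * j" using assms by (simp add: anticommuting_def)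
  thus ?thesis using assms by (auto simp: anticommuting_def st_mult st_minus mult.assoc)
qed

text \<open>Scaling by an element c of k changes \<open>w\<close> by the square of
  \<open>av c\<close>, so only the parity of the exponent of q survives.\<close>

lemma anticommuting_normalize:
  assumes "anticommuting i j"
  obtains i' where "anticommuting i' j" "w i' = 1 \<or> w i' = 1 / real q"
proof -
  have "i \<noteq> 0" using assms by (simp add: anticommuting_def)
  then obtain m where m: "w i = real q powi m" by (rule w_values)
  define k where "k = (m + 1) div 2"
  have c: "\<pi> powi k \<noteq> 0" by simp
  have "w (em (\<pi> powi k) * i) = real q powi (- k) * real q powi (- k) * real q powi m"
    by (simp add: w_mult w_em av_power_int av_unif m power_int_minus power_int_inverse divide_inverse)
  also have "\<dots> = real q powi (m - 2 * k)"
    using q_nz by (simp add: power_int_add[symmetric])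
  also have "m - 2 * k = 0 \<or> m - 2 * k = -1" unfolding k_def by presburger
  hence "real q powi (m - 2 * k) = 1 \<or> real q powi (m - 2 * k) = 1 / real q"
    by (auto simp: power_int_minus divide_inverse)
  finally show thesis using that[OF anticommuting_scale[OF assms c]] by blast
qed

text \<open>The norm form x^2 + N i y^2 represents b modulo \<pi> by \<open>universal_form\<close>.
  The remaining quotient lies in 1 + \<pi> o, so it is a square and can be absorbed into x and
  y.\<close>

lemma norm_from_unramified:
  assumes i: "st i = - i" "w i = 1" and b: "av b = 1"
  obtains x y where "N (em x + em y * i) = b"
proof -
  have Nz: "N (em x + em y * i) = x * x + N i * (y * y)" for x y
  proof (rule N_I)
    have "(em x + em y * i) * st (em x + em y * i) = em x * em x - em y * em y * (i * i)"
      using i(1) by (simp add: st_add st_em_mult algebra_simps em_left_commute[of i] em_left_commute[of "em y" x]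
          em_commute[of _ i, symmetric])
    also have "\<dots> = em (x * x - y * y * (- N i))"
      unfolding skew_square[OF i(1)] by (simp only: em_diff em_mult)
    also have "\<dots> = em (x * x + N i * (y * y))" by (simp add: mult.commute)
    finally show "em (x * x + N i * (y * y)) = (em x + em y * i) * st (em x + em y * i)" by (rule sym)
  qed
  have "av (- N i) = 1" using i(2) by (simp add: w_def)
  then obtain x y where xy: "av (x * x - (- N i) * (y * y) - b) < 1"
    using universal_form[of "- N i" b] b by metis
  define n where "n = N (em x + em y * i)"
  have n: "av (n - b) < 1" using xy by (simp add: n_def Nz)
  hence avn: "av n = 1" using av_add_eq[of "n - b" b] b by simp
  hence n0: "n \<noteq> 0" by auto
  have "av ((b - n) / n) < 1" using n avn by (simp add: av_divide av_diff_commute)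
  then obtain r where "r * r = 1 + (b - n) / n" by (rule sqrt_one_plus)
  hence "r * r * n = b" using n0 by (simp add: field_simps)
  hence "N (em (r * x) + em (r * y) * i) = b"
    unfolding Nz n_def by (simp add: algebra_simps)
  thus thesis by (rule that)
qed

text \<open>If both were units, j^2 would be a norm N z from k(i). Then (j - z) (j + st z) = 0, so j
  would lie in k(i) and commute with i, although it anticommutes with i and 2 is not 0.\<close>

lemma not_both_units:
  assumes ij: "anticommuting i j" and units: "w i = 1" "w j = 1"
  shows False
proof -
  note ij' = ij[unfolded anticommuting_def]
  have "av (- N j) = 1" using units by (simp add: w_def)
  then obtain x y where xy: "N (em x + em y * i) = - N j"
    using norm_from_unramified[of i "- N j"] ij' units by metis
  define z where "z = em x + em y * i"
  have stz: "st z = em x - em y * i" using ij' by (simp add: z_def st_add st_em_mult)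
  have jz: "j * st z = z * j"
    unfolding stz using ij' by (simp add: z_def algebra_simps em_left_commute[of j] em_commute[of _ j, symmetric])
  have "(j - z) * (j + st z) = j * j - z * st z + (j * st z - z * j)"
    by (simp add: algebra_simps)
  also have "\<dots> = 0" using jz xy skew_square[of j] ij' by (simp add: em_N[symmetric] z_def)
  finally have "j = z \<or> j = - st z" by (simp add: eq_neg_iff_add_eq_0)
  moreover have "i * z = z * i" "i * (- st z) = - st z * i"
    unfolding stz by (simp_all add: z_def algebra_simps em_left_commute[of i] em_commute[of _ i, symmetric])
  ultimately have "i * j = j * i" by metis
  hence "j * i + j * i = 0" using ij' by (metis add.right_inverse)
  hence "em 2 * (j * i) = 0" by (simp only: em_2 mult_2)
  thus False using ij' by simp
qed

lemma standard_basis_exists: "\<exists>i j. anticommuting i j \<and> w i = 1 \<and> w j = 1 / real q"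
proof -
  obtain i0 j0 where "anticommuting i0 j0" using anticommuting_exists by blast
  then obtain i1 where i1: "anticommuting i1 j0" "w i1 = 1 \<or> w i1 = 1 / real q"
    by (rule anticommuting_normalize)
  obtain j1 where j1: "anticommuting j1 i1" "w j1 = 1 \<or> w j1 = 1 / real q"
    by (rule anticommuting_normalize[OF anticommuting_sym[OF i1(1)]])
  have ij: "anticommuting i1 j1" by (rule anticommuting_sym[OF j1(1)])
  consider "w i1 = 1" "w j1 = 1 / real q" | "w i1 = 1 / real q" "w j1 = 1"
    | "w i1 = 1 / real q" "w j1 = 1 / real q"
    using not_both_units[OF ij] i1(2) j1(2) by argo
  thus ?thesis
  proof cases
    \<comment> \<open>Both generators have \<open>w\<close> equal to 1/q. Their product has 1/q^2,
      and dividing it by \<pi> gives a unit that still anticommutes with j1.\<close>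
    case 3
    have "anticommuting (em (inverse \<pi>) * (i1 * j1)) j1"
      using ij by (intro anticommuting_scale anticommuting_mult) auto
    moreover have "w (em (inverse \<pi>) * (i1 * j1)) = 1"
      using 3 q_nz by (simp add: w_mult w_em av_inverse av_unif)
    ultimately show ?thesis using 3 by blast
  qed (use ij j1 in blast)+
qed

end

section \<open>The valuation ring of D and its residue field\<close>

locale quaternion_basis = quaternion Q
  for Q :: "('k :: field_char_0, 'd :: division_ring) quat_datum" +
  fixes \<iota> \<tau> :: 'd
  assumes anti: "anticommuting \<iota> \<tau>" and w_iota: "w \<iota> = 1" and w_tau: "w \<tau> = 1 / real (resq Q)"
begin

lemma st_iota: "st \<iota> = - \<iota>" and st_tau: "st \<tau> = - \<tau>" and tau_nz [simp]: "\<tau> \<noteq> 0" and iota_nz [simp]: "\<iota> \<noteq> 0"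
  and iota_tau: "\<iota> * \<tau> = - (\<tau> * \<iota>)"
  using anti by (auto simp: anticommuting_def)

text \<open>A prime of k used in place of \<pi>: the scalar matrix \<tau> multiplies the diagonal
  entries of a hermitian matrix exactly by \<eta>, so powers of \<eta> make convenient orbit
  representatives.\<close>

abbreviation "\<eta> \<equiv> N \<tau>"

lemma eta_nz [simp]: "\<eta> \<noteq> 0" and av_eta: "av \<eta> = 1 / real q"
  using w_tau by (simp_all add: w_def)

definition \<O> :: "'d set" where "\<O> = {x. w x \<le> 1}"

lemma \<O>_iff: "x \<in> \<O> \<longleftrightarrow> w x \<le> 1"
  by (simp add: \<O>_def)

lemma norm_surj:
  assumes "av u = 1" obtains z where "N z = u" "w z = 1"
  using norm_from_unramified[OF st_iota w_iota assms] assms unfolding w_def by metis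

lemma w_lt_1_tau: "w x < 1 \<longleftrightarrow> w (inverse \<tau> * x) \<le> 1" "w x < 1 \<longleftrightarrow> w (x * inverse \<tau>) \<le> 1"
  using q_pos by (auto simp: w_lt_1_iff w_mult w_divide w_inverse w_tau field_simps)

text \<open>The basis 1, \<iota>, \<tau>, \<iota>\<tau> is orthogonal for the trace form, so each
  coordinate is read off from one trace.\<close>

lemma coords_trace:
  assumes x: "x = em c0 + em c1 * \<iota> + em c2 * \<tau> + em c3 * (\<iota> * \<tau>)"
  shows "tr x = 2 * c0" "tr (\<iota> * x) = - 2 * N \<iota> * c1" "tr (\<tau> * x) = - 2 * \<eta> * c2"
    "tr (\<iota> * \<tau> * x) = - 2 * N \<iota> * \<eta> * c3"
proof -
  have tr0: "tr (em c * y) = 0" if "st y = - y" for c y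
    using tr_st[of y] that by (simp add: tr_em_mult tr_minus)
  have a1: "st \<iota> = - \<iota>" "st \<tau> = - \<tau>" "st (\<iota> * \<tau>) = - (\<iota> * \<tau>)" "st (\<tau> * \<iota>) = - (\<tau> * \<iota>)"
    using st_iota st_tau iota_tau by (auto simp: st_mult st_minus)
  have sq: "\<iota> * \<iota> = em (- N \<iota>)" "\<tau> * \<tau> = em (- \<eta>)"
    using a1 by (auto simp: skew_square)
  have ttt: "\<iota> * (\<iota> * \<tau>) = em (- N \<iota>) * \<tau>" "\<tau> * (\<iota> * \<tau>) = em \<eta> * \<iota>"
    "\<iota> * \<tau> * \<iota> = em (N \<iota>) * \<tau>" "\<iota> * \<tau> * \<tau> = em (- \<eta>) * \<iota>"
    "\<iota> * \<tau> * (\<iota> * \<tau>) = em (- (N \<iota> * \<eta>))"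
  proof -
    show "\<iota> * (\<iota> * \<tau>) = em (- N \<iota>) * \<tau>" by (simp add: mult.assoc[symmetric] sq)
    show 1: "\<iota> * \<tau> * \<tau> = em (- \<eta>) * \<iota>" by (simp add: mult.assoc sq em_commute)
    have anti': "\<tau> * \<iota> = - (\<iota> * \<tau>)" by (simp add: iota_tau)
    have "\<tau> * (\<iota> * \<tau>) = \<tau> * \<iota> * \<tau>" by (rule mult.assoc[symmetric])
    also have "\<dots> = - (\<iota> * \<tau> * \<tau>)" unfolding anti' by (rule mult_minus_left)
    finally show "\<tau> * (\<iota> * \<tau>) = em \<eta> * \<iota>" by (simp add: 1 em_minus)
    have "\<iota> * \<tau> * \<iota> = \<iota> * (\<tau> * \<iota>)" by (rule mult.assoc)
    also have "\<dots> = - (\<iota> * \<iota> * \<tau>)" unfolding anti' by (simp only: mult_minus_right mult.assoc)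
    finally show 2: "\<iota> * \<tau> * \<iota> = em (N \<iota>) * \<tau>" by (simp add: sq em_minus)
    have "\<iota> * \<tau> * (\<iota> * \<tau>) = em (N \<iota>) * (\<tau> * \<tau>)" using 2 by (simp add: mult.assoc[symmetric])
    thus "\<iota> * \<tau> * (\<iota> * \<tau>) = em (- (N \<iota> * \<eta>))" by (simp add: sq em_mult[symmetric])
  qed
  show "tr x = 2 * c0" by (simp add: x tr_add tr0 a1)
  have right: "\<iota> * em c = em c * \<iota>" "\<tau> * em c = em c * \<tau>" for c
    by (rule em_commute[symmetric])+
  have "\<iota> * x = em c0 * \<iota> + em (c1 * (- N \<iota>)) + em c2 * (\<iota> * \<tau>) + em (c3 * (- N \<iota>)) * \<tau>"
    by (simp only: x distrib_left em_left_commute[of \<iota>] em_left_commute[of \<tau>] sq ttt em_mult right mult.assoc)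
  thus "tr (\<iota> * x) = - 2 * N \<iota> * c1" by (simp add: tr_add tr0 a1)
  have "\<tau> * x = em c0 * \<tau> + em c1 * (\<tau> * \<iota>) + em (c2 * (- \<eta>)) + em (c3 * \<eta>) * \<iota>"
    by (simp only: x distrib_left em_left_commute[of \<iota>] em_left_commute[of \<tau>] sq ttt em_mult right mult.assoc)
  thus "tr (\<tau> * x) = - 2 * \<eta> * c2" by (simp add: tr_add tr0 a1)
  have "\<iota> * \<tau> * x = em c0 * (\<iota> * \<tau>) + em (c1 * N \<iota>) * \<tau> + em (c2 * (- \<eta>)) * \<iota> + em (c3 * (- (N \<iota> * \<eta>)))"
    unfolding em_mult mult.assoc ttt(3-5)[unfolded mult.assoc, symmetric]
    by (simp only: x distrib_left em_left_commute[of \<iota>] em_left_commute[of \<tau>] right mult.assoc)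
  thus "tr (\<iota> * \<tau> * x) = - 2 * N \<iota> * \<eta> * c3" by (simp add: tr_add tr0 a1)
qed

text \<open>\<open>av_tr_le\<close> bounds the square of \<open>av (tr x)\<close> by 1/q, so
  \<open>av (tr x)\<close> is less than 1; discreteness of \<open>av\<close> improves this to
  1/q.\<close>

lemma av_tr_tau: "w x \<le> 1 / real q \<Longrightarrow> av (tr x) \<le> 1 / real q"
proof -
  assume a: "w x \<le> 1 / real q"
  have "av (tr x) < 1"
  proof (rule ccontr)
    assume "\<not> ?thesis"
    hence "1 * 1 \<le> av (tr x) * av (tr x)" by (intro mult_mono) auto
    thus False using av_tr_le[of x] a q_gt_1 by (smt (verit) divide_less_eq_1)
  qed
  thus ?thesis by (simp add: av_lt_1_iff)
qed

text \<open>Dividing by \<eta> in the last two coordinates costs a factor q, which is recovered by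
  \<open>av_tr_tau\<close> because \<tau> x and \<iota>\<tau> x have \<open>w\<close> at most
  1/q.\<close>

lemma coords_integral:
  assumes x: "x = em c0 + em c1 * \<iota> + em c2 * \<tau> + em c3 * (\<iota> * \<tau>)" and "w x \<le> 1"
  shows "av c0 \<le> 1" "av c1 \<le> 1" "av c2 \<le> 1" "av c3 \<le> 1"
proof -
  note t = coords_trace[OF x]
  have avi: "av (N \<iota>) = 1" using w_iota by (simp add: w_def)
  show "av c0 \<le> 1" using av_tr_le_1[OF assms(2)] by (simp add: t)
  have "w (\<iota> * x) \<le> 1" using assms(2) by (simp add: w_mult w_iota)
  from av_tr_le_1[OF this] show "av c1 \<le> 1" by (simp add: t av_mult avi)
  have "w (\<tau> * x) \<le> 1 / real q" using assms(2) q_pos by (simp add: w_mult w_tau divide_right_mono)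
  from av_tr_tau[OF this] show "av c2 \<le> 1" using q_pos by (simp add: t av_mult av_eta divide_simps)
  have "w (\<iota> * \<tau> * x) \<le> 1 / real q" using assms(2) q_pos by (simp add: w_mult w_tau w_iota divide_right_mono)
  from av_tr_tau[OF this] show "av c3 \<le> 1" using q_pos by (simp add: t av_mult av_eta avi divide_simps)
qed

lemma coords_exist:
  obtains c0 c1 c2 c3 where "x = em c0 + em c1 * \<iota> + em c2 * \<tau> + em c3 * (\<iota> * \<tau>)"
  using anticommuting_spans(1)[OF anti, of x] by blast

lemma w_em_le: "av c \<le> 1 \<Longrightarrow> w (em c) \<le> 1"
  by (simp add: w_em mult_le_one)

lemma order_integers: "is_order Q \<O>"
  unfolding is_order_def
proof (intro conjI ballI)
  show "1 \<in> \<O>" by (simp add: \<O>_iff)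
  show "x - y \<in> \<O>" if "x \<in> \<O>" "y \<in> \<O>" for x y using that by (simp add: \<O>_iff w_diff_le)
  show "x * y \<in> \<O>" if "x \<in> \<O>" "y \<in> \<O>" for x y using that by (simp add: \<O>_iff w_mult mult_le_one)
  let ?S = "{1, \<iota>, \<tau>, \<iota> * \<tau>}"
  have sumS: "(\<Sum>s\<in>?S. kscale Q (c s) s) = em (c 1) + em (c \<iota>) * \<iota> + em (c \<tau>) * \<tau> + em (c (\<iota> * \<tau>)) * (\<iota> * \<tau>)" for c
    using anticommuting_spans(2)[OF anti] by (simp add: kscale_def add.assoc)
  have wS: "w s \<le> 1" if "s \<in> ?S" for s
    using that q_gt_1 by (auto simp: w_mult w_iota w_tau)
  have "\<O> = {x. \<exists>c. (\<forall>s\<in>?S. c s \<in> int_ring Q) \<and> x = (\<Sum>s\<in>?S. kscale Q (c s) s)}"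
  proof (rule Set.set_eqI, rule iffI)
    fix x assume "x \<in> \<O>"
    hence wx: "w x \<le> 1" by (simp add: \<O>_iff)
    obtain c0 c1 c2 c3 where x: "x = em c0 + em c1 * \<iota> + em c2 * \<tau> + em c3 * (\<iota> * \<tau>)"
      by (rule coords_exist)
    define c where "c s = (if s = 1 then c0 else if s = \<iota> then c1 else if s = \<tau> then c2 else c3)" for s
    have c: "c 1 = c0" "c \<iota> = c1" "c \<tau> = c2" "c (\<iota> * \<tau>) = c3"
      using anticommuting_spans(2)[OF anti] by (auto simp: c_def)
    show "x \<in> {x. \<exists>c. (\<forall>s\<in>?S. c s \<in> int_ring Q) \<and> x = (\<Sum>s\<in>?S. kscale Q (c s) s)}"
      by (intro CollectI exI[of _ c]) (use coords_integral[OF x wx] x in \<open>auto simp only: sumS c int_ring_def insert_iff empty_iff mem_Collect_eq\<close>)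
  next
    fix x assume "x \<in> {x. \<exists>c. (\<forall>s\<in>?S. c s \<in> int_ring Q) \<and> x = (\<Sum>s\<in>?S. kscale Q (c s) s)}"
    then obtain c where c: "\<forall>s\<in>?S. c s \<in> int_ring Q" and x: "x = (\<Sum>s\<in>?S. kscale Q (c s) s)" by blast
    have "w (kscale Q (c s) s) \<le> 1" if "s \<in> ?S" for s
      using c that wS[OF that] w_em_le[of "c s"] by (auto simp: kscale_def w_mult int_ring_def intro: mult_le_one)
    thus "x \<in> \<O>" unfolding \<O>_iff x by (intro w_sum_le) auto
  qed
  thus "\<exists>S. finite S \<and> \<O> = {x. \<exists>c. (\<forall>s\<in>S. c s \<in> int_ring Q) \<and> x = (\<Sum>s\<in>S. kscale Q (c s) s)}"
    by (intro exI[of _ ?S]) simp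
  interpret vector_space "kscale Q" by (rule vs)
  have "x \<in> span \<O>" for x
  proof -
    obtain c0 c1 c2 c3 where x: "x = em c0 + em c1 * \<iota> + em c2 * \<tau> + em c3 * (\<iota> * \<tau>)"
      by (rule coords_exist)
    have "kscale Q c0 1 + kscale Q c1 \<iota> + kscale Q c2 \<tau> + kscale Q c3 (\<iota> * \<tau>) \<in> span \<O>"
      by (intro span_add span_scale span_base) (use wS in \<open>auto simp: \<O>_iff\<close>)
    thus ?thesis by (simp add: x kscale_def)
  qed
  thus "span \<O> = UNIV" by blast
qed

text \<open>An order is contained in \<open>\<O>\<close> because the powers of its elements stay bounded.\<close>

lemma maxord_eq: "maxord Q = \<O>"
proof -
  let ?R = "maxord Q"
  have R: "is_order Q ?R" "\<And>R'. is_order Q R' \<Longrightarrow> ?R \<subseteq> R' \<Longrightarrow> R' = ?R"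
    using padic_quaternion by (auto simp: padic_quaternion_def is_maximal_order_def)
  obtain S where S: "finite S" "?R = {x. \<exists>c. (\<forall>s \<in> S. c s \<in> int_ring Q) \<and> x = (\<Sum>s\<in>S. kscale Q (c s) s)}"
    using R(1) by (auto simp: is_order_def)
  define M where "M = (\<Sum>s\<in>S. w s)"
  have bound: "w x \<le> M" if "x \<in> ?R" for x
  proof -
    from that[unfolded S(2)]
    obtain c where c: "\<forall>s\<in>S. c s \<in> int_ring Q" and x: "x = (\<Sum>s\<in>S. kscale Q (c s) s)"
      by (elim CollectE exE conjE)
    have "w (kscale Q (c s) s) \<le> M" if "s \<in> S" for s
    proof -
      have "w (em (c s)) * w s \<le> 1 * w s" using c that by (intro mult_right_mono w_em_le) (auto simp: int_ring_def)
      also have "\<dots> \<le> M" using S(1) that by (auto simp: M_def intro: member_le_sum)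
      finally show ?thesis by (simp add: kscale_def w_mult)
    qed
    thus ?thesis unfolding x by (intro w_sum_le) (auto simp: M_def sum_nonneg)
  qed
  have "?R \<subseteq> \<O>"
  proof
    fix x assume x: "x \<in> ?R"
    have pow: "x ^ m \<in> ?R" for m using R(1) x by (induction m) (auto simp: is_order_def)
    show "x \<in> \<O>"
    proof (rule ccontr)
      assume "x \<notin> \<O>"
      then obtain m where "M < w x ^ m" using real_arch_pow[of "w x" M] by (auto simp: \<O>_iff)
      thus False using bound[OF pow[of m]] by (simp add: w_power)
    qed
  qed
  thus ?thesis using R(2)[OF order_integers] by simp
qed

text \<open>Modulo \<tau> only the coordinates along 1 and \<iota> matter, so the elements a + b
  \<iota> with a, b among residue representatives cover. A choice function that is constant on
  classes thins them to one per class.\<close>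

lemma residue_reps_integers:
  obtains T where "finite T" "\<And>t. t \<in> T \<Longrightarrow> w t \<le> 1" "\<And>x. w x \<le> 1 \<Longrightarrow> \<exists>t\<in>T. w (x - t) < 1"
    "\<And>t t'. t \<in> T \<Longrightarrow> t' \<in> T \<Longrightarrow> w (t - t') < 1 \<Longrightarrow> t = t'"
proof -
  obtain R where R: "finite R" "\<And>r. r \<in> R \<Longrightarrow> av r \<le> 1" "\<And>x. av x \<le> 1 \<Longrightarrow> \<exists>r \<in> R. av (x - r) < 1"
    by (rule residue_reps) blast
  define T0 where "T0 = (\<lambda>(a, b). em a + em b * \<iota>) ` (R \<times> R)"
  have T0: "finite T0" "\<And>t. t \<in> T0 \<Longrightarrow> w t \<le> 1"
    using R by (auto simp: T0_def w_mult w_iota intro!: w_add_le w_em_le)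
  have cover: "\<exists>t\<in>T0. w (x - t) < 1" if "w x \<le> 1" for x
  proof -
    obtain c0 c1 c2 c3 where x: "x = em c0 + em c1 * \<iota> + em c2 * \<tau> + em c3 * (\<iota> * \<tau>)"
      by (rule coords_exist)
    note c = coords_integral[OF x that]
    obtain a b where ab: "a \<in> R" "av (c0 - a) < 1" "b \<in> R" "av (c1 - b) < 1" using R(3) c by meson
    have sq: "u * u < 1" if "0 \<le> u" "u < 1" for u :: real using that mult_left_le[of u u] by linarith
    have "w (em (c0 - a)) < 1" "w (em (c1 - b) * \<iota>) < 1"
      using ab sq by (auto simp: w_em w_mult w_iota)
    moreover have "w (em c2 * \<tau>) < 1" "w (em c3 * (\<iota> * \<tau>)) < 1"
      using w_em_le[of c2] w_em_le[of c3] c q_gt_1 by (auto simp: w_mult w_iota w_tau)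
    moreover have "x - (em a + em b * \<iota>) = em (c0 - a) + em (c1 - b) * \<iota> + em c2 * \<tau> + em c3 * (\<iota> * \<tau>)"
      by (simp add: x em_diff algebra_simps)
    ultimately have "w (x - (em a + em b * \<iota>)) < 1" by (simp add: w_add_less)
    moreover have "em a + em b * \<iota> \<in> T0" using ab by (auto simp: T0_def)
    ultimately show ?thesis by blast
  qed
  define f where "f x = (SOME t. t \<in> T0 \<and> w (x - t) < 1)" for x
  have f: "f x \<in> T0" "w (x - f x) < 1" if "w x \<le> 1" for x
    using someI_ex[of "\<lambda>t. t \<in> T0 \<and> w (x - t) < 1"] cover[OF that] unfolding f_def by blast+
  have fcong: "f x = f y" if "w (x - y) < 1" for x y
  proof -
    have "w (x - t) < 1 \<longleftrightarrow> w (y - t) < 1" for t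
    proof -
      have "y - t = (x - t) - (x - y)" "x - t = (y - t) + (x - y)" by simp_all
      thus ?thesis using that w_diff_less w_add_less by metis
    qed
    thus ?thesis by (simp add: f_def)
  qed
  show thesis
  proof (rule that[of "f ` T0"])
    show "\<exists>t\<in>f ` T0. w (x - t) < 1" if x: "w x \<le> 1" for x
    proof -
      have "w (f x - f (f x)) < 1" using f f(1)[OF x] T0(2) by blast
      moreover have "x - f (f x) = (x - f x) + (f x - f (f x))" by simp
      ultimately have "w (x - f (f x)) < 1" using f(2)[OF x] w_add_less by metis
      thus ?thesis using f(1)[OF x] by blast
    qed
    show "t = t'" if tt: "t \<in> f ` T0" "t' \<in> f ` T0" "w (t - t') < 1" for t t'
    proof -
      obtain x y where xy: "x \<in> T0" "y \<in> T0" "t = f x" "t' = f y" using tt by blast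
      have "x - y = (x - f x) + (f x - f y) - (y - f y)" by simp
      hence "w (x - y) < 1" using f(2) T0(2) xy tt(3) by (metis w_add_less w_diff_less)
      thus ?thesis using fcong xy by blast
    qed
  qed (use T0 f in auto)
qed

end

section \<open>Hermitian matrices\<close>

definition mat2 :: "'a \<Rightarrow> 'a \<Rightarrow> 'a \<Rightarrow> 'a \<Rightarrow> 'a mat" where
  "mat2 a b c d = Matrix.mat 2 2 (\<lambda>(i, j). if i = 0 then if j = 0 then a else b else if j = 0 then c else d)"

lemma mat2_carrier [simp]: "mat2 a b c d \<in> carrier_mat 2 2"
  and mat2_dim [simp]: "dim_row (mat2 a b c d) = 2" "dim_col (mat2 a b c d) = 2"
  by (simp_all add: mat2_def)

lemma mat2_index [simp]:
  "mat2 a b c d $$ (0, 0) = a" "mat2 a b c d $$ (0, Suc 0) = b"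
  "mat2 a b c d $$ (Suc 0, 0) = c" "mat2 a b c d $$ (Suc 0, Suc 0) = d"
  by (simp_all add: mat2_def)

lemma mat2_eqI:
  assumes "A \<in> carrier_mat 2 2" "B \<in> carrier_mat 2 2"
    "A $$ (0, 0) = B $$ (0, 0)" "A $$ (0, Suc 0) = B $$ (0, Suc 0)"
    "A $$ (Suc 0, 0) = B $$ (Suc 0, 0)" "A $$ (Suc 0, Suc 0) = B $$ (Suc 0, Suc 0)"
  shows "A = B"
  by (rule eq_matI) (use assms in \<open>auto simp: less_2_cases_iff\<close>)

lemma mat2_cases:
  assumes "A \<in> carrier_mat 2 2" obtains a b c d where "A = mat2 a b c d"
  by (rule that[of "A $$ (0, 0)" "A $$ (0, Suc 0)" "A $$ (Suc 0, 0)" "A $$ (Suc 0, Suc 0)"])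
    (rule mat2_eqI[OF assms], simp_all)

lemma mat2_inject [simp]: "mat2 a b c d = mat2 a' b' c' d' \<longleftrightarrow> a = a' \<and> b = b' \<and> c = c' \<and> d = d'"
  using mat2_index by metis

lemma mat2_mult [simp]:
  fixes a :: "'a :: semiring_0"
  shows "mat2 a b c d * mat2 a' b' c' d' = mat2 (a * a' + b * c') (a * b' + b * d') (c * a' + d * c') (c * b' + d * d')"
proof -
  have "sum f {0..<2} = f 0 + f (Suc 0)" for f :: "nat \<Rightarrow> 'a" by (simp add: numeral_2_eq_2)
  thus ?thesis by (intro mat2_eqI mult_carrier_mat[of _ 2 2]) (simp_all add: scalar_prod_def)
qed

lemma mat2_add [simp]: "mat2 a b c d + mat2 a' b' c' d' = mat2 (a + a') (b + b') (c + c') (d + d')"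
  by (rule mat2_eqI) simp_all

lemma mat2_one: "1\<^sub>m 2 = mat2 1 0 0 1"
  by (rule mat2_eqI) simp_all

section \<open>Splittings and reduced norms of hermitian matrices\<close>

context quaternion_basis begin

lemma mult_by_iota_tau:
  "\<iota> * \<iota> = em (- N \<iota>)" "\<tau> * \<iota> = - (\<iota> * \<tau>)" "\<tau> * \<tau> = em (- \<eta>)"
  "\<iota> * (\<iota> * x) = em (- N \<iota>) * x" "\<tau> * (\<iota> * x) = - (\<iota> * (\<tau> * x))" "\<tau> * (\<tau> * x) = em (- \<eta>) * x"
proof -
  show 1: "\<iota> * \<iota> = em (- N \<iota>)" "\<tau> * \<iota> = - (\<iota> * \<tau>)" "\<tau> * \<tau> = em (- \<eta>)"
    using st_iota st_tau iota_tau by (auto simp: skew_square)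
  show "\<iota> * (\<iota> * x) = em (- N \<iota>) * x" "\<tau> * (\<tau> * x) = em (- \<eta>) * x"
    by (simp_all only: 1 mult.assoc[symmetric])
  show "\<tau> * (\<iota> * x) = - (\<iota> * (\<tau> * x))"
    by (simp only: 1 mult.assoc[symmetric] mult_minus_left)
qed

lemma quaternion_mult:
  "(em x0 + em x1 * \<iota> + em x2 * \<tau> + em x3 * (\<iota> * \<tau>)) *
   (em y0 + em y1 * \<iota> + em y2 * \<tau> + em y3 * (\<iota> * \<tau>)) =
   em (x0 * y0 - N \<iota> * x1 * y1 - \<eta> * x2 * y2 - N \<iota> * \<eta> * x3 * y3) +
   em (x0 * y1 + x1 * y0 + \<eta> * x2 * y3 - \<eta> * x3 * y2) * \<iota> +
   em (x0 * y2 + x2 * y0 - N \<iota> * x1 * y3 + N \<iota> * x3 * y1) * \<tau> +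
   em (x0 * y3 + x3 * y0 + x1 * y2 - x2 * y1) * (\<iota> * \<tau>)"
proof -
  have em2: "em a * (em b * x) = em (a * b) * x" for a b x
    by (simp add: em_mult mult.assoc)
  have right: "\<iota> * em c = em c * \<iota>" "\<tau> * em c = em c * \<tau>" for c
    by (rule em_commute[symmetric])+
  show ?thesis
    by (simp add: distrib_left distrib_right mult.assoc em2 right mult_by_iota_tau em_left_commute[of \<iota>]
          em_left_commute[of \<tau>] em_mult[symmetric] em_minus em_add em_diff left_diff_distrib)
      (simp add: algebra_simps em_mult[symmetric])
qed

lemma coords_eq:
  "x = em (tr x / 2) + em (- tr (\<iota> * x) / (2 * N \<iota>)) * \<iota> + em (- tr (\<tau> * x) / (2 * \<eta>)) * \<tau> +
       em (- tr (\<iota> * \<tau> * x) / (2 * (N \<iota> * \<eta>))) * (\<iota> * \<tau>)"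
proof -
  obtain c0 c1 c2 c3 where x: "x = em c0 + em c1 * \<iota> + em c2 * \<tau> + em c3 * (\<iota> * \<tau>)"
    by (rule coords_exist)
  have "tr x / 2 = c0" "- tr (\<iota> * x) / (2 * N \<iota>) = c1" "- tr (\<tau> * x) / (2 * \<eta>) = c2"
    "- tr (\<iota> * \<tau> * x) / (2 * (N \<iota> * \<eta>)) = c3"
    unfolding coords_trace[OF x] by (simp_all add: field_simps)
  thus ?thesis using x by simp
qed

text \<open>\<open>u + v \<tau>\<close> with \<open>u, v \<in> k(\<iota>)\<close> is sent to the matrix with rows \<open>(u, v)\<close> and
  \<open>(\<tau>\<^sup>2 v\<^sup>*, u\<^sup>*)\<close>, where \<open>r\<close> plays the role of \<open>\<iota>\<close>.\<close>

lemma splitting_exists: "\<exists>\<rho>. splitting Q \<rho>"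
proof -
  obtain r :: "'k alg_closure" where r: "r ^ 2 = to_ac (- N \<iota>)"
    using nth_root_exists[of 2 "to_ac (- N \<iota>)"] by auto
  define f where "f x0 x1 x2 x3 = mat2 (to_ac x0 + to_ac x1 * r) (to_ac x2 + to_ac x3 * r)
    (- to_ac \<eta> * (to_ac x2 - to_ac x3 * r)) (to_ac x0 - to_ac x1 * r)" for x0 x1 x2 x3
  define \<rho> where "\<rho> x = f (tr x / 2) (- tr (\<iota> * x) / (2 * N \<iota>)) (- tr (\<tau> * x) / (2 * \<eta>))
    (- tr (\<iota> * \<tau> * x) / (2 * (N \<iota> * \<eta>)))" for x
  have \<rho>: "\<rho> x = f c0 c1 c2 c3" if "x = em c0 + em c1 * \<iota> + em c2 * \<tau> + em c3 * (\<iota> * \<tau>)" for x c0 c1 c2 c3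
  proof -
    have "tr x / 2 = c0" "- tr (\<iota> * x) / (2 * N \<iota>) = c1" "- tr (\<tau> * x) / (2 * \<eta>) = c2"
      "- tr (\<iota> * \<tau> * x) / (2 * (N \<iota> * \<eta>)) = c3"
      unfolding coords_trace[OF that] by (simp_all add: field_simps)
    thus ?thesis unfolding \<rho>_def by simp
  qed
  have rr: "r * r = - to_ac (N \<iota>)" "r * (r * y) = - to_ac (N \<iota>) * y" for y
    using r by (simp_all add: power2_eq_square mult.assoc[symmetric])
  have "splitting Q \<rho>"
    unfolding splitting_def
  proof (intro conjI allI)
    show "\<rho> x \<in> carrier_mat 2 2" for x by (simp add: \<rho>_def f_def)
    show "\<rho> (em c) = to_ac c \<cdot>\<^sub>m 1\<^sub>m 2" for c
      using \<rho>[of "em c" c 0 0 0] by (auto simp: f_def intro!: mat2_eqI)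
    fix x y
    obtain x0 x1 x2 x3 where x: "x = em x0 + em x1 * \<iota> + em x2 * \<tau> + em x3 * (\<iota> * \<tau>)"
      by (rule coords_exist)
    obtain y0 y1 y2 y3 where y: "y = em y0 + em y1 * \<iota> + em y2 * \<tau> + em y3 * (\<iota> * \<tau>)"
      by (rule coords_exist)
    have "x + y = em (x0 + y0) + em (x1 + y1) * \<iota> + em (x2 + y2) * \<tau> + em (x3 + y3) * (\<iota> * \<tau>)"
      by (simp add: x y em_add algebra_simps)
    thus "\<rho> (x + y) = \<rho> x + \<rho> y"
      unfolding \<rho>[OF x] \<rho>[OF y] by (subst \<rho>) (assumption, simp add: f_def algebra_simps)
    have "x * y = em (x0 * y0 - N \<iota> * x1 * y1 - \<eta> * x2 * y2 - N \<iota> * \<eta> * x3 * y3) +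
       em (x0 * y1 + x1 * y0 + \<eta> * x2 * y3 - \<eta> * x3 * y2) * \<iota> +
       em (x0 * y2 + x2 * y0 - N \<iota> * x1 * y3 + N \<iota> * x3 * y1) * \<tau> +
       em (x0 * y3 + x3 * y0 + x1 * y2 - x2 * y1) * (\<iota> * \<tau>)"
      unfolding x y by (rule quaternion_mult)
    thus "\<rho> (x * y) = \<rho> x * \<rho> y"
      unfolding \<rho>[OF x] \<rho>[OF y] by (subst \<rho>) (assumption, simp add: f_def algebra_simps rr)
  qed
  thus ?thesis by blast
qed

lemma splittingD:
  assumes "splitting Q \<rho>"
  shows "\<rho> x \<in> carrier_mat 2 2" "\<rho> (x + y) = \<rho> x + \<rho> y" "\<rho> (x * y) = \<rho> x * \<rho> y"
    "\<rho> (em c) = to_ac c \<cdot>\<^sub>m 1\<^sub>m 2"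
  using assms unfolding splitting_def by blast+

lemma split_mat2:
  assumes "splitting Q \<rho>"
  shows "split_mat \<rho> (mat2 a b c d) = four_block_mat (\<rho> a) (\<rho> b) (\<rho> c) (\<rho> d)"
proof (rule eq_matI)
  have dims: "dim_row (\<rho> x) = 2" "dim_col (\<rho> x) = 2" for x
    using splittingD(1)[OF assms] by blast+
  fix i j assume "i < dim_row (four_block_mat (\<rho> a) (\<rho> b) (\<rho> c) (\<rho> d))"
    "j < dim_col (four_block_mat (\<rho> a) (\<rho> b) (\<rho> c) (\<rho> d))"
  hence ij: "i < 4" "j < 4" by (simp_all add: dims)
  have d: "i div 2 = (if i < 2 then 0 else Suc 0)" "i mod 2 = (if i < 2 then i else i - 2)"
    if "i < 4" for i :: nat using that by (auto simp: div_if mod_if)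
  show "split_mat \<rho> (mat2 a b c d) $$ (i, j) = four_block_mat (\<rho> a) (\<rho> b) (\<rho> c) (\<rho> d) $$ (i, j)"
    using ij by (simp add: split_mat_def dims d)
qed (use carrier_matD[OF splittingD(1)[OF assms]] in \<open>auto simp: split_mat_def\<close>)

lemma split_mat2_mult:
  assumes "splitting Q \<rho>"
  shows "split_mat \<rho> (mat2 a b c d * mat2 a' b' c' d') = split_mat \<rho> (mat2 a b c d) * split_mat \<rho> (mat2 a' b' c' d')"
  using splittingD[OF assms]
  by (simp add: split_mat2[OF assms] mult_four_block_mat[of _ 2 2 _ 2 _ 2 _ _ 2 _ 2])

lemma det_split_mat2_mult:
  assumes "splitting Q \<rho>" "A \<in> carrier_mat 2 2" "B \<in> carrier_mat 2 2"
  shows "Determinant.det (split_mat \<rho> (A * B)) = Determinant.det (split_mat \<rho> A) * Determinant.det (split_mat \<rho> B)"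
proof -
  obtain a b c d where A: "A = mat2 a b c d" using assms(2) by (rule mat2_cases)
  obtain a' b' c' d' where B: "B = mat2 a' b' c' d'" using assms(3) by (rule mat2_cases)
  have car: "split_mat \<rho> M \<in> carrier_mat 4 4" if "M \<in> carrier_mat 2 2" for M
    using that by (auto simp: split_mat_def)
  show ?thesis
    unfolding A B split_mat2_mult[OF assms(1)] by (rule Determinant.det_mult) (rule car, simp)+
qed

text \<open>The off-diagonal blocks multiply to the scalar N b and the lower blocks commute, so the
  block determinant is that of the scalar 2 by 2 matrix a c - N b. This is where the square root of
  the reduced norm comes from.\<close>

lemma det_split_hermitian:
  assumes \<rho>: "splitting Q \<rho>"
  shows "Determinant.det (split_mat \<rho> (mat2 (em a) b (st b) (em c))) = to_ac ((a * c - N b)\<^sup>2)"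
proof -
  note s = splittingD[OF \<rho>]
  have "em (N b) = b * st b" by (rule em_N)
  hence bb: "\<rho> b * \<rho> (st b) = to_ac (N b) \<cdot>\<^sub>m 1\<^sub>m 2" by (metis s(3,4))
  have comm: "\<rho> (st b) * \<rho> (em c) = \<rho> (em c) * \<rho> (st b)"
    by (metis s(3) em_commute)
  have "Determinant.det (split_mat \<rho> (mat2 (em a) b (st b) (em c))) = Determinant.det (\<rho> (em a) * \<rho> (em c) - \<rho> b * \<rho> (st b))"
    unfolding split_mat2[OF \<rho>] by (rule det_four_block_mat[of _ 2]) (use s(1) comm in auto)
  also have "\<rho> (em a) * \<rho> (em c) - \<rho> b * \<rho> (st b) = to_ac (a * c - N b) \<cdot>\<^sub>m 1\<^sub>m 2"
    unfolding bb s(3)[symmetric, of "em a" "em c"] em_mult[symmetric] s(4) by (rule mat2_eqI) auto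
  also have "Determinant.det \<dots> = to_ac ((a * c - N b)\<^sup>2)"
    by (simp add: Determinant.det_smult)
  finally show ?thesis .
qed

lemma det_split_scalar:
  assumes \<rho>: "splitting Q \<rho>"
  shows "Determinant.det (split_mat \<rho> (Matrix.mat 1 1 (\<lambda>ab. em a))) = to_ac (a\<^sup>2)"
proof -
  have "split_mat \<rho> (Matrix.mat 1 1 (\<lambda>ab. em a)) = \<rho> (em a)"
    using splittingD(1)[OF \<rho>, of "em a"] by (intro eq_matI) (auto simp: split_mat_def less_2_cases_iff)
  thus ?thesis using splittingD(4)[OF \<rho>] by (simp add: Determinant.det_smult)
qed

lemma Nrd_eqI:
  assumes "\<And>\<rho>. splitting Q \<rho> \<Longrightarrow> Determinant.det (split_mat \<rho> A) = to_ac c"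
  shows "Nrd Q A = c"
  unfolding Nrd_def
  by (rule the_equality) (use assms splitting_exists in force)+

text \<open>The root picked by choice is determined up to sign, which fixes its size and whether it
  vanishes.\<close>

lemma av_sqrt:
  assumes "v = c\<^sup>2" shows "av (SOME d. d ^ 2 = v) = av c" "(SOME d. d ^ 2 = v) = 0 \<longleftrightarrow> c = 0"
proof -
  have "\<exists>d. d ^ 2 = v" using assms by blast
  from someI_ex[OF this] have "(SOME d. d ^ 2 = v) ^ 2 = c\<^sup>2" unfolding assms .
  hence "(SOME d. d ^ 2 = v) = c \<or> (SOME d. d ^ 2 = v) = - c" by (simp add: power2_eq_iff)
  thus "av (SOME d. d ^ 2 = v) = av c" "(SOME d. d ^ 2 = v) = 0 \<longleftrightarrow> c = 0" by auto
qed

lemma dpf_1: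
  assumes "x $$ (0, 0) = em a"
  shows "av (dpf Q 1 x) = av a" "dpf Q 1 x = 0 \<longleftrightarrow> a = 0"
proof -
  have "Matrix.mat 1 1 (\<lambda>ab. x $$ ab) = Matrix.mat 1 1 (\<lambda>ab. em a)" using assms by (intro eq_matI) auto
  hence "Nrd Q (Matrix.mat 1 1 (\<lambda>ab. x $$ ab)) = a\<^sup>2" by (intro Nrd_eqI) (simp only: det_split_scalar)
  from av_sqrt[OF this] show "av (dpf Q 1 x) = av a" "dpf Q 1 x = 0 \<longleftrightarrow> a = 0"
    by (simp_all add: dpf_def)
qed

lemma dpf_2:
  assumes "x = mat2 (em a) b (st b) (em c)"
  shows "av (dpf Q 2 x) = av (a * c - N b)" "dpf Q 2 x = 0 \<longleftrightarrow> a * c - N b = 0"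
proof -
  have "Matrix.mat 2 2 (\<lambda>ab. x $$ ab) = x" by (intro eq_matI) (auto simp: assms)
  hence "Nrd Q (Matrix.mat 2 2 (\<lambda>ab. x $$ ab)) = (a * c - N b)\<^sup>2"
    by (intro Nrd_eqI) (simp only: assms det_split_hermitian)
  from av_sqrt[OF this] show "av (dpf Q 2 x) = av (a * c - N b)" "dpf Q 2 x = 0 \<longleftrightarrow> a * c - N b = 0"
    by (simp_all add: dpf_def)
qed

lemma adj_mat2 [simp]: "adj Q (mat2 a b c d) = mat2 (st a) (st c) (st b) (st d)"
  by (rule mat2_eqI) (auto simp: adj_def)

lemma act_mat2:
  "act Q (mat2 p r s t) (mat2 a b c d) =
   mat2 ((p * a + r * c) * st p + (p * b + r * d) * st r) ((p * a + r * c) * st s + (p * b + r * d) * st t)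
     ((s * a + t * c) * st p + (s * b + t * d) * st r) ((s * a + t * c) * st s + (s * b + t * d) * st t)"
  by (simp add: act_def)

lemma st_fixed:
  assumes "st x = x" obtains a where "x = em a"
proof -
  have "em (tr x / 2) = em (1/2) * (x + x)" using assms em_tr[of x] em_mult[of "1/2" "tr x"] by simp
  also have "\<dots> = em (1/2 * 2) * x" unfolding em_mult by (simp add: em_2 mult_2 distrib_left mult.assoc)
  finally show thesis using that[of "tr x / 2"] by simp
qed

lemma hermitian_mat2:
  assumes "A \<in> carrier_mat 2 2" "adj Q A = A"
  obtains a b c where "A = mat2 (em a) b (st b) (em c)"
proof -
  obtain a b c d where A: "A = mat2 a b c d" using assms(1) by (rule mat2_cases)
  hence h: "st a = a" "c = st b" "st d = d" using assms(2) by auto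
  thus thesis using A that st_fixed by metis
qed

end

section \<open>The groups \<open>G\<close> and \<open>K\<close>\<close>

locale quaternion_rank = quaternion_basis Q \<iota> \<tau>
  for Q :: "('k :: field_char_0, 'd :: division_ring) quat_datum" and \<iota> \<tau> +
  fixes n :: nat
begin

abbreviation "G \<equiv> carrier (GLD Q n)"
abbreviation "K \<equiv> GLO Q n"
abbreviation "HX \<equiv> herm Q n"
abbreviation "iv A \<equiv> inv\<^bsub>GLD Q n\<^esub> A"
abbreviation "ad \<equiv> adj Q"

lemma GLD_mult [simp]: "A \<otimes>\<^bsub>GLD Q n\<^esub> B = A * B" and GLD_one [simp]: "\<one>\<^bsub>GLD Q n\<^esub> = 1\<^sub>m n"
  by (simp_all add: GLD_def units_of_def ring_mat_simps)

sublocale GL: group "GLD Q n"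
proof -
  interpret semiring "ring_mat TYPE('d) n ()" by (rule semiring_mat)
  show "group (GLD Q n)" unfolding GLD_def by (rule units_group)
qed

lemma G_iff: "A \<in> G \<longleftrightarrow> A \<in> carrier_mat n n \<and> (\<exists>B \<in> carrier_mat n n. B * A = 1\<^sub>m n \<and> A * B = 1\<^sub>m n)"
  by (simp add: GLD_def units_of_def ring_mat_simps Units_def)

lemma G_carrier: "A \<in> G \<Longrightarrow> A \<in> carrier_mat n n"
  by (simp add: G_iff)

lemma G_mult [simp]: "A \<in> G \<Longrightarrow> B \<in> G \<Longrightarrow> A * B \<in> G"
  using GL.m_closed[of A B] by simp

lemma G_one [simp]: "1\<^sub>m n \<in> G"
  using GL.one_closed by simp

lemma iv_mult [simp]: "A \<in> G \<Longrightarrow> iv A * A = 1\<^sub>m n" "A \<in> G \<Longrightarrow> A * iv A = 1\<^sub>m n"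
  using GL.l_inv GL.r_inv by auto

lemma mat_closed [simp]: "A \<in> carrier_mat n n \<Longrightarrow> B \<in> carrier_mat n n \<Longrightarrow> A * B \<in> carrier_mat n n" for A B :: "'d mat"
  by (rule mult_carrier_mat)

lemma mat_assoc [simp]: "A \<in> carrier_mat n n \<Longrightarrow> B \<in> carrier_mat n n \<Longrightarrow> C \<in> carrier_mat n n \<Longrightarrow>
    A * B * C = A * (B * C)" for A B C :: "'d mat"
  by (rule assoc_mult_mat)

lemma iv_cancel [simp]: "A \<in> G \<Longrightarrow> B \<in> carrier_mat n n \<Longrightarrow> iv A * (A * B) = B"
    "A \<in> G \<Longrightarrow> B \<in> carrier_mat n n \<Longrightarrow> A * (iv A * B) = B"
    "A \<in> G \<Longrightarrow> B \<in> carrier_mat n n \<Longrightarrow> B * A * iv A = B"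
    "A \<in> G \<Longrightarrow> B \<in> carrier_mat n n \<Longrightarrow> B * iv A * A = B"
proof -
  assume A: "A \<in> G" and B: "B \<in> carrier_mat n n"
  hence c: "A \<in> carrier_mat n n" "iv A \<in> carrier_mat n n" by (auto simp: G_carrier)
  show "iv A * (A * B) = B" by (subst assoc_mult_mat[symmetric, OF c(2,1) B]) (use A B in simp)
  show "A * (iv A * B) = B" by (subst assoc_mult_mat[symmetric, OF c(1,2) B]) (use A B in simp)
  show "B * A * iv A = B" by (subst assoc_mult_mat[OF B c]) (use A B in simp)
  show "B * iv A * A = B" by (subst assoc_mult_mat[OF B c(2,1)]) (use A B in simp)
qed

lemma iv_eqI: "A \<in> carrier_mat n n \<Longrightarrow> B \<in> carrier_mat n n \<Longrightarrow> A * B = 1\<^sub>m n \<Longrightarrow> B * A = 1\<^sub>m n \<Longrightarrow> A \<in> G \<and> iv A = B"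
  using GL.inv_equality[of B A] by (auto simp: G_iff)

lemma iv_of_mult: "A \<in> G \<Longrightarrow> B \<in> G \<Longrightarrow> iv (A * B) = iv B * iv A"
  using GL.inv_mult_group[of A B] by simp

text \<open>An entrywise bound, submultiplicative because \<open>w\<close> is ultrametric.
  Membership in K and in balls is phrased through it.\<close>

definition bd :: "real \<Rightarrow> 'd mat \<Rightarrow> bool" where
  "bd r A \<longleftrightarrow> (\<forall>i < n. \<forall>j < n. w (A $$ (i, j)) \<le> r)"

lemma bd_mult:
  assumes "bd r A" "bd s B" "0 \<le> r" "0 \<le> s" "A \<in> carrier_mat n n" "B \<in> carrier_mat n n"
  shows "bd (r * s) (A * B)"
  using assms unfolding bd_def
  by (auto simp: scalar_prod_def w_mult intro!: w_sum_le mult_mono)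

lemma bd_mono: "bd r A \<Longrightarrow> r \<le> s \<Longrightarrow> bd s A"
  unfolding bd_def by (meson order_trans)

lemma bd_one: "bd 1 (1\<^sub>m n)"
  by (auto simp: bd_def)

lemma K_iff: "A \<in> K \<longleftrightarrow> A \<in> G \<and> bd 1 A \<and> bd 1 (iv A)"
proof -
  have "elements_mat A \<subseteq> maxord Q \<longleftrightarrow> bd 1 A" if "A \<in> G" for A
  proof -
    have "elements_mat A = {A $$ (i, j) | i j. i < n \<and> j < n}"
      using G_carrier[OF that] by (auto dest!: elements_matD)
    thus ?thesis by (simp add: bd_def maxord_eq subset_iff \<O>_iff) blast
  qed
  thus ?thesis by (auto simp: GLO_def)
qed

lemma K_G: "A \<in> K \<Longrightarrow> A \<in> G" and K_bd: "A \<in> K \<Longrightarrow> bd 1 A"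
  by (auto simp: K_iff)

lemma K_one [simp]: "1\<^sub>m n \<in> K"
  using GL.inv_one by (simp add: K_iff bd_one)

lemma K_mult [simp]: "A \<in> K \<Longrightarrow> B \<in> K \<Longrightarrow> A * B \<in> K"
  using bd_mult[of 1 A 1 B] bd_mult[of 1 "iv B" 1 "iv A"]
  by (simp add: K_iff iv_of_mult G_carrier)

lemma K_iv [simp]: "A \<in> K \<Longrightarrow> iv A \<in> K"
  by (simp add: K_iff)

lemma bd_K_mult:
  assumes "h \<in> K" "A \<in> carrier_mat n n" "0 \<le> r"
  shows "bd r (h * A) \<longleftrightarrow> bd r A" "bd r (A * h) \<longleftrightarrow> bd r A"
proof -
  have h: "h \<in> carrier_mat n n" "iv h \<in> carrier_mat n n" "bd 1 h" "bd 1 (iv h)" "h \<in> G"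
    using assms(1) by (auto simp: K_iff G_carrier)
  show "bd r (h * A) \<longleftrightarrow> bd r A"
    using bd_mult[of 1 h r A] bd_mult[of 1 "iv h" r "h * A"] h assms by auto
  show "bd r (A * h) \<longleftrightarrow> bd r A"
    using bd_mult[of r A 1 h] bd_mult[of r "A * h" 1 "iv h"] h assms by auto
qed

lemma st_sum: "st (sum f S) = (\<Sum>i\<in>S. st (f i))"
  by (induction S rule: infinite_finite_induct) (auto simp: st_add)

lemma ad_carrier [simp]: "A \<in> carrier_mat n n \<Longrightarrow> ad A \<in> carrier_mat n n"
  by (auto simp: adj_def)

lemma ad_index: "A \<in> carrier_mat n n \<Longrightarrow> i < n \<Longrightarrow> j < n \<Longrightarrow> ad A $$ (i, j) = st (A $$ (j, i))"
  by (auto simp: adj_def)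

lemma ad_mult: "A \<in> carrier_mat n n \<Longrightarrow> B \<in> carrier_mat n n \<Longrightarrow> ad (A * B) = ad B * ad A"
  by (rule eq_matI) (auto simp: adj_def scalar_prod_def st_sum st_mult)

lemma ad_ad [simp]: "A \<in> carrier_mat n n \<Longrightarrow> ad (ad A) = A"
  by (rule eq_matI) (auto simp: adj_def)

lemma ad_one [simp]: "ad (1\<^sub>m n) = 1\<^sub>m n"
  by (rule eq_matI) (auto simp: adj_def)

lemma ad_G: "A \<in> G \<Longrightarrow> ad A \<in> G \<and> iv (ad A) = ad (iv A)"
  by (rule iv_eqI) (simp_all add: G_carrier ad_mult[symmetric])

lemma bd_ad: "A \<in> carrier_mat n n \<Longrightarrow> bd r (ad A) \<longleftrightarrow> bd r A"
  unfolding bd_def by (auto simp: ad_index)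

lemma ad_K: "A \<in> K \<Longrightarrow> ad A \<in> K"
  using ad_G[of A] bd_ad[of A 1] bd_ad[of "iv A" 1] by (auto simp: K_iff G_carrier)

lemma X_iff: "x \<in> HX \<longleftrightarrow> x \<in> G \<and> ad x = x"
  by (simp add: herm_def)

lemma X_carrier: "x \<in> HX \<Longrightarrow> x \<in> carrier_mat n n"
  by (simp add: X_iff G_carrier)

lemma act_X [simp]: "g \<in> G \<Longrightarrow> x \<in> HX \<Longrightarrow> act Q g x \<in> HX"
  using ad_G[of g] by (auto simp: X_iff act_def ad_mult G_carrier)

lemma act_act: "g \<in> carrier_mat n n \<Longrightarrow> h \<in> carrier_mat n n \<Longrightarrow> x \<in> carrier_mat n n \<Longrightarrow> act Q (g * h) x = act Q g (act Q h x)"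
  by (simp add: act_def ad_mult)

lemma act_one [simp]: "x \<in> carrier_mat n n \<Longrightarrow> act Q (1\<^sub>m n) x = x"
  by (simp add: act_def)

definition TT :: "'d mat" where "TT = Matrix.mat n n (\<lambda>(i, j). if i = j then \<tau> else 0)"

definition TT' :: "'d mat" where "TT' = Matrix.mat n n (\<lambda>(i, j). if i = j then inverse \<tau> else 0)"

lemma TT_carrier [simp]: "TT \<in> carrier_mat n n" "TT' \<in> carrier_mat n n"
  by (simp_all add: TT_def TT'_def)

lemma TT_mult_index:
  assumes "A \<in> carrier_mat n n" "i < n" "j < n"
  shows "(TT * A) $$ (i, j) = \<tau> * A $$ (i, j)" "(A * TT) $$ (i, j) = A $$ (i, j) * \<tau>"
    "(TT' * A) $$ (i, j) = inverse \<tau> * A $$ (i, j)" "(A * TT') $$ (i, j) = A $$ (i, j) * inverse \<tau>"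
  using assms by (auto simp: TT_def TT'_def scalar_prod_def if_distrib[of "\<lambda>x. x * _"] if_distrib[of "\<lambda>x. _ * x"] cong: if_cong)

lemma TT_inverse: "TT * TT' = 1\<^sub>m n" "TT' * TT = 1\<^sub>m n"
  by (rule eq_matI; use TT_mult_index[of TT'] TT_mult_index[of TT] in \<open>auto simp: TT_def TT'_def\<close>)+

lemma TT_G [simp]: "TT \<in> G" "TT' \<in> G" and iv_TT: "iv TT = TT'" "iv TT' = TT"
  using iv_eqI[of TT TT'] iv_eqI[of TT' TT] by (auto simp: TT_inverse)

lemma bd_TT_mult:
  assumes "A \<in> carrier_mat n n"
  shows "bd r (TT * A) \<longleftrightarrow> bd (r * real q) A" "bd r (A * TT) \<longleftrightarrow> bd (r * real q) A"
    "bd r (TT' * A) \<longleftrightarrow> bd (r / real q) A" "bd r (A * TT') \<longleftrightarrow> bd (r / real q) A"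
  using q_pos by (auto simp: bd_def TT_mult_index[OF assms] w_mult w_tau w_inverse w_divide field_simps)

text \<open>The uniformizer \<tau> normalizes \<O>: the factor q gained on one side is lost on the
  other.\<close>

lemma TT_conj:
  assumes "h \<in> K" shows "TT * h * TT' \<in> K" "TT' * h * TT \<in> K"
proof -
  have h: "h \<in> carrier_mat n n" "iv h \<in> carrier_mat n n" "bd 1 h" "bd 1 (iv h)" "h \<in> G"
    using assms(1) by (auto simp: K_iff G_carrier)
  have "iv (TT * h * TT') = TT * iv h * TT'" "iv (TT' * h * TT) = TT' * iv h * TT"
    using h by (simp_all add: iv_of_mult iv_TT G_carrier)
  thus "TT * h * TT' \<in> K" "TT' * h * TT \<in> K" using h q_nz by (simp_all add: K_iff bd_TT_mult)
qed

end

section \<open>Finite residue systems and completeness of D\<close>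

context quaternion_basis begin

text \<open>Digit expansion in powers of \<tau>: each step appends one residue of \<O> modulo
  \<tau>.\<close>

lemma integer_reps:
  "\<exists>R. finite R \<and> (\<forall>x. w x \<le> 1 \<longrightarrow> (\<exists>r\<in>R. w (x - r) \<le> (1 / real q) ^ l))"
proof (induction l)
  case 0
  show ?case by (intro exI[of _ "{0}"]) simp
next
  case (Suc l)
  then obtain R where R: "finite R" "\<And>x. w x \<le> 1 \<Longrightarrow> \<exists>r\<in>R. w (x - r) \<le> (1 / real q) ^ l" by blast
  obtain T where T: "finite T" "\<And>x. w x \<le> 1 \<Longrightarrow> \<exists>t\<in>T. w (x - t) < 1" by (rule residue_reps_integers) blast
  have cover: "\<exists>r\<in>(\<lambda>(r, t). r + \<tau> ^ l * t) ` (R \<times> T). w (x - r) \<le> (1 / real q) ^ Suc l" if x: "w x \<le> 1" for x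
  proof -
    obtain r where r: "r \<in> R" "w (x - r) \<le> (1 / real q) ^ l" using R(2)[OF x] by blast
    define y where "y = inverse (\<tau> ^ l) * (x - r)"
    have "w y \<le> 1" using r q_pos
      by (simp add: y_def w_mult w_inverse w_divide w_power w_tau field_simps)
    then obtain t where t: "t \<in> T" "w (y - t) < 1" using T by blast
    have "x - (r + \<tau> ^ l * t) = \<tau> ^ l * (y - t)"
      by (simp add: y_def right_diff_distrib mult.assoc[symmetric])
    hence "w (x - (r + \<tau> ^ l * t)) = (1 / real q) ^ l * w (y - t)"
      by (simp only: w_mult w_power w_tau)
    also have "\<dots> \<le> (1 / real q) ^ l * (1 / real q)"
      using t(2) by (intro mult_left_mono) (simp_all add: w_lt_1_iff)
    finally have "w (x - (r + \<tau> ^ l * t)) \<le> (1 / real q) ^ Suc l" by (simp add: mult.commute)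
    thus ?thesis using r(1) t(1) by force
  qed
  have "finite ((\<lambda>(r, t). r + \<tau> ^ l * t) ` (R \<times> T))" using R(1) T(1) by simp
  thus ?case using cover by (intro exI[of _ "(\<lambda>(r, t). r + \<tau> ^ l * t) ` (R \<times> T)"] conjI allI impI)
qed

text \<open>Completeness is inherited from k through the coordinates, which are traces. The sharp
  rate is recovered at the end by comparing with a very late term of the sequence.\<close>

lemma complete_D:
  assumes step: "\<And>m. w (u (Suc m) - u m) \<le> (1 / real q) ^ (2 * m)"
  obtains l where "\<And>m. w (u m - l) \<le> (1 / real q) ^ (2 * m)"
proof -
  let ?e = "\<lambda>m. (1 / real q) ^ m"
  have qq: "0 < 1 / real q" "1 / real q < 1" using q_gt_1 q_pos by auto
  have dist: "w (u (m + k) - u m) \<le> ?e (2 * m)" for m k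
  proof (induction k)
    case (Suc k)
    have "?e (2 * (m + k)) \<le> ?e (2 * m)" using qq by (intro power_decreasing) auto
    hence "w (u (Suc (m + k)) - u (m + k)) \<le> ?e (2 * m)" using step[of "m + k"] by linarith
    moreover have "u (m + Suc k) - u m = (u (Suc (m + k)) - u (m + k)) + (u (m + k) - u m)" by simp
    ultimately show ?case using Suc w_add_le by metis
  qed (use qq in simp)
  have trace_bound: "av (tr (y * x)) \<le> ?e m" if "w x \<le> ?e (2 * m)" "w y \<le> 1" for x y m
  proof -
    have "av (tr (y * x)) * av (tr (y * x)) \<le> w (y * x)" by (rule av_tr_le)
    also have "\<dots> \<le> 1 * ?e (2 * m)" unfolding w_mult using that by (intro mult_mono) auto
    also have "\<dots> = ?e m * ?e m" by (simp add: power_add[symmetric] mult_2)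
    finally show ?thesis using qq by (metis abs_le_square_iff abs_of_nonneg av_nonneg power2_eq_square zero_le_power less_imp_le)
  qed
  have lim: "\<exists>l. \<forall>e>0. \<exists>M. \<forall>m\<ge>M. av (tr (y * u m) - l) < e" if y: "w y \<le> 1" for y
  proof -
    have tri: "av (tr (y * u i) - tr (y * u j)) \<le> ?e (min i j)" for i j
    proof (cases "i \<le> j")
      case True
      have "tr (y * u j) - tr (y * u i) = tr (y * (u j - u i))"
        using tr_add[of "y * (u j - u i)" "y * u i"] by (simp add: right_diff_distrib)
      thus ?thesis using trace_bound[OF dist[of i "j - i"] y] True by (simp add: av_diff_commute[of "tr (y * u i)"] min_def)
    next
      case False
      have "tr (y * u i) - tr (y * u j) = tr (y * (u i - u j))"
        using tr_add[of "y * (u i - u j)" "y * u j"] by (simp add: right_diff_distrib)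
      thus ?thesis using trace_bound[OF dist[of j "i - j"] y] False by (simp add: min_def)
    qed
    have "\<exists>l. (\<lambda>i. av (tr (y * u i) - l)) \<longlonglongrightarrow> 0"
    proof (rule complete)
      fix e :: real assume "e > 0"
      then obtain M where M: "?e M < e" using real_arch_pow_inv[of e "1 / real q"] qq by auto
      have "av (tr (y * u i) - tr (y * u j)) < e" if "i \<ge> M" "j \<ge> M" for i j
      proof -
        have "?e (min i j) \<le> ?e M" using that qq by (intro power_decreasing) auto
        thus ?thesis using tri[of i j] M by linarith
      qed
      thus "\<exists>N. \<forall>i\<ge>N. \<forall>j\<ge>N. av (tr (y * u i) - tr (y * u j)) < e" by blast
    qed
    then obtain l where "(\<lambda>i. av (tr (y * u i) - l)) \<longlonglongrightarrow> 0" by blast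
    hence "eventually (\<lambda>i. av (tr (y * u i) - l) < e) sequentially" if "e > 0" for e
      using that by (rule order_tendstoD(2))
    thus ?thesis by (auto simp: eventually_sequentially)
  qed
  have w4: "w 1 \<le> 1" "w \<iota> \<le> 1" "w \<tau> \<le> 1" "w (\<iota> * \<tau>) \<le> 1"
    using q_gt_1 by (auto simp: w_mult w_iota w_tau)
  obtain l0 where l0: "\<And>e. e > 0 \<Longrightarrow> \<exists>M. \<forall>m\<ge>M. av (tr (1 * u m) - l0) < e" using lim[OF w4(1)] by blast
  obtain l1 where l1: "\<And>e. e > 0 \<Longrightarrow> \<exists>M. \<forall>m\<ge>M. av (tr (\<iota> * u m) - l1) < e" using lim[OF w4(2)] by blast
  obtain l2 where l2: "\<And>e. e > 0 \<Longrightarrow> \<exists>M. \<forall>m\<ge>M. av (tr (\<tau> * u m) - l2) < e" using lim[OF w4(3)] by blast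
  obtain l3 where l3: "\<And>e. e > 0 \<Longrightarrow> \<exists>M. \<forall>m\<ge>M. av (tr (\<iota> * \<tau> * u m) - l3) < e" using lim[OF w4(4)] by blast
  define l where "l = em (l0 / 2) + em (- l1 / (2 * N \<iota>)) * \<iota> + em (- l2 / (2 * \<eta>)) * \<tau> + em (- l3 / (2 * (N \<iota> * \<eta>))) * (\<iota> * \<tau>)"
  have avi: "av (N \<iota>) = 1" using w_iota by (simp add: w_def)
  have near: "\<exists>M. \<forall>m\<ge>M. w (u m - l) \<le> e" if e: "0 < e" "e < 1" for e
  proof -
    \<comment> \<open>Two of the coordinates divide a trace by \<eta>, which multiplies its size by
      q.\<close>
    define d where "d = e / real q"
    have d: "d > 0" "d < 1" "d < e" "real q * d = e" using e q_gt_1 by (auto simp: d_def field_simps)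
    obtain M where M: "\<forall>m\<ge>M. av (tr (1 * u m) - l0) < d \<and> av (tr (\<iota> * u m) - l1) < d \<and>
        av (tr (\<tau> * u m) - l2) < d \<and> av (tr (\<iota> * \<tau> * u m) - l3) < d"
    proof -
      obtain M0 M1 M2 M3 where "\<forall>m\<ge>M0. av (tr (1 * u m) - l0) < d" "\<forall>m\<ge>M1. av (tr (\<iota> * u m) - l1) < d"
        "\<forall>m\<ge>M2. av (tr (\<tau> * u m) - l2) < d" "\<forall>m\<ge>M3. av (tr (\<iota> * \<tau> * u m) - l3) < d"
        using l0[OF d(1)] l1[OF d(1)] l2[OF d(1)] l3[OF d(1)] by blast
      thus thesis by (intro that[of "max (max M0 M1) (max M2 M3)"]) auto
    qed
    have "w (u m - l) \<le> e" if m: "m \<ge> M" for m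
    proof -
      note Mm = M[rule_format, OF m]
      have sq: "w (em c) \<le> e" if "av c \<le> e" for c
      proof -
        have "av c * av c \<le> av c * 1" using that e by (intro mult_left_mono) auto
        thus ?thesis using that by (simp add: w_em)
      qed
      have qd: "av c / av \<eta> \<le> e" if "av c < d" for c
      proof -
        have "av c * real q \<le> d * real q" using that by (intro mult_right_mono) auto
        thus ?thesis using d(4) by (simp add: av_eta mult.commute)
      qed
      have "u m - l = em ((tr (1 * u m) - l0) / 2) + em (- (tr (\<iota> * u m) - l1) / (2 * N \<iota>)) * \<iota>
         + em (- (tr (\<tau> * u m) - l2) / (2 * \<eta>)) * \<tau> + em (- (tr (\<iota> * \<tau> * u m) - l3) / (2 * (N \<iota> * \<eta>))) * (\<iota> * \<tau>)"
        unfolding l_def by (subst coords_eq[of "u m"])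
          (simp add: em_diff em_add em_minus algebra_simps diff_divide_distrib)
      moreover have "w (em ((tr (1 * u m) - l0) / 2)) \<le> e"
        using Mm d by (intro sq) auto
      moreover have "w (em (- (tr (\<iota> * u m) - l1) / (2 * N \<iota>)) * \<iota>) \<le> e * 1"
        unfolding w_mult using Mm d w4 e by (intro mult_mono sq) (auto simp: av_divide av_mult avi av_diff_commute)
      moreover have "w (em (- (tr (\<tau> * u m) - l2) / (2 * \<eta>)) * \<tau>) \<le> e * 1"
        unfolding w_mult using Mm qd[of "tr (\<tau> * u m) - l2"] w4 e
        by (intro mult_mono sq) (auto simp: av_divide av_mult av_diff_commute)
      moreover have "w (em (- (tr (\<iota> * \<tau> * u m) - l3) / (2 * (N \<iota> * \<eta>))) * (\<iota> * \<tau>)) \<le> e * 1"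
        unfolding w_mult[of "em _"] using Mm qd[of "tr (\<iota> * \<tau> * u m) - l3"] w4 e
        by (intro mult_mono sq) (auto simp: av_divide av_mult avi av_diff_commute)
      ultimately show ?thesis by (auto intro!: w_add_le)
    qed
    thus ?thesis by blast
  qed
  have "w (u m - l) \<le> ?e (2 * m)" for m
  proof -
    have "0 < ?e (Suc (2 * m))" "?e (Suc (2 * m)) < 1" using qq by (auto simp del: power_Suc intro: power_Suc_less_one)
    then obtain M where M: "\<forall>i\<ge>M. w (u i - l) \<le> ?e (Suc (2 * m))" using near by blast
    have "?e (Suc (2 * m)) \<le> ?e (2 * m)" using qq by (intro power_decreasing) auto
    hence "w (u (m + M) - l) \<le> ?e (2 * m)" using M[rule_format, of "m + M"] by linarith
    moreover have "u m - l = (u (m + M) - l) - (u (m + M) - u m)" by simp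
    ultimately show ?thesis using dist[of m M] w_diff_le by metis
  qed
  thus thesis by (rule that)
qed

end

section \<open>Congruence balls and the topology of G\<close>

context quaternion_rank begin

abbreviation "TG \<equiv> GL_topology Q n"
abbreviation "nbh A m \<equiv> GL_ball Q n A m"
text \<open>The value of \<open>w\<close> at \<pi>^m, hence the exponent 2 m.\<close>

abbreviation "eps m \<equiv> (1 / real q) ^ (2 * m)"

lemma eps_pos [simp]: "0 < eps m" and eps_le_1: "eps m \<le> 1"
  and eps_anti: "m \<le> m' \<Longrightarrow> eps m' \<le> eps m"
  using q_gt_1 q_pos by (auto intro!: power_le_one power_decreasing)

lemma eps_lt_1: "1 \<le> m \<Longrightarrow> eps m < 1"
  using q_gt_1 by (cases m) (auto simp del: power_Suc simp: power_Suc_less_one)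

lemma eps_small:
  assumes "r > 0" obtains m where "m \<ge> 1" "eps m < r"
proof -
  obtain k where k: "(1 / real q) ^ k < r" using real_arch_pow_inv[OF assms, of "1 / real q"] q_gt_1 by auto
  have "eps (Suc k) \<le> (1 / real q) ^ k" using q_gt_1 by (intro power_decreasing) auto
  thus thesis using that[of "Suc k"] k by linarith
qed

lemma mat_diff_closed [simp]: "A \<in> carrier_mat n n \<Longrightarrow> B \<in> carrier_mat n n \<Longrightarrow> A - B \<in> carrier_mat n n" for A B :: "'d mat"
  by (rule minus_carrier_mat)

lemma bd_diff_iff:
  "A \<in> carrier_mat n n \<Longrightarrow> bd r (B - A) \<longleftrightarrow> (\<forall>i<n. \<forall>j<n. w (B $$ (i, j) - A $$ (i, j)) \<le> r)"
  unfolding bd_def by auto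

lemma bd_diff:
  assumes "bd r A" "bd s B" "B \<in> carrier_mat n n" shows "bd (max r s) (A - B)"
proof -
  have "w (A $$ (i, j) - B $$ (i, j)) \<le> max r s" if "i < n" "j < n" for i j
    using assms that w_diff[of "A $$ (i, j)" "B $$ (i, j)"] by (fastforce simp: bd_def)
  thus ?thesis using assms(3) by (simp add: bd_diff_iff)
qed

lemma bd_diff_sym:
  "A \<in> carrier_mat n n \<Longrightarrow> B \<in> carrier_mat n n \<Longrightarrow> bd r (B - A) \<Longrightarrow> bd r (A - B)"
  by (simp add: bd_diff_iff w_diff_commute)

lemma bd_diff_trans:
  assumes "A \<in> carrier_mat n n" "B \<in> carrier_mat n n" "C \<in> carrier_mat n n" "bd r (B - A)" "bd r (C - B)"
  shows "bd r (C - A)"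
proof -
  have "w (C $$ (i, j) - A $$ (i, j)) \<le> r" if "i < n" "j < n" for i j
  proof -
    have "C $$ (i, j) - A $$ (i, j) = (C $$ (i, j) - B $$ (i, j)) + (B $$ (i, j) - A $$ (i, j))" by simp
    thus ?thesis using assms that by (metis bd_diff_iff w_add_le)
  qed
  thus ?thesis using assms by (simp add: bd_diff_iff)
qed

lemma mat_diff_mult: "A \<in> carrier_mat n n \<Longrightarrow> B \<in> carrier_mat n n \<Longrightarrow> C \<in> carrier_mat n n \<Longrightarrow> A * (B - C) = A * B - A * C"
    "A \<in> carrier_mat n n \<Longrightarrow> B \<in> carrier_mat n n \<Longrightarrow> C \<in> carrier_mat n n \<Longrightarrow> (B - C) * A = B * A - C * A" for A B C :: "'d mat"
  by (rule mult_minus_distrib_mat minus_mult_distrib_mat; assumption)+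

lemma bd_exists:
  assumes "A \<in> carrier_mat n n" obtains r where "r \<ge> 1" "bd r A"
proof -
  let ?S = "insert 1 ((\<lambda>(i, j). w (A $$ (i, j))) ` ({..<n} \<times> {..<n}))"
  show thesis
  proof (rule that[of "Max ?S"])
    show "1 \<le> Max ?S" by (rule Max_ge) auto
    show "bd (Max ?S) A" unfolding bd_def by (intro allI impI Max_ge) auto
  qed
qed

lemma ball_iff:
  assumes "A \<in> G" shows "B \<in> nbh A m \<longleftrightarrow> B \<in> G \<and> bd (eps m) (B - A)"
proof -
  have *: "(\<exists>t\<in>maxord Q. z = em (\<pi> ^ m) * t) \<longleftrightarrow> w z \<le> eps m" for z
  proof -
    have wm: "w (em (\<pi> ^ m)) = eps m" by (simp add: w_em av_power av_unif power_add[symmetric] mult_2)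
    have nz: "em (\<pi> ^ m) \<noteq> 0" by simp
    show ?thesis
    proof
      assume "\<exists>t\<in>maxord Q. z = em (\<pi> ^ m) * t"
      then obtain t where t: "w t \<le> 1" "z = em (\<pi> ^ m) * t" by (auto simp: maxord_eq \<O>_iff)
      have "eps m * w t \<le> eps m * 1" using t(1) q_pos by (intro mult_left_mono) auto
      thus "w z \<le> eps m" unfolding t(2) w_mult wm by simp
    next
      assume z: "w z \<le> eps m"
      have "w (inverse (em (\<pi> ^ m)) * z) \<le> 1" using z eps_pos[of m] unfolding w_mult w_inverse wm
        by (simp add: divide_inverse[symmetric] mult.commute[of "inverse _"] del: eps_pos)
      moreover have "z = em (\<pi> ^ m) * (inverse (em (\<pi> ^ m)) * z)"
        using nz by (simp add: mult.assoc[symmetric])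
      ultimately show "\<exists>t\<in>maxord Q. z = em (\<pi> ^ m) * t" unfolding maxord_eq \<O>_def by blast
    qed
  qed
  show ?thesis using G_carrier[OF assms] by (simp add: GL_ball_def * bd_diff_iff)
qed

lemma ball_G: "A \<in> G \<Longrightarrow> nbh A m \<subseteq> G"
  by (auto simp: ball_iff)

lemma ball_refl [simp]: "A \<in> G \<Longrightarrow> A \<in> nbh A m"
  using eps_pos[of m] by (auto simp: ball_iff bd_diff_iff G_carrier less_imp_le simp del: eps_pos)

text \<open>Ultrametric: every point of a ball is a centre.\<close>

lemma ball_eq:
  assumes "A \<in> G" "B \<in> nbh A m" shows "nbh B m = nbh A m"
proof -
  have B: "B \<in> G" "bd (eps m) (B - A)" using assms by (auto simp: ball_iff)
  hence c: "A \<in> carrier_mat n n" "B \<in> carrier_mat n n" using assms by (auto simp: G_carrier)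
  hence AB: "bd (eps m) (A - B)" using B(2) by (simp add: bd_diff_sym)
  show ?thesis
  proof (rule Set.set_eqI)
    fix C show "C \<in> nbh B m \<longleftrightarrow> C \<in> nbh A m"
      using bd_diff_trans[of A B C] bd_diff_trans[of B A C] c B AB assms
      by (auto simp: ball_iff G_carrier)
  qed
qed

lemma ball_mono: "A \<in> G \<Longrightarrow> m \<le> m' \<Longrightarrow> nbh A m' \<subseteq> nbh A m"
  using eps_anti bd_mono by (fastforce simp: ball_iff)

lemma ball_mult_K:
  assumes "h \<in> K" "A \<in> G"
  shows "(\<lambda>B. h * B) ` nbh A m = nbh (h * A) m" "(\<lambda>B. B * h) ` nbh A m = nbh (A * h) m"
proof -
  have h: "h \<in> G" "iv h \<in> K" "iv h \<in> G" using assms by (auto simp: K_G)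
  note c = G_carrier[OF h(1)] G_carrier[OF h(3)] G_carrier[OF assms(2)]
  have l: "h * B \<in> nbh (h * A) m" "B * h \<in> nbh (A * h) m" if "B \<in> nbh A m" "h \<in> K" "A \<in> G" for h A B
    using that eps_pos[of m] bd_K_mult[of h "B - A" "eps m"]
    by (auto simp: ball_iff K_G mat_diff_mult[symmetric] G_carrier less_imp_le simp del: eps_pos)
  show "(\<lambda>B. h * B) ` nbh A m = nbh (h * A) m"
  proof (intro equalityI subsetI)
    fix C assume C: "C \<in> nbh (h * A) m"
    have CG: "C \<in> G" using ball_G[of "h * A" m] C assms(2) h(1) by auto
    have "iv h * C \<in> nbh (iv h * (h * A)) m" using C h assms by (intro l) (auto simp: K_G)
    hence "iv h * C \<in> nbh A m" using h c assms by simp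
    moreover have "C = h * (iv h * C)" using h CG by (simp add: G_carrier)
    ultimately show "C \<in> (\<lambda>B. h * B) ` nbh A m" by blast
  qed (use l[OF _ assms] in auto)
  show "(\<lambda>B. B * h) ` nbh A m = nbh (A * h) m"
  proof (intro equalityI subsetI)
    fix C assume C: "C \<in> nbh (A * h) m"
    have CG: "C \<in> G" using ball_G[of "A * h" m] C assms(2) h(1) by auto
    have "C * iv h \<in> nbh (A * h * iv h) m" using C h assms by (intro l) (auto simp: K_G)
    moreover have "A * h * iv h = A" using h c assms by (intro iv_cancel)
    moreover have "C = C * iv h * h" using h CG by (intro iv_cancel(4)[symmetric]) (simp_all add: G_carrier)
    ultimately show "C \<in> (\<lambda>B. B * h) ` nbh A m" by (metis imageI)
  qed (use l[OF _ assms] in auto)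
qed

text \<open>If \<open>B\<close> is close to \<open>h \<in> K\<close> and some entry of \<open>C = B\<^sup>-\<^sup>1\<close> has norm \<open>r > 1\<close>, maximal,
  then \<open>C h = 1 - C (B - h)\<close> is smaller than \<open>C\<close>, a contradiction.\<close>

lemma ball_K:
  assumes "h \<in> K" "m \<ge> 1" shows "nbh h m \<subseteq> K"
proof
  fix B assume "B \<in> nbh h m"
  hence B: "B \<in> G" "bd (eps m) (B - h)" using assms by (auto simp: ball_iff K_G)
  note c = G_carrier[OF B(1)] G_carrier[OF GL.inv_closed[OF B(1)]] G_carrier[OF K_G[OF assms(1)]]
  have bdB: "bd 1 B"
    unfolding bd_def
  proof (intro allI impI)
    fix i j assume ij: "i < n" "j < n"
    have "w (B $$ (i, j) - h $$ (i, j)) \<le> 1" "w (h $$ (i, j)) \<le> 1"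
      using B(2) K_bd[OF assms(1)] eps_le_1[of m] c ij by (auto simp: bd_diff_iff bd_def intro: order_trans)
    hence "w ((B $$ (i, j) - h $$ (i, j)) + h $$ (i, j)) \<le> 1" by (rule w_add_le)
    thus "w (B $$ (i, j)) \<le> 1" by simp
  qed
  have small: "bd (max 1 (r * eps m)) (iv B)" if r: "bd r (iv B)" "r \<ge> 0" for r
  proof -
    have Ch: "iv B * h = 1\<^sub>m n - iv B * (B - h)"
      unfolding mat_diff_mult(1)[OF c(2,1,3)] using B(1) c by (intro eq_matI) auto
    have "bd (r * eps m) (iv B * (B - h))" using r B(2) c eps_pos[of m] by (intro bd_mult) (auto simp del: eps_pos)
    hence "bd (max 1 (r * eps m)) (iv B * h)"
      unfolding Ch using c by (intro bd_diff bd_one) auto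
    thus ?thesis using bd_K_mult(2)[OF assms(1) c(2), of "max 1 (r * eps m)"] by simp
  qed
  obtain r where r: "r \<ge> 1" "bd r (iv B)" using bd_exists[OF c(2)] .
  \<comment> \<open>Feeding a bound back into \<open>small\<close> gains a factor
    \<open>eps m\<close> each time, until 1 dominates.\<close>
  have iter: "bd (max 1 (r * eps m ^ k)) (iv B)" for k
  proof (induction k)
    case (Suc k)
    have "max 1 (max 1 (r * a) * e) \<le> max 1 (r * (e * a))" if "0 < e" "e \<le> 1" for a e :: real
      using that by (cases "1 \<le> r * a") (auto simp: max_def ac_simps)
    from this[of "eps m" "eps m ^ k"] have "max 1 (max 1 (r * eps m ^ k) * eps m) \<le> max 1 (r * eps m ^ Suc k)"
      using eps_le_1[of m] eps_pos[of m] by (simp del: eps_pos)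
    thus ?case using small[OF Suc] by (intro bd_mono[OF small[OF Suc]]) auto
  qed (use r bd_mono in auto)
  obtain k where "eps m ^ k < 1 / r" using real_arch_pow_inv[of "1 / r" "eps m"] eps_lt_1[OF assms(2)] r by auto
  hence "max 1 (r * eps m ^ k) = 1" using r by (simp add: max_def field_simps)
  hence "bd 1 (iv B)" using iter[of k] by simp
  thus "B \<in> K" using B(1) bdB by (simp add: K_iff)
qed

text \<open>Balls form a base because each point of a ball is a centre of it. Indices m \<ge> 1 are
  asked for because these keep a ball around a point of K inside K.\<close>

lemma openin_TG: "openin TG U \<longleftrightarrow> U \<subseteq> G \<and> (\<forall>A\<in>U. \<exists>m\<ge>1. nbh A m \<subseteq> U)"
proof
  assume "openin TG U"
  hence "generate_topology_on {GL_ball Q n A m | A m. A \<in> carrier (GLD Q n)} U"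
    by (simp add: GL_topology_def openin_topology_generated_by_iff)
  thus "U \<subseteq> G \<and> (\<forall>A\<in>U. \<exists>m\<ge>1. nbh A m \<subseteq> U)"
  proof induction
    case (Int U V)
    have "\<exists>m\<ge>1. nbh A m \<subseteq> U \<inter> V" if A: "A \<in> U \<inter> V" for A
    proof -
      obtain m m' where m: "m \<ge> 1" "nbh A m \<subseteq> U" "m' \<ge> 1" "nbh A m' \<subseteq> V" using Int.IH A by blast
      have "A \<in> G" using Int.IH A by blast
      hence "nbh A (max m m') \<subseteq> U \<inter> V" using m ball_mono[of A m "max m m'"] ball_mono[of A m' "max m m'"] by auto
      thus ?thesis using m by (meson max.coboundedI1)
    qed
    thus ?case using Int.IH by blast
  next
    case (UN \<U>)
    thus ?case by (meson Sup_least Sup_upper UnionE order_trans)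
  next
    case (Basis U)
    then obtain A m where U: "U = nbh A m" "A \<in> G" by blast
    have "nbh B (max 1 m) \<subseteq> U" if "B \<in> U" for B
      using ball_eq[of A B m] ball_mono[of B m "max 1 m"] that U ball_G[of A m] by auto
    hence "\<forall>B\<in>U. \<exists>m\<ge>1. nbh B m \<subseteq> U" using max.cobounded1[of 1 m] by blast
    thus ?case using U ball_G[of A m] by simp
  qed simp
next
  assume U: "U \<subseteq> G \<and> (\<forall>A\<in>U. \<exists>m\<ge>1. nbh A m \<subseteq> U)"
  have "openin TG (nbh A m)" if "A \<in> G" for A m
    unfolding GL_topology_def openin_topology_generated_by_iff using that by (blast intro: generate_topology_on.Basis)
  moreover have "U = \<Union>{nbh A m | A m. A \<in> U \<and> nbh A m \<subseteq> U}" using U ball_refl by blast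
  ultimately show "openin TG U" using U by (subst \<open>U = _\<close>) (rule openin_Union, blast)
qed

lemma openin_ball: "A \<in> G \<Longrightarrow> openin TG (nbh A m)"
  unfolding openin_TG
proof (intro conjI ballI)
  fix B assume "A \<in> G" "B \<in> nbh A m"
  thus "\<exists>m'\<ge>1. nbh B m' \<subseteq> nbh A m"
    using ball_eq[of A B m] ball_mono[of B m "max 1 m"] ball_G[of A m]
    by (intro exI[of _ "max 1 m"] conjI) auto
qed (rule ball_G)

lemma openin_K: "openin TG K"
  unfolding openin_TG using ball_K K_G by blast

text \<open>Undoing the translation by g enlarges distances at most by a bound r for the inverse of
  g, so the radius is shrunk by that factor.\<close>

lemma openin_mult:
  assumes U: "openin TG U" and g: "g \<in> G"
  shows "openin TG ((\<lambda>k. g * k) ` U)" "openin TG ((\<lambda>k. k * g) ` U)"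
proof -
  have UG: "A \<in> G" if "A \<in> U" for A using U that by (auto simp: openin_TG)
  note c = G_carrier[OF g] G_carrier[OF GL.inv_closed[OF g]]
  obtain r where r: "r \<ge> 1" "bd r (iv g)" using bd_exists[OF c(2)] .
  have "\<exists>m\<ge>1. nbh (g * A) m \<subseteq> (\<lambda>k. g * k) ` U \<and> nbh (A * g) m \<subseteq> (\<lambda>k. k * g) ` U" if A: "A \<in> U" for A
  proof -
    note cA = G_carrier[OF UG[OF A]]
    obtain m0 where m0: "nbh A m0 \<subseteq> U" using U A by (auto simp: openin_TG)
    have "eps m0 / r > 0" using r eps_pos[of m0] by (simp del: eps_pos)
    then obtain m where m: "m \<ge> 1" "eps m < eps m0 / r" by (rule eps_small)
    have "eps m * r < eps m0" using m(2) r(1) pos_less_divide_eq[of r "eps m" "eps m0"] by linarith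
    hence rm: "r * eps m \<le> eps m0" by (simp only: mult.commute)
    have "C \<in> (\<lambda>k. g * k) ` U" if "C \<in> nbh (g * A) m" for C
    proof -
      have C: "C \<in> G" "bd (eps m) (C - g * A)" using that g UG[OF A] by (auto simp: ball_iff)
      have "bd (r * eps m) (iv g * (C - g * A))"
        using r C c cA eps_pos[of m] by (intro bd_mult) (auto simp: G_carrier simp del: eps_pos)
      hence "bd (eps m0) (iv g * C - A)"
        using rm bd_mono c cA C g by (auto simp: mat_diff_mult G_carrier)
      hence "iv g * C \<in> U" using m0 UG[OF A] C g by (auto simp: ball_iff)
      moreover have "C = g * (iv g * C)" using C g by (simp add: G_carrier)
      ultimately show ?thesis by blast
    qed
    moreover have "C \<in> (\<lambda>k. k * g) ` U" if "C \<in> nbh (A * g) m" for C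
    proof -
      have C: "C \<in> G" "bd (eps m) (C - A * g)" using that g UG[OF A] by (auto simp: ball_iff)
      have "bd (eps m * r) ((C - A * g) * iv g)"
        using r C c cA eps_pos[of m] by (intro bd_mult) (auto simp: G_carrier simp del: eps_pos)
      hence "bd (eps m0) (C * iv g - A)"
        using rm bd_mono c cA C g by (auto simp: mat_diff_mult G_carrier mult.commute[of r])
      hence "C * iv g \<in> U" using m0 UG[OF A] C g by (auto simp: ball_iff)
      moreover have "C = C * iv g * g" using C g by (intro iv_cancel(4)[symmetric]) (simp_all add: G_carrier)
      ultimately show ?thesis by (metis imageI)
    qed
    ultimately show ?thesis using m(1) by blast
  qed
  moreover have "g * A \<in> G" "A * g \<in> G" if "A \<in> U" for A using UG[OF that] g by auto
  ultimately show "openin TG ((\<lambda>k. g * k) ` U)" "openin TG ((\<lambda>k. k * g) ` U)"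
    unfolding openin_TG by (auto; blast)+
qed

definition balls :: "nat \<Rightarrow> 'd mat set set" where "balls m = (\<lambda>h. nbh h m) ` K"

text \<open>A ball around an element of K depends only on its entries modulo \<pi>^m, and these have
  finitely many residues.\<close>

lemma finite_balls: "finite (balls m)"
proof -
  obtain R where R: "finite R" "\<And>x. w x \<le> 1 \<Longrightarrow> \<exists>r\<in>R. w (x - r) \<le> eps m"
    using integer_reps[of "2 * m"] by blast
  let ?P = "({..<n} \<times> {..<n}) \<rightarrow>\<^sub>E R"
  have fin: "finite ?P" using R(1) by (intro finite_PiE) auto
  have "\<exists>p\<in>?P. \<forall>i<n. \<forall>j<n. w (h $$ (i, j) - p (i, j)) \<le> eps m" if h: "h \<in> K" for h
  proof -
    define p where "p = restrict (\<lambda>ij. SOME r. r \<in> R \<and> w (h $$ ij - r) \<le> eps m) ({..<n} \<times> {..<n})"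
    have p: "p (i, j) \<in> R \<and> w (h $$ (i, j) - p (i, j)) \<le> eps m" if "i < n" "j < n" for i j
    proof -
      have "\<exists>r. r \<in> R \<and> w (h $$ (i, j) - r) \<le> eps m" using R(2) K_bd[OF h] that by (force simp: bd_def)
      thus ?thesis using someI_ex[of "\<lambda>r. r \<in> R \<and> w (h $$ (i, j) - r) \<le> eps m"] that by (simp add: p_def)
    qed
    hence "p \<in> ?P" by (auto simp: p_def)
    thus ?thesis using p by blast
  qed
  then obtain f where f: "\<And>h. h \<in> K \<Longrightarrow> f h \<in> ?P \<and> (\<forall>i<n. \<forall>j<n. w (h $$ (i, j) - f h (i, j)) \<le> eps m)" by metis
  have eq: "nbh h m = nbh h' m" if "h \<in> K" "h' \<in> K" "f h = f h'" for h h'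
  proof -
    have "w (h $$ (i, j) - h' $$ (i, j)) \<le> eps m" if "i < n" "j < n" for i j
    proof -
      have "h $$ (i, j) - h' $$ (i, j) = (h $$ (i, j) - f h (i, j)) - (h' $$ (i, j) - f h (i, j))" by simp
      thus ?thesis using f \<open>h \<in> K\<close> \<open>h' \<in> K\<close> \<open>f h = f h'\<close> \<open>i < n\<close> \<open>j < n\<close> by (metis w_diff_le)
    qed
    hence "h \<in> nbh h' m" using that by (simp add: ball_iff K_G G_carrier bd_diff_iff)
    thus ?thesis using that by (intro ball_eq) (auto simp: K_G)
  qed
  have "finite (f ` K)" using f fin by (meson finite_subset image_subsetI)
  moreover have "\<exists>g. \<forall>h\<in>K. nbh h m = g (f h)"
    by (intro exI[of _ "\<lambda>p. nbh (SOME h. h \<in> K \<and> f h = p) m"]) (metis (mono_tags, lifting) eq someI)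
  then obtain g where "\<And>h. h \<in> K \<Longrightarrow> nbh h m = g (f h)" by blast
  hence "balls m = g ` f ` K" unfolding balls_def image_image by (intro image_cong) auto
  ultimately show ?thesis by simp
qed

lemma disjoint_balls: "C \<in> balls m \<Longrightarrow> C' \<in> balls m \<Longrightarrow> C \<noteq> C' \<Longrightarrow> C \<inter> C' = {}"
  unfolding balls_def using ball_eq K_G by blast

end

section \<open>Compactness of K and sets made of balls\<close>

context quaternion_rank begin

lemma mat_one [simp]: "A \<in> carrier_mat n n \<Longrightarrow> A * 1\<^sub>m n = A" "A \<in> carrier_mat n n \<Longrightarrow> 1\<^sub>m n * A = A" for A :: "'d mat"
  by (rule right_mult_one_mat left_mult_one_mat; assumption)+

lemma eps_zero: "(\<And>m. w x \<le> eps m) \<Longrightarrow> x = 0"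
proof (rule ccontr)
  assume *: "\<And>m. w x \<le> eps m" and "x \<noteq> 0"
  then obtain m where "eps m < w x" using eps_small w_pos by blast
  thus False using *[of m] by simp
qed

text \<open>The elements and their inverses converge entrywise at the same rate. The limits are
  integral, and their products are limits of the identity, so they are inverse to each
  other.\<close>

lemma K_limit:
  assumes h: "\<And>m. h m \<in> K" "\<And>m. h (Suc m) \<in> nbh (h m) m"
  obtains H where "H \<in> K" "\<And>m. H \<in> nbh (h m) m"
proof -
  have G: "h m \<in> G" "iv (h m) \<in> G" and c: "h m \<in> carrier_mat n n" "iv (h m) \<in> carrier_mat n n" for m
    using K_G[OF h(1)] by (auto simp: G_carrier)
  have bdh: "bd 1 (h m)" "bd 1 (iv (h m))" for m using h(1) by (auto simp: K_iff)
  have step: "bd (eps m) (h (Suc m) - h m)" for m using h(2) G by (simp add: ball_iff)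
  have step': "bd (eps m) (iv (h (Suc m)) - iv (h m))" for m
  proof -
    \<comment> \<open>The difference of two inverses is the difference of the elements multiplied on
      both sides by integral matrices, so the rate is preserved.\<close>
    have "iv (h (Suc m)) * ((h m - h (Suc m)) * iv (h m)) = iv (h (Suc m)) * (h m * iv (h m)) - iv (h (Suc m)) * (h (Suc m) * iv (h m))"
      using c by (simp add: mat_diff_mult)
    also have "\<dots> = iv (h (Suc m)) - iv (h m)" using c G by simp
    finally have *: "iv (h (Suc m)) - iv (h m) = iv (h (Suc m)) * ((h m - h (Suc m)) * iv (h m))" by simp
    have "bd (1 * (eps m * 1)) (iv (h (Suc m)) * ((h m - h (Suc m)) * iv (h m)))"
      using bdh c bd_diff_sym[OF c(1) c(1) step] by (intro bd_mult) auto
    thus ?thesis unfolding * by simp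
  qed
  have lim: "\<exists>l. \<forall>m. w (h m $$ (i, j) - l) \<le> eps m" if "i < n" "j < n" for i j
    using complete_D[of "\<lambda>m. h m $$ (i, j)"] step c that by (metis bd_diff_iff)
  have lim': "\<exists>l. \<forall>m. w (iv (h m) $$ (i, j) - l) \<le> eps m" if "i < n" "j < n" for i j
    using complete_D[of "\<lambda>m. iv (h m) $$ (i, j)"] step' c that by (metis bd_diff_iff)
  obtain l where l: "\<And>i j m. i < n \<Longrightarrow> j < n \<Longrightarrow> w (h m $$ (i, j) - l i j) \<le> eps m" using lim by metis
  obtain l' where l': "\<And>i j m. i < n \<Longrightarrow> j < n \<Longrightarrow> w (iv (h m) $$ (i, j) - l' i j) \<le> eps m" using lim' by metis
  define H where "H = Matrix.mat n n (\<lambda>(i, j). l i j)"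
  define H' where "H' = Matrix.mat n n (\<lambda>(i, j). l' i j)"
  have cH: "H \<in> carrier_mat n n" "H' \<in> carrier_mat n n" by (simp_all add: H_def H'_def)
  have near: "bd (eps m) (h m - H)" "bd (eps m) (iv (h m) - H')" for m
    using l l' cH by (simp_all add: bd_diff_iff) (simp_all add: H_def H'_def)
  have bdH: "bd 1 H" "bd 1 H'"
  proof -
    have "bd (max 1 (eps 0)) (h 0 - (h 0 - H))" "bd (max 1 (eps 0)) (iv (h 0) - (iv (h 0) - H'))"
      using bd_diff[OF bdh(1)[of 0] near(1)[of 0]] bd_diff[OF bdh(2)[of 0] near(2)[of 0]] c cH by simp_all
    moreover have "h 0 - (h 0 - H) = H" "iv (h 0) - (iv (h 0) - H') = H'"
      using c cH by (intro eq_matI; auto)+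
    ultimately show "bd 1 H" "bd 1 H'" by simp_all
  qed
  have zero: "A = B" if "A \<in> carrier_mat n n" "B \<in> carrier_mat n n" "\<And>m. bd (eps m) (A - B)" for A B
  proof (rule eq_matI)
    fix i j assume "i < dim_row B" "j < dim_col B"
    hence "w (A $$ (i, j) - B $$ (i, j)) \<le> eps m" for m using that by (simp add: bd_diff_iff)
    thus "A $$ (i, j) = B $$ (i, j)" using eps_zero by force
  qed (use that in auto)
  have prod: "bd (eps m) (h m * iv (h m) - H * H')" "bd (eps m) (iv (h m) * h m - H' * H)" for m
  proof -
    have "bd (1 * eps m) (H * (iv (h m) - H'))" "bd (eps m * 1) ((h m - H) * iv (h m))"
      "bd (1 * eps m) (H' * (h m - H))" "bd (eps m * 1) ((iv (h m) - H') * h m)"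
      using near[of m] bdH bdh c cH by (intro bd_mult; auto)+
    hence *: "bd (eps m) (H * iv (h m) - H * H')" "bd (eps m) (h m * iv (h m) - H * iv (h m))"
      "bd (eps m) (H' * h m - H' * H)" "bd (eps m) (iv (h m) * h m - H' * h m)"
      using c cH by (simp_all add: mat_diff_mult)
    show "bd (eps m) (h m * iv (h m) - H * H')" "bd (eps m) (iv (h m) * h m - H' * H)"
      by (rule bd_diff_trans[OF _ _ _ *(1,2)] bd_diff_trans[OF _ _ _ *(3,4)]; use c cH in simp)+
  qed
  have "1\<^sub>m n = H * H'" "1\<^sub>m n = H' * H"
    by (rule zero; use prod G c cH in simp)+
  hence "H \<in> G \<and> iv H = H'" using cH by (intro iv_eqI) auto
  hence "H \<in> K" using bdH by (simp add: K_iff)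
  moreover have "H \<in> nbh (h m) m" for m
    using \<open>H \<in> K\<close> G near[of m] bd_diff_sym[of H "h m" "eps m"] cH c by (simp add: ball_iff K_G)
  ultimately show thesis by (rule that)
qed

lemma topspace_TG [simp]: "topspace TG = G"
proof
  have "openin TG (topspace TG)" by simp
  thus "topspace TG \<subseteq> G" unfolding openin_TG by blast
  have "openin TG G" unfolding openin_TG using ball_G by blast
  thus "G \<subseteq> topspace TG" by (rule openin_subset)
qed

text \<open>If \<open>K\<close> had a cover without finite subcover, so would one of the finitely many balls of
  each radius, and such nested balls shrink to a point of \<open>K\<close>.\<close>

lemma compactin_K: "compactin TG K"
  unfolding compactin_def
proof (intro conjI allI impI)
  show "K \<subseteq> topspace TG" using K_G by auto
  fix \<U> assume \<U>: "Ball \<U> (openin TG) \<and> K \<subseteq> \<Union>\<U>"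
  define bad where "bad C \<longleftrightarrow> (\<forall>\<F>. finite \<F> \<and> \<F> \<subseteq> \<U> \<longrightarrow> \<not> C \<subseteq> \<Union>\<F>)" for C
  have bad_mono: "bad C \<Longrightarrow> C \<subseteq> C' \<Longrightarrow> bad C'" for C C' unfolding bad_def by (meson order_trans)
  have bad_Union: "\<exists>C\<in>P. bad C" if "finite P" "bad (\<Union>P)" for P
  proof (rule ccontr)
    assume "\<not> ?thesis"
    then obtain F where F: "\<And>C. C \<in> P \<Longrightarrow> finite (F C) \<and> F C \<subseteq> \<U> \<and> C \<subseteq> \<Union>(F C)"
      unfolding bad_def by metis
    have "finite (\<Union>(F ` P))" using F that(1) by (intro finite_Union) auto
    moreover have "\<Union>(F ` P) \<subseteq> \<U>" using F by (intro UN_least) auto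
    moreover have "\<Union>P \<subseteq> \<Union>(\<Union>(F ` P))"
    proof
      fix x assume "x \<in> \<Union>P"
      then obtain C where C: "C \<in> P" "x \<in> C" by blast
      hence "x \<in> \<Union>(F C)" using F[OF C(1)] by blast
      thus "x \<in> \<Union>(\<Union>(F ` P))" using C(1) by blast
    qed
    ultimately show False
      using that(2)[unfolded bad_def, rule_format, of "\<Union>(F ` P)"] by (simp only: simp_thms)
  qed
  show "\<exists>\<F>. finite \<F> \<and> \<F> \<subseteq> \<U> \<and> K \<subseteq> \<Union>\<F>"
  proof (rule ccontr)
    assume "\<not> ?thesis"
    hence badK: "bad K" unfolding bad_def by blast
    \<comment> \<open>The chain of bad balls starts at the identity with radius \<open>eps 0\<close>
      = 1, a ball that contains all of K.\<close>
    have "\<exists>h. \<forall>m. (h m \<in> K \<and> bad (nbh (h m) m \<inter> K)) \<and> h (Suc m) \<in> nbh (h m) m"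
    proof (rule dependent_nat_choice)
      have "nbh (1\<^sub>m n) 0 \<inter> K = K"
        using bd_diff[OF K_bd bd_one] by (auto simp: ball_iff K_G)
      thus "\<exists>x. x \<in> K \<and> bad (nbh x 0 \<inter> K)" using badK by (intro exI[of _ "1\<^sub>m n"]) simp
    next
      fix x m assume x: "x \<in> K \<and> bad (nbh x m \<inter> K)"
      let ?P = "(\<lambda>C. C \<inter> nbh x m \<inter> K) ` balls (Suc m)"
      have "nbh x m \<inter> K \<subseteq> \<Union>?P" by (auto simp: balls_def K_G)
      hence "bad (\<Union>?P)" using x bad_mono by blast
      then obtain h' where h': "h' \<in> K" "bad (nbh h' (Suc m) \<inter> nbh x m \<inter> K)"
        using bad_Union[of ?P] finite_balls by (auto simp: balls_def)
      have "bad C \<Longrightarrow> C \<noteq> {}" for C unfolding bad_def by blast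
      then obtain B where B: "B \<in> nbh h' (Suc m)" "B \<in> nbh x m" "B \<in> K" using h'(2) by blast
      have "nbh B (Suc m) = nbh h' (Suc m)" using B h' by (intro ball_eq) (auto simp: K_G)
      hence "bad (nbh B (Suc m) \<inter> K)" using bad_mono[OF h'(2), of "nbh h' (Suc m) \<inter> K"] by auto
      thus "\<exists>y. (y \<in> K \<and> bad (nbh y (Suc m) \<inter> K)) \<and> y \<in> nbh x m" using B by blast
    qed
    then obtain h where h: "\<And>m. h m \<in> K" "\<And>m. bad (nbh (h m) m \<inter> K)" "\<And>m. h (Suc m) \<in> nbh (h m) m" by blast
    obtain H where H: "H \<in> K" "\<And>m. H \<in> nbh (h m) m" by (rule K_limit[OF h(1,3)]) blast
    obtain U where U: "U \<in> \<U>" "H \<in> U" using \<U> H(1) by blast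
    then obtain m where "nbh H m \<subseteq> U" using \<U> unfolding openin_TG by blast
    hence "nbh (h m) m \<inter> K \<subseteq> \<Union>{U}" using ball_eq[OF K_G[OF h(1)] H(2)] by auto
    thus False using h(2)[of m, unfolded bad_def, rule_format, of "{U}"] U(1) by simp
  qed
qed

lemma compactin_K_mult:
  assumes g: "g \<in> G"
  shows "compactin TG ((\<lambda>k. g * k) ` K)" "compactin TG ((\<lambda>k. k * g) ` K)"
proof -
  have "{x \<in> G. g * x \<in> U} = (\<lambda>k. iv g * k) ` U" if "openin TG U" for U
  proof -
    have "U \<subseteq> G" using that by (simp add: openin_TG)
    thus ?thesis using g by (auto simp: G_carrier image_iff) (metis G_carrier iv_cancel(1) subsetD)
  qed
  hence "continuous_map TG TG (\<lambda>k. g * k)"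
    using openin_mult(1)[of _ "iv g"] g by (auto simp: continuous_map_def)
  thus "compactin TG ((\<lambda>k. g * k) ` K)" by (rule image_compactin[OF compactin_K])
  have "{x \<in> G. x * g \<in> U} = (\<lambda>k. k * iv g) ` U" if "openin TG U" for U
  proof -
    have U: "U \<subseteq> G" using that by (simp add: openin_TG)
    have "x = x * g * iv g" "x * iv g * g = x" if "x \<in> G" for x using that g iv_cancel(3,4) G_carrier by auto
    thus ?thesis using U g by (auto simp: image_iff simp del: mat_assoc)
  qed
  hence "continuous_map TG TG (\<lambda>k. k * g)"
    using openin_mult(2)[of _ "iv g"] g by (auto simp: continuous_map_def)
  thus "compactin TG ((\<lambda>k. k * g) ` K)" by (rule image_compactin[OF compactin_K])
qed

definition K_invariant :: "('d mat \<Rightarrow> complex) \<Rightarrow> bool" where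
  "K_invariant F \<longleftrightarrow> (\<forall>h\<in>K. \<forall>x\<in>HX. F (act Q h x) = F x)"

text \<open>A union of balls of one radius inside K: an open set whose Haar mass is a number of
  balls times the mass of one ball.\<close>

definition level :: "nat \<Rightarrow> 'd mat set \<Rightarrow> bool" where
  "level m A \<longleftrightarrow> m \<ge> 1 \<and> A \<subseteq> K \<and> (\<forall>h\<in>A. nbh h m \<subseteq> A)"

lemma level_open: "level m A \<Longrightarrow> openin TG A"
  unfolding level_def openin_TG using K_G by blast

lemma level_K: "m \<ge> 1 \<Longrightarrow> level m K"
  unfolding level_def using ball_K by blast

text \<open>Distinct balls of one radius are disjoint and there are finitely many, so the mass is a
  count. The injection \<phi> lets the same count serve translates and conjugates.\<close>

lemma content:
  fixes c :: real
  assumes A: "level m A" and inj: "inj_on \<phi> K"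
    and C: "\<And>C. C \<in> balls m \<Longrightarrow> \<phi> ` C \<in> sets M \<and> emeasure M (\<phi> ` C) \<noteq> \<infinity> \<and> measure M (\<phi> ` C) = c"
  shows "measure M (\<phi> ` A) = card {C \<in> balls m. C \<subseteq> A} * c"
proof -
  let ?S = "{C \<in> balls m. C \<subseteq> A}"
  have "A = \<Union>?S"
    using A K_G by (fastforce simp: level_def balls_def)
  hence "\<phi> ` A = (\<Union>C\<in>?S. \<phi> ` C)" by blast
  also have "measure M \<dots> = (\<Sum>C\<in>?S. measure M (\<phi> ` C))"
  proof (rule measure_finite_Union)
    show "disjoint_family_on (\<lambda>C. \<phi> ` C) ?S"
    proof (unfold disjoint_family_on_def, intro ballI impI)
      fix C C' assume CC: "C \<in> ?S" "C' \<in> ?S" "C \<noteq> C'"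
      hence "C \<subseteq> K" "C' \<subseteq> K" using A by (auto simp: level_def)
      hence "\<phi> ` C \<inter> \<phi> ` C' = \<phi> ` (C \<inter> C')" using inj by (metis inj_on_image_Int)
      moreover have "C \<inter> C' = {}" using CC by (intro disjoint_balls) auto
      ultimately show "\<phi> ` C \<inter> \<phi> ` C' = {}" by simp
    qed
  qed (use finite_balls C in auto)
  also have "\<dots> = card ?S * c" using C by simp
  finally show ?thesis .
qed

end

section \<open>Haar measures\<close>

locale quaternion_haar = quaternion_rank Q \<iota> \<tau> n
  for Q :: "('k :: field_char_0, 'd :: division_ring) quat_datum" and \<iota> \<tau> n +
  fixes \<mu> \<nu> :: "'d mat measure"
  assumes haar_G: "haar_G Q n \<mu>" and haar_K: "haar_K Q n \<nu>"
begin

lemma space_mu [simp]: "space \<mu> = G"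
  and sets_mu: "sets \<mu> = sigma_sets G {U. openin TG U}"
  and mu_left: "g \<in> G \<Longrightarrow> A \<in> sets \<mu> \<Longrightarrow> emeasure \<mu> ((\<lambda>h. g * h) ` A) = emeasure \<mu> A"
  and mu_compact: "C \<in> sets \<mu> \<Longrightarrow> compactin TG C \<Longrightarrow> emeasure \<mu> C < \<infinity>"
  and mu_K: "emeasure \<mu> K = 1"
  using haar_G unfolding haar_G_def haar_measure_def by auto

lemma space_nu [simp]: "space \<nu> = K"
  and sets_nu: "sets \<nu> = sigma_sets K {U. openin (subtopology TG K) U}"
  and nu_left: "g \<in> K \<Longrightarrow> A \<in> sets \<nu> \<Longrightarrow> emeasure \<nu> ((\<lambda>h. g * h) ` A) = emeasure \<nu> A"
  and nu_K: "emeasure \<nu> K = 1"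
  using haar_K unfolding haar_K_def haar_measure_def by auto

lemma prob_nu: "emeasure \<nu> (space \<nu>) = 1"
  using nu_K by simp

lemma finite_nu: "emeasure \<nu> A \<noteq> \<infinity>"
  using emeasure_space[of \<nu> A] prob_nu by (auto simp: top_unique)

lemma open_sets_mu: "openin TG U \<Longrightarrow> U \<in> sets \<mu>"
  unfolding sets_mu by (rule sigma_sets.Basic) simp

lemma open_sets_nu: "openin TG U \<Longrightarrow> U \<subseteq> K \<Longrightarrow> U \<in> sets \<nu>"
  unfolding sets_nu by (rule sigma_sets.Basic) (auto simp: openin_subtopology)

lemma level_sets: "level m A \<Longrightarrow> A \<in> sets \<nu>" "level m A \<Longrightarrow> A \<in> sets \<mu>"
  using level_open open_sets_mu open_sets_nu by (auto simp: level_def)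

lemma ball_translate: "h \<in> K \<Longrightarrow> nbh h m = (\<lambda>k. h * k) ` nbh (1\<^sub>m n) m"
  using ball_mult_K(1)[of h "1\<^sub>m n" m] by (simp add: K_G G_carrier)

lemma measure_ball: "h \<in> K \<Longrightarrow> m \<ge> 1 \<Longrightarrow> measure \<nu> (nbh h m) = measure \<nu> (nbh (1\<^sub>m n) m)"
  unfolding measure_def ball_translate[of h]
  using ball_K[of "1\<^sub>m n" m] by (subst nu_left) (auto intro!: open_sets_nu openin_ball)

text \<open>Up to scaling, \<open>\<nu>\<close> is the only content on the sets of a fixed level that is constant on balls.\<close>

lemma content_unique:
  assumes A: "level m A" and inj: "inj_on \<phi> K"
    and C: "\<And>h. h \<in> K \<Longrightarrow> \<phi> ` nbh h m \<in> sets M \<and> emeasure M (\<phi> ` nbh h m) \<noteq> \<infinity> \<and>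
              measure M (\<phi> ` nbh h m) = measure M (\<phi> ` nbh (1\<^sub>m n) m)"
  shows "measure M (\<phi> ` A) = measure M (\<phi> ` K) * measure \<nu> A"
proof -
  have m: "m \<ge> 1" using A by (simp add: level_def)
  have C': "\<phi> ` D \<in> sets M \<and> emeasure M (\<phi> ` D) \<noteq> \<infinity> \<and> measure M (\<phi> ` D) = measure M (\<phi> ` nbh (1\<^sub>m n) m)"
    if "D \<in> balls m" for D
  proof -
    obtain h where h: "h \<in> K" "D = nbh h m" using \<open>D \<in> balls m\<close> unfolding balls_def by blast
    show ?thesis unfolding h(2) by (rule C[OF h(1)])
  qed
  have 1: "measure M (\<phi> ` B) = card {C \<in> balls m. C \<subseteq> B} * measure M (\<phi> ` nbh (1\<^sub>m n) m)" if "level m B" for B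
    by (rule content[OF that inj C'])
  have D: "id ` D \<in> sets \<nu> \<and> emeasure \<nu> (id ` D) \<noteq> \<infinity> \<and> measure \<nu> (id ` D) = measure \<nu> (nbh (1\<^sub>m n) m)"
    if "D \<in> balls m" for D
  proof -
    obtain h where h: "h \<in> K" "D = nbh h m" using \<open>D \<in> balls m\<close> unfolding balls_def by blast
    show ?thesis
      unfolding h(2) image_id id_apply measure_ball[OF h(1) m]
      using open_sets_nu[OF openin_ball[OF K_G[OF h(1)]] ball_K[OF h(1) m]] finite_nu by blast
  qed
  have 2: "measure \<nu> (id ` B) = card {C \<in> balls m. C \<subseteq> B} * measure \<nu> (nbh (1\<^sub>m n) m)" if "level m B" for B
    by (rule content[OF that inj_on_id D])
  have "measure \<nu> K = 1" using nu_K by (simp add: measure_def)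
  hence 3: "card {C \<in> balls m. C \<subseteq> K} * measure \<nu> (nbh (1\<^sub>m n) m) = 1" using 2[OF level_K[OF m]] by simp
  show ?thesis
    unfolding 1[OF A] 1[OF level_K[OF m]] using 2[OF A] 3 by (simp add: algebra_simps)
qed

text \<open>Compact groups are unimodular. Concretely, right translation by an element of K permutes
  the balls of each radius and maps K onto itself, so \<open>content_unique\<close> applies.\<close>

lemma nu_right:
  assumes A: "level m A" and h: "h \<in> K"
  shows "measure \<nu> ((\<lambda>k. k * h) ` A) = measure \<nu> A"
proof -
  have m: "m \<ge> 1" using A by (simp add: level_def)
  have im: "(\<lambda>k. k * h) ` K = K"
  proof -
    have "k * iv h * h = k" if "k \<in> K" for k using that h by (intro iv_cancel) (auto simp: K_G G_carrier)
    hence "k \<in> (\<lambda>k. k * h) ` K" if "k \<in> K" for k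
      using that h by (intro image_eqI[of _ _ "k * iv h"]) (auto simp del: mat_assoc)
    thus ?thesis using h by auto
  qed
  have "measure \<nu> ((\<lambda>k. k * h) ` A) = measure \<nu> ((\<lambda>k. k * h) ` K) * measure \<nu> A"
  proof (rule content_unique[OF A])
    have "k * h * iv h = k" if "k \<in> K" for k using that h by (intro iv_cancel) (auto simp: K_G G_carrier)
    thus "inj_on (\<lambda>k. k * h) K" by (rule inj_on_inverseI)
    fix k assume k: "k \<in> K"
    show "(\<lambda>k. k * h) ` nbh k m \<in> sets \<nu> \<and> emeasure \<nu> ((\<lambda>k. k * h) ` nbh k m) \<noteq> \<infinity> \<and>
       measure \<nu> ((\<lambda>k. k * h) ` nbh k m) = measure \<nu> ((\<lambda>k. k * h) ` nbh (1\<^sub>m n) m)"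
      unfolding ball_mult_K(2)[OF h K_G[OF k]] ball_mult_K(2)[OF h G_one]
        measure_ball[OF K_mult[OF k h] m] measure_ball[OF K_mult[OF K_one h] m]
      using open_sets_nu[OF openin_ball[OF K_G[OF K_mult[OF k h]]] ball_K[OF K_mult[OF k h] m]] finite_nu by blast
  qed
  thus ?thesis unfolding im using nu_K by (simp add: measure_def)
qed

text \<open>Conjugation by \<tau> is an automorphism of K, so the images of the balls are left
  translates of one another and have equal mass.\<close>

lemma nu_conj:
  assumes A: "level m A"
  shows "measure \<nu> ((\<lambda>k. TT' * k * TT) ` A) = measure \<nu> A"
proof -
  let ?f = "\<lambda>k. TT' * k * TT"
  have m: "m \<ge> 1" using A by (simp add: level_def)
  have inv: "TT * ?f k * TT' = k" "?f (TT * k * TT') = k" if "k \<in> carrier_mat n n" for k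
    using that iv_cancel(1,2)[of TT k] iv_cancel(1,2)[of TT' k] TT_inverse by (simp_all add: iv_TT)
  have im: "?f ` K = K"
  proof
    show "?f ` K \<subseteq> K" using TT_conj by auto
    show "K \<subseteq> ?f ` K"
    proof
      fix k assume k: "k \<in> K"
      hence "k = ?f (TT * k * TT')" "TT * k * TT' \<in> K" using inv TT_conj K_G G_carrier by auto
      thus "k \<in> ?f ` K" by (rule image_eqI)
    qed
  qed
  have homo: "?f (h * k) = ?f h * ?f k" if "h \<in> carrier_mat n n" "k \<in> carrier_mat n n" for h k
    using that iv_cancel(2)[of TT "k * TT"] by (simp add: iv_TT)
  have op: "openin TG (?f ` U)" if "openin TG U" for U
  proof -
    have "?f ` U = (\<lambda>k. k * TT) ` (\<lambda>k. TT' * k) ` U" by (simp only: image_image)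
    thus ?thesis using openin_mult[OF openin_mult(1)[OF that]] by simp
  qed
  have "measure \<nu> (?f ` A) = measure \<nu> (?f ` K) * measure \<nu> A"
  proof (rule content_unique[OF A])
    show "inj_on ?f K" by (rule inj_on_inverseI[of _ "\<lambda>k. TT * k * TT'"]) (use inv K_G G_carrier in auto)
    fix h assume h: "h \<in> K"
    have s: "?f ` nbh h m \<in> sets \<nu>" if "h \<in> K" for h
      using ball_K[OF that m] im that by (intro open_sets_nu op openin_ball) (auto simp: K_G simp del: mat_assoc)
    have "?f ` nbh h m = (\<lambda>k. ?f h * k) ` ?f ` nbh (1\<^sub>m n) m"
    proof -
      have "?f (h * k) = ?f h * ?f k" if "k \<in> nbh (1\<^sub>m n) m" for k
        using that ball_G[of "1\<^sub>m n" m] h by (intro homo) (auto simp: K_G G_carrier)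
      thus ?thesis unfolding ball_translate[OF h] image_image by (intro image_cong) auto
    qed
    hence "measure \<nu> (?f ` nbh h m) = measure \<nu> (?f ` nbh (1\<^sub>m n) m)"
      unfolding measure_def using nu_left[OF TT_conj(2)[OF h] s[OF K_one]] by (simp del: mat_assoc)
    thus "?f ` nbh h m \<in> sets \<nu> \<and> emeasure \<nu> (?f ` nbh h m) \<noteq> \<infinity> \<and>
       measure \<nu> (?f ` nbh h m) = measure \<nu> (?f ` nbh (1\<^sub>m n) m)" using s[OF h] finite_nu by blast
  qed
  thus ?thesis unfolding im using nu_K by (simp add: measure_def)
qed

text \<open>On K the measures \<mu> and \<nu> agree by uniqueness and common normalisation; left
  invariance carries this to the coset g K.\<close>

lemma mu_left_coset:
  assumes A: "level m A" and g: "g \<in> G"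
  shows "(\<lambda>k. g * k) ` A \<in> sets \<mu>" "emeasure \<mu> ((\<lambda>k. g * k) ` A) \<noteq> \<infinity>"
    "measure \<mu> ((\<lambda>k. g * k) ` A) = measure \<nu> A"
proof -
  have m: "m \<ge> 1" and AK: "A \<subseteq> K" using A by (auto simp: level_def)
  show "(\<lambda>k. g * k) ` A \<in> sets \<mu>" by (intro open_sets_mu openin_mult level_open[OF A] g)
  have fin: "emeasure \<mu> B \<noteq> \<infinity>" if "B \<subseteq> K" for B
    using emeasure_mono[OF that open_sets_mu[OF openin_K]] mu_K by (auto simp: top_unique)
  show "emeasure \<mu> ((\<lambda>k. g * k) ` A) \<noteq> \<infinity>" using mu_left[OF g level_sets(2)[OF A]] fin[OF AK] by simp
  have "measure \<mu> (id ` A) = measure \<mu> (id ` K) * measure \<nu> A"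
  proof (rule content_unique[OF A])
    fix h assume h: "h \<in> K"
    have "measure \<mu> (nbh h m) = measure \<mu> (nbh (1\<^sub>m n) m)"
      unfolding measure_def ball_translate[OF h]
      using mu_left[of h "nbh (1\<^sub>m n) m"] h by (simp add: K_G open_sets_mu openin_ball)
    thus "id ` nbh h m \<in> sets \<mu> \<and> emeasure \<mu> (id ` nbh h m) \<noteq> \<infinity> \<and>
       measure \<mu> (id ` nbh h m) = measure \<mu> (id ` nbh (1\<^sub>m n) m)"
      using fin[OF ball_K[OF h m]] h by (simp add: K_G open_sets_mu openin_ball)
  qed simp
  moreover have "measure \<mu> (id ` K) = 1" using mu_K by (simp add: measure_def)
  ultimately have "measure \<mu> A = measure \<nu> A" by simp
  thus "measure \<mu> ((\<lambda>k. g * k) ` A) = measure \<nu> A"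
    using mu_left[OF g level_sets(2)[OF A]] by (simp add: measure_def)
qed

text \<open>Pulled back along right translation by g, \<mu> is still left invariant, hence
  proportional to \<nu> on K. The factor, the mass of K g, is the modulus of g;
  \<open>mu_gam\<close> evaluates it for the representatives \<open>gam\<close>.\<close>

lemma mu_right_coset:
  assumes A: "level m A" and g: "g \<in> G"
  shows "(\<lambda>k. k * g) ` A \<in> sets \<mu>" "emeasure \<mu> ((\<lambda>k. k * g) ` A) \<noteq> \<infinity>"
    "measure \<mu> ((\<lambda>k. k * g) ` A) = measure \<mu> ((\<lambda>k. k * g) ` K) * measure \<nu> A"
proof -
  let ?f = "\<lambda>k. k * g"
  have m: "m \<ge> 1" and AK: "A \<subseteq> K" using A by (auto simp: level_def)
  show s: "?f ` A \<in> sets \<mu>" by (intro open_sets_mu openin_mult level_open[OF A] g)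
  have "emeasure \<mu> (?f ` K) < \<infinity>"
    by (intro mu_compact open_sets_mu openin_mult openin_K g compactin_K_mult)
  hence fin: "emeasure \<mu> (?f ` B) \<noteq> \<infinity>" if "B \<subseteq> K" for B
    using emeasure_mono[OF image_mono[OF that, of ?f] open_sets_mu[OF openin_mult(2)[OF openin_K g]]] by (auto simp: top_unique)
  show "emeasure \<mu> (?f ` A) \<noteq> \<infinity>" using fin[OF AK] .
  show "measure \<mu> (?f ` A) = measure \<mu> (?f ` K) * measure \<nu> A"
  proof (rule content_unique[OF A])
    have "k * g * iv g = k" if "k \<in> K" for k using that g by (intro iv_cancel) (auto simp: K_G G_carrier)
    thus "inj_on ?f K" by (rule inj_on_inverseI)
    fix h assume h: "h \<in> K"
    have s: "?f ` nbh h m \<in> sets \<mu>" if "h \<in> K" for h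
      by (intro open_sets_mu openin_mult openin_ball g K_G that)
    have "?f ` nbh h m = (\<lambda>k. h * k) ` ?f ` nbh (1\<^sub>m n) m"
    proof -
      have "?f (h * k) = h * ?f k" if "k \<in> nbh (1\<^sub>m n) m" for k
        using that ball_G[of "1\<^sub>m n" m] h g by (intro mat_assoc) (auto simp: K_G G_carrier)
      thus ?thesis unfolding ball_translate[OF h] image_image by (intro image_cong) auto
    qed
    hence "measure \<mu> (?f ` nbh h m) = measure \<mu> (?f ` nbh (1\<^sub>m n) m)"
      unfolding measure_def using mu_left[OF K_G[OF h] s[OF K_one]] by simp
    thus "?f ` nbh h m \<in> sets \<mu> \<and> emeasure \<mu> (?f ` nbh h m) \<noteq> \<infinity> \<and>
       measure \<mu> (?f ` nbh h m) = measure \<mu> (?f ` nbh (1\<^sub>m n) m)"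
      using s[OF h] fin[OF ball_K[OF h m]] by blast
  qed
qed

text \<open>On a coset g K the integrand is constant, since the inverse of g k differs from that of
  g by a left factor in K and \<Phi> is K-invariant. Each coset has mass 1.\<close>

lemma hecke_act_indicator:
  assumes I: "finite I" and g: "\<And>i. i \<in> I \<Longrightarrow> g i \<in> G"
    and disj: "\<And>i j. i \<in> I \<Longrightarrow> j \<in> I \<Longrightarrow> i \<noteq> j \<Longrightarrow> (\<lambda>k. g i * k) ` K \<inter> (\<lambda>k. g j * k) ` K = {}"
    and inv: "K_invariant \<Phi>" and x: "x \<in> HX"
  shows "hecke_act Q n \<mu> (indicator (\<Union>i\<in>I. (\<lambda>k. g i * k) ` K)) \<Phi> x = (\<Sum>i\<in>I. \<Phi> (act Q (iv (g i)) x))"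
proof -
  let ?C = "\<lambda>i. (\<lambda>k. g i * k) ` K"
  have "has_bochner_integral \<mu> (\<lambda>h. \<Sum>i\<in>I. indicat_real (?C i) h *\<^sub>R \<Phi> (act Q (iv (g i)) x))
      (\<Sum>i\<in>I. measure \<mu> (?C i) *\<^sub>R \<Phi> (act Q (iv (g i)) x))"
  proof (intro has_bochner_integral_sum has_bochner_integral_indicator)
    fix i assume "i \<in> I"
    thus "?C i \<in> sets \<mu>" "emeasure \<mu> (?C i) < \<infinity>"
      using mu_left_coset[OF level_K[of 1] g[of i]] by (auto simp: less_top)
  qed
  also have "(\<Sum>i\<in>I. measure \<mu> (?C i) *\<^sub>R \<Phi> (act Q (iv (g i)) x)) = (\<Sum>i\<in>I. \<Phi> (act Q (iv (g i)) x))"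
    using mu_left_coset(3)[OF level_K[of 1] g] nu_K by (intro sum.cong) (auto simp: measure_def)
  finally have *: "has_bochner_integral \<mu> (\<lambda>h. \<Sum>i\<in>I. indicat_real (?C i) h *\<^sub>R \<Phi> (act Q (iv (g i)) x))
      (\<Sum>i\<in>I. \<Phi> (act Q (iv (g i)) x))" .
  have eq: "indicator (\<Union>i\<in>I. ?C i) h * \<Phi> (act Q (iv h) x) = (\<Sum>i\<in>I. indicat_real (?C i) h *\<^sub>R \<Phi> (act Q (iv (g i)) x))"
    if "h \<in> space \<mu>" for h
  proof (cases "h \<in> (\<Union>i\<in>I. ?C i)")
    case True
    then obtain i k where i: "i \<in> I" "k \<in> K" "h = g i * k" by blast
    have "indicat_real (?C j) h = (if j = i then 1 else 0)" if "j \<in> I" for j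
      using disj[of i j] i that by (auto simp: indicator_def)
    hence "(\<Sum>j\<in>I. indicat_real (?C j) h *\<^sub>R \<Phi> (act Q (iv (g j)) x)) = (\<Sum>j\<in>I. if j = i then \<Phi> (act Q (iv (g j)) x) else 0)"
      by (intro sum.cong) auto
    also have "\<dots> = \<Phi> (act Q (iv (g i)) x)" using I i by simp
    also have "act Q (iv h) x = act Q (iv k) (act Q (iv (g i)) x)"
      using i g[OF i(1)] x by (simp add: iv_of_mult K_G act_act G_carrier X_carrier)
    hence "\<Phi> (act Q (iv (g i)) x) = \<Phi> (act Q (iv h) x)"
      using inv i g[OF i(1)] x by (simp add: K_invariant_def)
    finally show ?thesis using True by simp
  qed auto
  have "hecke_act Q n \<mu> (indicator (\<Union>i\<in>I. ?C i)) \<Phi> x = (\<integral>h. (\<Sum>i\<in>I. indicat_real (?C i) h *\<^sub>R \<Phi> (act Q (iv (g i)) x)) \<partial>\<mu>)"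
    unfolding hecke_act_def by (rule Bochner_Integration.integral_cong) (use eq in auto)
  thus ?thesis using has_bochner_integral_integral_eq[OF *] by simp
qed

lemma indicator_hecke:
  assumes I: "finite I" and g: "\<And>i. i \<in> I \<Longrightarrow> g i \<in> G"
    and biinv: "\<And>h h' a. h \<in> K \<Longrightarrow> h' \<in> K \<Longrightarrow> a \<in> G \<Longrightarrow>
      h * a * h' \<in> (\<Union>i\<in>I. (\<lambda>k. g i * k) ` K) \<longleftrightarrow> a \<in> (\<Union>i\<in>I. (\<lambda>k. g i * k) ` K)"
  shows "indicator (\<Union>i\<in>I. (\<lambda>k. g i * k) ` K) \<in> hecke_algebra Q n"
  unfolding hecke_algebra_def
proof (intro CollectI conjI ballI exI)
  show "compactin TG (\<Union>i\<in>I. (\<lambda>k. g i * k) ` K)"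
    using I g compactin_K_mult(1) by (intro compactin_Union) auto
qed (use biinv in \<open>auto simp: indicator_def simp del: mat_assoc\<close>)

lemma spherical_K_invariant: "spherical_function Q n \<mu> \<Phi> \<Longrightarrow> K_invariant \<Phi>"
  by (simp add: spherical_function_def K_invariant_def)

lemma spherical_eigen:
  assumes "spherical_function Q n \<mu> \<Phi>" and I: "finite I" and g: "\<And>i. i \<in> I \<Longrightarrow> g i \<in> G"
    and disj: "\<And>i j. i \<in> I \<Longrightarrow> j \<in> I \<Longrightarrow> i \<noteq> j \<Longrightarrow> (\<lambda>k. g i * k) ` K \<inter> (\<lambda>k. g j * k) ` K = {}"
    and biinv: "\<And>h h' a. h \<in> K \<Longrightarrow> h' \<in> K \<Longrightarrow> a \<in> G \<Longrightarrow>
      h * a * h' \<in> (\<Union>i\<in>I. (\<lambda>k. g i * k) ` K) \<longleftrightarrow> a \<in> (\<Union>i\<in>I. (\<lambda>k. g i * k) ` K)"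
  shows "\<exists>ev. \<forall>x\<in>HX. (\<Sum>i\<in>I. \<Phi> (act Q (iv (g i)) x)) = ev * \<Phi> x"
proof -
  let ?f = "indicator (\<Union>i\<in>I. (\<lambda>k. g i * k) ` K) :: 'd mat \<Rightarrow> complex"
  have "?f \<in> hecke_algebra Q n" by (rule indicator_hecke[OF I g biinv])
  then obtain ev where "\<forall>x\<in>HX. hecke_act Q n \<mu> ?f \<Phi> x = ev * \<Phi> x"
    using assms(1) unfolding spherical_function_def by blast
  thus ?thesis
    using hecke_act_indicator[OF I g disj spherical_K_invariant[OF assms(1)]] by (intro exI[of _ ev]) auto
qed

text \<open>As TT normalizes K, the coset TT K is a whole double coset, and its operator is
  translation by the inverse of TT. This operator is invertible and \<Phi> is not 0, so the
  eigenvalue is nonzero; c is its inverse.\<close>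

lemma spherical_TT:
  assumes "spherical_function Q n \<mu> \<Phi>"
  obtains c where "c \<noteq> 0" "\<And>x. x \<in> HX \<Longrightarrow> \<Phi> (act Q TT x) = c * \<Phi> x"
proof -
  let ?V = "\<Union>i\<in>{()}. (\<lambda>k. TT * k) ` K"
  have V: "a \<in> ?V \<longleftrightarrow> TT' * a \<in> K" if "a \<in> G" for a
  proof
    assume "a \<in> ?V"
    then obtain k where "k \<in> K" "a = TT * k" by blast
    thus "TT' * a \<in> K" using iv_cancel(1)[of TT k] by (simp add: iv_TT K_G G_carrier)
  next
    assume "TT' * a \<in> K"
    moreover have "a = TT * (TT' * a)" using iv_cancel(2)[of TT a] that by (simp add: iv_TT G_carrier)
    ultimately show "a \<in> ?V" by blast
  qed
  have biV: "h * a * h' \<in> ?V \<longleftrightarrow> a \<in> ?V" if h: "h \<in> K" "h' \<in> K" "a \<in> G" for h h' a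
  proof -
    note c = G_carrier[OF K_G[OF h(1)]] G_carrier[OF K_G[OF h(2)]] G_carrier[OF h(3)]
      G_carrier[OF K_G[OF K_iv[OF h(1)]]] G_carrier[OF K_G[OF K_iv[OF h(2)]]]
    have 1: "TT' * (h * a * h') = (TT' * h * TT) * (TT' * a) * h'"
      using c iv_cancel(2)[of TT "a * h'"] by (simp add: iv_TT)
    have 2: "TT' * a = (TT' * iv h * TT) * (TT' * (h * a * h')) * iv h'"
      using c h iv_cancel(2)[of TT "h * (a * (h' * iv h'))"] by (simp add: iv_TT K_G)
    have "h * a * h' \<in> G" using h by (simp add: K_G)
    thus ?thesis unfolding V[OF \<open>h * a * h' \<in> G\<close>] V[OF h(3)]
      using 1 2 TT_conj(2)[OF h(1)] TT_conj(2)[OF K_iv[OF h(1)]] h(2) K_iv[OF h(2)] K_mult by metis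
  qed
  obtain ev where ev: "\<And>x. x \<in> HX \<Longrightarrow> \<Phi> (act Q (iv TT) x) = ev * \<Phi> x"
    using spherical_eigen[OF assms, of "{()}" "\<lambda>_. TT", OF _ _ _ biV] by auto
  have ev': "\<Phi> x = ev * \<Phi> (act Q TT x)" if x: "x \<in> HX" for x
  proof -
    have "act Q TT' (act Q TT x) = x" using x by (simp add: act_act[symmetric] X_carrier TT_inverse)
    thus ?thesis using ev[of "act Q TT x"] x by (simp add: iv_TT)
  qed
  obtain x where "x \<in> HX" "\<Phi> x \<noteq> 0" using assms by (auto simp: spherical_function_def)
  hence "ev \<noteq> 0" using ev'[of x] by auto
  show thesis
  proof (rule that[of "inverse ev"])
    show "\<Phi> (act Q TT x) = inverse ev * \<Phi> x" if "x \<in> HX" for x using ev'[OF that] \<open>ev \<noteq> 0\<close> by simp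
  qed (use \<open>ev \<noteq> 0\<close> in simp)
qed

end

section \<open>Cosets in rank two\<close>

context quaternion_basis begin

text \<open>A residue system of \<O> modulo \<tau>, fixed once so that \<open>II\<close>,
  \<open>zeros\<close> and \<open>gs\<close> all refer to the same one.\<close>

definition reps :: "'d set" where
  "reps = (SOME T. finite T \<and> (\<forall>t\<in>T. w t \<le> 1) \<and> (\<forall>x. w x \<le> 1 \<longrightarrow> (\<exists>t\<in>T. w (x - t) < 1)) \<and>
     (\<forall>t\<in>T. \<forall>t'\<in>T. w (t - t') < 1 \<longrightarrow> t = t'))"

lemma finite_reps: "finite reps" and reps_integral: "t \<in> reps \<Longrightarrow> w t \<le> 1"
  and reps_cover: "w x \<le> 1 \<Longrightarrow> \<exists>t\<in>reps. w (x - t) < 1"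
  and reps_inj: "t \<in> reps \<Longrightarrow> t' \<in> reps \<Longrightarrow> w (t - t') < 1 \<Longrightarrow> t = t'"
proof -
  obtain T where "finite T \<and> (\<forall>t\<in>T. w t \<le> 1) \<and> (\<forall>x. w x \<le> 1 \<longrightarrow> (\<exists>t\<in>T. w (x - t) < 1)) \<and>
     (\<forall>t\<in>T. \<forall>t'\<in>T. w (t - t') < 1 \<longrightarrow> t = t')"
    by (rule residue_reps_integers) blast
  hence *: "finite reps \<and> (\<forall>t\<in>reps. w t \<le> 1) \<and> (\<forall>x. w x \<le> 1 \<longrightarrow> (\<exists>t\<in>reps. w (x - t) < 1)) \<and>
     (\<forall>t\<in>reps. \<forall>t'\<in>reps. w (t - t') < 1 \<longrightarrow> t = t')"
    unfolding reps_def by (rule someI)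
  show "finite reps" "t \<in> reps \<Longrightarrow> w t \<le> 1" "w x \<le> 1 \<Longrightarrow> \<exists>t\<in>reps. w (x - t) < 1"
    "t \<in> reps \<Longrightarrow> t' \<in> reps \<Longrightarrow> w (t - t') < 1 \<Longrightarrow> t = t'"
    using * by blast+
qed

lemma card_reps_pos: "card reps > 0"
  using finite_reps reps_cover[of 0] by (auto simp: card_gt_0_iff)

definition hm :: "'k \<Rightarrow> 'd \<Rightarrow> 'k \<Rightarrow> 'd mat" where "hm a b c = mat2 (em a) b (st b) (em c)"

lemma conj_em: "x * (em c * st x) = em (N x * c)" "st x * (em c * x) = em (N x * c)"
proof -
  have "x * (em c * st x) = em c * (x * st x)" "st x * (em c * x) = em c * (st x * x)"
    by (rule em_left_commute)+
  thus "x * (em c * st x) = em (N x * c)" "st x * (em c * x) = em (N x * c)"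
    by (simp_all only: em_N[symmetric] em_N'[symmetric] em_mult[symmetric] mult.commute)
qed

lemma act_upper: "act Q (mat2 1 s 0 1) (hm a b c) = hm (a + tr (s * st b) + N s * c) (b + s * em c) c"
  by (simp add: hm_def act_mat2 em_add em_tr st_mult st_add distrib_right add.assoc mult.assoc conj_em)

lemma act_lower: "act Q (mat2 1 0 s 1) (hm a b c) = hm a (b + em a * st s) (c + tr (s * b) + N s * a)"
  by (simp add: hm_def act_mat2 em_add em_tr st_mult st_add distrib_right mult.assoc conj_em
        em_commute[of a s, symmetric] em_N[symmetric] em_mult[symmetric] mult.commute[of a] add_ac)

lemma act_diag: "act Q (mat2 u 0 0 v) (hm a b c) = hm (N u * a) (u * b * st v) (N v * c)"
  by (simp add: hm_def act_mat2 st_mult mult.assoc conj_em)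

lemma act_swap: "act Q (mat2 0 1 1 0) (hm a b c) = hm c (st b) a"
  by (simp add: hm_def act_mat2)

end

section \<open>Cosets of K in the double coset of diag(1, \<tau>)\<close>

locale quaternion_rank_two = quaternion_rank Q \<iota> \<tau> 2
  for Q :: "('k :: field_char_0, 'd :: division_ring) quat_datum" and \<iota> \<tau>
begin

lemma bd_mat2: "bd r (mat2 a b c d) \<longleftrightarrow> w a \<le> r \<and> w b \<le> r \<and> w c \<le> r \<and> w d \<le> r"
  by (auto simp: bd_def less_2_cases_iff)

lemma mat2_inverse:
  assumes "mat2 a b c d * mat2 a' b' c' d' = mat2 1 0 0 1" "mat2 a' b' c' d' * mat2 a b c d = mat2 1 0 0 1"
  shows "mat2 a b c d \<in> G" "iv (mat2 a b c d) = mat2 a' b' c' d'"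
  using iv_eqI[of "mat2 a b c d" "mat2 a' b' c' d'"] assms by (simp_all only: mat2_one mat2_carrier)

lemma mat2_K:
  assumes "mat2 a b c d * mat2 a' b' c' d' = mat2 1 0 0 1" "mat2 a' b' c' d' * mat2 a b c d = mat2 1 0 0 1"
    "bd 1 (mat2 a b c d)" "bd 1 (mat2 a' b' c' d')"
  shows "mat2 a b c d \<in> K"
  using mat2_inverse[OF assms(1,2)] assms(3,4) by (simp add: K_iff)

lemma upper_K: "w s \<le> 1 \<Longrightarrow> mat2 1 s 0 1 \<in> K"
  by (rule mat2_K[of _ _ _ _ 1 "- s" 0 1]) (simp_all add: bd_mat2)

lemma lower_K: "w s \<le> 1 \<Longrightarrow> mat2 1 0 s 1 \<in> K"
  by (rule mat2_K[of _ _ _ _ 1 0 "- s" 1]) (simp_all add: bd_mat2)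

lemma diag_K: "w u = 1 \<Longrightarrow> w v = 1 \<Longrightarrow> mat2 u 0 0 v \<in> K"
proof -
  assume uv: "w u = 1" "w v = 1"
  hence "u \<noteq> 0" "v \<noteq> 0" by auto
  thus ?thesis using uv by (intro mat2_K[of _ _ _ _ "inverse u" 0 0 "inverse v"]) (auto simp: bd_mat2 w_inverse w_divide)
qed

lemma swap_K: "mat2 0 1 1 0 \<in> K"
  by (rule mat2_K[of _ _ _ _ 0 1 1 0]) (simp_all add: bd_mat2)

lemma TT_mat2: "TT = mat2 \<tau> 0 0 \<tau>"
  by (rule mat2_eqI) (simp_all add: TT_def)

lemma HX_cases:
  assumes "x \<in> HX" obtains a b c where "x = hm a b c"
  using hermitian_mat2[of x] assms unfolding hm_def by (metis X_iff G_carrier)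

text \<open>The matrix with rows (c, -b) and (- st b, a) is an adjugate: its product with
  \<open>hm a b c\<close> is the scalar a c - N b. If that scalar is 0, an inverse would force the
  adjugate, and with it the matrix itself, to be 0.\<close>

lemma hm_HX: "hm a b c \<in> HX \<longleftrightarrow> a * c - N b \<noteq> 0"
proof
  let ?d = "a * c - N b"
  assume d: "?d \<noteq> 0"
  define e where "e = inverse ?d"
  have com: "em x * (em y * z) = em (x * y) * z" for x y z by (simp add: em_mult mult.assoc)
  have 1: "a * (c * e) - N b * e = 1" "c * (a * e) - N b * e = 1"
    using right_inverse[OF d] unfolding e_def[symmetric] by (simp_all add: algebra_simps)
  have ent: "em a * em (c * e) + b * (- (em e * st b)) = 1" "st b * (- (em e * b)) + em c * em (a * e) = 1"
    "em (c * e) * em a + - (em e * b) * st b = 1" "- (em e * st b) * b + em (a * e) * em c = 1"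
    using 1 by (simp_all add: conj_em em_mult[symmetric] em_diff[symmetric] mult.assoc em_N[symmetric] em_N'[symmetric] ac_simps)
  have off: "em a * - (em e * b) + b * em (a * e) = 0" "st b * em (c * e) + em c * - (em e * st b) = 0"
    "em (c * e) * b + - (em e * b) * em c = 0" "- (em e * st b) * em a + em (a * e) * st b = 0"
    by (simp_all add: com em_commute[of _ b, symmetric] em_commute[of _ "st b", symmetric] mult.assoc mult.commute[of e])
  have "hm a b c \<in> G"
    unfolding hm_def
    by (rule mat2_inverse(1)[of _ _ _ _ "em (c * e)" "- (em e * b)" "- (em e * st b)" "em (a * e)"])
      (simp_all only: mat2_mult mat2_inject ent off simp_thms)
  thus "hm a b c \<in> HX" by (simp add: X_iff) (simp add: hm_def)
next
  assume x: "hm a b c \<in> HX"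
  hence G: "hm a b c \<in> G" by (simp add: X_iff)
  show "a * c - N b \<noteq> 0"
  proof
    assume d: "a * c - N b = 0"
    let ?M = "mat2 (em c) (- b) (- st b) (em a)"
    have "em a * em c = b * st b" "em c * em a = st b * b"
      using d by (simp_all add: em_mult[symmetric] em_N[symmetric] em_N'[symmetric] mult.commute)
    hence 0: "hm a b c * ?M = mat2 0 0 0 0"
      by (simp add: hm_def em_commute[of _ b, symmetric] em_commute[of _ "st b", symmetric])
    obtain p r s t where i: "iv (hm a b c) = mat2 p r s t"
      using G_carrier[OF GL.inv_closed[OF G]] by (rule mat2_cases)
    have "?M = iv (hm a b c) * (hm a b c * ?M)" using G by simp
    also have "\<dots> = mat2 0 0 0 0" unfolding 0 i by simp
    finally have "hm a b c = mat2 0 0 0 0" by (simp add: hm_def)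
    hence "iv (hm a b c) * hm a b c = mat2 0 0 0 0" unfolding i by simp
    thus False using G by (simp add: mat2_one)
  qed
qed

text \<open>Representatives of the cosets K g in \<open>SS\<close>, indexed by the projective line
  over the residue field of \<O>, with \<open>None\<close> as the point at infinity.\<close>

definition gam :: "'d option \<Rightarrow> 'd mat" where
  "gam i = (case i of None \<Rightarrow> mat2 1 0 0 \<tau> | Some t \<Rightarrow> mat2 \<tau> 0 t 1)"

definition gam' :: "'d option \<Rightarrow> 'd mat" where
  "gam' i = (case i of None \<Rightarrow> mat2 1 0 0 (inverse \<tau>) | Some t \<Rightarrow> mat2 (inverse \<tau>) 0 (- t * inverse \<tau>) 1)"

definition II :: "'d option set" where "II = insert None (Some ` reps)"

lemma finite_II: "finite II"
  by (simp add: II_def finite_reps)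

lemma card_II: "card II = card reps + 1"
  by (simp add: II_def finite_reps card_image card_insert_if image_iff)

lemma sum_II: "(\<Sum>i\<in>II. f i) = f None + (\<Sum>t\<in>reps. f (Some t))"
  by (simp add: II_def finite_reps sum.reindex image_iff)

lemma gam_G: "gam i \<in> G" and iv_gam: "iv (gam i) = gam' i"
proof -
  have "gam i * gam' i = 1\<^sub>m 2" "gam' i * gam i = 1\<^sub>m 2"
    by (auto simp: gam_def gam'_def mat2_one mult.assoc split: option.splits)
  moreover have "gam i \<in> carrier_mat 2 2" "gam' i \<in> carrier_mat 2 2"
    by (auto simp: gam_def gam'_def split: option.splits)
  ultimately show "gam i \<in> G" "iv (gam i) = gam' i" using iv_eqI by blast+
qed

text \<open>The double coset of \<open>diag(1, \<tau>)\<close>, characterized by norms.\<close>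

definition SS :: "'d mat set" where
  "SS = {g \<in> G. bd 1 g \<and> bd (real q) (iv g) \<and> g \<notin> K \<and> TT' * g \<notin> K}"

lemma SS_G: "g \<in> SS \<Longrightarrow> g \<in> G"
  by (simp add: SS_def)

lemma K_cancel:
  assumes "h \<in> K" "g \<in> G"
  shows "h * g \<in> K \<longleftrightarrow> g \<in> K" "g * h \<in> K \<longleftrightarrow> g \<in> K"
proof -
  have "iv h * (h * g) = g" "g * h * iv h = g" using assms by (auto intro!: iv_cancel simp: K_G G_carrier simp del: mat_assoc)
  thus "h * g \<in> K \<longleftrightarrow> g \<in> K" "g * h \<in> K \<longleftrightarrow> g \<in> K"
    using assms(1) K_mult K_iv by metis+
qed

lemma SS_mult_K:
  assumes h: "h \<in> K" and g: "g \<in> G"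
  shows "h * g \<in> SS \<longleftrightarrow> g \<in> SS" "g * h \<in> SS \<longleftrightarrow> g \<in> SS"
proof -
  note c = G_carrier[OF g] G_carrier[OF K_G[OF h]] G_carrier[OF GL.inv_closed[OF g]]
  have TG: "TT' * g \<in> G" using g by simp
  have conj: "TT' * h * TT \<in> K" by (rule TT_conj[OF h])
  have "TT' * (h * g) = (TT' * h * TT) * (TT' * g)"
    using c iv_cancel(2)[of TT g] by (simp add: iv_TT)
  hence 1: "TT' * (h * g) \<in> K \<longleftrightarrow> TT' * g \<in> K" using K_cancel(1)[OF conj TG] by (simp only:)
  have 2: "TT' * (g * h) \<in> K \<longleftrightarrow> TT' * g \<in> K" using K_cancel(2)[OF h TG] c by simp
  show "h * g \<in> SS \<longleftrightarrow> g \<in> SS" "g * h \<in> SS \<longleftrightarrow> g \<in> SS"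
    using 1 2 K_cancel[OF h g] h g c q_pos bd_K_mult[OF h c(1), of 1] bd_K_mult[OF K_iv[OF h] c(3), of "real q"]
    by (auto simp: SS_def K_G iv_of_mult)
qed

lemma SS_ad: assumes g: "g \<in> SS" shows "ad g \<in> SS"
proof -
  have gG: "g \<in> G" using g by (simp add: SS_def)
  note c = G_carrier[OF gG] G_carrier[OF GL.inv_closed[OF gG]]
  have ag: "ad g \<in> G" "iv (ad g) = ad (iv g)" using ad_G[OF gG] by auto
  have "ad g \<in> K \<Longrightarrow> g \<in> K" using ad_K[of "ad g"] c by simp
  moreover have "TT' * ad g \<in> K \<Longrightarrow> TT' * g \<in> K"
  proof -
    assume a: "TT' * ad g \<in> K"
    have "bd 1 (TT' * ad g)" "bd 1 (iv (TT' * ad g))" using a by (auto simp: K_iff)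
    hence "bd (1 / real q) g" "bd (real q) (iv g)"
      using c ag by (simp_all add: bd_TT_mult bd_ad iv_of_mult iv_TT)
    thus "TT' * g \<in> K" using c gG by (simp add: K_iff bd_TT_mult iv_of_mult iv_TT)
  qed
  ultimately show ?thesis using g ag c by (auto simp: SS_def bd_ad)
qed

lemma gam_SS: assumes i: "i \<in> II" shows "gam i \<in> SS"
proof -
  have q: "1 \<le> real q" "\<not> real q \<le> 1" using q_gt_1 by auto
  have wt: "w \<tau> \<le> 1" "w (inverse \<tau>) = real q" using q_gt_1 by (auto simp: w_tau w_inverse)
  have t: "w t \<le> 1" if "i = Some t" for t using i that reps_integral by (auto simp: II_def)
  have 1: "bd 1 (gam i)" using t wt by (auto simp: gam_def bd_mat2 split: option.splits)
  have "w t * real q \<le> real q" if "w t \<le> 1" for t using that q by simp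
  hence 2: "bd (real q) (gam' i)" using t wt q by (auto simp: gam'_def bd_mat2 w_mult simp flip: divide_inverse split: option.splits)
      (auto simp: divide_inverse w_mult)
  have 3: "\<not> bd 1 (gam' i)" using wt q by (auto simp: gam'_def bd_mat2 split: option.splits)
  have "TT' = mat2 (inverse \<tau>) 0 0 (inverse \<tau>)" by (rule mat2_eqI) (simp_all add: TT'_def)
  hence 4: "\<not> bd 1 (TT' * gam i)" using wt q by (auto simp: gam_def bd_mat2 split: option.splits)
  show ?thesis using 1 2 3 4 gam_G by (simp add: SS_def K_iff iv_gam)
qed

text \<open>If two cosets agree, the quotient of their representatives is integral. Between
  \<open>Some t\<close> and \<open>Some s\<close> its lower left entry is t - s times the inverse of
  \<tau>, so t and s are congruent; between \<open>None\<close> and \<open>Some\<close> the inverse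
  of \<tau> itself occurs.\<close>

lemma K_gam_disjoint:
  assumes ij: "i \<in> II" "j \<in> II" and h: "h \<in> K" "k \<in> K" and eq: "h * gam i = k * gam j"
  shows "i = j"
proof -
  have q: "\<not> real q \<le> 1" "w (inverse \<tau>) = real q" using q_gt_1 by (auto simp: w_tau w_inverse)
  note c = G_carrier[OF K_G[OF h(1)]] G_carrier[OF K_G[OF h(2)]] G_carrier[OF gam_G[of i]] G_carrier[OF gam_G[of j]]
  have cg: "gam' j \<in> carrier_mat 2 2" using G_carrier[OF GL.inv_closed[OF gam_G[of j]]] by (simp add: iv_gam)
  have "h * (gam i * gam' j) = h * gam i * gam' j" by (rule mat_assoc[symmetric, OF c(1,3) cg])
  also have "\<dots> = k" unfolding eq iv_gam[symmetric] by (rule iv_cancel(3)[OF gam_G c(2)])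
  finally have "bd 1 (h * (gam i * gam' j))" using K_bd[OF h(2)] by simp
  hence bd: "bd 1 (gam i * gam' j)" using bd_K_mult(1)[OF h(1), of "gam i * gam' j" 1] c cg by simp
  show ?thesis
  proof (cases i; cases j)
    fix t s assume ts: "i = Some t" "j = Some s"
    hence "w (t * inverse \<tau> + - (s * inverse \<tau>)) \<le> 1" using bd by (simp add: gam_def gam'_def bd_mat2)
    hence "w ((t - s) * inverse \<tau>) \<le> 1" by (simp add: left_diff_distrib)
    hence "w (t - s) < 1" using w_lt_1_tau(2) by blast
    thus "i = j" using ts ij reps_inj by (auto simp: II_def)
  qed (use bd q in \<open>auto simp: gam_def gam'_def bd_mat2\<close>)
qed

text \<open>Row reduction over \<O>. A unit in the second column is moved to the lower right and
  leads to some \<open>gam (Some t)\<close>; units in the first column only lead to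
  \<open>gam None\<close>; with no unit entry at all, g is divisible by \<tau>, which
  \<open>SS\<close> excludes.\<close>

lemma SS_cover:
  assumes g: "g \<in> SS" obtains i k where "i \<in> II" "k \<in> K" "g = k * gam i"
proof -
  define P where "P g \<longleftrightarrow> (\<exists>i\<in>II. \<exists>k\<in>K. g = k * gam i)" for g
  have PI: "P (1\<^sub>m 2 * gam i)" if "i \<in> II" for i
    unfolding P_def using that K_one by blast
  have P_K: "P (h * g) \<Longrightarrow> P g" if "h \<in> K" "g \<in> G" for h g
  proof -
    assume "P (h * g)"
    then obtain i k where ik: "i \<in> II" "k \<in> K" "h * g = k * gam i" by (auto simp: P_def)
    have "g = iv h * (h * g)" using that by (simp add: K_G G_carrier)
    also have "\<dots> = (iv h * k) * gam i" unfolding ik(3) using that ik by (simp add: K_G G_carrier gam_G)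
    finally show "P g" using ik that unfolding P_def by (metis K_mult K_iv)
  qed
  \<comment> \<open>It suffices to reach a representative after multiplying on the left by any
    element of K, one elementary factor at a time.\<close>
  have red: "P g" if "h \<in> K" "g \<in> SS" "h * g \<in> SS \<Longrightarrow> P (h * g)" for h g
    using that P_K[of h g] SS_mult_K(1)[of h g] by (auto simp: SS_def)
  have q: "real q > 1" "\<not> real q \<le> 1" by (rule q_gt_1) (use q_gt_1 in simp)
  \<comment> \<open>The bound q on the inverse keeps the diagonal entries of a triangular g from
    falling below 1/q.\<close>
  have rec: "x \<ge> 1 / real q" if "x * y = 1" "y \<le> real q" "0 \<le> x" for x y
    using mult_left_mono[OF that(2,3)] that(1) q_pos by (simp add: field_simps)
  have ent: "w a \<le> 1 \<and> w b \<le> 1 \<and> w c \<le> 1 \<and> w d \<le> 1" if "mat2 a b c d \<in> SS" for a b c d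
    using that by (simp add: SS_def bd_mat2)
  have lower_right: "w a = 1 / real q" if "mat2 a 0 c 1 \<in> SS" for a c
  proof -
    have g: "mat2 a 0 c 1 \<in> G" "bd (real q) (iv (mat2 a 0 c 1))" "mat2 a 0 c 1 \<notin> K" using that by (auto simp: SS_def)
    obtain p r s t where i: "iv (mat2 a 0 c 1) = mat2 p r s t"
      using G_carrier[OF GL.inv_closed[OF g(1)]] by (rule mat2_cases)
    have "mat2 a 0 c 1 * mat2 p r s t = 1\<^sub>m 2" using g(1) unfolding i[symmetric] by simp
    hence ap: "a * p = 1" by (simp add: mat2_one)
    hence "w a * w p = 1" "a \<noteq> 0" by (auto simp: w_mult[symmetric])
    moreover have "w p \<le> real q" using g(2) by (simp add: i bd_mat2)
    ultimately have ge: "w a \<ge> 1 / real q" using rec w_nonneg by blast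
    \<comment> \<open>A unit here would make g invertible over \<O>, so the entry must be a
      uniformizer.\<close>
    have "w a \<noteq> 1"
    proof
      assume "w a = 1"
      moreover have "c * inverse a * a = c" using \<open>a \<noteq> 0\<close> by (simp add: mult.assoc)
      ultimately have "mat2 a 0 c 1 \<in> K" using ent[OF that] \<open>a \<noteq> 0\<close>
        by (intro mat2_K[of _ _ _ _ "inverse a" 0 "- c * inverse a" 1])
          (auto simp: bd_mat2 w_inverse w_divide w_mult)
      thus False using g(3) by blast
    qed
    thus ?thesis using ge ent[OF that] w_lt_1_iff[of a] by force
  qed
  have upper_left: "w d = 1 / real q" if "mat2 1 b 0 d \<in> SS" "w d < 1" for b d
  proof -
    have g: "mat2 1 b 0 d \<in> G" "bd (real q) (iv (mat2 1 b 0 d))" using that by (auto simp: SS_def)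
    obtain p r s t where i: "iv (mat2 1 b 0 d) = mat2 p r s t"
      using G_carrier[OF GL.inv_closed[OF g(1)]] by (rule mat2_cases)
    have "mat2 1 b 0 d * mat2 p r s t = 1\<^sub>m 2" using g(1) unfolding i[symmetric] by simp
    hence "d * t = 1" by (simp add: mat2_one)
    hence "w d * w t = 1" by (auto simp: w_mult[symmetric])
    moreover have "w t \<le> real q" using g(2) by (simp add: i bd_mat2)
    ultimately have "w d \<ge> 1 / real q" using rec w_nonneg by blast
    thus ?thesis using that(2) w_lt_1_iff[of d] by force
  qed
  have div: "w (x * inverse y) \<le> 1" if "w x \<le> 1" "w y = 1" for x y
    using that by (simp add: w_mult w_inverse)
  have d_unit: "P (mat2 a b c d)" if S: "mat2 a b c d \<in> SS" and d: "w d = 1" for a b c d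
  proof -
    have d0: "d \<noteq> 0" using d by auto
    show ?thesis
    proof (rule red[OF upper_K[of "- (b * inverse d)"] S])
      show "w (- (b * inverse d)) \<le> 1" using div[of b d] ent[OF S] d by simp
      define a' where "a' = a + - (b * inverse d) * c"
      have eq: "mat2 1 (- (b * inverse d)) 0 1 * mat2 a b c d = mat2 a' 0 c d"
        using d0 by (simp add: a'_def mult.assoc)
      assume S: "mat2 1 (- (b * inverse d)) 0 1 * mat2 a b c d \<in> SS"
      show "P (mat2 1 (- (b * inverse d)) 0 1 * mat2 a b c d)"
        unfolding eq
      proof (rule red[OF diag_K[of 1 "inverse d"] S[unfolded eq]])
        define c' where "c' = inverse d * c"
        have eq: "mat2 1 0 0 (inverse d) * mat2 a' 0 c d = mat2 a' 0 c' 1" using d0 by (simp add: c'_def)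
        assume S: "mat2 1 0 0 (inverse d) * mat2 a' 0 c d \<in> SS"
        have wa: "w a' = 1 / real q" using lower_right S unfolding eq by blast
        hence a0: "a' \<noteq> 0" using q by auto
        show "P (mat2 1 0 0 (inverse d) * mat2 a' 0 c d)"
          unfolding eq
        proof (rule red[OF diag_K[of "\<tau> * inverse a'" 1] S[unfolded eq]])
          show "w (\<tau> * inverse a') = 1" using wa q by (simp add: w_mult w_inverse w_tau)
          have eq: "mat2 (\<tau> * inverse a') 0 0 1 * mat2 a' 0 c' 1 = mat2 \<tau> 0 c' 1" using a0 by (simp add: mult.assoc)
          assume S: "mat2 (\<tau> * inverse a') 0 0 1 * mat2 a' 0 c' 1 \<in> SS"
          \<comment> \<open>Adding left multiples of the row (\<tau>, 0) changes the lower left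
            entry exactly modulo \<tau>.\<close>
          obtain t where t: "t \<in> reps" "w (c' - t) < 1" using reps_cover[of c'] ent S unfolding eq by blast
          show "P (mat2 (\<tau> * inverse a') 0 0 1 * mat2 a' 0 c' 1)"
            unfolding eq
          proof (rule red[OF lower_K[of "- ((c' - t) * inverse \<tau>)"] S[unfolded eq]])
            show "w (- ((c' - t) * inverse \<tau>)) \<le> 1" using t(2) w_lt_1_tau(2)[of "c' - t"] by simp
            have "mat2 1 0 (- ((c' - t) * inverse \<tau>)) 1 * mat2 \<tau> 0 c' 1 = mat2 \<tau> 0 t 1"
              by (simp add: mult.assoc)
            also have "\<dots> = 1\<^sub>m 2 * gam (Some t)" by (simp add: gam_def mat2_one)
            finally have e: "mat2 1 0 (- ((c' - t) * inverse \<tau>)) 1 * mat2 \<tau> 0 c' 1 = 1\<^sub>m 2 * gam (Some t)" .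
            show "P (mat2 1 0 (- ((c' - t) * inverse \<tau>)) 1 * mat2 \<tau> 0 c' 1)"
              unfolding e by (rule PI) (simp add: II_def t(1))
          qed
        qed simp
      qed (use d in \<open>simp_all add: w_inverse\<close>)
    qed
  qed
  have a_unit: "P (mat2 a b c d)" if S: "mat2 a b c d \<in> SS" and a: "w a = 1" and bd: "w b < 1" "w d < 1" for a b c d
  proof -
    have a0: "a \<noteq> 0" using a by auto
    show ?thesis
    proof (rule red[OF lower_K[of "- (c * inverse a)"] S])
      show "w (- (c * inverse a)) \<le> 1" using div[of c a] ent[OF S] a by simp
      define d' where "d' = - (c * inverse a) * b + d"
      have eq: "mat2 1 0 (- (c * inverse a)) 1 * mat2 a b c d = mat2 a b 0 d'"
        using a0 by (simp add: d'_def mult.assoc)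
      have "w (c * inverse a) * w b \<le> 1 * w b" using div[of c a] ent[OF S] a by (intro mult_right_mono) auto
      hence wd: "w d' < 1" unfolding d'_def using bd by (intro w_add_less) (auto simp: w_mult)
      assume S: "mat2 1 0 (- (c * inverse a)) 1 * mat2 a b c d \<in> SS"
      show "P (mat2 1 0 (- (c * inverse a)) 1 * mat2 a b c d)"
        unfolding eq
      proof (rule red[OF diag_K[of "inverse a" 1] S[unfolded eq]])
        define b' where "b' = inverse a * b"
        have wb: "w b' < 1" using bd a by (simp add: b'_def w_mult w_inverse)
        have eq: "mat2 (inverse a) 0 0 1 * mat2 a b 0 d' = mat2 1 b' 0 d'" using a0 by (simp add: b'_def)
        assume S: "mat2 (inverse a) 0 0 1 * mat2 a b 0 d' \<in> SS"
        have wd': "w d' = 1 / real q" using upper_left S wd unfolding eq by blast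
        hence d0: "d' \<noteq> 0" using q by auto
        show "P (mat2 (inverse a) 0 0 1 * mat2 a b 0 d')"
          unfolding eq
        proof (rule red[OF diag_K[of 1 "\<tau> * inverse d'"] S[unfolded eq]])
          show "w (\<tau> * inverse d') = 1" using wd' q by (simp add: w_mult w_inverse w_tau)
          have eq: "mat2 1 0 0 (\<tau> * inverse d') * mat2 1 b' 0 d' = mat2 1 b' 0 \<tau>" using d0 by (simp add: mult.assoc)
          assume S: "mat2 1 0 0 (\<tau> * inverse d') * mat2 1 b' 0 d' \<in> SS"
          show "P (mat2 1 0 0 (\<tau> * inverse d') * mat2 1 b' 0 d')"
            unfolding eq
          proof (rule red[OF upper_K[of "- (b' * inverse \<tau>)"] S[unfolded eq]])
            show "w (- (b' * inverse \<tau>)) \<le> 1" using wb w_lt_1_tau(2)[of b'] by simp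
            have "mat2 1 (- (b' * inverse \<tau>)) 0 1 * mat2 1 b' 0 \<tau> = mat2 1 0 0 \<tau>"
              by (simp add: mult.assoc)
            also have "\<dots> = 1\<^sub>m 2 * gam None" by (simp add: gam_def mat2_one)
            finally have e: "mat2 1 (- (b' * inverse \<tau>)) 0 1 * mat2 1 b' 0 \<tau> = 1\<^sub>m 2 * gam None" .
            show "P (mat2 1 (- (b' * inverse \<tau>)) 0 1 * mat2 1 b' 0 \<tau>)"
              unfolding e by (rule PI) (simp add: II_def)
          qed
        qed simp
      qed (use a in \<open>simp_all add: w_inverse\<close>)
    qed
  qed
  have swap: "mat2 0 1 1 0 * mat2 a b c d = mat2 c d a b" for a b c d :: 'd by simp
  obtain a b c d where abcd: "g = mat2 a b c d" using G_carrier[OF SS_G[OF g]] by (rule mat2_cases)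
  note S = g[unfolded abcd]
  consider "w d = 1" | "w b = 1" | "w b < 1" "w d < 1" "w a = 1" | "w b < 1" "w d < 1" "w c = 1"
    | "w a < 1" "w b < 1" "w c < 1" "w d < 1" using ent[OF S] by force
  hence "P g"
  proof cases
    case 1 thus ?thesis using d_unit S abcd by blast
  next
    case 2
    show ?thesis unfolding abcd by (rule red[OF swap_K S]) (use d_unit 2 in \<open>simp only: swap\<close>)
  next
    case 3 thus ?thesis using a_unit S abcd by blast
  next
    case 4
    show ?thesis unfolding abcd by (rule red[OF swap_K S]) (use a_unit 4 in \<open>simp only: swap\<close>)
  next
    case 5
    have gG: "g \<in> G" and gq: "bd (real q) (iv g)" using g by (auto simp: SS_def)
    have "bd (1 / real q) g" using 5 by (simp add: abcd bd_mat2 w_lt_1_iff)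
    hence "TT' * g \<in> K" using gG gq by (simp add: K_iff bd_TT_mult iv_of_mult iv_TT G_carrier)
    thus ?thesis using g by (simp add: SS_def)
  qed
  thus thesis using that by (auto simp: P_def)
qed

lemma SS_iff: "g \<in> SS \<longleftrightarrow> (\<exists>i\<in>II. \<exists>k\<in>K. g = k * gam i)"
proof
  show "g \<in> SS \<Longrightarrow> \<exists>i\<in>II. \<exists>k\<in>K. g = k * gam i" by (metis SS_cover)
  show "\<exists>i\<in>II. \<exists>k\<in>K. g = k * gam i \<Longrightarrow> g \<in> SS" using gam_SS SS_mult_K(1) gam_G by auto
qed

end

lemma power_int_recurrence:
  fixes f :: "int \<Rightarrow> 'a :: field"
  assumes "c \<noteq> 0" "\<And>l. f (l + 1) = c * f l" shows "f l = c powi l * f 0"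
proof (induction l rule: int_induct[where k = 0])
  case (step1 i)
  thus ?case using assms by (simp add: power_int_add_1')
next
  case (step2 i)
  have "f i = c * f (i - 1)" using assms(2)[of "i - 1"] by simp
  thus ?case using step2 assms(1) by (simp add: power_int_diff field_simps)
qed simp

section \<open>Hecke eigenfunctions in rank two\<close>

context quaternion_rank_two begin

text \<open>The sum runs over \<open>gam i\<close> and not over inverses because the operator taken
  is that of the inverse double coset. A spherical function and \<omega>(.; s) both satisfy this
  predicate, and the recurrences use nothing else.\<close>

definition eigen :: "('d mat \<Rightarrow> complex) \<Rightarrow> complex \<Rightarrow> complex \<Rightarrow> bool" where
  "eigen F c lam \<longleftrightarrow> K_invariant F \<and> (\<forall>x\<in>HX. F (act Q TT x) = c * F x) \<and>
     (\<forall>x\<in>HX. (\<Sum>i\<in>II. F (act Q (gam i) x)) = lam * F x)"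

lemma K_invD: "K_invariant F \<Longrightarrow> h \<in> K \<Longrightarrow> a * c - N b \<noteq> 0 \<Longrightarrow> F (act Q h (hm a b c)) = F (hm a b c)"
  unfolding K_invariant_def using hm_HX by blast

lemma F_swap: "K_invariant F \<Longrightarrow> a * c - N b \<noteq> 0 \<Longrightarrow> F (hm a b c) = F (hm c (st b) a)"
  using K_invD[OF _ swap_K, of F a c b] by (simp add: act_swap)

text \<open>Completing the square: when c dominates, the quotient of b by c is integral, so an upper
  unitriangular element of K clears b.\<close>

lemma F_diagonalize:
  assumes F: "K_invariant F" and c: "c \<noteq> 0" "w b \<le> av c * av c" and d: "a * c - N b \<noteq> 0"
  shows "F (hm a b c) = F (hm ((a * c - N b) / c) 0 c)"
proof -
  define s where "s = - (b * em (1 / c))"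
  have "w s = w b / (av c * av c)" by (simp add: s_def w_mult w_em av_divide)
  hence ws: "w s \<le> 1" using c by (simp add: divide_le_eq_1 less_le)
  have b0: "b + s * em c = 0"
    using c(1) by (simp add: s_def mult.assoc em_mult[symmetric])
  have "s * st b = - (b * (em (1 / c) * st b))" by (simp add: s_def mult.assoc)
  hence "s * st b = em (- (N b / c))" by (simp add: conj_em em_minus)
  hence tr: "tr (s * st b) = - (2 * (N b / c))" by simp
  have Ns: "N s * c = N b / c" using c(1) by (simp add: s_def N_mult N_em)
  have "a + tr (s * st b) + N s * c = (a * c - N b) / c" unfolding tr Ns using c(1) by (simp add: field_simps)
  hence "act Q (mat2 1 s 0 1) (hm a b c) = hm ((a * c - N b) / c) 0 c"
    unfolding act_upper b0 by simp
  thus ?thesis using K_invD[OF F upper_K[OF ws] d] by simp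
qed

text \<open>Units of o are norms of units of \<O>, so only the sizes of the diagonal entries
  matter.\<close>

lemma F_units:
  assumes F: "K_invariant F" and "a \<noteq> 0" "c \<noteq> 0" "av a = av a'" "av c = av c'"
  shows "F (hm a 0 c) = F (hm a' 0 c')"
proof -
  have "av (a' / a) = 1" "av (c' / c) = 1" using assms by (auto simp: av_divide)
  then obtain u v where u: "N u = a' / a" "w u = 1" and v: "N v = c' / c" "w v = 1"
    using norm_surj by metis
  have "act Q (mat2 u 0 0 v) (hm a 0 c) = hm a' 0 c'" using assms by (simp add: act_diag u v)
  thus ?thesis using K_invD[OF F diag_K[OF u(2) v(2)], of a c 0] assms by simp
qed

definition Fd :: "('d mat \<Rightarrow> complex) \<Rightarrow> int \<Rightarrow> int \<Rightarrow> complex" where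
  "Fd F m k = F (hm (\<eta> powi m) 0 (\<eta> powi k))"

lemma av_eta_power: "av (\<eta> powi m) = real q powi (- m)"
  by (simp add: av_power_int av_eta power_int_minus power_int_inverse divide_inverse)

lemma F_diag:
  assumes "K_invariant F" "av a = real q powi (- m)" "av c = real q powi (- k)"
  shows "F (hm a 0 c) = Fd F m k"
proof -
  have "a \<noteq> 0" "c \<noteq> 0" using assms(2,3) q_nz by auto
  thus ?thesis unfolding Fd_def using assms by (intro F_units) (auto simp: av_eta_power)
qed

lemma Fd_swap: "K_invariant F \<Longrightarrow> Fd F m k = Fd F k m"
  unfolding Fd_def by (subst F_swap) auto

text \<open>If \<open>b\<close> dominates and has odd valuation, then \<open>a\<close> is killed by an upper unitriangular
  matrix whose entry solves a quadratic equation with discriminant in \<open>1 + \<pi> o\<close>.\<close>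

lemma F_antidiagonal:
  assumes F: "K_invariant F" and u: "u \<noteq> 0" and b: "w b = av u * av u / real q"
    and a: "av a < av u" and c: "av c < av u"
  shows "F (hm a b c) = F (hm 0 (em u * \<tau>) 0)"
proof -
  have avu: "av u > 0" using u by (simp add: less_le)
  have wb: "w b > 0" using b avu q_pos by simp
  hence b0: "b \<noteq> 0" by auto
  have less: "w (em x) < w b" if "av x * real q \<le> av u" for x
  proof -
    have "av x * real q * (av x * real q) \<le> av u * av u" using that by (intro mult_mono) auto
    hence "w (em x) * real q \<le> w b" using q_pos unfolding b w_em by (simp add: field_simps)
    moreover have "w (em x) * real q > w (em x) \<or> w (em x) = 0" using q_gt_1 w_nonneg[of "em x"] by (auto simp: less_le)
    ultimately show ?thesis using wb by auto
  qed
  have q_le: "av x * real q \<le> av u" if "av x < av u" for x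
  proof -
    have "av (x / u) < 1" using that avu by (simp add: av_divide)
    hence "av (x / u) \<le> 1 / real q" by (simp add: av_lt_1_iff)
    thus ?thesis using avu q_pos by (simp add: av_divide field_simps)
  qed
  have det: "x * y - N z \<noteq> 0" if "av x < av u" "av y < av u" "w z = w b" for x y z
  proof -
    have "av x * real q * (av y * real q) \<le> av u * av u" using q_le that by (intro mult_mono) auto
    hence "av (x * y) * real q \<le> w b" using q_pos unfolding b av_mult by (simp add: field_simps)
    moreover have "av (x * y) * real q > av (x * y) \<or> av (x * y) = 0" using q_gt_1 av_nonneg[of "x * y"] by (auto simp: less_le)
    ultimately have "av (x * y) < w z" using wb that by auto
    thus ?thesis by (auto simp: w_def)
  qed
  \<comment> \<open>Chosen so that \<sigma> st b lies in k. For s = y \<sigma> with y in k the new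
    upper left entry is \<eta> u (A y^2 + y + B), a quadratic polynomial over k.\<close>
  define \<sigma> where "\<sigma> = em (\<eta> * u / 2) * inverse (st b)"
  have \<sigma>b: "\<sigma> * st b = em (\<eta> * u / 2)" using b0 by (simp add: \<sigma>_def mult.assoc)
  have "w \<sigma> = (av u / real q) * (av u / real q) / w b"
    by (simp add: \<sigma>_def w_mult w_em av_mult av_eta w_inverse w_divide field_simps)
  also have "\<dots> = 1 / real q" using avu u q_pos unfolding b by (simp add: field_simps)
  finally have w\<sigma>: "w \<sigma> = 1 / real q" .
  define A where "A = N \<sigma> * c / (\<eta> * u)"
  define B where "B = a / (\<eta> * u)"
  have avA: "av A < 1" using c avu q_pos w\<sigma> by (simp add: A_def av_divide av_mult av_eta w_def)
  have avB: "av B \<le> 1" using q_le[OF a] avu q_pos by (simp add: B_def av_divide av_mult av_eta field_simps)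
  have "av (- (2 * (2 * (A * B)))) < 1"
    using mult_left_le[OF avB av_nonneg[of A]] avA by (simp add: av_mult av_4)
  then obtain r where r: "r * r = 1 + - (2 * (2 * (A * B)))" "av (r - 1) < 1" by (rule sqrt_one_plus)
  have "av ((r - 1) + 2) = av 2" using r(2) by (intro av_add_eq) simp
  hence avr: "av (1 + r) = 1" by (simp add: add.commute)
  hence r0: "1 + r \<noteq> 0" by auto
  \<comment> \<open>This form of the root avoids dividing by A, which may be 0, and is integral
    because 1 + r is a unit.\<close>
  define y where "y = - (2 * B) / (1 + r)"
  have avy: "av y \<le> 1" using avB avr by (simp add: y_def av_divide)
  have "(A * (y * y) + y + B) * ((1 + r) * (1 + r)) = B * (4 * (A * B) + r * r - 1)"
    unfolding y_def using r0 by (simp add: divide_simps) (simp add: algebra_simps)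
  also have "\<dots> = 0" unfolding r(1) by simp
  finally have eq: "A * (y * y) + y + B = 0" using r0 by simp
  define s where "s = em y * \<sigma>"
  have ws: "w s \<le> 1 / real q" using mult_mono[OF w_em_le[OF avy] order.refl, of "1 / real q"] q_pos
    by (simp add: s_def w_mult w\<sigma>)
  have "s * st b = em (y * (\<eta> * u / 2))" 
    unfolding s_def mult.assoc \<sigma>b em_mult[symmetric] ..
  hence tr1: "tr (s * st b) = y * (\<eta> * u)" by simp
  have Ns: "N s * c = y * y * A * (\<eta> * u)" using u by (simp add: s_def A_def N_mult N_em)
  have "a + tr (s * st b) + N s * c = (A * (y * y) + y + B) * (\<eta> * u)"
    unfolding tr1 Ns using u by (simp add: B_def field_simps)
  hence kill: "a + tr (s * st b) + N s * c = 0" using eq by simp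
  define b' where "b' = b + s * em c"
  have "w (s * em c) < w b"
  proof -
    have "w s * w (em c) \<le> 1 * w (em c)" using ws q_gt_1 by (intro mult_right_mono) (auto intro: order_trans)
    thus ?thesis using less[OF q_le[OF c]] by (simp add: w_mult)
  qed
  hence wb': "w b' = w b" unfolding b'_def using w_add_eq[of "s * em c" b] by (simp add: add.commute)
  hence b'0: "b' \<noteq> 0" using wb by auto
  have K1: "w s \<le> 1" using ws q_gt_1 by (auto intro: order_trans)
  have e1: "F (hm a b c) = F (hm 0 b' c)"
    using K_invD[OF F upper_K[OF K1] det[OF a c refl]] unfolding act_upper kill b'_def by simp
  \<comment> \<open>With the upper left entry gone, the lower right one changes only by tr (t b') =
    - c.\<close>
  define t where "t = em (- c / 2) * inverse b'"
  have tb: "t * b' = em (- c / 2)" using b'0 by (simp add: t_def mult.assoc)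
  have "w t = w (em c) / w b" unfolding wb'[symmetric] 
    by (simp add: t_def w_mult w_inverse w_em w_divide inverse_eq_divide)
  hence wt: "w t \<le> 1" using less[OF q_le[OF c]] wb by simp
  have e2: "F (hm 0 b' c) = F (hm 0 b' 0)"
    using K_invD[OF F lower_K[OF wt] det[OF _ c wb'], of 0] avu unfolding act_lower tb by simp
  define v where "v = st (inverse b' * (em u * \<tau>))"
  have wv: "w v = 1" using wb wb' by (simp add: v_def w_mult w_inverse w_divide w_em w_tau b)
     (use u avu q_pos in \<open>simp add: field_simps\<close>)
  have "b' * st v = em u * \<tau>" using b'0 by (simp add: v_def mult.assoc[symmetric])
  hence e3: "F (hm 0 b' 0) = F (hm 0 (em u * \<tau>) 0)"
    using K_invD[OF F diag_K[OF w_1 wv], of 0 0 b'] b'0 unfolding act_diag by simp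
  show ?thesis using e1 e2 e3 by simp
qed

text \<open>If \<open>b\<close> dominates and has even valuation, then \<open>c\<close> can be given half that valuation.\<close>

lemma F_even:
  assumes u: "u \<noteq> 0" and b: "w b = av u * av u" and a: "av a < av u" and c: "av c < av u"
    and d: "a * c - N b \<noteq> 0"
  obtains b' c' where "\<And>F. K_invariant F \<Longrightarrow> F (hm a b c) = F (hm a b' c')" "av c' = av u"
    "w b' = w b" "a * c' - N b' \<noteq> 0"
proof -
  have avu: "av u > 0" using u by (simp add: less_le)
  have b0: "b \<noteq> 0" using b avu by auto
  \<comment> \<open>A unit with tr (s b) = u, so the new lower right entry c + u + N s a has exactly
    the size of u.\<close>
  define s where "s = em (u / 2) * inverse b"
  have ws: "w s = 1" using b avu u by (simp add: s_def w_mult w_inverse w_em w_divide field_simps)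
  have "s * b = em (u / 2)" using b0 by (simp add: s_def mult.assoc)
  hence tr: "tr (s * b) = u" by simp
  define b' where "b' = b + em a * st s"
  define c' where "c' = c + u + N s * a"
  have act: "act Q (mat2 1 0 s 1) (hm a b c) = hm a b' c'" by (simp add: act_lower tr b'_def c'_def)
  have sK: "mat2 1 0 s 1 \<in> K" using ws by (intro lower_K) simp
  have "hm a b' c' \<in> HX" using act_X[OF K_G[OF sK]] hm_HX d act by metis
  hence d': "a * c' - N b' \<noteq> 0" by (simp add: hm_HX)
  have "av (c + N s * a) < av u" using a c ws by (intro av_add_less) (auto simp: av_mult w_def)
  hence "av ((c + N s * a) + u) = av u" by (rule av_add_eq)
  hence c': "av c' = av u" by (simp add: c'_def add_ac)
  have "av a * av a < av u * av u" using a by (intro mult_strict_mono') auto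
  hence "w (em a * st s) < w b" using ws b by (simp add: w_mult w_em)
  hence "w (em a * st s + b) = w b" by (rule w_add_eq)
  hence wb': "w b' = w b" by (simp add: b'_def add.commute)
  show thesis
  proof (rule that[OF _ c' wb' d'])
    show "F (hm a b c) = F (hm a b' c')" if "K_invariant F" for F
      using K_invD[OF that sK d] by (simp add: act)
  qed
qed

definition Fb :: "('d mat \<Rightarrow> complex) \<Rightarrow> int \<Rightarrow> complex" where
  "Fb F l = F (hm 0 (em (\<eta> powi l) * \<tau>) 0)"

lemma diagonal_case:
  assumes c: "c \<noteq> 0" "w b \<le> av c * av c" and d: "a * c - N b \<noteq> 0"
  shows "\<exists>m k. \<forall>F. K_invariant F \<longrightarrow> F (hm a b c) = Fd F m k"
proof -
  have "(a * c - N b) / c \<noteq> 0" using c d by simp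
  then obtain m where "av ((a * c - N b) / c) = real q powi m" by (rule av_values)
  moreover obtain k where "av c = real q powi k" using c(1) by (rule av_values)
  ultimately have "\<forall>F. K_invariant F \<longrightarrow> F (hm a b c) = Fd F (- m) (- k)"
    using F_diagonalize[OF _ c d] F_diag by (metis minus_minus)
  thus ?thesis by blast
qed

text \<open>The dominating entry decides: a diagonal entry allows diagonalization, and so does b
  after \<open>F_even\<close> if its valuation is even, while odd valuation gives the antidiagonal
  form. The exponents are chosen before F, so they describe the orbit of x.\<close>

lemma orbit_cases:
  assumes "x \<in> HX"
  shows "(\<exists>m k. \<forall>F. K_invariant F \<longrightarrow> F x = Fd F m k) \<or> (\<exists>l. \<forall>F. K_invariant F \<longrightarrow> F x = Fb F l)"
proof -
  obtain a b c where x: "x = hm a b c" using assms by (rule HX_cases)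
  hence d: "a * c - N b \<noteq> 0" using assms hm_HX by simp
  consider "c \<noteq> 0" "w b \<le> av c * av c" | "a \<noteq> 0" "w b \<le> av a * av a"
    | "b \<noteq> 0" "av a * av a < w b" "av c * av c < w b"
  proof -
    have "av y * av y < w b" if "\<not> (y \<noteq> 0 \<and> w b \<le> av y * av y)" "b \<noteq> 0" for y
      using that w_pos by (cases "y = 0") auto
    moreover have "b = 0 \<Longrightarrow> c \<noteq> 0 \<and> w b \<le> av c * av c" using d by auto
    ultimately show thesis using that by blast
  qed
  thus ?thesis
  proof cases
    case 1 thus ?thesis using diagonal_case[OF _ _ d] x by simp
  next
    case 2
    have "c * a - N (st b) \<noteq> 0" using d by (simp add: mult.commute)
    hence "\<exists>m k. \<forall>F. K_invariant F \<longrightarrow> F (hm c (st b) a) = Fd F m k" using 2 by (intro diagonal_case) auto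
    thus ?thesis using F_swap[OF _ d] x by metis
  next
    case 3
    obtain j where j: "w b = real q powi j" using 3(1) by (rule w_values)
    \<comment> \<open>Makes \<open>w b\<close> either the square of \<open>av u\<close> or that
      square divided by q.\<close>
    define l where "l = - ((j + 1) div 2)"
    define u where "u = \<eta> powi l"
    have u: "u \<noteq> 0" by (simp add: u_def)
    have avu: "av u * av u = real q powi (- 2 * l)"
      using q_nz by (simp add: u_def av_eta_power power_int_add[symmetric])
    have lt: "av y < av u" if "av y * av y < av u * av u" for y
      using that by (metis abs_of_nonneg av_nonneg mult_mono not_le)
    have "j = - 2 * l \<or> j = - 2 * l - 1" unfolding l_def by presburger
    thus ?thesis
    proof
      assume "j = - 2 * l"
      hence wb: "w b = av u * av u" using j avu by simp
      obtain b' c' where bc: "\<And>F. K_invariant F \<Longrightarrow> F (hm a b c) = F (hm a b' c')" "av c' = av u"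
        "w b' = w b" "a * c' - N b' \<noteq> 0"
        using F_even[OF u wb _ _ d] lt 3 wb by metis
      have "c' \<noteq> 0" using bc(2) u by auto
      hence "\<exists>m k. \<forall>F. K_invariant F \<longrightarrow> F (hm a b' c') = Fd F m k"
        using bc wb by (intro diagonal_case) auto
      thus ?thesis using bc(1) x by metis
    next
      assume "j = - 2 * l - 1"
      hence wb: "w b = av u * av u / real q" using j q_nz unfolding avu by (simp add: power_int_diff)
      have "av u * av u / real q \<le> av u * av u" 
        using q_gt_1 mult_left_mono[of 1 "real q" "av u * av u"] by (simp add: divide_le_eq)
      hence "av a < av u" "av c < av u" using 3 wb lt by auto
      hence "F (hm a b c) = Fb F l" if "K_invariant F" for F
        unfolding Fb_def u_def[symmetric] using that u wb by (intro F_antidiagonal)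
      thus ?thesis using x by blast
    qed
  qed
qed

section \<open>The two Hecke operators on orbit representatives\<close>

lemma act_TT: "act Q TT (hm a b c) = hm (\<eta> * a) (\<tau> * b * st \<tau>) (\<eta> * c)"
  unfolding TT_mat2 by (rule act_diag)

lemma act_gam_Some: "act Q (gam (Some t)) (hm a b c) = hm (\<eta> * a) (\<tau> * (em a * st t) + \<tau> * b) (N t * a + tr (t * b) + c)"
  by (simp add: gam_def hm_def act_mat2 em_add em_tr st_mult st_add st_em_mult mult.assoc distrib_left distrib_right conj_em
      em_left_commute[of t] add_ac)

lemma act_gam_None: "act Q (gam None) (hm a b c) = hm a (b * st \<tau>) (\<eta> * c)"
  using act_diag[of 1 \<tau> a b c] by (simp add: gam_def)

lemma av_eta_less: "av \<eta> < 1"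
  using q_gt_1 by (simp add: av_eta)

lemma eta_powi [simp]: "\<eta> * \<eta> powi m = \<eta> powi (m + 1)"
  by (simp add: power_int_add_1')

lemma Fd_shift:
  assumes "eigen F c lam" shows "Fd F (m + 1) (k + 1) = c * Fd F m k"
proof -
  have "hm (\<eta> powi m) 0 (\<eta> powi k) \<in> HX" by (simp add: hm_HX)
  thus ?thesis using assms by (auto simp: eigen_def Fd_def act_TT simp flip: eta_powi)
qed

lemma Fb_shift:
  assumes "eigen F c lam" shows "Fb F (l + 1) = c * Fb F l"
proof -
  have "hm 0 (em (\<eta> powi l) * \<tau>) 0 \<in> HX" by (simp add: hm_HX)
  hence "F (act Q TT (hm 0 (em (\<eta> powi l) * \<tau>) 0)) = c * Fb F l"
    using assms by (auto simp: eigen_def Fb_def)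
  moreover have "\<tau> * (em (\<eta> powi l) * \<tau>) * st \<tau> = em (\<eta> powi (l + 1)) * \<tau>"
  proof -
    have "\<tau> * (em (\<eta> powi l) * \<tau>) * st \<tau> = em (\<eta> powi l) * (\<tau> * (\<tau> * st \<tau>))"
      by (simp add: em_left_commute[of \<tau>] mult.assoc)
    also have "\<dots> = em (\<eta> powi l) * (em \<eta> * \<tau>)" by (simp only: em_N[symmetric] em_commute)
    also have "\<dots> = em (\<eta> powi (l + 1)) * \<tau>"
      by (simp add: mult.assoc[symmetric] em_mult[symmetric] mult.commute[of _ \<eta>] del: em_mult)
    finally show ?thesis .
  qed
  ultimately show ?thesis by (simp add: act_TT Fb_def)
qed

text \<open>Counts the residues t for which \<open>gam (Some t)\<close> moves the unit form to the
  antidiagonal orbit: there the new lower right entry 1 + N t is not a unit.\<close>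

definition zeros :: nat where "zeros = card {t \<in> reps. av (1 + N t) < 1}"

lemma av_N_le: "w t \<le> 1 \<Longrightarrow> av (N t) \<le> 1"
  by (simp add: w_def)

text \<open>For e \<ge> 1 the new lower right entry N t \<eta>^e + 1 is a unit for every t, so
  completing the square always leads to diag(\<eta>^(e+1), 1). Only \<open>None\<close> gives a
  different orbit.\<close>

lemma hecke_diagonal:
  assumes F: "K_invariant F" and e: "e \<ge> 1"
  shows "(\<Sum>i\<in>II. F (act Q (gam i) (hm (\<eta> powi e) 0 1))) = Fd F e 1 + of_nat (card reps) * Fd F (e + 1) 0"
proof -
  let ?a = "\<eta> powi e"
  have ava: "av ?a < 1"
  proof -
    have "real q powi (- e) \<le> real q powi (-1)" using e q_gt_1 by (intro power_int_increasing) auto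
    thus ?thesis using q_gt_1 by (simp add: av_eta_power power_int_minus field_simps)
  qed
  have "F (act Q (gam (Some t)) (hm ?a 0 1)) = Fd F (e + 1) 0" if t: "t \<in> reps" for t
  proof -
    let ?b = "\<tau> * (em ?a * st t)" and ?c = "N t * ?a + 1"
    have wt: "w t \<le> 1" using reps_integral t .
    have "av (N t * ?a) < 1" using av_N_le[OF wt] ava mult_mono[of "av (N t)" 1 "av ?a" "av ?a"] by (simp add: av_mult)
    hence avc: "av ?c = 1" using av_add_eq[of "N t * ?a" 1] by simp
    hence c0: "?c \<noteq> 0" by auto
    have wa: "w (em ?a) \<le> 1" using ava by (intro w_em_le) simp
    have "w ?b \<le> 1" unfolding w_mult w_st w_tau using q_gt_1 wa wt by (intro mult_le_one) (auto simp: mult_le_one)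
    hence wb: "w ?b \<le> av ?c * av ?c" by (simp add: avc)
    have d: "\<eta> * ?a * ?c - N ?b = \<eta> * ?a" by (simp add: N_mult N_em algebra_simps)
    have "F (hm (\<eta> * ?a) ?b ?c) = F (hm (\<eta> * ?a / ?c) 0 ?c)"
      using F_diagonalize[OF F c0 wb, of "\<eta> * ?a"] by (simp add: d del: eta_powi)
    also have "\<dots> = Fd F (e + 1) 0"
      by (rule F_diag[OF F]) (simp_all add: av_divide avc av_eta_power)
    finally show ?thesis by (simp add: act_gam_Some)
  qed
  moreover have "F (act Q (gam None) (hm ?a 0 1)) = Fd F e 1" by (simp add: act_gam_None Fd_def)
  ultimately show ?thesis by (simp add: sum_II)
qed

lemma hecke_unit:
  assumes F: "K_invariant F"
  shows "(\<Sum>i\<in>II. F (act Q (gam i) (hm 1 0 1))) =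
    Fd F 1 0 + of_nat (card reps - zeros) * Fd F 1 0 + of_nat zeros * Fb F 0"
proof -
  let ?Z = "{t \<in> reps. av (1 + N t) < 1}"
  have unit: "F (act Q (gam (Some t)) (hm 1 0 1)) = Fd F 1 0" if t: "t \<in> reps - ?Z" for t
  proof -
    let ?b = "\<tau> * st t" and ?c = "N t + 1"
    have wt: "w t \<le> 1" using reps_integral t by blast
    have "av ?c \<le> 1" using av_N_le[OF wt] by (intro av_add_le) auto
    hence avc: "av ?c = 1" using t by (simp add: add.commute)
    hence c0: "?c \<noteq> 0" by auto
    have "w ?b \<le> 1" unfolding w_mult w_st w_tau using q_gt_1 wt by (intro mult_le_one) auto
    hence wb: "w ?b \<le> av ?c * av ?c" by (simp add: avc)
    have d: "\<eta> * ?c - N ?b = \<eta>" by (simp add: N_mult algebra_simps)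
    have "F (hm \<eta> ?b ?c) = F (hm (\<eta> / ?c) 0 ?c)"
      using F_diagonalize[OF F c0 wb, of \<eta>] by (simp add: d)
    also have "\<dots> = Fd F 1 0"
      by (rule F_diag[OF F]) (simp_all add: av_divide avc av_eta power_int_minus inverse_eq_divide)
    finally show ?thesis by (simp add: act_gam_Some)
  qed
  have zero: "F (act Q (gam (Some t)) (hm 1 0 1)) = Fb F 0" if t: "t \<in> ?Z" for t
  proof -
    have "av (N t) = 1"
      using t av_add_eq'[of "N t" 1] av_N_le[OF reps_integral, of t] by force
    hence wb: "w (\<tau> * st t) = av 1 * av 1 / real q" by (simp add: w_mult w_tau w_def[of t])
    have "F (hm \<eta> (\<tau> * st t) (N t + 1)) = F (hm 0 (em 1 * \<tau>) 0)"
      by (rule F_antidiagonal[OF F _ wb]) (use t av_eta_less in \<open>simp_all add: add.commute\<close>)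
    thus ?thesis by (simp add: act_gam_Some Fb_def)
  qed
  have "(\<Sum>t\<in>reps. F (act Q (gam (Some t)) (hm 1 0 1))) =
      (\<Sum>t\<in>reps - ?Z. F (act Q (gam (Some t)) (hm 1 0 1))) + (\<Sum>t\<in>?Z. F (act Q (gam (Some t)) (hm 1 0 1)))"
    using finite_reps by (intro sum.subset_diff) auto
  also have "\<dots> = of_nat (card (reps - ?Z)) * Fd F 1 0 + of_nat zeros * Fb F 0"
    using unit zero by (simp add: zeros_def)
  also have "card (reps - ?Z) = card reps - zeros"
    unfolding zeros_def using finite_reps by (intro card_Diff_subset) auto
  finally have "(\<Sum>t\<in>reps. F (act Q (gam (Some t)) (hm 1 0 1))) = of_nat (card reps - zeros) * Fd F 1 0 + of_nat zeros * Fb F 0" .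
  moreover have "F (act Q (gam None) (hm 1 0 1)) = Fd F 1 0"
    using Fd_swap[OF F, of 1 0] by (simp add: act_gam_None Fd_def)
  ultimately show ?thesis by (simp add: sum_II)
qed

text \<open>The valuation of b is even, so \<open>F_even\<close> can give c the size 1/q if it does
  not have it; diagonalizing then leaves two entries of size 1/q.\<close>

lemma F_even_block:
  assumes F: "K_invariant F" and b: "w b = 1 / (real q * real q)" and c: "av c \<le> 1 / real q"
  shows "F (hm 0 b c) = Fd F 1 1"
proof -
  have wb: "w b = av \<eta> * av \<eta>" using b by (simp add: av_eta)
  have b0: "b \<noteq> 0" using b q_pos by auto
  have unit: "F (hm 0 b c) = Fd F 1 1" if b: "w b = av \<eta> * av \<eta>" and c: "av c = av \<eta>" for b c
  proof -
    have c0: "c \<noteq> 0" using c eta_nz av_eq_0 by metis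
    have b0: "b \<noteq> 0" using b by auto
    have "F (hm 0 b c) = F (hm ((0 * c - N b) / c) 0 c)"
      using b c b0 by (intro F_diagonalize[OF F c0]) auto
    also have "\<dots> = Fd F 1 1"
      by (rule F_diag[OF F]) (use b c q_pos in \<open>simp_all add: av_divide w_def av_eta power_int_minus inverse_eq_divide\<close>)
    finally show ?thesis .
  qed
  show ?thesis
  proof (cases "av c = av \<eta>")
    case False
    hence "av c < av \<eta>" using c by (simp add: av_eta)
    moreover have "av 0 < av \<eta>" using q_pos by (simp add: av_eta)
    moreover have "0 * c - N b \<noteq> 0" using b0 by simp
    ultimately obtain b' c' where "F (hm 0 b c) = F (hm 0 b' c')" "av c' = av \<eta>" "w b' = w b"
      using F_even[OF eta_nz wb, of 0 c] F by metis
    thus ?thesis using unit wb by simp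
  qed (use unit wb in blast)
qed

lemma hecke_block:
  assumes F: "K_invariant F"
  shows "(\<Sum>i\<in>II. F (act Q (gam i) (hm 0 \<tau> 0))) = (of_nat (card reps) + 1) * Fd F 1 1"
proof -
  have "F (act Q (gam (Some t)) (hm 0 \<tau> 0)) = Fd F 1 1" if t: "t \<in> reps" for t
  proof -
    have "w (t * \<tau>) \<le> 1 / real q" using reps_integral[OF t] q_pos by (simp add: w_mult w_tau divide_right_mono)
    hence "F (hm 0 (\<tau> * \<tau>) (tr (t * \<tau>))) = Fd F 1 1"
      by (intro F_even_block[OF F] av_tr_tau) (auto simp: w_mult w_tau)
    thus ?thesis by (simp add: act_gam_Some)
  qed
  moreover have "F (hm 0 (\<tau> * st \<tau>) 0) = Fd F 1 1"
    using q_pos by (intro F_even_block[OF F]) (auto simp: w_mult w_tau)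
  hence "F (act Q (gam None) (hm 0 \<tau> 0)) = Fd F 1 1" by (simp add: act_gam_None)
  ultimately show ?thesis by (simp add: sum_II algebra_simps)
qed

text \<open>The value of an eigenfunction at \<open>diag(\<eta>\<^sup>e, 1)\<close>, relative to its value at the
  antidiagonal form \<open>hm 0 \<tau> 0\<close>.\<close>

fun gs :: "complex \<Rightarrow> complex \<Rightarrow> nat \<Rightarrow> complex" where
  "gs c lam 0 = lam / (of_nat (card reps + 1) * c)"
| "gs c lam (Suc 0) = (lam * gs c lam 0 - of_nat zeros) / of_nat (1 + (card reps - zeros))"
| "gs c lam (Suc (Suc e)) = (lam * gs c lam (Suc e) - c * gs c lam e) / of_nat (card reps)"

text \<open>The Hecke equation at the antidiagonal form yields the value at the unit form, at the
  unit form the value at diag(\<eta>, 1), and at diag(\<eta>^e, 1) the two-term recurrence, where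
  diag(\<eta>^e, \<eta>) is shifted back at the cost of a factor c.\<close>

lemma eigen_diagonal:
  assumes F: "eigen F c lam" and c: "c \<noteq> 0"
  shows "Fd F (int e) 0 = gs c lam e * Fb F 0"
proof -
  have inv: "K_invariant F" and ev: "\<And>x. x \<in> HX \<Longrightarrow> (\<Sum>i\<in>II. F (act Q (gam i) x)) = lam * F x"
    using F by (auto simp: eigen_def)
  have q0: "(of_nat (card reps) :: complex) \<noteq> 0" using card_reps_pos by simp
  have "hm 0 \<tau> 0 \<in> HX" by (simp add: hm_HX)
  hence "(of_nat (card reps) + 1) * Fd F (0 + 1) (0 + 1) = lam * Fb F 0"
    using ev hecke_block[OF inv] by (simp add: Fb_def)
  hence block: "(of_nat (card reps) + 1) * (c * Fd F 0 0) = lam * Fb F 0" using Fd_shift[OF F, of 0 0] by simp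
  have k: "of_nat (card reps + 1) * c \<noteq> 0" using c by (simp del: of_nat_add of_nat_Suc)
  have "of_nat (card reps + 1) * c * Fd F 0 0 = lam * Fb F 0" using block by (simp add: algebra_simps)
  hence 0: "Fd F 0 0 = gs c lam 0 * Fb F 0" using k by (simp add: eq_divide_eq mult.commute del: of_nat_add)
  have "hm 1 0 1 \<in> HX" by (simp add: hm_HX)
  hence "lam * Fd F 0 0 = (1 + of_nat (card reps - zeros)) * Fd F 1 0 + of_nat zeros * Fb F 0"
    using ev hecke_unit[OF inv] by (simp add: Fd_def algebra_simps)
  moreover have "(1 + of_nat (card reps - zeros) :: complex) \<noteq> 0"
    by (metis of_nat_Suc of_nat_neq_0 add.commute)
  ultimately have 1: "Fd F 1 0 = gs c lam (Suc 0) * Fb F 0"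
    by (simp add: 0 field_simps del: gs.simps(1))
  have step: "Fd F (int (Suc (Suc e))) 0 = (lam * Fd F (int (Suc e)) 0 - c * Fd F (int e) 0) / of_nat (card reps)" for e
  proof -
    have "hm (\<eta> powi int (Suc e)) 0 1 \<in> HX" by (simp add: hm_HX)
    hence "lam * Fd F (int (Suc e)) 0 = Fd F (int e + 1) (0 + 1) + of_nat (card reps) * Fd F (int (Suc (Suc e))) 0"
      using ev hecke_diagonal[OF inv, of "int (Suc e)"] by (simp add: Fd_def add_ac)
    thus ?thesis using q0 unfolding Fd_shift[OF F] by (simp add: field_simps)
  qed
  show ?thesis
  proof (induction e rule: induct_nat_012)
    case (ge2 e)
    show ?case unfolding step ge2.IH by (simp add: algebra_simps diff_divide_distrib)
  qed (use 0 1 in \<open>simp_all del: gs.simps\<close>)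
qed

text \<open>The exponent l and the function g depend on x alone. Keeping g as a function of c and
  lam lets one formula serve the spherical function and, with c and lam depending on s, the integral
  \<omega>.\<close>

lemma eigen_determined:
  assumes "x \<in> HX"
  obtains l :: int and g :: "complex \<Rightarrow> complex \<Rightarrow> complex"
  where "g = (\<lambda>c lam. 1) \<or> (\<exists>e. g = (\<lambda>c lam. gs c lam e))"
    "\<And>F c lam. eigen F c lam \<Longrightarrow> c \<noteq> 0 \<Longrightarrow> F x = c powi l * g c lam * F (hm 0 \<tau> 0)"
proof -
  have Fb0: "Fb F 0 = F (hm 0 \<tau> 0)" for F by (simp add: Fb_def)
  from orbit_cases[OF assms] show thesis
  proof
    assume "\<exists>m k. \<forall>F. K_invariant F \<longrightarrow> F x = Fd F m k"
    then obtain m k where mk: "\<And>F. K_invariant F \<Longrightarrow> F x = Fd F m k" by blast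
    define l where "l = min m k"
    define e where "e = nat \<bar>m - k\<bar>"
    show thesis
    proof (rule that[of "\<lambda>c lam. gs c lam e" l])
      fix F c lam assume F: "eigen F c lam" and c: "c \<noteq> (0::complex)"
      hence inv: "K_invariant F" by (simp add: eigen_def)
      have "Fd F m k = Fd F (int e + l) (0 + l)"
        using Fd_swap[OF inv, of m k] by (cases "m \<le> k") (auto simp: e_def l_def)
      also have "\<dots> = c powi l * Fd F (int e + 0) (0 + 0)"
        by (rule power_int_recurrence[OF c, of "\<lambda>l. Fd F (int e + l) (0 + l)"])
          (use Fd_shift[OF F] in \<open>simp add: add.assoc[symmetric]\<close>)
      also have "\<dots> = c powi l * gs c lam e * F (hm 0 \<tau> 0)" using eigen_diagonal[OF F c] Fb0 by simp
      finally show "F x = c powi l * gs c lam e * F (hm 0 \<tau> 0)" using mk[OF inv] by simp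
    qed blast
  next
    assume "\<exists>l. \<forall>F. K_invariant F \<longrightarrow> F x = Fb F l"
    then obtain l where l: "\<And>F. K_invariant F \<Longrightarrow> F x = Fb F l" by blast
    show thesis
    proof (rule that[of "\<lambda>c lam. 1" l])
      fix F c lam assume F: "eigen F c lam" and c: "c \<noteq> (0::complex)"
      hence "F x = Fb F l" using l by (simp add: eigen_def)
      also have "\<dots> = c powi l * Fb F 0" by (rule power_int_recurrence[OF c]) (rule Fb_shift[OF F])
      finally show "F x = c powi l * 1 * F (hm 0 \<tau> 0)" by (simp add: Fb0)
    qed blast
  qed
qed

end

section \<open>Subsets of K cut out by conjugation and translation\<close>

context quaternion_rank begin

lemma bd_mult3:
  assumes "bd r A" "bd s B" "bd t C" "0 \<le> r" "0 \<le> s" "0 \<le> t"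
    "A \<in> carrier_mat n n" "B \<in> carrier_mat n n" "C \<in> carrier_mat n n"
  shows "bd (r * (s * t)) (A * (B * C))"
  using assms by (intro bd_mult) auto

text \<open>The map k \<mapsto> a k b distorts distances by a bounded factor, and K contains a ball
  of fixed radius around each of its points.\<close>

lemma level_conj_K:
  assumes a: "a \<in> G" and b: "b \<in> G"
  obtains M where "level M {k \<in> K. a * k * b \<in> K}"
proof -
  note c = G_carrier[OF a] G_carrier[OF b]
  obtain ra where ra: "ra \<ge> 1" "bd ra a" using bd_exists[OF c(1)] .
  obtain rb where rb: "rb \<ge> 1" "bd rb b" using bd_exists[OF c(2)] .
  have "eps 1 / (ra * rb) > 0" using ra rb eps_pos[of 1] by (simp del: eps_pos)
  then obtain M where M: "M \<ge> 1" "eps M < eps 1 / (ra * rb)" by (rule eps_small)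
  hence small: "ra * (eps M * rb) \<le> eps 1"
    using ra rb pos_less_divide_eq[of "ra * rb" "eps M" "eps 1"] by (simp add: ac_simps)
  have "level M {k \<in> K. a * k * b \<in> K}"
    unfolding level_def
  proof (intro conjI ballI subsetI)
    fix k k' assume k: "k \<in> {k \<in> K. a * k * b \<in> K}" and k': "k' \<in> nbh k M"
    have kK: "k \<in> K" "k' \<in> K" using k k' ball_K[of k M] M by auto
    note ck = G_carrier[OF K_G[OF kK(1)]] G_carrier[OF K_G[OF kK(2)]]
    have "bd (eps M) (k' - k)" using k' kK by (simp add: ball_iff K_G)
    hence "bd (ra * (eps M * rb)) (a * ((k' - k) * b))"
      using ra rb c ck eps_pos[of M] by (intro bd_mult) (auto simp del: eps_pos)
    hence "bd (eps 1) (a * ((k' - k) * b))" using small by (rule bd_mono)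
    moreover have "a * ((k' - k) * b) = a * k' * b - a * k * b" using c ck by (simp add: mat_diff_mult)
    ultimately have "a * k' * b \<in> nbh (a * k * b) 1" using a b kK by (simp add: ball_iff K_G)
    thus "k' \<in> {k \<in> K. a * k * b \<in> K}" using ball_K[of "a * k * b" 1] k kK by auto
  qed (use M in auto)
  thus thesis by (rule that)
qed

lemma level_right:
  assumes A: "level m A" and h: "h \<in> K" shows "level m ((\<lambda>k. k * h) ` A)"
  unfolding level_def
proof (intro conjI ballI)
  show "1 \<le> m" "(\<lambda>k. k * h) ` A \<subseteq> K" using A h by (auto simp: level_def)
  fix x assume "x \<in> (\<lambda>k. k * h) ` A"
  then obtain k where k: "k \<in> A" "x = k * h" by blast
  hence kG: "k \<in> G" using A by (auto simp: level_def K_G)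
  show "nbh x m \<subseteq> (\<lambda>k. k * h) ` A"
    unfolding k(2) ball_mult_K(2)[OF h kG, symmetric] using A k(1) unfolding level_def by blast
qed

end

section \<open>The integral \<open>\<omega>\<close> in rank two\<close>

context quaternion_rank_two begin

text \<open>The upper left entry of a hermitian matrix is central; half its trace recovers it as an
  element of k, which agrees with the square root d_1 up to sign.\<close>

definition d1 :: "'d mat \<Rightarrow> 'k" where "d1 y = tr (y $$ (0, 0)) / 2"

lemma d1_hm [simp]: "d1 (hm a b c) = a"
  by (simp add: d1_def hm_def)

lemma d1_HX: "y \<in> HX \<Longrightarrow> y $$ (0, 0) = em (d1 y)"
  by (elim HX_cases) (simp, simp add: hm_def)

text \<open>Uniform continuity in k: the two hermitian matrices differ by a (k' - k) y ad(a k') + a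
  k y ad(a (k' - k)), so M depends only on bounds for a and for y = b x st b in the sense of
  \<open>act\<close>.\<close>

lemma d1_close:
  assumes x: "x \<in> HX" and a: "a \<in> G" and b: "b \<in> G" and r: "r > 0"
  obtains M where "M \<ge> 1" "\<And>k k'. k \<in> K \<Longrightarrow> k' \<in> nbh k M \<Longrightarrow>
    k' \<in> K \<and> av (d1 (act Q (a * k' * b) x) - d1 (act Q (a * k * b) x)) < r"
proof -
  define y where "y = act Q b x"
  have y: "y \<in> HX" using x b by (simp add: y_def)
  note c = G_carrier[OF a] X_carrier[OF y]
  obtain ra where ra: "ra \<ge> 1" "bd ra a" using bd_exists[OF c(1)] .
  obtain ry where ry: "ry \<ge> 1" "bd ry y" using bd_exists[OF c(2)] .
  \<comment> \<open>Bounds the factors of either summand other than k' - k. It is compared with r^2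
    because \<open>w\<close> on k is the square of \<open>av\<close>.\<close>
  define C where "C = ra * ra * ry"
  have C: "C > 0" using ra ry by (simp add: C_def)
  have "r * r / C > 0" using r C by simp
  then obtain M where M: "M \<ge> 1" "eps M < r * r / C" by (rule eps_small)
  hence small: "C * eps M < r * r"
    using C pos_less_divide_eq[of C "eps M" "r * r"] by (simp add: mult.commute)
  show thesis
  proof (rule that[OF M(1)])
    fix k k' assume k: "k \<in> K" and k': "k' \<in> nbh k M"
    have kK: "k' \<in> K" using k k' ball_K[OF k M(1)] by auto
    note ck = G_carrier[OF K_G[OF k]] G_carrier[OF K_G[OF kK]]
    have act_eq: "act Q (a * z * b) x = act Q (a * z) y" if "z \<in> carrier_mat 2 2" for z
      unfolding y_def using that c(1) G_carrier[OF b] X_carrier[OF x] by (intro act_act) auto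
    have "bd (eps M) (k' - k)" using k' k kK by (simp add: ball_iff K_G)
    hence diff: "bd (ra * eps M) (a * (k' - k))"
      using ra c ck eps_pos[of M] by (intro bd_mult) (auto simp del: eps_pos)
    have ak: "bd ra (a * z)" if "z \<in> K" for z
      using bd_K_mult(2)[OF that c(1), of ra] ra by simp
    have cc: "a * k \<in> carrier_mat 2 2" "a * k' \<in> carrier_mat 2 2" "a * (k' - k) \<in> carrier_mat 2 2"
      using c ck by auto
    have adb: "bd ra (ad (a * k'))" "bd (ra * eps M) (ad (a * (k' - k)))"
      using ak[OF kK] diff cc by (simp_all only: bd_ad)
    have nn: "0 \<le> ra" "0 \<le> ry" "0 \<le> ra * eps M" using ra ry eps_pos[of M] by (auto simp del: eps_pos)
    have "bd (ra * eps M * (ry * ra)) (a * (k' - k) * (y * ad (a * k')))"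
      by (rule bd_mult3[OF diff ry(2) adb(1) nn(3,2,1) cc(3) c(2)]) (use cc in simp)
    moreover have "bd (ra * (ry * (ra * eps M))) (a * k * (y * ad (a * (k' - k))))"
      by (rule bd_mult3[OF ak[OF k] ry(2) adb(2) nn(1,2,3) cc(1) c(2)]) (use cc in simp)
    ultimately have b2: "bd (C * eps M) (a * (k' - k) * (y * ad (a * k')))" "bd (C * eps M) (a * k * (y * ad (a * (k' - k))))"
      by (simp_all only: C_def ac_simps)
    have adsub: "ad (a * (k' - k)) = ad (a * k') - ad (a * k)"
      using cc c ck by (intro eq_matI) (auto simp: mat_diff_mult adj_def st_diff simp del: index_mult_mat(1))
    have "act Q (a * k') y - act Q (a * k) y = a * (k' - k) * (y * ad (a * k')) + a * k * (y * ad (a * (k' - k)))"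
    proof -
      define P Q' where "P = y * ad (a * k')" and "Q' = y * ad (a * k)"
      have cP: "P \<in> carrier_mat 2 2" "Q' \<in> carrier_mat 2 2" using cc c by (simp_all add: P_def Q'_def)
      have 1: "a * (k' - k) * P = a * k' * P - a * k * P"
        unfolding mat_diff_mult(1)[OF c(1) ck(2) ck(1)] by (rule mat_diff_mult(2)[OF cP(1) cc(2,1)])
      have "y * ad (a * (k' - k)) = P - Q'"
        unfolding adsub P_def Q'_def using cc by (intro mat_diff_mult(1)[OF c(2)]) simp_all
      hence 2: "a * k * (y * ad (a * (k' - k))) = a * k * P - a * k * Q'"
        using mat_diff_mult(1)[OF cc(1) cP] by simp
      have 3: "act Q (a * k') y = a * k' * P" "act Q (a * k) y = a * k * Q'"
        unfolding act_def P_def Q'_def using cc c by (intro mat_assoc; simp)+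
      have 4: "U - V = U - W + (W - V)" if "U \<in> carrier_mat 2 2" "V \<in> carrier_mat 2 2" "W \<in> carrier_mat 2 2" for U V W :: "'d mat"
        using that by (intro eq_matI) auto
      show ?thesis
        unfolding P_def[symmetric] 1 2 3 by (rule 4) (rule mat_closed, rule cc, rule cP)+
    qed
    moreover have "(a * (k' - k) * (y * ad (a * k')) + a * k * (y * ad (a * (k' - k)))) $$ (0, 0) =
        (a * (k' - k) * (y * ad (a * k'))) $$ (0, 0) + (a * k * (y * ad (a * (k' - k)))) $$ (0, 0)"
    proof -
      have "a * k * (y * ad (a * (k' - k))) \<in> carrier_mat 2 2" by (intro mat_closed ad_carrier cc c)
      hence "dim_row (a * k * (y * ad (a * (k' - k)))) = 2" "dim_col (a * k * (y * ad (a * (k' - k)))) = 2"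
        by (rule carrier_matD)+
      thus ?thesis by (intro index_add_mat(1)) linarith+
    qed
    ultimately have "w ((act Q (a * k') y - act Q (a * k) y) $$ (0, 0)) \<le> C * eps M"
      using b2 by (auto simp: bd_def intro!: w_add_le simp del: index_mult_mat)
    moreover have H: "act Q (a * k') y \<in> HX" "act Q (a * k) y \<in> HX" using a k kK y by (simp_all add: K_G)
    moreover have "(act Q (a * k') y - act Q (a * k) y) $$ (0, 0) = em (d1 (act Q (a * k') y) - d1 (act Q (a * k) y))"
      using X_carrier[OF H(1)] X_carrier[OF H(2)] d1_HX[OF H(1)] d1_HX[OF H(2)] by (simp add: em_diff)
    ultimately have le: "w (em (d1 (act Q (a * k') y) - d1 (act Q (a * k) y))) < r * r" using small by simp
    have "av (d1 (act Q (a * k') y) - d1 (act Q (a * k) y)) < r"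
    proof (rule ccontr)
      assume "\<not> ?thesis"
      hence "r * r \<le> w (em (d1 (act Q (a * k') y) - d1 (act Q (a * k) y)))" unfolding w_em using r by (intro mult_mono) auto
      thus False using le by simp
    qed
    thus "k' \<in> K \<and> av (d1 (act Q (a * k' * b) x) - d1 (act Q (a * k * b) x)) < r"
      using kK act_eq ck by simp
  qed
qed

definition lev :: "'d mat \<Rightarrow> int \<Rightarrow> 'd mat set" where
  "lev x m = {k \<in> K. av (d1 (act Q k x)) = real q powi (- m)}"

lemma av_eta_mult: "av \<eta> * r = real q powi (- m) \<longleftrightarrow> r = real q powi (- (m - 1))"
proof -
  have "real q powi (- (m - 1)) = real q * real q powi (- m)"
    using power_int_add_1'[of "real q" "- m"] q_nz by simp
  thus ?thesis using q_pos by (simp add: av_eta field_simps)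
qed

lemma level_d1:
  assumes x: "x \<in> HX" and a: "a \<in> G" and b: "b \<in> G"
  obtains M where "level M {k \<in> K. av (d1 (act Q (a * k * b) x)) = real q powi (- m)}"
proof -
  have pos: "real q powi (- m) > 0" using q_pos by simp
  obtain M where M: "M \<ge> 1" "\<And>k k'. k \<in> K \<Longrightarrow> k' \<in> nbh k M \<Longrightarrow>
    k' \<in> K \<and> av (d1 (act Q (a * k' * b) x) - d1 (act Q (a * k * b) x)) < real q powi (- m)"
    by (rule d1_close[OF x a b pos]) blast
  have "level M {k \<in> K. av (d1 (act Q (a * k * b) x)) = real q powi (- m)}"
    unfolding level_def
  proof (intro conjI ballI subsetI)
    fix k k' assume k: "k \<in> {k \<in> K. av (d1 (act Q (a * k * b) x)) = real q powi (- m)}" and k': "k' \<in> nbh k M"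
    note Mk = M(2)[of k k']
    have "av ((d1 (act Q (a * k' * b) x) - d1 (act Q (a * k * b) x)) + d1 (act Q (a * k * b) x)) = av (d1 (act Q (a * k * b) x))"
      using Mk k k' by (intro av_add_eq) auto
    thus "k' \<in> {k \<in> K. av (d1 (act Q (a * k * b) x)) = real q powi (- m)}" using Mk k k' by simp
  qed (use M in auto)
  thus thesis by (rule that)
qed

lemma level_lev:
  assumes "x \<in> HX" obtains M where "level M (lev x m)"
proof -
  obtain M where M: "level M {k \<in> K. av (d1 (act Q (1\<^sub>m 2 * k * 1\<^sub>m 2) x)) = real q powi (- m)}"
    by (rule level_d1[OF assms G_one G_one])
  have "{k \<in> K. av (d1 (act Q (1\<^sub>m 2 * k * 1\<^sub>m 2) x)) = real q powi (- m)} = lev x m"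
    unfolding lev_def by (rule Collect_cong) (auto simp: K_G G_carrier)
  thus thesis using M that by metis
qed

text \<open>Representatives of \<open>SS / K\<close>. Being lower triangular, they only rescale \<open>d1\<close>.\<close>

definition bb :: "'d option \<Rightarrow> 'd mat" where
  "bb i = (case i of None \<Rightarrow> mat2 (st \<tau>) 0 0 1 | Some t \<Rightarrow> mat2 1 0 (st t) (st \<tau>))"

text \<open>The adjoint exchanges left and right cosets, and conjugating by the swap keeps the
  result lower triangular. Covering and disjointness for \<open>bb\<close> are thus inherited from
  \<open>gam\<close>.\<close>

lemma bb_eq: "bb i = mat2 0 1 1 0 * ad (gam i) * mat2 0 1 1 0"
  by (auto simp: bb_def gam_def split: option.splits)

lemma bb_G [simp]: "bb i \<in> G"
  unfolding bb_eq using ad_G[OF gam_G] K_G[OF swap_K] by (intro G_mult) auto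

lemma bb_SS: "i \<in> II \<Longrightarrow> bb i \<in> SS"
  unfolding bb_eq using SS_ad[OF gam_SS] SS_mult_K swap_K K_G ad_G[OF gam_G] G_mult by metis

lemma bb_cover:
  assumes g: "g \<in> SS" obtains i k where "i \<in> II" "k \<in> K" "g = bb i * k"
proof -
  let ?s = "mat2 0 1 1 0 :: 'd mat"
  have gG: "g \<in> G" using g by (rule SS_G)
  have ss: "?s * ?s = 1\<^sub>m 2" "ad ?s = ?s" by (simp_all add: mat2_one)
  have "?s * g \<in> SS" using SS_mult_K(1)[OF swap_K gG] g by simp
  hence "ad (?s * g) \<in> SS" by (rule SS_ad)
  then obtain i k where ik: "i \<in> II" "k \<in> K" "ad (?s * g) = k * gam i" by (rule SS_cover)
  note c = G_carrier[OF gG] G_carrier[OF K_G[OF ik(2)]] G_carrier[OF gam_G[of i]] G_carrier[OF K_G[OF swap_K]]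
  have "?s * g = ad (gam i) * ad k"
    using ad_ad[of "?s * g"] c ik(3) by (simp add: ad_mult)
  hence "?s * (?s * g) = ?s * (ad (gam i) * ad k)" by simp
  moreover have "?s * (?s * g) = g" using c ss by (simp add: mat_assoc[symmetric] del: mat_assoc mat2_mult)
  ultimately have "g = ?s * ad (gam i) * ad k" using c by simp
  also have "\<dots> = ?s * ad (gam i) * (?s * ?s) * ad k" unfolding ss using c by simp
  also have "\<dots> = bb i * (?s * ad k)" unfolding bb_eq using c by (simp del: mat2_mult)
  finally show thesis using that[OF ik(1), of "?s * ad k"] ad_K[OF ik(2)] swap_K by simp
qed

lemma bb_disjoint:
  assumes "i \<in> II" "j \<in> II" "h \<in> K" "k \<in> K" and eq: "bb i * h = bb j * k"
  shows "i = j"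
proof -
  let ?s = "mat2 0 1 1 0 :: 'd mat"
  note c = G_carrier[OF K_G[OF assms(3)]] G_carrier[OF K_G[OF assms(4)]] G_carrier[OF gam_G] G_carrier[OF K_G[OF swap_K]]
  have ss: "?s * ?s = 1\<^sub>m 2" "ad ?s = ?s" by (simp_all add: mat2_one)
  have form: "ad (?s * (bb l * z)) = ad (?s * z) * gam l" if "z \<in> carrier_mat 2 2" for l z
  proof -
    have "?s * (bb l * z) = (?s * ?s) * ad (gam l) * (?s * z)"
      unfolding bb_eq using c that by (simp del: mat2_mult)
    also have "\<dots> = ad (gam l) * (?s * z)" unfolding ss using c by simp
    finally show ?thesis using c that by (simp add: ad_mult del: mat_assoc mat2_mult)
  qed
  have "ad (?s * h) * gam i = ad (?s * k) * gam j" using form[of h i] form[of k j] c eq by simp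
  thus ?thesis using assms swap_K ad_K by (intro K_gam_disjoint[of i j "ad (?s * h)" "ad (?s * k)"]) auto
qed

lemma d1_bb:
  assumes "y \<in> HX"
  shows "d1 (act Q (bb None) y) = \<eta> * d1 y" "d1 (act Q (bb (Some t)) y) = d1 y"
proof -
  obtain a b c where y: "y = hm a b c" using assms by (rule HX_cases)
  have "st \<tau> * em a * \<tau> = em (\<eta> * a)" using conj_em(2)[of \<tau> a] by (simp add: mult.assoc)
  thus "d1 (act Q (bb None) y) = \<eta> * d1 y" "d1 (act Q (bb (Some t)) y) = d1 y"
    by (simp_all add: y d1_def bb_def hm_def act_mat2)
qed

end

section \<open>Masses of the level sets of \<open>d1\<close>\<close>

locale quaternion_haar_two = quaternion_rank_two Q \<iota> \<tau> + quaternion_haar Q \<iota> \<tau> 2 \<mu> \<nu>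
  for Q :: "('k :: field_char_0, 'd :: division_ring) quat_datum" and \<iota> \<tau> and \<mu> \<nu> :: "'d mat measure"
begin

text \<open>The Hecke action involves the inverse of g, so the indicator of the inverses of
  \<open>SS\<close> is used; its left cosets are the inverses of the cosets K
  \<open>gam i\<close>.\<close>

lemma spherical_is_eigen:
  assumes \<Phi>: "spherical_function Q 2 \<mu> \<Phi>"
  obtains c lam where "c \<noteq> 0" "eigen \<Phi> c lam"
proof -
  let ?V = "\<Union>i\<in>II. (\<lambda>k. iv (gam i) * k) ` K"
  have V: "a \<in> ?V \<longleftrightarrow> iv a \<in> SS" if a: "a \<in> G" for a
  proof
    assume "a \<in> ?V"
    then obtain i k where ik: "i \<in> II" "k \<in> K" "a = iv (gam i) * k" by blast
    hence "iv a = iv k * gam i" by (simp add: iv_of_mult gam_G K_G)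
    thus "iv a \<in> SS" using ik SS_iff K_iv by blast
  next
    assume "iv a \<in> SS"
    then obtain i k where ik: "i \<in> II" "k \<in> K" "iv a = k * gam i" by (rule SS_cover)
    hence "iv (iv a) = iv (gam i) * iv k" by (simp add: iv_of_mult gam_G K_G)
    hence "a = iv (gam i) * iv k" using a by simp
    thus "a \<in> ?V" by (intro UN_I[OF ik(1)] image_eqI[OF _ K_iv[OF ik(2)]])
  qed
  have biV: "h * a * h' \<in> ?V \<longleftrightarrow> a \<in> ?V" if h: "h \<in> K" "h' \<in> K" "a \<in> G" for h h' a
  proof -
    have "h * a * h' \<in> G" using h by (simp add: K_G)
    moreover have "iv (h * a * h') = iv h' * (iv a * iv h)" using h by (simp add: iv_of_mult K_G)
    ultimately show ?thesis using V h SS_mult_K[OF K_iv[OF h(1)]] SS_mult_K[OF K_iv[OF h(2)]] by (simp add: K_G)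
  qed
  have disj: "(\<lambda>k. iv (gam i) * k) ` K \<inter> (\<lambda>k. iv (gam j) * k) ` K = {}" if ij: "i \<in> II" "j \<in> II" "i \<noteq> j" for i j
  proof (rule ccontr)
    assume "\<not> ?thesis"
    then obtain h k where hk: "h \<in> K" "k \<in> K" "iv (gam i) * h = iv (gam j) * k" by blast
    hence "iv (iv (gam i) * h) = iv (iv (gam j) * k)" by simp
    moreover have "iv (iv (gam l) * z) = iv z * gam l" if "z \<in> K" for l z
      using that by (simp add: iv_of_mult gam_G K_G)
    ultimately have "iv h * gam i = iv k * gam j" using hk(1,2) by simp
    thus False using K_gam_disjoint[OF ij(1,2) K_iv[OF hk(1)] K_iv[OF hk(2)]] ij(3) by blast
  qed
  obtain lam where lam: "\<forall>x\<in>HX. (\<Sum>i\<in>II. \<Phi> (act Q (iv (iv (gam i))) x)) = lam * \<Phi> x"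
    using spherical_eigen[OF \<Phi> finite_II, of "\<lambda>i. iv (gam i)", OF _ disj biV] gam_G by auto
  obtain c where c: "c \<noteq> 0" "\<And>x. x \<in> HX \<Longrightarrow> \<Phi> (act Q TT x) = c * \<Phi> x" by (rule spherical_TT[OF \<Phi>]) blast
  have "eigen \<Phi> c lam"
    using lam c(2) spherical_K_invariant[OF \<Phi>] by (simp add: eigen_def gam_G)
  thus thesis using that c(1) by blast
qed

text \<open>With the next lemma this gives two ways to measure a subset of \<open>SS\<close>: along
  left cosets, each a copy of \<nu>, and along right cosets, each a copy of \<nu> scaled by its
  modulus.\<close>

lemma measure_SS_bb:
  assumes Y: "Y \<subseteq> SS" and lv: "\<And>i. i \<in> II \<Longrightarrow> \<exists>M. level M {k \<in> K. bb i * k \<in> Y}"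
  shows "measure \<mu> Y = (\<Sum>i\<in>II. measure \<nu> {k \<in> K. bb i * k \<in> Y})"
proof -
  let ?A = "\<lambda>i. (\<lambda>k. bb i * k) ` {k \<in> K. bb i * k \<in> Y}"
  have "Y = (\<Union>i\<in>II. ?A i)"
  proof (rule Set.set_eqI, rule iffI)
    fix g assume g: "g \<in> Y"
    then obtain i k where "i \<in> II" "k \<in> K" "g = bb i * k" using Y bb_cover by blast
    thus "g \<in> (\<Union>i\<in>II. ?A i)" using g by blast
  qed auto
  also have "measure \<mu> \<dots> = (\<Sum>i\<in>II. measure \<mu> (?A i))"
  proof (rule measure_finite_Union[OF finite_II])
    show "disjoint_family_on ?A II" unfolding disjoint_family_on_def using bb_disjoint by blast
    show "?A ` II \<subseteq> sets \<mu>" using mu_left_coset(1) lv bb_G by blast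
    show "emeasure \<mu> (?A i) \<noteq> \<infinity>" if "i \<in> II" for i using mu_left_coset(2) lv[OF that] bb_G by blast
  qed
  also have "\<dots> = (\<Sum>i\<in>II. measure \<nu> {k \<in> K. bb i * k \<in> Y})"
    using mu_left_coset(3) lv bb_G by (intro sum.cong) blast+
  finally show ?thesis .
qed

lemma measure_SS_gam:
  assumes Y: "Y \<subseteq> SS" and lv: "\<And>i. i \<in> II \<Longrightarrow> \<exists>M. level M {k \<in> K. k * gam i \<in> Y}"
  shows "measure \<mu> Y = (\<Sum>i\<in>II. measure \<mu> ((\<lambda>k. k * gam i) ` K) * measure \<nu> {k \<in> K. k * gam i \<in> Y})"
proof -
  let ?A = "\<lambda>i. (\<lambda>k. k * gam i) ` {k \<in> K. k * gam i \<in> Y}"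
  have "Y = (\<Union>i\<in>II. ?A i)"
  proof (rule Set.set_eqI, rule iffI)
    fix g assume g: "g \<in> Y"
    then obtain i k where "i \<in> II" "k \<in> K" "g = k * gam i" using Y SS_cover by blast
    thus "g \<in> (\<Union>i\<in>II. ?A i)" using g by blast
  qed auto
  also have "measure \<mu> \<dots> = (\<Sum>i\<in>II. measure \<mu> (?A i))"
  proof (rule measure_finite_Union[OF finite_II])
    show "disjoint_family_on ?A II" unfolding disjoint_family_on_def using K_gam_disjoint by blast
    show "?A ` II \<subseteq> sets \<mu>" using mu_right_coset(1) lv gam_G by blast
    show "emeasure \<mu> (?A i) \<noteq> \<infinity>" if "i \<in> II" for i using mu_right_coset(2) lv[OF that] gam_G by blast
  qed
  also have "\<dots> = (\<Sum>i\<in>II. measure \<mu> ((\<lambda>k. k * gam i) ` K) * measure \<nu> {k \<in> K. k * gam i \<in> Y})"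
    using mu_right_coset(3) lv gam_G by (intro sum.cong) blast+
  finally show ?thesis .
qed

lemma level_right_coset:
  assumes b: "b \<in> G" and g: "g \<in> G"
  obtains M where "level M {k \<in> K. b * k \<in> (\<lambda>k. k * g) ` K}"
proof -
  obtain M where M: "level M {k \<in> K. b * k * iv g \<in> K}" by (rule level_conj_K[OF b GL.inv_closed[OF g]])
  have "b * k \<in> (\<lambda>k. k * g) ` K \<longleftrightarrow> b * k * iv g \<in> K" if k: "k \<in> K" for k
  proof
    assume "b * k \<in> (\<lambda>k. k * g) ` K"
    then obtain h where h: "h \<in> K" "b * k = h * g" by blast
    show "b * k * iv g \<in> K" unfolding h(2) using iv_cancel(3)[OF g G_carrier[OF K_G[OF h(1)]]] h(1) by simp
  next
    assume "b * k * iv g \<in> K"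
    moreover have "b * k * iv g * g = b * k" using b g k by (intro iv_cancel) (auto simp: K_G G_carrier)
    ultimately show "b * k \<in> (\<lambda>k. k * g) ` K" by (metis imageI)
  qed
  hence "{k \<in> K. b * k \<in> (\<lambda>k. k * g) ` K} = {k \<in> K. b * k * iv g \<in> K}" by auto
  thus thesis using M that by metis
qed

text \<open>Measured along left cosets, right translation by h only translates each piece inside K,
  where \<nu> is right invariant.\<close>

lemma mu_gam_right:
  assumes g: "g \<in> SS" and h: "h \<in> K"
  shows "measure \<mu> ((\<lambda>k. k * (g * h)) ` K) = measure \<mu> ((\<lambda>k. k * g) ` K)"
proof -
  have gG: "g \<in> G" using g by (rule SS_G)
  have sub: "(\<lambda>k. k * g') ` K \<subseteq> SS" if "g' \<in> SS" for g' using that SS_mult_K(1) SS_G by blast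
  have gh: "g * h \<in> SS" using SS_mult_K(2)[OF h gG] g by simp
  have "measure \<nu> {k \<in> K. bb i * k \<in> (\<lambda>k. k * (g * h)) ` K} = measure \<nu> {k \<in> K. bb i * k \<in> (\<lambda>k. k * g) ` K}" for i
  proof -
    let ?A = "{k \<in> K. bb i * k \<in> (\<lambda>k. k * g) ` K}"
    have eqA: "{k \<in> K. bb i * k \<in> (\<lambda>k. k * (g * h)) ` K} = (\<lambda>k. k * h) ` ?A"
    proof (rule Set.set_eqI, rule iffI)
      fix k assume "k \<in> {k \<in> K. bb i * k \<in> (\<lambda>k. k * (g * h)) ` K}"
      then obtain z where z: "k \<in> K" "z \<in> K" "bb i * k = z * (g * h)" by blast
      note c = G_carrier[OF K_G[OF z(1)]] G_carrier[OF K_G[OF z(2)]] G_carrier[OF gG] G_carrier[OF K_G[OF h]]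
        G_carrier[OF K_G[OF K_iv[OF h]]] G_carrier[OF bb_G[of i]]
      have "bb i * (k * iv h) = bb i * k * iv h" using c by simp
      also have "\<dots> = z * g" unfolding z(3) using c K_G[OF h] by simp
      finally have "k * iv h \<in> ?A" using z h by auto
      moreover have "k = k * iv h * h" using iv_cancel(4)[OF K_G[OF h] c(1)] by simp
      ultimately show "k \<in> (\<lambda>k. k * h) ` ?A" by (rule image_eqI[rotated])
    next
      fix k assume "k \<in> (\<lambda>k. k * h) ` ?A"
      then obtain z y where z: "k = z * h" "z \<in> K" "y \<in> K" "bb i * z = y * g" by blast
      note c = G_carrier[OF K_G[OF z(2)]] G_carrier[OF K_G[OF z(3)]] G_carrier[OF gG] G_carrier[OF K_G[OF h]]
        G_carrier[OF bb_G[of i]]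
      have "bb i * k = bb i * z * h" unfolding z(1) by (rule mat_assoc[symmetric, OF c(5,1,4)])
      also have "\<dots> = y * (g * h)" unfolding z(4) using c by simp
      finally show "k \<in> {k \<in> K. bb i * k \<in> (\<lambda>k. k * (g * h)) ` K}" using z h by auto
    qed
    obtain M where M: "level M ?A" by (rule level_right_coset[OF bb_G gG])
    show ?thesis unfolding eqA by (rule nu_right[OF M h])
  qed
  moreover have "measure \<mu> ((\<lambda>k. k * g') ` K) = (\<Sum>i\<in>II. measure \<nu> {k \<in> K. bb i * k \<in> (\<lambda>k. k * g') ` K})"
    if g': "g' \<in> SS" for g'
  proof (rule measure_SS_bb[OF sub[OF g']])
    fix i obtain M where "level M {k \<in> K. bb i * k \<in> (\<lambda>k. k * g') ` K}"
      by (rule level_right_coset[OF bb_G SS_G[OF g']])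
    thus "\<exists>M. level M {k \<in> K. bb i * k \<in> (\<lambda>k. k * g') ` K}" by blast
  qed
  ultimately show ?thesis using g gh by simp
qed

text \<open>All \<open>gam j\<close> lie in K \<open>gam None\<close> K, so the cosets K
  \<open>gam j\<close> share one mass. As \<open>SS\<close> consists of equally many left and right
  cosets and each left coset has mass 1, the common mass is 1.\<close>

lemma mu_gam:
  assumes i: "i \<in> II" shows "measure \<mu> ((\<lambda>k. k * gam i) ` K) = 1"
proof -
  let ?c = "measure \<mu> ((\<lambda>k. k * gam None) ` K)"
  have None: "None \<in> II" by (simp add: II_def)
  have eq: "measure \<mu> ((\<lambda>k. k * gam j) ` K) = ?c" if "j \<in> II" for j
  proof (cases j)
    case (Some t)
    let ?s = "mat2 0 1 1 0 :: 'd mat"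
    let ?h = "?s * mat2 1 0 t 1"
    have t: "mat2 1 0 t 1 \<in> K" using that Some reps_integral by (intro lower_K) (auto simp: II_def)
    have hK: "?h \<in> K" using t swap_K by (rule K_mult[rotated])
    have "?s * (gam None * ?h) = gam j" by (simp add: Some gam_def)
    hence "(\<lambda>k. k * gam j) ` K = (\<lambda>k. (k * ?s) * (gam None * ?h)) ` K"
      using G_carrier[OF K_G] G_carrier[OF gam_G] G_carrier[OF K_G[OF hK]]
      by (intro image_cong refl) (simp del: mat2_mult)
    also have "\<dots> = (\<lambda>k. k * (gam None * ?h)) ` (\<lambda>k. k * ?s) ` K" by (simp only: image_image)
    also have "(\<lambda>k. k * ?s) ` K = K"
    proof -
      have "k \<in> (\<lambda>k. k * ?s) ` K" if "k \<in> K" for k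
      proof (rule image_eqI)
        show "k * ?s \<in> K" using that swap_K by (rule K_mult)
        have "k * ?s * ?s = k * (?s * ?s)" using G_carrier[OF K_G[OF that]] by (intro mat_assoc) auto
        also have "\<dots> = k" using G_carrier[OF K_G[OF that]] by (simp add: mat2_one[symmetric])
        finally show "k = k * ?s * ?s" by simp
      qed
      thus ?thesis using swap_K by auto
    qed
    finally show ?thesis using mu_gam_right[OF gam_SS[OF None] hK] by simp
  qed simp
  have m1: "(1::nat) \<ge> 1" by simp
  have full1: "{k \<in> K. bb i * k \<in> SS} = K" if "i \<in> II" for i using SS_mult_K(2) bb_SS[OF that] by auto
  have full2: "{k \<in> K. k * gam i \<in> SS} = K" if "i \<in> II" for i using SS_mult_K(1) gam_SS[OF that] gam_G by auto
  have nuK: "measure \<nu> K = 1" using nu_K by (simp add: measure_def)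
  have "measure \<mu> SS = (\<Sum>i\<in>II. measure \<nu> K)"
    using measure_SS_bb[of SS] level_K[OF m1] full1 by (auto cong: sum.cong)
  moreover have "measure \<mu> SS = (\<Sum>i\<in>II. ?c * measure \<nu> K)"
    using measure_SS_gam[of SS] level_K[OF m1] full2 eq by (auto cong: sum.cong)
  ultimately have "?c * card II = card II" using nuK by simp
  thus ?thesis using eq[OF i] by (simp add: card_II)
qed

definition Lm :: "'d mat \<Rightarrow> int \<Rightarrow> real" where "Lm x m = measure \<nu> (lev x m)"

text \<open>A double count of the g in \<open>SS\<close> for which d1 of g x has size q^-m. Right
  cosets give the masses at the neighbours of x. Left cosets preserve the level at x, except that
  \<open>bb None\<close> multiplies d1 by \<eta> and shifts it by one.\<close>

lemma Lm_hecke: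
  assumes x: "x \<in> HX"
  shows "(\<Sum>i\<in>II. Lm (act Q (gam i) x) m) = card reps * Lm x m + Lm x (m - 1)"
proof -
  note cx = X_carrier[OF x]
  let ?Y = "{g \<in> SS. av (d1 (act Q g x)) = real q powi (- m)}"
  have e1: "{k \<in> K. k * gam i \<in> ?Y} = lev (act Q (gam i) x) m" if "i \<in> II" for i
    using SS_mult_K(1) gam_SS[OF that] gam_G act_act[OF _ G_carrier[OF gam_G] cx]
    by (auto simp: lev_def K_G G_carrier)
  have "measure \<mu> ?Y = (\<Sum>i\<in>II. measure \<mu> ((\<lambda>k. k * gam i) ` K) * measure \<nu> {k \<in> K. k * gam i \<in> ?Y})"
  proof (rule measure_SS_gam)
    fix i assume "i \<in> II"
    show "\<exists>M. level M {k \<in> K. k * gam i \<in> ?Y}"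
      unfolding e1[OF \<open>i \<in> II\<close>] using level_lev[OF act_X[OF gam_G x]] by metis
  qed auto
  also have "\<dots> = (\<Sum>i\<in>II. Lm (act Q (gam i) x) m)"
    using mu_gam e1 by (intro sum.cong) (auto simp: Lm_def)
  finally have 1: "measure \<mu> ?Y = (\<Sum>i\<in>II. Lm (act Q (gam i) x) m)" .
  have Yb: "{k \<in> K. bb i * k \<in> ?Y} = {k \<in> K. av (d1 (act Q (bb i) (act Q k x))) = real q powi (- m)}" if "i \<in> II" for i
    using SS_mult_K(2) bb_SS[OF that] act_act[OF G_carrier[OF bb_G] _ cx] by (auto simp: K_G G_carrier)
  note none = av_eta_mult
  have e2: "{k \<in> K. bb i * k \<in> ?Y} = lev x (if i = None then m - 1 else m)" if "i \<in> II" for i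
  proof (cases i)
    case None
    show ?thesis
      unfolding Yb[OF that] lev_def using None d1_bb(1)[OF act_X[OF K_G x]] none by (auto simp: av_mult)
  next
    case (Some t)
    show ?thesis unfolding Yb[OF that] lev_def using Some d1_bb(2)[OF act_X[OF K_G x]] by auto
  qed
  have "measure \<mu> ?Y = (\<Sum>i\<in>II. measure \<nu> {k \<in> K. bb i * k \<in> ?Y})"
  proof (rule measure_SS_bb)
    fix i assume "i \<in> II"
    show "\<exists>M. level M {k \<in> K. bb i * k \<in> ?Y}"
      unfolding e2[OF \<open>i \<in> II\<close>] using level_lev[OF x] by metis
  qed auto
  also have "\<dots> = (\<Sum>i\<in>II. Lm x (if i = None then m - 1 else m))"
    using e2 by (intro sum.cong) (auto simp: Lm_def)
  also have "\<dots> = card reps * Lm x m + Lm x (m - 1)" by (simp add: sum_II)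
  finally show ?thesis using 1 by simp
qed

lemma Lm_K:
  assumes x: "x \<in> HX" and h: "h \<in> K" shows "Lm (act Q h x) m = Lm x m"
proof -
  note c = G_carrier[OF K_G[OF h]] X_carrier[OF x]
  have eq: "lev x m = (\<lambda>k. k * h) ` lev (act Q h x) m"
  proof (rule Set.set_eqI, rule iffI)
    fix k assume k: "k \<in> lev x m"
    hence kK: "k \<in> K" by (simp add: lev_def)
    have e: "k * iv h * h = k" using iv_cancel(4)[OF K_G[OF h]] G_carrier[OF K_G[OF kK]] by simp
    have "act Q (k * iv h) (act Q h x) = act Q (k * iv h * h) x"
      using G_carrier[OF K_G[OF K_mult[OF kK K_iv[OF h]]]] c by (intro act_act[symmetric]) auto
    hence "k * iv h \<in> lev (act Q h x) m" using k h kK unfolding e by (simp add: lev_def)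
    thus "k \<in> (\<lambda>k. k * h) ` lev (act Q h x) m" using e by (intro image_eqI[of _ _ "k * iv h"]) simp_all
  next
    fix k assume "k \<in> (\<lambda>k. k * h) ` lev (act Q h x) m"
    thus "k \<in> lev x m" using h c act_act[of _ h x] by (auto simp: lev_def K_G G_carrier)
  qed
  obtain M where M: "level M (lev (act Q h x) m)" by (rule level_lev[OF act_X[OF K_G[OF h] x]])
  show ?thesis unfolding Lm_def eq by (rule nu_right[OF M h, symmetric])
qed

text \<open>Moving TT past k conjugates k, which preserves \<nu> by \<open>nu_conj\<close>; TT
  itself multiplies d1 by \<eta>.\<close>

lemma Lm_TT:
  assumes x: "x \<in> HX" shows "Lm (act Q TT x) m = Lm x (m - 1)"
proof -
  note cx = X_carrier[OF x]
  note none = av_eta_mult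
  have dTT: "d1 (act Q TT y) = \<eta> * d1 y" if "y \<in> HX" for y
    using that by (elim HX_cases) (simp add: act_TT)
  have conj: "act Q k (act Q TT x) = act Q TT (act Q (TT' * k * TT) x)" if "k \<in> K" for k
  proof -
    note ck = G_carrier[OF K_G[OF that]]
    have "act Q TT (act Q (TT' * k * TT) x) = act Q (TT * (TT' * k * TT)) x"
      using ck cx by (intro act_act[symmetric]) auto
    also have "TT * (TT' * k * TT) = k * TT" using iv_cancel(2)[of TT "k * TT"] ck by (simp add: iv_TT)
    finally show ?thesis using ck cx by (simp add: act_act)
  qed
  have mem: "k \<in> lev (act Q TT x) m \<longleftrightarrow> TT' * k * TT \<in> lev x (m - 1)" if "k \<in> K" for k
    using conj[OF that] dTT[OF act_X[OF K_G x], OF TT_conj(2)[OF that]] none TT_conj(2)[OF that] that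
    by (simp add: lev_def av_mult del: mat_assoc)
  have eq: "lev x (m - 1) = (\<lambda>k. TT' * k * TT) ` lev (act Q TT x) m"
  proof (rule Set.set_eqI, rule iffI)
    fix k assume k: "k \<in> lev x (m - 1)"
    hence kK: "k \<in> K" by (simp add: lev_def)
    have e: "TT' * (TT * k * TT') * TT = k"
      using G_carrier[OF K_G[OF kK]] iv_cancel(1)[of TT "k * (TT' * TT)"] by (simp add: iv_TT TT_inverse)
    show "k \<in> (\<lambda>k. TT' * k * TT) ` lev (act Q TT x) m"
    proof (rule image_eqI[of _ _ "TT * k * TT'"])
      show "k = TT' * (TT * k * TT') * TT" by (rule e[symmetric])
      show "TT * k * TT' \<in> lev (act Q TT x) m" using mem[OF TT_conj(1)[OF kK]] k unfolding e by simp
    qed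
  next
    fix k assume "k \<in> (\<lambda>k. TT' * k * TT) ` lev (act Q TT x) m"
    then obtain h where "k = TT' * h * TT" "h \<in> lev (act Q TT x) m" by blast
    thus "k \<in> lev x (m - 1)" using mem[of h] by (simp add: lev_def del: mat_assoc)
  qed
  obtain M where M: "level M (lev (act Q TT x) m)" by (rule level_lev[OF act_X[OF TT_G(1) x]])
  show ?thesis unfolding Lm_def eq by (rule nu_conj[OF M, symmetric])
qed

end

section \<open>Digits in k and equidistribution\<close>

context local_field begin

lemma av_less_pow_iff: "av x < (1 / real q) ^ m \<longleftrightarrow> av x \<le> (1 / real q) ^ Suc m"
proof -
  have "av (x / \<pi> ^ m) < 1 \<longleftrightarrow> av (x / \<pi> ^ m) \<le> 1 / real q" by (rule av_lt_1_iff)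
  thus ?thesis using q_pos by (simp add: av_divide av_power av_unif field_simps)
qed

lemma residue_reps_pow:
  obtains R where "finite R" "card R = q" "\<And>r. r \<in> R \<Longrightarrow> av r \<le> 1"
    "\<And>x m. av x \<le> (1 / real q) ^ m \<Longrightarrow> \<exists>r \<in> R. av (x - \<pi> ^ m * r) \<le> (1 / real q) ^ Suc m"
    "\<And>x m r r'. r \<in> R \<Longrightarrow> r' \<in> R \<Longrightarrow> av (x - \<pi> ^ m * r) \<le> (1 / real q) ^ Suc m \<Longrightarrow>
       av (x - \<pi> ^ m * r') \<le> (1 / real q) ^ Suc m \<Longrightarrow> r = r'"
proof -
  obtain R where R: "finite R" "card R = q" "\<And>r. r \<in> R \<Longrightarrow> av r \<le> 1"
    "\<And>x. av x \<le> 1 \<Longrightarrow> \<exists>r \<in> R. av (x - r) < 1"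
    "\<And>r r'. r \<in> R \<Longrightarrow> r' \<in> R \<Longrightarrow> av (r - r') < 1 \<Longrightarrow> r = r'" by (rule residue_reps) blast
  have scale: "av (\<pi> ^ m * y) \<le> (1 / real q) ^ Suc m \<longleftrightarrow> av y < 1" for y m
    using q_pos unfolding av_lt_1_iff by (simp add: av_mult av_power av_unif field_simps)
  show thesis
  proof (rule that[OF R(1-3)])
    fix x m assume x: "av x \<le> (1 / real q) ^ m"
    have "av (x / \<pi> ^ m) \<le> 1" using x q_pos by (simp add: av_divide av_power av_unif field_simps)
    then obtain r where r: "r \<in> R" "av (x / \<pi> ^ m - r) < 1" using R(4) by blast
    have "x - \<pi> ^ m * r = \<pi> ^ m * (x / \<pi> ^ m - r)" by (simp add: field_simps)
    thus "\<exists>r \<in> R. av (x - \<pi> ^ m * r) \<le> (1 / real q) ^ Suc m" using r scale by metis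
  next
    fix x m r r' assume rr: "r \<in> R" "r' \<in> R" "av (x - \<pi> ^ m * r) \<le> (1 / real q) ^ Suc m"
      "av (x - \<pi> ^ m * r') \<le> (1 / real q) ^ Suc m"
    have "\<pi> ^ m * (r - r') = (x - \<pi> ^ m * r') - (x - \<pi> ^ m * r)" by (simp add: algebra_simps)
    hence "av (\<pi> ^ m * (r - r')) \<le> (1 / real q) ^ Suc m" using rr(3,4) av_diff_le by metis
    thus "r = r'" using rr scale R(5) by blast
  qed
qed

text \<open>Turns a size raised to a complex exponent into an integer power of q^-z, the variable of
  the Laurent polynomials.\<close>

lemma complex_powr_av: "(complex_of_real (real q powi (- m))) powr z = (of_nat q powr (- z)) powi m"
proof -
  define r where "r = - of_int m * ln (real q)"
  have "real q powi (- m) = real q powr (of_int (- m))"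
    using powr_real_of_int'[of "real q" "- m"] q_pos by simp
  also have "\<dots> = exp r" using q_pos by (simp add: powr_def r_def)
  finally have "(complex_of_real (real q powi (- m))) powr z = exp (z * complex_of_real r)"
    by (simp add: powr_def Ln_of_real)
  also have "\<dots> = exp (- z * complex_of_real (ln (real q))) powi m"
    unfolding exp_power_int by (simp add: r_def mult_ac)
  also have "exp (- z * complex_of_real (ln (real q))) = of_nat q powr (- z)"
    using q_pos Ln_of_real[of "real q"] by (simp add: powr_def)
  finally show ?thesis .
qed

end

context quaternion_rank begin

lemma av_tr_eps: "w x \<le> eps m \<Longrightarrow> av (tr x) \<le> (1 / real q) ^ m"
proof -
  assume "w x \<le> eps m"
  hence "(av (tr x))\<^sup>2 \<le> ((1 / real q) ^ m)\<^sup>2"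
    using av_tr_le[of x] by (simp add: power2_eq_square power_add[symmetric] mult_2)
  thus ?thesis by (rule power2_le_imp_le) simp
qed

end

context quaternion_haar begin

text \<open>By right invariance of \<nu>, its image under \<rho> is a measure on o invariant under
  all translations, so the q discs into which a disc splits have equal mass.\<close>

lemma equidistribution:
  fixes \<rho> :: "'d mat \<Rightarrow> 'k"
  assumes int: "\<And>k. k \<in> A \<Longrightarrow> av (\<rho> k) \<le> 1"
    and trans: "\<And>y. av y \<le> 1 \<Longrightarrow> \<exists>h\<in>K. \<forall>k\<in>A. k * h \<in> A \<and> \<rho> (k * h) = \<rho> k + y"
    and lv: "\<And>y m. av y \<le> 1 \<Longrightarrow> \<exists>M. level M {k \<in> A. av (\<rho> k - y) \<le> (1 / real q) ^ m}"
  shows "measure \<nu> {k \<in> A. av (\<rho> k) \<le> (1 / real q) ^ m} = (1 / real q) ^ m * measure \<nu> A"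
proof -
  define S where "S y m = {k \<in> A. av (\<rho> k - y) \<le> (1 / real q) ^ m}" for y m
  have sets: "S y m \<in> sets \<nu>" if "av y \<le> 1" for y m
    using lv[OF that] level_sets(1) unfolding S_def by blast
  have mono: "measure \<nu> B \<le> measure \<nu> C" if "B \<subseteq> C" "B \<in> sets \<nu>" "C \<in> sets \<nu>" for B C
    using that finite_nu[of C] by (intro measure_mono_fmeasurable) (auto simp: fmeasurable_def less_top)
  \<comment> \<open>A translation only gives an inclusion; the inequality for z and for - z together
    yields equality.\<close>
  have le: "measure \<nu> (S y m) \<le> measure \<nu> (S (y + z) m)" if yz: "av y \<le> 1" "av z \<le> 1" for y z m
  proof -
    obtain h where h: "h \<in> K" "\<forall>k\<in>A. k * h \<in> A \<and> \<rho> (k * h) = \<rho> k + z" using trans[OF yz(2)] by blast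
    obtain M where M: "level M (S y m)" using lv[OF yz(1)] unfolding S_def by blast
    have "measure \<nu> (S y m) = measure \<nu> ((\<lambda>k. k * h) ` S y m)" by (rule nu_right[OF M h(1), symmetric])
    also have "\<dots> \<le> measure \<nu> (S (y + z) m)"
    proof (rule mono)
      show "(\<lambda>k. k * h) ` S y m \<subseteq> S (y + z) m" using h(2) by (auto simp: S_def)
      show "(\<lambda>k. k * h) ` S y m \<in> sets \<nu>" by (rule level_sets(1)[OF level_right[OF M h(1)]])
    qed (use yz in \<open>auto intro!: sets av_add_le\<close>)
    finally show ?thesis .
  qed
  have eq: "measure \<nu> (S y m) = measure \<nu> (S 0 m)" if "av y \<le> 1" for y m
    using le[of 0 y m] le[of y "- y" m] that by simp
  obtain R where R: "finite R" "card R = q" "\<And>r. r \<in> R \<Longrightarrow> av r \<le> 1"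
    "\<And>x m. av x \<le> (1 / real q) ^ m \<Longrightarrow> \<exists>r \<in> R. av (x - \<pi> ^ m * r) \<le> (1 / real q) ^ Suc m"
    "\<And>x m r r'. r \<in> R \<Longrightarrow> r' \<in> R \<Longrightarrow> av (x - \<pi> ^ m * r) \<le> (1 / real q) ^ Suc m \<Longrightarrow>
       av (x - \<pi> ^ m * r') \<le> (1 / real q) ^ Suc m \<Longrightarrow> r = r'" by (rule residue_reps_pow) blast
  have q1: "(1 / real q) ^ m \<le> 1" for m using q_gt_1 by (intro power_le_one) auto
  have avp: "av (\<pi> ^ m * r) \<le> (1 / real q) ^ m" if "r \<in> R" for r m
    using mult_left_le[OF R(3)[OF that], of "(1 / real q) ^ m"] by (simp add: av_mult av_power av_unif power_one_over)
  have step: "measure \<nu> (S 0 m) = real q * measure \<nu> (S 0 (Suc m))" for m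
  proof -
    have "S 0 m = (\<Union>r\<in>R. S (\<pi> ^ m * r) (Suc m))"
    proof (rule Set.set_eqI, rule iffI)
      fix k assume "k \<in> S 0 m"
      thus "k \<in> (\<Union>r\<in>R. S (\<pi> ^ m * r) (Suc m))" using R(4)[of "\<rho> k" m] by (auto simp: S_def)
    next
      fix k assume "k \<in> (\<Union>r\<in>R. S (\<pi> ^ m * r) (Suc m))"
      then obtain r where r: "r \<in> R" "k \<in> A" "av (\<rho> k - \<pi> ^ m * r) \<le> (1 / real q) ^ Suc m" by (auto simp: S_def)
      have "(1 / real q) ^ Suc m \<le> (1 / real q) ^ m" using q_gt_1 by (intro power_decreasing) auto
      hence "av ((\<rho> k - \<pi> ^ m * r) + \<pi> ^ m * r) \<le> (1 / real q) ^ m"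
        using r avp[OF r(1), of m] by (intro av_add_le) auto
      thus "k \<in> S 0 m" using r by (simp add: S_def)
    qed
    also have "measure \<nu> \<dots> = (\<Sum>r\<in>R. measure \<nu> (S (\<pi> ^ m * r) (Suc m)))"
    proof (rule measure_finite_Union[OF R(1)])
      show "disjoint_family_on (\<lambda>r. S (\<pi> ^ m * r) (Suc m)) R"
        unfolding disjoint_family_on_def S_def using R(5) by blast
      show "(\<lambda>r. S (\<pi> ^ m * r) (Suc m)) ` R \<subseteq> sets \<nu>" using sets avp q1 by (meson image_subsetI order_trans)
    qed (rule finite_nu)
    also have "\<dots> = (\<Sum>r\<in>R. measure \<nu> (S 0 (Suc m)))"
      using avp q1 by (intro sum.cong refl eq) (meson order_trans)
    finally show ?thesis using R(2) by simp
  qed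
  have "measure \<nu> (S 0 m) = (1 / real q) ^ m * measure \<nu> A"
  proof (induction m)
    case 0
    have "S 0 0 = A" using int by (auto simp: S_def)
    thus ?case by simp
  next
    case (Suc m)
    thus ?case using step[of m] q_pos by (simp add: field_simps)
  qed
  thus ?thesis by (simp add: S_def)
qed

end

section \<open>Distribution of \<open>d1\<close> at the antidiagonal matrix\<close>

context quaternion_haar_two begin

definition Bl :: "'d mat" where "Bl = hm 0 \<tau> 0"

lemma Bl_HX: "Bl \<in> HX"
  by (simp add: Bl_def hm_HX)

lemma d1_Bl: "d1 (act Q (mat2 u v s t) Bl) = tr (u * \<tau> * st v)"
proof -
  have "act Q (mat2 u v s t) Bl $$ (0, 0) = em (tr (u * \<tau> * st v))"
    by (simp add: Bl_def hm_def act_mat2 em_tr st_mult mult.assoc add.commute)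
  thus ?thesis by (simp add: d1_def)
qed

text \<open>P is used as the constant True and as the identity. The first case collects all k with
  unit upper left entry; the second, after swapping columns, the remaining k.\<close>

definition rowset :: "(bool \<Rightarrow> bool) \<Rightarrow> 'd mat set" where
  "rowset P = {k \<in> K. w (k $$ (0, 0)) = 1 \<and> P (w (k $$ (0, 1)) < 1)}"

text \<open>On the orbit of \<open>Bl\<close>, d1 at a row (u, v) is tr (u \<tau> st v). For a unit
  u, dividing by N u \<eta> makes it integral, and adding u (y / 2) \<tau> to v shifts it by exactly
  y.\<close>

definition ratio :: "'d mat \<Rightarrow> 'k" where
  "ratio k = tr (k $$ (0, 0) * \<tau> * st (k $$ (0, 1))) / (N (k $$ (0, 0)) * \<eta>)"

lemma K_entries: "mat2 u v s t \<in> K \<Longrightarrow> w u \<le> 1 \<and> w v \<le> 1 \<and> w s \<le> 1 \<and> w t \<le> 1"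
  using K_bd[of "mat2 u v s t"] by (simp add: bd_mat2)

lemma d1_Bl_le:
  assumes kK: "k \<in> K" shows "av (d1 (act Q k Bl)) \<le> 1 / real q"
proof -
  obtain u v s t where kk: "k = mat2 u v s t" using G_carrier[OF K_G[OF kK]] by (rule mat2_cases)
  have "w u * w v \<le> 1" using K_entries kK by (intro mult_le_one) (auto simp: kk)
  hence "w (u * \<tau> * st v) \<le> 1 / real q" using q_pos by (simp add: w_mult w_tau divide_right_mono)
  thus ?thesis unfolding kk d1_Bl by (rule av_tr_tau)
qed

text \<open>On a ball of index \<open>Suc m\<close> the trace and N u are constant modulo
  \<pi>^(m+1); dividing by \<eta> costs one step.\<close>

lemma ratio_level:
  assumes y: "av y \<le> 1"
  shows "level (Suc m) {k \<in> rowset P. av (ratio k - y) \<le> (1 / real q) ^ m}"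
  unfolding level_def
proof (intro conjI ballI subsetI)
  fix k k' assume k: "k \<in> {k \<in> rowset P. av (ratio k - y) \<le> (1 / real q) ^ m}" and k': "k' \<in> nbh k (Suc m)"
  have kK: "k \<in> K" "k' \<in> K" using k k' ball_K[of k "Suc m"] by (auto simp: rowset_def)
  obtain u v s t where kk: "k = mat2 u v s t" using G_carrier[OF K_G[OF kK(1)]] by (rule mat2_cases)
  obtain u' v' s' t' where kk': "k' = mat2 u' v' s' t'" using G_carrier[OF K_G[OF kK(2)]] by (rule mat2_cases)
  have "bd (eps (Suc m)) (k' - k)" using k' kK by (simp add: ball_iff K_G)
  hence "\<forall>i<2. \<forall>j<2. w (k' $$ (i, j) - k $$ (i, j)) \<le> eps (Suc m)"
    using G_carrier[OF K_G[OF kK(1)]] by (simp only: bd_diff_iff)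
  from this[rule_format, of 0 0] this[rule_format, of 0 1]
  have d: "w (u' - u) \<le> eps (Suc m)" "w (v' - v) \<le> eps (Suc m)" by (simp_all add: kk kk')
  have e1: "eps (Suc m) < 1" by (rule eps_lt_1) simp
  have wu: "w u = 1" "w u \<le> 1" "w v \<le> 1" "w u' \<le> 1" "w v' \<le> 1"
    using k K_entries kK by (auto simp: rowset_def kk kk')
  have "w ((u' - u) + u) = w u" using d(1) e1 wu(1) by (intro w_add_eq) linarith
  hence wu': "w u' = 1" using wu(1) by simp
  have wv: "w v' < 1 \<longleftrightarrow> w v < 1"
    using w_add_less[of "v' - v" 1 v] w_diff_less[of v' 1 "v' - v"] d(2) e1 by auto
  have prod: "w (a * b) \<le> eps (Suc m)" if "w a \<le> eps (Suc m)" "w b \<le> 1" for a b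
    using mult_mono[OF that] by (simp add: w_mult)
  have wt: "w \<tau> \<le> 1" using q_gt_1 by (simp add: w_tau)
  have "w ((u' - u) * (\<tau> * st v')) \<le> eps (Suc m)"
    using wt wu by (intro prod d) (simp add: w_mult mult_le_one)
  moreover have "w (u * \<tau> * st (v' - v)) \<le> eps (Suc m)"
  proof -
    have "w (st (v' - v) * (u * \<tau>)) \<le> eps (Suc m)" using d wt wu by (intro prod) (simp_all add: w_mult mult_le_one)
    thus ?thesis by (simp add: w_mult mult_ac)
  qed
  moreover have "u' * \<tau> * st v' - u * \<tau> * st v = (u' - u) * (\<tau> * st v') + u * \<tau> * st (v' - v)"
    by (simp add: algebra_simps st_diff)
  ultimately have "w (u' * \<tau> * st v' - u * \<tau> * st v) \<le> eps (Suc m)" using w_add_le by metis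
  hence "av (tr (u' * \<tau> * st v' - u * \<tau> * st v)) \<le> (1 / real q) ^ Suc m" by (rule av_tr_eps)
  hence tr1: "av (tr (u' * \<tau> * st v') - tr (u * \<tau> * st v)) \<le> (1 / real q) ^ Suc m"
    using tr_add[of "u' * \<tau> * st v' - u * \<tau> * st v" "u * \<tau> * st v"] by simp
  have "w ((u' - u) * st u) \<le> eps (Suc m)" using wu by (intro prod d) simp
  hence "av (tr ((u' - u) * st u)) \<le> (1 / real q) ^ Suc m" by (rule av_tr_eps)
  moreover have "av (N (u' - u)) \<le> (1 / real q) ^ Suc m"
  proof -
    have "eps (Suc m) \<le> (1 / real q) ^ Suc m" using q_gt_1 by (intro power_decreasing) auto
    thus ?thesis using d(1) by (simp only: w_def)
  qed
  moreover have "N u' - N u = N (u' - u) + tr ((u' - u) * st u)" using N_add[of "u' - u" u] by simp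
  ultimately have N1: "av (N u' - N u) \<le> (1 / real q) ^ Suc m" using av_add_le by metis
  have ratio_iff: "av (tr z / (N x * \<eta>) - y) \<le> (1 / real q) ^ m \<longleftrightarrow> av (tr z - N x * (\<eta> * y)) \<le> (1 / real q) ^ Suc m"
    if "w x = 1" for x z
  proof -
    have "N x * \<eta> \<noteq> 0" using that by auto
    hence "tr z / (N x * \<eta>) - y = (tr z - N x * (\<eta> * y)) / (N x * \<eta>)" by (simp add: field_simps)
    moreover have "av (N x) = 1" using that by (simp add: w_def)
    ultimately show ?thesis using q_pos by (simp add: av_divide av_mult av_eta field_simps)
  qed
  have "av (tr (u * \<tau> * st v) - N u * (\<eta> * y)) \<le> (1 / real q) ^ Suc m"
    using k ratio_iff[OF wu(1), of "u * \<tau> * st v"] by (simp add: ratio_def kk)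
  moreover have "av ((N u' - N u) * (\<eta> * y)) \<le> (1 / real q) ^ Suc m"
  proof -
    have "av \<eta> * av y \<le> 1" using y av_eta_less by (intro mult_le_one) auto
    hence "av (N u' - N u) * av (\<eta> * y) \<le> (1 / real q) ^ Suc m * 1" using N1 by (intro mult_mono) (auto simp: av_mult)
    thus ?thesis by (simp add: av_mult)
  qed
  moreover have "tr (u' * \<tau> * st v') - N u' * (\<eta> * y) =
    (tr (u' * \<tau> * st v') - tr (u * \<tau> * st v)) + (tr (u * \<tau> * st v) - N u * (\<eta> * y)) - (N u' - N u) * (\<eta> * y)"
    by (simp add: algebra_simps)
  ultimately have "av (tr (u' * \<tau> * st v') - N u' * (\<eta> * y)) \<le> (1 / real q) ^ Suc m"
    using tr1 av_add_le av_diff_le by metis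
  hence "av (ratio k' - y) \<le> (1 / real q) ^ m"
    using ratio_iff[OF wu', of "u' * \<tau> * st v'"] by (simp add: ratio_def kk')
  thus "k' \<in> {k \<in> rowset P. av (ratio k - y) \<le> (1 / real q) ^ m}"
    using kK k wu' wv by (simp add: rowset_def kk kk')
qed (auto simp: rowset_def)

lemma ratio_equidistributed:
  "measure \<nu> {k \<in> rowset P. av (ratio k) \<le> (1 / real q) ^ m} = (1 / real q) ^ m * measure \<nu> (rowset P)"
proof (rule equidistribution)
  fix k assume k: "k \<in> rowset P"
  hence "k \<in> carrier_mat 2 2" by (simp add: rowset_def K_G G_carrier)
  then obtain u v s t where kk: "k = mat2 u v s t" by (rule mat2_cases)
  have "w u = 1" "w v \<le> 1" using k K_entries by (auto simp: rowset_def kk)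
  moreover from this have "av (tr (u * \<tau> * st v)) \<le> 1 / real q"
    using q_pos by (intro av_tr_tau) (simp add: w_mult w_tau divide_right_mono)
  ultimately show "av (ratio k) \<le> 1"
    using q_pos by (simp add: ratio_def kk av_divide av_mult av_eta w_def field_simps)
next
  fix y assume y: "av y \<le> 1"
  define T where "T = em (y / 2) * \<tau>"
  have wT: "w T < 1"
  proof -
    have "w T \<le> 1 * (1 / real q)" using w_em_le[of "y / 2"] y unfolding T_def w_mult w_tau by (intro mult_mono) auto
    thus ?thesis using w_lt_1_iff by simp
  qed
  have "\<tau> * st T = em (y / 2 * \<eta>)"
    by (simp add: T_def st_em_mult em_left_commute[of \<tau>] em_N[symmetric] em_mult[symmetric])
  hence tT: "u * (\<tau> * (st T * st u)) = em (N u * (y / 2 * \<eta>))" for u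
    by (simp add: mult.assoc[symmetric]) (simp add: mult.assoc conj_em)
  show "\<exists>h\<in>K. \<forall>k\<in>rowset P. k * h \<in> rowset P \<and> ratio (k * h) = ratio k + y"
  proof (intro bexI[of _ "mat2 1 T 0 1"] ballI)
    show TK: "mat2 1 T 0 1 \<in> K" using wT by (intro upper_K) simp
    fix k assume k: "k \<in> rowset P"
    hence kK: "k \<in> K" by (simp add: rowset_def)
    obtain u v s t where kk: "k = mat2 u v s t" using G_carrier[OF K_G[OF kK]] by (rule mat2_cases)
    have wu: "w u = 1" using k by (simp add: rowset_def kk)
    have "w (u * T) < 1" using wT wu by (simp add: w_mult)
    hence "w (u * T + v) < 1 \<longleftrightarrow> w v < 1"
      using w_add_less[of "u * T" 1 v] w_diff_less[of "u * T + v" 1 "u * T"] by auto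
    hence mem: "k * mat2 1 T 0 1 \<in> rowset P"
      using k K_mult[OF kK TK] by (simp add: rowset_def kk)
    have "u * \<tau> * st (u * T + v) = em (N u * (y / 2 * \<eta>)) + u * \<tau> * st v"
      by (simp add: st_add st_mult distrib_left tT mult.assoc)
    hence "tr (u * \<tau> * st (u * T + v)) = N u * y * \<eta> + tr (u * \<tau> * st v)" by (simp add: tr_add)
    moreover have "N u \<noteq> 0" using wu by auto
    ultimately have "ratio (k * mat2 1 T 0 1) = ratio k + y"
      by (simp add: ratio_def kk add_divide_distrib)
    thus "k * mat2 1 T 0 1 \<in> rowset P \<and> ratio (k * mat2 1 T 0 1) = ratio k + y" using mem by blast
  qed
next
  fix y :: 'k and m assume "av y \<le> 1"
  thus "\<exists>M. level M {k \<in> rowset P. av (ratio k - y) \<le> (1 / real q) ^ m}" using ratio_level by blast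
qed

text \<open>The first row of k contains a unit. Rows with unit u, and the others after a column swap
  that changes d1 only in sign, are both governed by \<open>ratio_equidistributed\<close>.\<close>

lemma tail_Bl:
  "measure \<nu> {k \<in> K. av (d1 (act Q k Bl)) \<le> (1 / real q) ^ Suc m} = (1 / real q) ^ m"
  and tail_Bl_sets: "{k \<in> K. av (d1 (act Q k Bl)) \<le> (1 / real q) ^ Suc m} \<in> sets \<nu>"
proof -
  let ?s = "mat2 0 1 1 0 :: 'd mat"
  let ?A = "\<lambda>P m. {k \<in> rowset P. av (ratio k) \<le> (1 / real q) ^ m}"
  let ?T = "\<lambda>m. {k \<in> K. av (d1 (act Q k Bl)) \<le> (1 / real q) ^ Suc m}"
  have ratio_iff: "av (ratio k) \<le> (1 / real q) ^ m \<longleftrightarrow> av (d1 (act Q k Bl)) \<le> (1 / real q) ^ Suc m"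
    if kw: "k \<in> K" "w (k $$ (0, 0)) = 1" for k m
  proof -
    obtain u v s t where kk: "k = mat2 u v s t" using G_carrier[OF K_G[OF kw(1)]] by (rule mat2_cases)
    have "av (N u) = 1" using kw(2) by (simp add: kk w_def)
    thus ?thesis using q_pos by (simp add: kk d1_Bl ratio_def av_divide av_mult av_eta field_simps)
  qed
  have primitive: "w u = 1 \<or> w v = 1" if uvK: "mat2 u v s t \<in> K" for u v s t
  proof (rule ccontr)
    assume *: "\<not> ?thesis"
    obtain p r a b where i: "iv (mat2 u v s t) = mat2 p r a b" using G_carrier[OF K_G[OF K_iv[OF uvK]]] by (rule mat2_cases)
    have "mat2 u v s t * mat2 p r a b = 1\<^sub>m 2" using K_G[OF uvK] unfolding i[symmetric] by simp
    hence one: "u * p + v * a = 1" by (simp add: mat2_one)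
    have "w p \<le> 1" "w a \<le> 1" using K_entries[of p r a b] K_iv[OF uvK] by (simp_all add: i)
    moreover have "w u < 1" "w v < 1" using K_entries[OF uvK] * by auto
    ultimately have "w (u * p) < 1" "w (v * a) < 1"
      using mult_left_le[of "w p" "w u"] mult_left_le[of "w a" "w v"] by (auto simp: w_mult)
    hence "w (u * p + v * a) < 1" by (rule w_add_less)
    thus False by (simp add: one)
  qed
  have sw: "k * ?s * ?s = k" if "k \<in> K" for k
  proof -
    have "k * ?s * ?s = k * (?s * ?s)" using G_carrier[OF K_G[OF that]] by (intro mat_assoc) auto
    thus ?thesis using G_carrier[OF K_G[OF that]] by (simp add: mat2_one[symmetric])
  qed
  have d1s: "av (d1 (act Q (k * ?s) Bl)) = av (d1 (act Q k Bl))" if kK: "k \<in> K" for k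
  proof -
    obtain u v s t where kk: "k = mat2 u v s t" using G_carrier[OF K_G[OF kK]] by (rule mat2_cases)
    have "st (v * \<tau> * st u) = - (u * \<tau> * st v)" by (simp add: st_mult st_tau mult.assoc)
    hence "tr (v * \<tau> * st u) = - tr (u * \<tau> * st v)" using tr_st[of "v * \<tau> * st u"] by (simp add: tr_minus)
    thus ?thesis by (simp add: kk d1_Bl)
  qed
  have split: "?T m = ?A (\<lambda>_. True) m \<union> (\<lambda>k. k * ?s) ` ?A (\<lambda>b. b) m" for m
  proof (rule Set.set_eqI, rule iffI)
    fix k assume k: "k \<in> ?T m"
    hence kK: "k \<in> K" by simp
    obtain u v s t where kk: "k = mat2 u v s t" using G_carrier[OF K_G[OF kK]] by (rule mat2_cases)
    show "k \<in> ?A (\<lambda>_. True) m \<union> (\<lambda>k. k * ?s) ` ?A (\<lambda>b. b) m"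
    proof (cases "w u = 1")
      case True
      thus ?thesis using k ratio_iff[OF kK] by (simp add: rowset_def kk)
    next
      case False
      hence uv: "w u < 1" "w v = 1" using primitive K_entries kK by (auto simp: kk less_le)
      have ks: "k * ?s \<in> K" using kK swap_K by (rule K_mult)
      have "w ((k * ?s) $$ (0, 0)) = 1" "w ((k * ?s) $$ (0, 1)) < 1" using uv by (simp_all add: kk)
      hence "k * ?s \<in> ?A (\<lambda>b. b) m" using ks k ratio_iff[OF ks] d1s[OF kK] by (simp add: rowset_def)
      hence "k \<in> (\<lambda>k. k * ?s) ` ?A (\<lambda>b. b) m"
        by (rule image_eqI[of k "\<lambda>k. k * ?s" "k * ?s", OF sw[OF kK, symmetric]])
      thus ?thesis by (rule UnI2)
    qed
  next
    fix k assume "k \<in> ?A (\<lambda>_. True) m \<union> (\<lambda>k. k * ?s) ` ?A (\<lambda>b. b) m"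
    thus "k \<in> ?T m"
    proof
      assume "k \<in> ?A (\<lambda>_. True) m"
      thus ?thesis using ratio_iff by (auto simp: rowset_def)
    next
      assume "k \<in> (\<lambda>k. k * ?s) ` ?A (\<lambda>b. b) m"
      then obtain z where "z \<in> ?A (\<lambda>b. b) m" "k = z * ?s" by blast
      thus ?thesis using ratio_iff d1s K_mult[OF _ swap_K] by (auto simp: rowset_def)
    qed
  qed
  have lvl: "level (Suc m) (?A P m)" for P m using ratio_level[of 0 m P] by simp
  have lvs: "level (Suc m) ((\<lambda>k. k * ?s) ` ?A (\<lambda>b. b) m)" for m by (rule level_right[OF lvl swap_K])
  have disj: "?A (\<lambda>_. True) m \<inter> (\<lambda>k. k * ?s) ` ?A (\<lambda>b. b) m = {}" for m
  proof -
    have "w ((k * ?s) $$ (0, 0)) < 1" if "k \<in> rowset (\<lambda>b. b)" for k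
    proof -
      have "k \<in> carrier_mat 2 2" using that by (simp add: rowset_def K_G G_carrier)
      then obtain u v s t where "k = mat2 u v s t" by (rule mat2_cases)
      thus ?thesis using that by (simp add: rowset_def)
    qed
    thus ?thesis by (fastforce simp: rowset_def)
  qed
  show "?T m \<in> sets \<nu>" unfolding split using level_sets(1)[OF lvl] level_sets(1)[OF lvs] by (rule sets.Un)
  have T: "measure \<nu> (?T m) = (1 / real q) ^ m * (measure \<nu> (rowset (\<lambda>_. True)) + measure \<nu> (rowset (\<lambda>b. b)))" for m
  proof -
    have "measure \<nu> (?T m) = measure \<nu> (?A (\<lambda>_. True) m) + measure \<nu> ((\<lambda>k. k * ?s) ` ?A (\<lambda>b. b) m)"
      unfolding split using level_sets(1)[OF lvl] level_sets(1)[OF lvs] disj finite_nu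
      by (intro measure_Union) auto
    also have "measure \<nu> ((\<lambda>k. k * ?s) ` ?A (\<lambda>b. b) m) = measure \<nu> (?A (\<lambda>b. b) m)" by (rule nu_right[OF lvl swap_K])
    finally show ?thesis unfolding ratio_equidistributed by (simp add: distrib_left)
  qed
  \<comment> \<open>The bound 1/q holds on all of K, so m = 0 yields the total mass of the two row
    sets without computing either one.\<close>
  have "?T 0 = K" using d1_Bl_le by auto
  hence "measure \<nu> (rowset (\<lambda>_. True)) + measure \<nu> (rowset (\<lambda>b. b)) = 1"
    using T[of 0] nu_K by (simp add: measure_def)
  thus "measure \<nu> (?T m) = (1 / real q) ^ m" using T[of m] by simp
qed

lemma Lm_Bl:
  "Lm Bl (1 + int j) = (1 / real q) ^ j * (1 - 1 / real q)"
  and Lm_Bl_0: "m \<le> 0 \<Longrightarrow> Lm Bl m = 0"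
proof -
  let ?T = "\<lambda>m. {k \<in> K. av (d1 (act Q k Bl)) \<le> (1 / real q) ^ Suc m}"
  have pw: "real q powi (- (1 + int j)) = (1 / real q) ^ Suc j" for j
    by (simp add: power_int_minus power_int_def nat_add_distrib power_one_over divide_inverse)
  have pt: "av x = (1 / real q) ^ Suc j \<longleftrightarrow> av x \<le> (1 / real q) ^ Suc j \<and> \<not> av x \<le> (1 / real q) ^ Suc (Suc j)" for x
    unfolding av_less_pow_iff[of x "Suc j", symmetric] by linarith
  have eq: "lev Bl (1 + int j) = ?T j - ?T (Suc j)"
    unfolding lev_def pw pt by blast
  have sub: "?T (Suc j) \<subseteq> ?T j"
  proof -
    have "(1 / real q) ^ Suc (Suc j) \<le> (1 / real q) ^ Suc j" using q_gt_1 by (intro power_decreasing) auto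
    thus ?thesis by (auto simp del: power_Suc)
  qed
  have "Lm Bl (1 + int j) = measure \<nu> (?T j) - measure \<nu> (?T (Suc j))"
    unfolding Lm_def eq by (rule measure_Diff[OF finite_nu tail_Bl_sets tail_Bl_sets sub])
  thus "Lm Bl (1 + int j) = (1 / real q) ^ j * (1 - 1 / real q)"
    unfolding tail_Bl by (simp add: algebra_simps)
  assume m: "m \<le> 0"
  have "lev Bl m = {}"
  proof -
    have "av (d1 (act Q k Bl)) \<le> 1 / real q" if "k \<in> K" for k by (rule d1_Bl_le[OF that])
    moreover have "1 / real q < real q powi (- m)"
    proof -
      have "real q powi 0 \<le> real q powi (- m)" using m q_gt_1 by (intro power_int_increasing) auto
      moreover have "1 / real q < 1" using q_gt_1 by simp
      ultimately show ?thesis by simp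
    qed
    ultimately show ?thesis by (force simp: lev_def)
  qed
  thus "Lm Bl m = 0" by (simp add: Lm_def)
qed

section \<open>The integral \<omega> as a series in q^-z\<close>

definition D2 :: "'d mat \<Rightarrow> real" where "D2 x = av (dpf Q 2 x)"

lemma D2_hm: "D2 (hm a b c) = av (a * c - N b)"
  unfolding D2_def by (rule dpf_2(1)) (simp add: hm_def)

lemma dpf_HX:
  assumes "x \<in> HX"
  shows "dpf Q 2 x \<noteq> 0" "av (dpf Q 1 x) = av (d1 x)" "dpf Q 1 x = 0 \<longleftrightarrow> d1 x = 0" "D2 x > 0"
proof -
  obtain a b c where x: "x = hm a b c" using assms by (rule HX_cases)
  have d: "a * c - N b \<noteq> 0" using assms x hm_HX by simp
  show "dpf Q 2 x \<noteq> 0" using dpf_2(2)[of x a b c] d by (simp add: x hm_def)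
  have "x $$ (0, 0) = em a" by (simp add: x hm_def)
  from dpf_1[OF this] show "av (dpf Q 1 x) = av (d1 x)" "dpf Q 1 x = 0 \<longleftrightarrow> d1 x = 0" by (simp_all add: x)
  show "D2 x > 0" using d by (simp add: x D2_hm less_le)
qed

lemma one_hm: "1\<^sub>m 2 = hm 1 0 1"
  by (simp add: hm_def mat2_one)

lemma one_HX: "1\<^sub>m 2 \<in> HX"
  by (simp add: one_hm hm_HX)

text \<open>The determinant in a splitting is multiplicative and, on hermitian matrices, the square
  of a c - N b; hence the identity is obtained for squares. Acting on the identity matrix expresses
  the contribution of g as a \<open>D2\<close>.\<close>

lemma D2_act:
  assumes g: "g \<in> G" and x: "x \<in> HX"
  shows "D2 (act Q g x) = D2 (act Q g (1\<^sub>m 2)) * D2 x"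
proof -
  obtain \<rho> where \<rho>: "splitting Q \<rho>" using splitting_exists by blast
  let ?det = "\<lambda>A. Determinant.det (split_mat \<rho> A)"
  note c = G_carrier[OF g] X_carrier[OF x]
  obtain a b e where X: "x = hm a b e" using x by (rule HX_cases)
  obtain a' b' e' where X': "act Q g x = hm a' b' e'" using act_X[OF g x] by (rule HX_cases)
  obtain a'' b'' e'' where X'': "act Q g (1\<^sub>m 2) = hm a'' b'' e''" using act_X[OF g one_HX] by (rule HX_cases)
  have "?det (act Q g y) = ?det g * ?det y * ?det (ad g)" if "y \<in> carrier_mat 2 2" for y
    unfolding act_def using c that by (simp add: det_split_mat2_mult[OF \<rho>] del: mat_assoc)
  hence "?det (act Q g x) = ?det g * ?det x * ?det (ad g)" "?det (act Q g (1\<^sub>m 2)) = ?det g * ?det (1\<^sub>m 2) * ?det (ad g)"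
    using c by simp_all
  moreover have "?det (1\<^sub>m 2) = 1" unfolding one_hm hm_def det_split_hermitian[OF \<rho>] by simp
  ultimately have "?det (act Q g x) = ?det (act Q g (1\<^sub>m 2)) * ?det x" by simp
  hence "?det (hm a' b' e') = ?det (hm a'' b'' e'') * ?det (hm a b e)" by (simp only: X'[symmetric] X''[symmetric] X[symmetric])
  hence "(a' * e' - N b')\<^sup>2 = (a'' * e'' - N b'')\<^sup>2 * (a * e - N b)\<^sup>2"
    unfolding hm_def det_split_hermitian[OF \<rho>] to_ac_mult[symmetric] to_ac_eq_iff .
  hence "av ((a' * e' - N b')\<^sup>2) = av (((a'' * e'' - N b'') * (a * e - N b))\<^sup>2)" by (simp add: power_mult_distrib)
  moreover have "D2 (act Q g x) = av (a' * e' - N b')" "D2 (act Q g (1\<^sub>m 2)) = av (a'' * e'' - N b'')"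
    unfolding X' X'' by (rule D2_hm)+
  moreover have "D2 x = av (a * e - N b)" unfolding X by (rule D2_hm)
  ultimately have "(D2 (act Q g x))\<^sup>2 = (D2 (act Q g (1\<^sub>m 2)) * D2 x)\<^sup>2" by (simp only: av_power av_mult)
  moreover have "0 \<le> D2 (act Q g x)" "0 \<le> D2 (act Q g (1\<^sub>m 2)) * D2 x" by (simp_all add: D2_def)
  ultimately show ?thesis by (rule power2_eq_imp_eq)
qed

text \<open>The factors of h and of its inverse are at most 1 by integrality, and their product is
  1.\<close>

lemma D2_K:
  assumes h: "h \<in> K" and x: "x \<in> HX" shows "D2 (act Q h x) = D2 x"
proof -
  have le: "D2 (act Q k (1\<^sub>m 2)) \<le> 1" if k: "k \<in> K" for k
  proof -
    obtain a b c where X: "act Q k (1\<^sub>m 2) = hm a b c" using act_X[OF K_G[OF k] one_HX] by (rule HX_cases)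
    have "act Q k (1\<^sub>m 2) = k * ad k" using G_carrier[OF K_G[OF k]] by (simp add: act_def)
    hence "hm a b c \<in> K" using X k ad_K by (metis K_mult)
    hence "w (em a) \<le> 1" "w b \<le> 1" "w (em c) \<le> 1" using K_entries by (auto simp: hm_def)
    hence "av a * av a \<le> 1" "av (N b) \<le> 1" "av c * av c \<le> 1" by (simp_all add: w_em w_def[of b])
    moreover have "av y \<le> 1" if "av y * av y \<le> 1" for y using that by (metis less_1_mult not_le)
    ultimately have "av a \<le> 1" "av (N b) \<le> 1" "av c \<le> 1" by blast+
    hence "av (a * c - N b) \<le> 1" by (intro av_diff_le) (auto simp: av_mult mult_le_one)
    thus ?thesis by (simp add: X D2_hm)
  qed
  have "act Q h (act Q (iv h) (1\<^sub>m 2)) = 1\<^sub>m 2"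
    using act_act[of h "iv h" "1\<^sub>m 2"] h by (simp add: K_G G_carrier)
  hence "D2 (1\<^sub>m 2) = D2 (act Q h (1\<^sub>m 2)) * D2 (act Q (iv h) (1\<^sub>m 2))"
    using D2_act[OF K_G[OF h] act_X[OF K_G[OF K_iv[OF h]] one_HX]] by simp
  hence "1 = D2 (act Q h (1\<^sub>m 2)) * D2 (act Q (iv h) (1\<^sub>m 2))" by (simp add: one_hm D2_hm)
  also have "\<dots> \<le> D2 (act Q h (1\<^sub>m 2)) * 1" using le[OF K_iv[OF h]] by (intro mult_left_mono) (auto simp: D2_def)
  finally have "D2 (act Q h (1\<^sub>m 2)) = 1" using le[OF h] by simp
  thus ?thesis using D2_act[OF K_G[OF h] x] by simp
qed

lemma D2_TT: "x \<in> HX \<Longrightarrow> D2 (act Q TT x) = D2 x / (real q * real q)"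
  using D2_act[OF TT_G(1)] by (simp add: one_hm act_TT D2_hm av_mult av_eta)

lemma D2_gam: "x \<in> HX \<Longrightarrow> D2 (act Q (gam i) x) = D2 x / real q"
proof -
  have "D2 (act Q (gam i) (1\<^sub>m 2)) = 1 / real q"
    by (cases i) (simp_all add: one_hm act_gam_None act_gam_Some D2_hm av_eta N_mult algebra_simps)
  thus "x \<in> HX \<Longrightarrow> D2 (act Q (gam i) x) = D2 x / real q" using D2_act[OF gam_G] by simp
qed

text \<open>The part of \<omega> that varies over K: the size of d_2 is constant along K and leaves
  the integral.\<close>

definition Eo :: "'d mat \<Rightarrow> complex \<Rightarrow> complex" where
  "Eo x z = (\<integral>k. (if d1 (act Q k x) = 0 then 0 else complex_of_real (av (d1 (act Q k x))) powr z) \<partial>\<nu>)"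

lemma omega_Eo:
  assumes x: "x \<in> HX"
  shows "omega_int Q 2 \<nu> x s = complex_of_real (D2 x) powr s 2 * Eo x (s 1)"
proof -
  have "dpow Q 2 (act Q k x) s = complex_of_real (D2 x) powr s 2 *
      (if d1 (act Q k x) = 0 then 0 else complex_of_real (av (d1 (act Q k x))) powr s 1)" if k: "k \<in> K" for k
  proof -
    note d = dpf_HX[OF act_X[OF K_G[OF k] x]]
    have "{1..2::nat} = {1, 2}" by auto
    thus ?thesis using d D2_K[OF k x] by (simp add: dpow_def D2_def)
  qed
  hence "omega_int Q 2 \<nu> x s = (\<integral>k. complex_of_real (D2 x) powr s 2 *
      (if d1 (act Q k x) = 0 then 0 else complex_of_real (av (d1 (act Q k x))) powr s 1) \<partial>\<nu>)"
    unfolding omega_int_def by (intro Bochner_Integration.integral_cong) auto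
  thus ?thesis unfolding Eo_def by (simp only: integral_mult_right_zero)
qed

lemma lev_bounded:
  assumes x: "x \<in> HX"
  obtains m1 where "\<And>k. k \<in> K \<Longrightarrow> av (d1 (act Q k x)) \<le> real q powi (- m1)"
proof -
  obtain r where r: "r \<ge> 1" "bd r x" using bd_exists[OF X_carrier[OF x]] .
  obtain n where n: "r < real q ^ n" using real_arch_pow[OF q_gt_1] by blast
  have "av (d1 (act Q k x)) \<le> real q ^ n" if k: "k \<in> K" for k
  proof -
    note c = X_carrier[OF x] G_carrier[OF K_G[OF k]]
    have "bd r (act Q k x)"
      unfolding act_def using bd_K_mult(2)[OF ad_K[OF k], of "k * x" r] bd_K_mult(1)[OF k c(1), of r] r c by simp
    hence "w (act Q k x $$ (0, 0)) \<le> r" by (simp add: bd_def)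
    hence "av (d1 (act Q k x)) * av (d1 (act Q k x)) \<le> r"
      unfolding d1_HX[OF act_X[OF K_G[OF k] x]] by (simp add: w_em)
    moreover have "av y \<le> r" if "av y * av y \<le> r" for y
    proof (cases "av y \<le> 1")
      case False
      hence "av y * 1 \<le> av y * av y" by (intro mult_left_mono) auto
      thus ?thesis using that by simp
    qed (use r(1) in simp)
    ultimately have "av (d1 (act Q k x)) \<le> r" by blast
    thus ?thesis using n by simp
  qed
  thus thesis using that[of "- int n"] by simp
qed

lemma lev_empty:
  assumes "\<And>k. k \<in> K \<Longrightarrow> av (d1 (act Q k x)) \<le> real q powi (- m1)" "m < m1"
  shows "lev x m = {}"
proof -
  have "real q powi (- m1) < real q powi (- m)" using assms(2) q_gt_1 by (intro power_int_strict_increasing) auto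
  thus ?thesis using assms(1) by (force simp: lev_def)
qed

lemma lev_disjoint: "m \<noteq> m' \<Longrightarrow> lev x m \<inter> lev x m' = {}"
proof -
  have "real q powi (- m) \<noteq> real q powi (- m')" if "m < m'" for m m' :: int
    using power_int_strict_increasing[of "- m'" "- m" "real q"] that q_gt_1 by simp
  thus "m \<noteq> m' \<Longrightarrow> lev x m \<inter> lev x m' = {}" unfolding lev_def by (cases "m < m'") force+
qed

text \<open>K is sorted by the size of d1, and the sum converges because q^-z has norm at most 1 and
  the masses add up to at most 1. The starting index is free below a bound, so the series of
  finitely many matrices can be compared term by term.\<close>

lemma Eo_sums:
  assumes x: "x \<in> HX"
  obtains m1 where "\<And>m0 z. m0 \<le> m1 \<Longrightarrow> 0 \<le> Re z \<Longrightarrow>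
    (\<lambda>j. complex_of_real (Lm x (m0 + int j)) * (of_nat q powr (- z)) powi (m0 + int j)) sums Eo x z"
proof -
  obtain m1 where m1: "\<And>k. k \<in> K \<Longrightarrow> av (d1 (act Q k x)) \<le> real q powi (- m1)"
    by (rule lev_bounded[OF x]) blast
  have "(\<lambda>j. complex_of_real (Lm x (m0 + int j)) * (of_nat q powr (- z)) powi (m0 + int j)) sums Eo x z"
    if m0: "m0 \<le> m1" and z: "0 \<le> Re z" for m0 z
  proof -
    define \<xi> where "\<xi> = of_nat q powr (- z)"
    have xi0: "\<xi> \<noteq> 0" using q_pos by (simp add: \<xi>_def)
    have xi_le: "norm \<xi> \<le> 1"
    proof -
      have "norm \<xi> = real q powr (- Re z)" using norm_powr_real_powr[of "of_nat q" "- z"] by (simp add: \<xi>_def)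
      also have "\<dots> \<le> real q powr 0" using z q_gt_1 by (intro powr_mono) auto
      finally show ?thesis using q_pos by simp
    qed
    define f where "f j k = indicat_real (lev x (m0 + int j)) k *\<^sub>R \<xi> powi (m0 + int j)" for j k
    have meas: "lev x m \<in> sets \<nu>" for m using level_lev[OF x] level_sets(1) by metis
    have hb: "has_bochner_integral \<nu> (f j) (Lm x (m0 + int j) *\<^sub>R \<xi> powi (m0 + int j))" for j
      unfolding f_def Lm_def using meas finite_nu by (intro has_bochner_integral_indicator) (auto simp: less_top)
    have fsums: "(\<lambda>j. f j k) sums (if d1 (act Q k x) = 0 then 0 else complex_of_real (av (d1 (act Q k x))) powr z)"
      and fsumm: "summable (\<lambda>j. norm (f j k))" if k: "k \<in> K" for k
    proof -
      have "(\<lambda>j. f j k) sums (if d1 (act Q k x) = 0 then 0 else complex_of_real (av (d1 (act Q k x))) powr z) \<and>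
        summable (\<lambda>j. norm (f j k))"
      proof (cases "d1 (act Q k x) = 0")
        case True
        hence "f j k = 0" for j using q_pos by (auto simp: f_def lev_def)
        thus ?thesis using True by simp
      next
        case False
        then obtain m' where "av (d1 (act Q k x)) = real q powi m'" by (rule av_values)
        then obtain m where m: "av (d1 (act Q k x)) = real q powi (- m)" by (metis minus_minus)
        have kl: "k \<in> lev x m" using k m by (simp add: lev_def)
        hence "\<not> m < m1" using lev_empty[OF m1] by blast
        then obtain i where i: "m = m0 + int i" using m0 by (metis zle_iff_zadd not_less order_trans)
        have fj: "f j k = (if j = i then \<xi> powi m else 0)" for j
          using kl lev_disjoint[of "m0 + int j" m x] i by (auto simp: f_def indicator_def)
        have "\<xi> powi m = complex_of_real (av (d1 (act Q k x))) powr z" unfolding m \<xi>_def by (rule complex_powr_av[symmetric])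
        moreover have "(\<lambda>j. f j k) sums (\<xi> powi m)" unfolding fj by (rule sums_single)
        moreover have "summable (\<lambda>j. norm (f j k))"
          by (rule summable_finite[of "{i}"]) (auto simp: fj)
        ultimately show ?thesis using False by simp
      qed
      thus "(\<lambda>j. f j k) sums (if d1 (act Q k x) = 0 then 0 else complex_of_real (av (d1 (act Q k x))) powr z)"
        "summable (\<lambda>j. norm (f j k))" by blast+
    qed
    have normint: "(\<integral>k. norm (f j k) \<partial>\<nu>) = Lm x (m0 + int j) * norm (\<xi> powi (m0 + int j))" for j
    proof -
      have "(\<lambda>k. norm (f j k)) = (\<lambda>k. indicat_real (lev x (m0 + int j)) k *\<^sub>R norm (\<xi> powi (m0 + int j)))"
        by (auto simp: f_def)
      moreover have "has_bochner_integral \<nu> (\<lambda>k. indicat_real (lev x (m0 + int j)) k *\<^sub>R norm (\<xi> powi (m0 + int j)))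
          (Lm x (m0 + int j) *\<^sub>R norm (\<xi> powi (m0 + int j)))"
        unfolding Lm_def using meas finite_nu by (intro has_bochner_integral_indicator) (auto simp: less_top)
      ultimately show ?thesis by (simp only: has_bochner_integral_integral_eq real_scaleR_def)
    qed
    have Lsum: "summable (\<lambda>j. Lm x (m0 + int j))"
    proof (rule summableI_nonneg_bounded[of _ 1])
      fix J
      have "(\<Sum>j<J. Lm x (m0 + int j)) = measure \<nu> (\<Union>j<J. lev x (m0 + int j))"
        unfolding Lm_def
      proof (rule measure_finite_Union[symmetric])
        show "disjoint_family_on (\<lambda>j. lev x (m0 + int j)) {..<J}"
          unfolding disjoint_family_on_def using lev_disjoint by auto
      qed (use meas finite_nu in auto)
      also have "\<dots> \<le> measure \<nu> (space \<nu>)"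
        by (rule finite_measure.bounded_measure[OF finite_measureI[OF finite_nu]])
      also have "\<dots> = 1" using prob_nu by (simp add: measure_def)
      finally show "(\<Sum>j<J. Lm x (m0 + int j)) \<le> 1" .
    qed (simp add: Lm_def)
    have "summable (\<lambda>j. norm (\<xi> powi m0) * Lm x (m0 + int j))" by (rule summable_mult[OF Lsum])
    hence "summable (\<lambda>j. \<integral>k. norm (f j k) \<partial>\<nu>)"
    proof (rule summable_comparison_test'[where N = 0])
      fix j
      have "norm (\<xi> powi (m0 + int j)) = norm (\<xi> powi m0) * norm \<xi> ^ j"
        using xi0 by (simp add: power_int_add norm_mult norm_power)
      also have "\<dots> \<le> norm (\<xi> powi m0) * 1" using xi_le by (intro mult_left_mono power_le_one) auto
      finally have "Lm x (m0 + int j) * norm (\<xi> powi (m0 + int j)) \<le> Lm x (m0 + int j) * norm (\<xi> powi m0)"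
        by (intro mult_left_mono) (auto simp: Lm_def)
      thus "norm (\<integral>k. norm (f j k) \<partial>\<nu>) \<le> norm (\<xi> powi m0) * Lm x (m0 + int j)"
        unfolding normint by (simp add: Lm_def mult.commute)
    qed
    hence "(\<lambda>j. \<integral>k. f j k \<partial>\<nu>) sums (\<integral>k. (\<Sum>j. f j k) \<partial>\<nu>)"
      using hb fsumm by (intro sums_integral) (auto simp: has_bochner_integral_iff)
    moreover have "(\<integral>k. (\<Sum>j. f j k) \<partial>\<nu>) = Eo x z"
      unfolding Eo_def using fsums by (intro Bochner_Integration.integral_cong) (auto simp: sums_iff)
    moreover have "(\<integral>k. f j k \<partial>\<nu>) = complex_of_real (Lm x (m0 + int j)) * \<xi> powi (m0 + int j)" for j
      using hb[of j] by (simp add: has_bochner_integral_integral_eq scaleR_conv_of_real)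
    ultimately show ?thesis by (simp add: \<xi>_def)
  qed
  thus thesis using that by blast
qed

lemma Eo_K:
  assumes "x \<in> HX" "h \<in> K" "0 \<le> Re z" shows "Eo (act Q h x) z = Eo x z"
proof -
  obtain m1 where m1: "\<And>m0 z. m0 \<le> m1 \<Longrightarrow> 0 \<le> Re z \<Longrightarrow>
    (\<lambda>j. complex_of_real (Lm x (m0 + int j)) * (of_nat q powr (- z)) powi (m0 + int j)) sums Eo x z"
    by (rule Eo_sums[OF assms(1)]) blast
  obtain m2 where m2: "\<And>m0 z. m0 \<le> m2 \<Longrightarrow> 0 \<le> Re z \<Longrightarrow>
    (\<lambda>j. complex_of_real (Lm (act Q h x) (m0 + int j)) * (of_nat q powr (- z)) powi (m0 + int j)) sums Eo (act Q h x) z"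
    by (rule Eo_sums[OF act_X[OF K_G[OF assms(2)] assms(1)]]) blast
  show ?thesis
    using m1[of "min m1 m2" z] m2[of "min m1 m2" z] assms(3) unfolding Lm_K[OF assms(1,2)] by (auto intro: sums_unique2)
qed

lemma Eo_TT:
  assumes "x \<in> HX" "0 \<le> Re z" shows "Eo (act Q TT x) z = of_nat q powr (- z) * Eo x z"
proof -
  let ?X = "of_nat q powr (- z) :: complex"
  have X0: "?X \<noteq> 0" using q_pos by simp
  obtain m1 where m1: "\<And>m0 z. m0 \<le> m1 \<Longrightarrow> 0 \<le> Re z \<Longrightarrow>
    (\<lambda>j. complex_of_real (Lm x (m0 + int j)) * (of_nat q powr (- z)) powi (m0 + int j)) sums Eo x z"
    by (rule Eo_sums[OF assms(1)]) blast
  obtain m2 where m2: "\<And>m0 z. m0 \<le> m2 \<Longrightarrow> 0 \<le> Re z \<Longrightarrow>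
    (\<lambda>j. complex_of_real (Lm (act Q TT x) (m0 + int j)) * (of_nat q powr (- z)) powi (m0 + int j)) sums Eo (act Q TT x) z"
    by (rule Eo_sums[OF act_X[OF TT_G(1) assms(1)]]) blast
  define m0 where "m0 = min m1 m2"
  have "(\<lambda>j. ?X * (complex_of_real (Lm x ((m0 - 1) + int j)) * ?X powi ((m0 - 1) + int j))) sums (?X * Eo x z)"
    using m1[of "m0 - 1" z] assms(2) by (intro sums_mult) (auto simp: m0_def)
  moreover have "?X * (complex_of_real (Lm x ((m0 - 1) + int j)) * ?X powi ((m0 - 1) + int j)) =
      complex_of_real (Lm (act Q TT x) (m0 + int j)) * ?X powi (m0 + int j)" for j
    using power_int_add_1'[of ?X "(m0 - 1) + int j"] X0 Lm_TT[OF assms(1), of "m0 + int j"]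
    by (simp add: algebra_simps)
  ultimately have "(\<lambda>j. complex_of_real (Lm (act Q TT x) (m0 + int j)) * ?X powi (m0 + int j)) sums (?X * Eo x z)" by simp
  thus ?thesis using m2[of m0 z] assms(2) by (auto simp: m0_def intro: sums_unique2)
qed

text \<open>\<open>Lm_hecke\<close> applied to each coefficient; the shift from m to m - 1 becomes a
  factor q^-z.\<close>

lemma Eo_hecke:
  assumes x: "x \<in> HX" and z: "0 \<le> Re z"
  shows "(\<Sum>i\<in>II. Eo (act Q (gam i) x) z) = (of_nat (card reps) + of_nat q powr (- z)) * Eo x z"
proof -
  let ?X = "of_nat q powr (- z) :: complex"
  have X0: "?X \<noteq> 0" using q_pos by simp
  obtain m1 where m1: "\<And>m0 z. m0 \<le> m1 \<Longrightarrow> 0 \<le> Re z \<Longrightarrow>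
    (\<lambda>j. complex_of_real (Lm x (m0 + int j)) * (of_nat q powr (- z)) powi (m0 + int j)) sums Eo x z"
    by (rule Eo_sums[OF x]) blast
  have "\<exists>m1. \<forall>m0 z. m0 \<le> m1 \<longrightarrow> 0 \<le> Re z \<longrightarrow>
    (\<lambda>j. complex_of_real (Lm (act Q (gam i) x) (m0 + int j)) * (of_nat q powr (- z)) powi (m0 + int j)) sums Eo (act Q (gam i) x) z" for i
    by (rule Eo_sums[OF act_X[OF gam_G[of i] x]]) blast
  then obtain f where f: "\<And>i m0 z. m0 \<le> f i \<Longrightarrow> 0 \<le> Re z \<Longrightarrow>
    (\<lambda>j. complex_of_real (Lm (act Q (gam i) x) (m0 + int j)) * (of_nat q powr (- z)) powi (m0 + int j)) sums Eo (act Q (gam i) x) z"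
    by metis
  define m0 where "m0 = Min (insert m1 (f ` II))"
  have m0: "m0 \<le> m1" "\<And>i. i \<in> II \<Longrightarrow> m0 \<le> f i" using finite_II by (auto simp: m0_def)
  have "(\<lambda>j. \<Sum>i\<in>II. complex_of_real (Lm (act Q (gam i) x) (m0 + int j)) * ?X powi (m0 + int j)) sums (\<Sum>i\<in>II. Eo (act Q (gam i) x) z)"
    using f m0 z by (intro sums_sum) auto
  moreover have "(\<Sum>i\<in>II. complex_of_real (Lm (act Q (gam i) x) (m0 + int j)) * ?X powi (m0 + int j)) =
      of_nat (card reps) * (complex_of_real (Lm x (m0 + int j)) * ?X powi (m0 + int j)) +
      ?X * (complex_of_real (Lm x ((m0 - 1) + int j)) * ?X powi ((m0 - 1) + int j))" for j
  proof -
    have "(\<Sum>i\<in>II. complex_of_real (Lm (act Q (gam i) x) (m0 + int j)) * ?X powi (m0 + int j)) =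
      complex_of_real (\<Sum>i\<in>II. Lm (act Q (gam i) x) (m0 + int j)) * ?X powi (m0 + int j)"
      by (simp add: sum_distrib_right)
    also have "\<dots> = complex_of_real (real (card reps) * Lm x (m0 + int j) + Lm x ((m0 - 1) + int j)) * (?X * ?X powi ((m0 - 1) + int j))"
      unfolding Lm_hecke[OF x] using power_int_add_1'[of ?X "(m0 - 1) + int j"] X0 by (simp add: algebra_simps)
    also have "?X * ?X powi ((m0 - 1) + int j) = ?X powi (m0 + int j)"
      using power_int_add_1'[of ?X "(m0 - 1) + int j"] X0 by (simp add: algebra_simps)
    finally show ?thesis
      using power_int_add_1'[of ?X "(m0 - 1) + int j"] X0 by (simp add: algebra_simps)
  qed
  ultimately have s1: "(\<lambda>j. of_nat (card reps) * (complex_of_real (Lm x (m0 + int j)) * ?X powi (m0 + int j)) +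
      ?X * (complex_of_real (Lm x ((m0 - 1) + int j)) * ?X powi ((m0 - 1) + int j))) sums (\<Sum>i\<in>II. Eo (act Q (gam i) x) z)" by simp
  have "(\<lambda>j. of_nat (card reps) * (complex_of_real (Lm x (m0 + int j)) * ?X powi (m0 + int j)) +
      ?X * (complex_of_real (Lm x ((m0 - 1) + int j)) * ?X powi ((m0 - 1) + int j))) sums (of_nat (card reps) * Eo x z + ?X * Eo x z)"
    using m1[of m0 z] m1[of "m0 - 1" z] m0 z by (intro sums_add sums_mult) auto
  from sums_unique2[OF s1 this] show ?thesis by (simp add: distrib_right)
qed

text \<open>By \<open>Lm_Bl\<close> the series is geometric with ratio q^-z / q. Its denominator is
  multiplied out, ready to serve as B in \<open>omega_rational\<close>.\<close>

lemma Eo_Bl: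
  assumes z: "0 \<le> Re z"
  shows "(1 - of_nat q powr (- z) / of_nat q) * Eo Bl z = of_nat q powr (- z) * (1 - 1 / of_nat q)"
proof -
  let ?X = "of_nat q powr (- z) :: complex"
  have X0: "?X \<noteq> 0" using q_pos by simp
  have "norm ?X = real q powr (- Re z)" using norm_powr_real_powr[of "of_nat q" "- z"] by simp
  also have "\<dots> \<le> real q powr 0" using z q_gt_1 by (intro powr_mono) auto
  finally have Xle: "norm ?X \<le> 1" using q_pos by simp
  obtain m1 where m1: "\<And>m0 z. m0 \<le> m1 \<Longrightarrow> 0 \<le> Re z \<Longrightarrow>
    (\<lambda>j. complex_of_real (Lm Bl (m0 + int j)) * (of_nat q powr (- z)) powi (m0 + int j)) sums Eo Bl z"
    by (rule Eo_sums[OF Bl_HX]) blast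
  \<comment> \<open>Levels below 1 carry no mass, so the series may be restarted at level 1 by
    dropping d zero terms.\<close>
  define m0 where "m0 = min m1 1"
  define d where "d = nat (1 - m0)"
  have d: "m0 + int d = 1" by (simp add: d_def m0_def)
  let ?f = "\<lambda>j. complex_of_real (Lm Bl (m0 + int j)) * ?X powi (m0 + int j)"
  have "?f sums Eo Bl z" using m1[of m0 z] z by (simp add: m0_def)
  moreover have "?f i = 0" if "i < d" for i using that d Lm_Bl_0[of "m0 + int i"] by simp
  ultimately have "(\<lambda>i. ?f (i + d)) sums Eo Bl z" by (subst sums_zero_iff_shift) auto
  moreover have "?f (i + d) = ?X * (1 - 1 / of_nat q) * (?X / of_nat q) ^ i" for i
  proof -
    have e: "m0 + int (i + d) = 1 + int i" using d by simp
    have "?X powi (1 + int i) = ?X * ?X ^ i" using X0 by (simp add: power_int_add)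
    thus ?thesis unfolding e Lm_Bl by (simp add: power_divide field_simps)
  qed
  ultimately have 1: "(\<lambda>i. ?X * (1 - 1 / of_nat q) * (?X / of_nat q) ^ i) sums Eo Bl z" by simp
  have "norm (?X / of_nat q) < 1"
    using Xle q_gt_1 by (simp add: norm_divide divide_less_eq del: norm_powr_real_powr)
  hence lt: "norm (?X / of_nat q) < 1" .
  have "(\<lambda>i. ?X * (1 - 1 / of_nat q) * (?X / of_nat q) ^ i) sums (?X * (1 - 1 / of_nat q) * (1 / (1 - ?X / of_nat q)))"
    by (intro sums_mult geometric_sums lt)
  from sums_unique2[OF 1 this] have "Eo Bl z = ?X * (1 - 1 / of_nat q) * (1 / (1 - ?X / of_nat q))" .
  moreover have "1 - ?X / of_nat q \<noteq> 0" using lt by auto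
  ultimately show ?thesis by simp
qed

lemma D2_powr_divide:
  assumes "x \<in> HX"
  shows "complex_of_real (D2 x / real q) powr z = of_nat q powr (- z) * complex_of_real (D2 x) powr z"
proof -
  have "dpf Q 2 x \<noteq> 0" using dpf_HX[OF assms] by simp
  then obtain m where m: "D2 x = real q powi m" unfolding D2_def by (rule av_values)
  have q0: "(of_nat q powr (- z) :: complex) \<noteq> 0" using q_pos by simp
  have "D2 x / real q = real q powi (- (- m + 1))" using q_nz by (simp add: m power_int_diff)
  hence "complex_of_real (D2 x / real q) powr z = (of_nat q powr (- z)) powi (- m + 1)"
    using complex_powr_av[of "- m + 1" z] by simp
  also have "\<dots> = of_nat q powr (- z) * (of_nat q powr (- z)) powi (- m)"
    by (rule power_int_add_1'[OF disjI1[OF q0]])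
  also have "(of_nat q powr (- z)) powi (- m) = complex_of_real (D2 x) powr z"
    using complex_powr_av[of "- m" z] by (simp add: m)
  finally show ?thesis .
qed

text \<open>Each \<open>gam i\<close> scales the size of d_2 by 1/q, contributing q^-s2, and TT
  scales it by 1/q^2, contributing the square; the other factors are those of
  \<open>Eo\<close>.\<close>

lemma omega_eigen:
  assumes s: "0 \<le> Re (s 1)"
  shows "eigen (\<lambda>x. omega_int Q 2 \<nu> x s) (of_nat q powr (- s 1) * (of_nat q powr (- s 2))\<^sup>2)
    (of_nat q powr (- s 2) * (of_nat (card reps) + of_nat q powr (- s 1)))"
  unfolding eigen_def
proof (intro conjI ballI)
  show "K_invariant (\<lambda>x. omega_int Q 2 \<nu> x s)"
    unfolding K_invariant_def using omega_Eo Eo_K[OF _ _ s] D2_K K_G act_X by simp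
next
  fix x assume x: "x \<in> HX"
  let ?y = "act Q (gam None) (act Q (gam None) x)"
  have y1: "act Q (gam None) x \<in> HX" by (rule act_X[OF gam_G x])
  have "D2 (act Q TT x) = D2 (act Q (gam None) x) / real q" using D2_TT[OF x] D2_gam[OF x] by simp
  hence "complex_of_real (D2 (act Q TT x)) powr s 2 = (of_nat q powr (- s 2))\<^sup>2 * complex_of_real (D2 x) powr s 2"
    using D2_powr_divide[OF y1, of "s 2"] D2_powr_divide[OF x, of "s 2"] D2_gam[OF x, of None] by (simp add: power2_eq_square)
  thus "omega_int Q 2 \<nu> (act Q TT x) s = of_nat q powr (- s 1) * (of_nat q powr (- s 2))\<^sup>2 * omega_int Q 2 \<nu> x s"
    using omega_Eo[OF act_X[OF TT_G(1) x]] omega_Eo[OF x] Eo_TT[OF x s] by simp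
next
  fix x assume x: "x \<in> HX"
  have "omega_int Q 2 \<nu> (act Q (gam i) x) s = of_nat q powr (- s 2) * complex_of_real (D2 x) powr s 2 * Eo (act Q (gam i) x) (s 1)" for i
    unfolding omega_Eo[OF act_X[OF gam_G x]] D2_gam[OF x] D2_powr_divide[OF x] ..
  hence "(\<Sum>i\<in>II. omega_int Q 2 \<nu> (act Q (gam i) x) s) =
      of_nat q powr (- s 2) * complex_of_real (D2 x) powr s 2 * (\<Sum>i\<in>II. Eo (act Q (gam i) x) (s 1))"
    by (simp add: sum_distrib_left)
  thus "(\<Sum>i\<in>II. omega_int Q 2 \<nu> (act Q (gam i) x) s) =
      of_nat q powr (- s 2) * (of_nat (card reps) + of_nat q powr (- s 1)) * omega_int Q 2 \<nu> x s"
    unfolding Eo_hecke[OF x s] omega_Eo[OF x] by simp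
qed

lemma omega_Bl:
  assumes s: "0 \<le> Re (s 1)"
  shows "(1 - of_nat q powr (- s 1) / of_nat q) * omega_int Q 2 \<nu> Bl s =
    of_nat q powr (- s 2) * of_nat q powr (- s 1) * (1 - 1 / of_nat q)"
proof -
  have "D2 Bl = 1 / real q" by (simp add: Bl_def D2_hm av_eta)
  hence "complex_of_real (D2 Bl) powr s 2 = of_nat q powr (- s 2)"
    using complex_powr_av[of 1 "s 2"] by (simp add: power_int_minus inverse_eq_divide)
  thus ?thesis unfolding omega_Eo[OF Bl_HX] using Eo_Bl[OF s] by (simp add: mult_ac)
qed

end

lemma powr_surj:
  assumes "c \<noteq> 0" "(q :: nat) > 1" obtains z :: complex where "of_nat q powr z = c"
proof -
  have "Ln (of_nat q) \<noteq> 0" using assms(2) Ln_of_real[of "real q"] by simp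
  hence "of_nat q powr (Ln c / Ln (of_nat q)) = c" using assms by (simp add: powr_def)
  thus thesis by (rule that)
qed

section \<open>Laurent polynomials and \<open>\<Psi>\<close>\<close>

context
  fixes q n :: nat
  assumes q: "q > 0"
begin

lemma laurent_const: "laurent_fun q n (\<lambda>w. c)"
  unfolding laurent_fun_def by (intro exI[of _ "{\<lambda>_. 0}"] exI[of _ "\<lambda>_. c"]) simp

lemma laurent_var:
  assumes "i \<in> {1..n}"
  shows "laurent_fun q n (\<lambda>w. of_nat q powr w i)" "laurent_fun q n (\<lambda>w. of_nat q powr (- w i))"
proof -
  have *: "laurent_fun q n (\<lambda>w. (of_nat q powr w i) powi k)" for k
  proof -
    have "(\<Prod>j = 1..n. (of_nat q powr w j) powi (if j = i then k else 0)) = (of_nat q powr w i :: complex) powi k" for w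
    proof -
      have "(\<Prod>j = 1..n. (of_nat q powr w j) powi (if j = i then k else 0)) =
        (\<Prod>j = 1..n. if j = i then (of_nat q powr w j :: complex) powi k else 1)" by (intro prod.cong) auto
      thus ?thesis using assms by simp
    qed
    thus ?thesis unfolding laurent_fun_def
      by (intro exI[of _ "{\<lambda>j. if j = i then k else 0}"] exI[of _ "\<lambda>_. 1"]) simp
  qed
  show "laurent_fun q n (\<lambda>w. of_nat q powr w i)" using *[of 1] by simp
  show "laurent_fun q n (\<lambda>w. of_nat q powr (- w i))" using *[of "-1"] by (simp add: powr_minus power_int_minus)
qed

lemma laurent_add:
  assumes "laurent_fun q n f" "laurent_fun q n g" shows "laurent_fun q n (\<lambda>w. f w + g w)"
proof -
  let ?m = "\<lambda>w a. \<Prod>i = 1..n. (of_nat q powr w i :: complex) powi a i"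
  obtain F c where F: "finite F" "\<And>w. f w = (\<Sum>a\<in>F. c a * ?m w a)" using assms(1) unfolding laurent_fun_def by blast
  obtain G d where G: "finite G" "\<And>w. g w = (\<Sum>a\<in>G. d a * ?m w a)" using assms(2) unfolding laurent_fun_def by blast
  have "f w + g w = (\<Sum>a\<in>F \<union> G. ((if a \<in> F then c a else 0) + (if a \<in> G then d a else 0)) * ?m w a)" for w
  proof -
    have "f w = (\<Sum>a\<in>F \<union> G. (if a \<in> F then c a else 0) * ?m w a)"
      unfolding F(2) using F(1) G(1) by (intro sum.mono_neutral_cong_left) auto
    moreover have "g w = (\<Sum>a\<in>F \<union> G. (if a \<in> G then d a else 0) * ?m w a)"
      unfolding G(2) using F(1) G(1) by (intro sum.mono_neutral_cong_left) auto
    ultimately show ?thesis by (simp add: sum.distrib distrib_right)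
  qed
  thus ?thesis unfolding laurent_fun_def using F(1) G(1)
    by (intro exI[of _ "F \<union> G"] exI[of _ "\<lambda>a. (if a \<in> F then c a else 0) + (if a \<in> G then d a else 0)"]) simp
qed

lemma laurent_sum:
  "finite S \<Longrightarrow> (\<And>a. a \<in> S \<Longrightarrow> laurent_fun q n (f a)) \<Longrightarrow> laurent_fun q n (\<lambda>w. \<Sum>a\<in>S. f a w)"
  by (induction S rule: finite_induct) (auto intro: laurent_const laurent_add)

lemma laurent_mult:
  assumes "laurent_fun q n f" "laurent_fun q n g" shows "laurent_fun q n (\<lambda>w. f w * g w)"
proof -
  let ?m = "\<lambda>w a. \<Prod>i = 1..n. (of_nat q powr w i :: complex) powi a i"
  obtain F c where F: "finite F" "\<And>w. f w = (\<Sum>a\<in>F. c a * ?m w a)" using assms(1) unfolding laurent_fun_def by blast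
  obtain G d where G: "finite G" "\<And>w. g w = (\<Sum>a\<in>G. d a * ?m w a)" using assms(2) unfolding laurent_fun_def by blast
  have m: "?m w a * ?m w b = ?m w (\<lambda>i. a i + b i)" for w a b
    using q by (simp add: prod.distrib[symmetric] power_int_add)
  have single: "laurent_fun q n (\<lambda>w. r * ?m w a)" for r a
    unfolding laurent_fun_def by (intro exI[of _ "{a}"] exI[of _ "\<lambda>_. r"]) simp
  have "f w * g w = (\<Sum>a\<in>F. \<Sum>b\<in>G. (c a * d b) * ?m w (\<lambda>i. a i + b i))" for w
    unfolding F(2) G(2) sum_product m[symmetric] by (simp add: mult_ac)
  moreover have "laurent_fun q n (\<lambda>w. \<Sum>a\<in>F. \<Sum>b\<in>G. (c a * d b) * ?m w (\<lambda>i. a i + b i))"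
    by (intro laurent_sum F(1) G(1) single)
  ultimately show ?thesis by simp
qed

lemma laurent_diff: "laurent_fun q n f \<Longrightarrow> laurent_fun q n g \<Longrightarrow> laurent_fun q n (\<lambda>w. f w - g w)"
  using laurent_add[of f "\<lambda>w. (-1) * g w"] laurent_mult[OF laurent_const, of g "-1"] by simp

lemma laurent_prod:
  "finite S \<Longrightarrow> (\<And>a. a \<in> S \<Longrightarrow> laurent_fun q n (f a)) \<Longrightarrow> laurent_fun q n (\<lambda>w. \<Prod>a\<in>S. f a w)"
  by (induction S rule: finite_induct) (auto intro: laurent_const laurent_mult)

lemma laurent_power: "laurent_fun q n f \<Longrightarrow> laurent_fun q n (\<lambda>w. f w ^ k)"
  by (induction k) (auto intro: laurent_const laurent_mult)

lemma laurent_power_int: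
  assumes "laurent_fun q n f" "laurent_fun q n (\<lambda>w. inverse (f w))"
  shows "laurent_fun q n (\<lambda>w. f w powi k)"
  using laurent_power[OF assms(1)] laurent_power[OF assms(2)] by (cases "k \<ge> 0") (simp_all add: power_int_def)

text \<open>Restriction to a complex line reduces continuation in several variables to one
  variable.\<close>

lemma laurent_line:
  assumes "laurent_fun q n f"
  shows "(\<lambda>t. f (\<lambda>i. x i + t * (y i - x i))) holomorphic_on UNIV"
proof -
  obtain F c where F: "finite F" "\<And>w. f w = (\<Sum>a\<in>F. c a * (\<Prod>i = 1..n. (of_nat q powr w i :: complex) powi a i))"
    using assms unfolding laurent_fun_def by blast
  show ?thesis unfolding F(2) using q by (intro holomorphic_intros) auto
qed

lemma laurent_s_of_z:
  assumes "laurent_fun q n f" "n \<ge> 1" shows "laurent_fun q n (\<lambda>z. f (s_of_z n z))"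
proof -
  obtain F c where F: "finite F" "\<And>w. f w = (\<Sum>a\<in>F. c a * (\<Prod>i = 1..n. (of_nat q powr w i :: complex) powi a i))"
    using assms unfolding laurent_fun_def by blast
  have var: "laurent_fun q n (\<lambda>z. (of_nat q powr s_of_z n z i) powi k)" if i: "i \<in> {1..n}" for i k
  proof -
    have q0: "(of_nat q :: complex) \<noteq> 0" using q by simp
    have "laurent_fun q n (\<lambda>z. of_nat q powr s_of_z n z i) \<and> laurent_fun q n (\<lambda>z. inverse (of_nat q powr s_of_z n z i))"
    proof (cases "i = n")
      case True
      have 1: "of_nat q powr s_of_z n z i = of_nat q powr (- z n) * of_nat q powr (of_nat n - 1 :: complex)" for z
        using q0 True by (simp add: s_of_z_def powr_add[symmetric] algebra_simps)
      have 2: "inverse (of_nat q powr s_of_z n z i) = of_nat q powr (z n) * of_nat q powr (1 - of_nat n :: complex)" for z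
        unfolding powr_minus[symmetric] using q0 True by (simp add: s_of_z_def powr_add[symmetric] algebra_simps)
      have "n \<in> {1..n}" using assms(2) by simp
      thus ?thesis unfolding 2 unfolding 1 by (intro conjI laurent_mult laurent_var laurent_const)
    next
      case False
      have 1: "of_nat q powr s_of_z n z i = of_nat q powr (- z i) * of_nat q powr (z (i + 1)) * of_nat q powr (- 2 :: complex)" for z
        using q0 False by (simp add: s_of_z_def powr_add[symmetric] algebra_simps)
      have 2: "inverse (of_nat q powr s_of_z n z i) = of_nat q powr (z i) * of_nat q powr (- z (i + 1)) * of_nat q powr (2 :: complex)" for z
        unfolding powr_minus[symmetric] powr_add[symmetric] using False by (simp add: s_of_z_def algebra_simps)
      have "i \<in> {1..n}" "i + 1 \<in> {1..n}" using i False by auto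
      thus ?thesis unfolding 2 unfolding 1 by (intro conjI laurent_mult laurent_var laurent_const)
    qed
    thus ?thesis using laurent_power_int by blast
  qed
  show ?thesis unfolding F(2) by (intro laurent_sum laurent_mult laurent_const laurent_prod F(1) var) auto
qed

text \<open>On the line from z to a point inside the domain of convergence, f vanishes on an open
  set around that point and therefore along the whole line.\<close>

lemma laurent_vanish:
  assumes f: "laurent_fun q n f"
    and zero: "\<And>z. (\<And>i. 1 \<le> i \<Longrightarrow> i < n \<Longrightarrow> Re (s_of_z n z i) \<ge> 0) \<Longrightarrow> f z = 0"
  shows "f z = 0"
proof -
  \<comment> \<open>At the point with coordinates 3 i every s_i with i < n equals 1, so t = 1 is
    interior to the domain.\<close>
  let ?l = "\<lambda>t i. z i + t * (3 * of_nat i - z i)"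
  define U where "U = (\<Inter>i\<in>{1..<n}. {t. Re (s_of_z n (?l t) i) > 0})"
  have cont: "continuous_on UNIV (\<lambda>t. Re (s_of_z n (?l t) i))" for i
  proof (cases "i = n")
    case True
    show ?thesis unfolding s_of_z_def True by (simp only: simp_thms if_True) (intro continuous_intros)
  next
    case False
    show ?thesis unfolding s_of_z_def by (simp only: False simp_thms if_False) (intro continuous_intros)
  qed
  have "open U" unfolding U_def by (intro open_INT ballI open_Collect_less continuous_on_const cont) simp
  moreover have "1 \<in> U" by (auto simp: U_def s_of_z_def)
  ultimately have lim: "1 islimpt U" by (intro interior_limit_point) (simp only: interior_open)
  have "(\<lambda>t. f (?l t)) 0 = 0"
    by (rule analytic_continuation[OF laurent_line[OF f] open_UNIV connected_UNIV subset_UNIV UNIV_I lim])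
      (auto simp: U_def intro!: zero less_imp_le)
  thus ?thesis by simp
qed

text \<open>On the line from z to y, f is nonzero on an open set around z, so g vanishes there and,
  by continuation, at y.\<close>

lemma laurent_integral_domain:
  assumes f: "laurent_fun q n f" and g: "laurent_fun q n g" and fg: "\<And>z. f z * g z = 0" and y: "g y \<noteq> 0"
  shows "f z = 0"
proof (rule ccontr)
  assume nz: "f z \<noteq> 0"
  let ?l = "\<lambda>t i. z i + t * (y i - z i)"
  let ?U = "{t. f (?l t) \<noteq> 0}"
  have "open ?U"
    by (intro open_Collect_neq holomorphic_on_imp_continuous_on[OF laurent_line[OF f]] continuous_intros)
  moreover have "0 \<in> ?U" using nz by simp
  ultimately have lim: "0 islimpt ?U" by (intro interior_limit_point) (simp only: interior_open)
  have "(\<lambda>t. g (?l t)) 1 = 0"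
    by (rule analytic_continuation[OF laurent_line[OF g] open_UNIV connected_UNIV subset_UNIV UNIV_I lim])
      (use fg in auto)
  thus False using y by simp
qed

end

lemma s_of_z_surj:
  assumes "n \<ge> 1" obtains z where "\<And>i. i \<in> {1..n} \<Longrightarrow> s_of_z n z i = s i"
proof -
  define z where "z i = of_nat n - 1 - s n - (\<Sum>j = i..<n. s j + 2)" for i
  have "s_of_z n z i = s i" if i: "i \<in> {1..n}" for i
  proof (cases "i = n")
    case False
    hence "(\<Sum>j = i..<n. s j + 2) = (s i + 2) + (\<Sum>j = Suc i..<n. s j + 2)" using i by (intro sum.atLeast_Suc_lessThan) auto
    thus ?thesis using False by (simp add: s_of_z_def z_def)
  qed (simp add: s_of_z_def z_def)
  thus thesis by (rule that)
qed

text \<open>Uniqueness for the description in \<open>Psi\<close>: where the integral converges, P is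
  the product times \<omega>, and so is any rival P' after multiplication by its B'. Hence (P' - P)
  B' vanishes there, then identically, and B' is not the zero function.\<close>

lemma Psi_eqI:
  assumes n: "n \<ge> 1" and q: "resq Q > 0" and P: "laurent_fun (resq Q) n P" and AB: "omega_rational Q n \<nu> x A B"
    and B: "\<And>s. (\<And>i. 1 \<le> i \<Longrightarrow> i < n \<Longrightarrow> Re (s i) \<ge> 0) \<Longrightarrow> B s \<noteq> 0"
    and rel: "\<And>z. P z * B (s_of_z n z) =
           (\<Prod>j = 1..n. \<Prod>i = 1..<j. of_nat (resq Q) powr z j - of_nat (resq Q) powr (z i + 1)) * A (s_of_z n z)"
  shows "Psi Q n \<nu> x = P"
  unfolding Psi_def
proof (rule the_equality)
  show "laurent_fun (resq Q) n P \<and>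
     (\<exists>A B. omega_rational Q n \<nu> x A B \<and>
        (\<forall>z. P z * B (s_of_z n z) =
           (\<Prod>j = 1..n. \<Prod>i = 1..<j. of_nat (resq Q) powr z j - of_nat (resq Q) powr (z i + 1)) * A (s_of_z n z)))"
    using P AB rel by blast
next
  let ?D = "\<lambda>z. \<Prod>j = 1..n. \<Prod>i = 1..<j. of_nat (resq Q) powr z j - of_nat (resq Q) powr (z i + 1)"
  fix P' assume "laurent_fun (resq Q) n P' \<and>
     (\<exists>A B. omega_rational Q n \<nu> x A B \<and> (\<forall>z. P' z * B (s_of_z n z) = ?D z * A (s_of_z n z)))"
  then obtain A' B' where P': "laurent_fun (resq Q) n P'" and AB': "omega_rational Q n \<nu> x A' B'"
    and rel': "\<And>z. P' z * B' (s_of_z n z) = ?D z * A' (s_of_z n z)" by blast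
  have lB': "laurent_fun (resq Q) n B'" using AB' by (simp add: omega_rational_def)
  obtain s where s: "B' s \<noteq> 0" using AB' by (auto simp: omega_rational_def)
  \<comment> \<open>A Laurent function sees only the coordinates 1 to n, so the nonzero value of B'
    is also taken at some \<open>s_of_z n y\<close>.\<close>
  obtain y where "\<And>i. i \<in> {1..n} \<Longrightarrow> s_of_z n y i = s i" using s_of_z_surj[OF n] by blast
  hence "B' (s_of_z n y) = B' s" using lB' unfolding laurent_fun_def by force
  hence y: "B' (s_of_z n y) \<noteq> 0" using s by simp
  have dl: "laurent_fun (resq Q) n (\<lambda>z. P' z - P z)" by (rule laurent_diff[OF q P' P])
  have bl: "laurent_fun (resq Q) n (\<lambda>z. B' (s_of_z n z))" by (rule laurent_s_of_z[OF q lB' n])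
  have "(P' z - P z) * B' (s_of_z n z) = 0" for z
  proof (rule laurent_vanish[OF q laurent_mult[OF q dl bl]])
    fix z assume z: "\<And>i. 1 \<le> i \<Longrightarrow> i < n \<Longrightarrow> Re (s_of_z n z i) \<ge> 0"
    let ?w = "omega_int Q n \<nu> x (s_of_z n z)"
    have w: "A (s_of_z n z) = B (s_of_z n z) * ?w" "A' (s_of_z n z) = B' (s_of_z n z) * ?w"
      using AB AB' z unfolding omega_rational_def by simp_all
    have 1: "P z * B (s_of_z n z) = ?D z * ?w * B (s_of_z n z)" and 2: "P' z * B' (s_of_z n z) = ?D z * ?w * B' (s_of_z n z)"
      unfolding rel rel' w by (simp_all only: mult_ac)
    have "B (s_of_z n z) \<noteq> 0" using z by (rule B)
    with 1 have 3: "P z = ?D z * ?w" by (rule mult_right_cancel[THEN iffD1, rotated])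
    show "(P' z - P z) * B' (s_of_z n z) = 0" unfolding left_diff_distrib 2 3 by (rule diff_self)
  qed
  hence "P' z - P z = 0" for z by (rule laurent_integral_domain[OF q dl bl _ y])
  thus "P' = P" by (intro ext) simp
qed

lemma quadratic_root:
  obtains t :: complex where "t * (l - t) = p"
proof
  let ?d = "csqrt (l\<^sup>2 - 4 * p)"
  have 1: "l - (l + ?d) / 2 = (l - ?d) / 2" by (simp add: diff_divide_distrib add_divide_distrib)
  have 2: "(l + ?d) * (l - ?d) = l\<^sup>2 - ?d\<^sup>2" by (simp only: square_diff_square_factored power2_eq_square)
  show "(l + ?d) / 2 * (l - (l + ?d) / 2) = p" unfolding 1 times_divide_times_eq 2 by simp
qed

text \<open>With a = q^z1, b = q^z2, r = q and t = m, substituting q^-s2 = b / r and q^-s1 = a r^2 /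
  b turns the eigenvalue of \<omega> into lam.\<close>

lemma hecke_parameter_identity:
  fixes a b r t :: complex
  assumes "b \<noteq> 0" "r \<noteq> 0" shows "b / r * (t + a / b * r\<^sup>2) = t * (b / r) + a * r"
  using assms by (simp add: distrib_left power2_eq_square)

text \<open>The factor b - a r from the product over i < j cancels the denominator 1 - a r / b of
  \<omega> at the antidiagonal matrix and leaves (r - 1) a b.\<close>

lemma psi_factor_identity:
  fixes a b r u v :: complex
  assumes "b \<noteq> 0" "r \<noteq> 0"
  shows "u * v * ((r - 1) * (a * b)) * (1 - a / b * r\<^sup>2 / r) =
        (b - a * r) * (u * v * (b / r * (a / b * r\<^sup>2) * (1 - 1 / r)))"
proof -
  have 1: "a / b * r\<^sup>2 / r = a * r / b" and 2: "b / r * (a / b * r\<^sup>2) * (1 - 1 / r) = a * (r - 1)"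
    and 3: "b * (1 - a * r / b) = b - a * r"
    using assms by (simp_all add: power2_eq_square right_diff_distrib)
  show ?thesis unfolding 1 2 unfolding 3[symmetric] by (simp only: mult_ac)
qed

section \<open>\<Psi> in rank two and its parameters\<close>

context quaternion_haar_two begin

lemma laurent_gs:
  assumes q0: "(p::nat) > 0" and "laurent_fun p m c" "laurent_fun p m (\<lambda>w. inverse (c w))" "laurent_fun p m lam"
  shows "laurent_fun p m (\<lambda>w. gs (c w) (lam w) e)"
proof (induction e rule: induct_nat_012)
  note l = laurent_mult[OF q0] laurent_diff[OF q0] laurent_const[OF q0]
  case 0
  have "laurent_fun p m (\<lambda>w. lam w * inverse (c w) * (1 / of_nat (card reps + 1)))" by (intro l assms)
  thus ?case by (simp add: divide_inverse mult_ac)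
next
  note l = laurent_mult[OF q0] laurent_diff[OF q0] laurent_const[OF q0]
  case 1
  have "laurent_fun p m (\<lambda>w. lam w * inverse (c w) * (1 / of_nat (card reps + 1)))" by (intro l assms)
  hence "laurent_fun p m (\<lambda>w. gs (c w) (lam w) 0)" by (simp add: divide_inverse mult_ac)
  hence "laurent_fun p m (\<lambda>w. (lam w * gs (c w) (lam w) 0 - of_nat zeros) * (1 / of_nat (1 + (card reps - zeros))))"
    by (intro l assms)
  thus ?case by (simp add: divide_inverse del: of_nat_add)
next
  note l = laurent_mult[OF q0] laurent_diff[OF q0] laurent_const[OF q0]
  case (ge2 e)
  hence "laurent_fun p m (\<lambda>w. (lam w * gs (c w) (lam w) (Suc e) - c w * gs (c w) (lam w) e) * (1 / of_nat (card reps)))"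
    by (intro l assms)
  thus ?case by (simp add: divide_inverse)
qed

text \<open>One pair l, g evaluates every eigenfunction at x, in particular \<omega>(.; s) for Re s1
  \<ge> 0. This makes A and B explicit there, and \<open>Psi_eqI\<close> extends the formula to all
  z.\<close>

lemma Psi_two:
  assumes x: "x \<in> HX"
  obtains l g where
    "\<And>F c lam. eigen F c lam \<Longrightarrow> c \<noteq> 0 \<Longrightarrow> F x = c powi l * g c lam * F Bl"
    "\<And>z. Psi Q 2 \<nu> x z = (of_nat q powr z 1 * of_nat q powr z 2) powi l *
       g (of_nat q powr z 1 * of_nat q powr z 2)
         (of_nat (card reps) * (of_nat q powr z 2 / of_nat q) + of_nat q powr z 1 * of_nat q) *
       ((of_nat q - 1) * (of_nat q powr z 1 * of_nat q powr z 2))"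
proof -
  obtain l :: int and g where g: "g = (\<lambda>c lam. 1) \<or> (\<exists>e. g = (\<lambda>c lam. gs c lam e))"
    and lg: "\<And>F c lam. eigen F c lam \<Longrightarrow> c \<noteq> 0 \<Longrightarrow> F x = c powi l * g c lam * F Bl"
    using eigen_determined[OF x] unfolding Bl_def by metis
  have q0: "resq Q > 0" using q_pos by simp
  have qc: "(of_nat q :: complex) \<noteq> 0" using q_nz by simp
  have laurent_g: "laurent_fun q 2 (\<lambda>w. g (c w) (lam w))"
    if "laurent_fun q 2 c" "laurent_fun q 2 (\<lambda>w. inverse (c w))" "laurent_fun q 2 lam" for c lam
    using g laurent_const[OF q0] laurent_gs[OF q0 that] by auto
  note lin = laurent_add[OF q0] laurent_mult[OF q0] laurent_diff[OF q0] laurent_const[OF q0] laurent_power_int[OF q0]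
    laurent_power[OF q0]
  define cs where "cs s = of_nat q powr (- s 1) * (of_nat q powr (- s 2))\<^sup>2" for s :: "nat \<Rightarrow> complex"
  define ls where "ls s = of_nat q powr (- s 2) * (of_nat (card reps) + of_nat q powr (- s 1))" for s :: "nat \<Rightarrow> complex"
  define A where "A s = cs s powi l * g (cs s) (ls s) * (of_nat q powr (- s 2) * of_nat q powr (- s 1) * (1 - 1 / of_nat q))" for s
  define B where "B s = 1 - of_nat q powr (- s 1) / of_nat q" for s :: "nat \<Rightarrow> complex"
  have var: "laurent_fun q 2 (\<lambda>w. of_nat q powr w i)" "laurent_fun q 2 (\<lambda>w. of_nat q powr (- w i))" if "i \<in> {1, 2}" for i
    using that by (auto intro!: laurent_var[OF q0])
  have lcs: "laurent_fun q 2 cs" unfolding cs_def by (intro lin var) auto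
  have ics: "inverse (cs s) = of_nat q powr (s 1) * (of_nat q powr (s 2))\<^sup>2" for s
    unfolding cs_def by (simp add: powr_minus power_inverse)
  have lics: "laurent_fun q 2 (\<lambda>s. inverse (cs s))" unfolding ics by (intro lin var) auto
  have lls: "laurent_fun q 2 ls" unfolding ls_def by (intro lin var) auto
  have lA: "laurent_fun q 2 A" unfolding A_def by (intro lin var laurent_g lcs lics lls) auto
  have "laurent_fun q 2 (\<lambda>s. 1 - of_nat q powr (- s 1) * (1 / of_nat q))" by (intro lin var) auto
  hence lB: "laurent_fun q 2 B" by (simp add: B_def[abs_def])
  \<comment> \<open>On this half plane q^-s1 has norm at most 1, so it cannot equal q.\<close>
  have B0: "B s \<noteq> 0" if "0 \<le> Re (s 1)" for s
  proof
    assume "B s = 0"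
    hence "of_nat q powr (- s 1) = (of_nat q :: complex)" using qc by (simp add: B_def field_simps)
    hence "real q powr (- Re (s 1)) = real q" using norm_powr_real_powr[of "of_nat q" "- s 1"] by simp
    moreover have "real q powr (- Re (s 1)) \<le> real q powr 0" using that q_gt_1 by (intro powr_mono) auto
    ultimately show False using q_gt_1 by simp
  qed
  have om: "B s * omega_int Q 2 \<nu> x s = A s" if s: "0 \<le> Re (s 1)" for s
  proof -
    have c0: "cs s \<noteq> 0" using qc by (simp add: cs_def)
    have "omega_int Q 2 \<nu> x s = cs s powi l * g (cs s) (ls s) * omega_int Q 2 \<nu> Bl s"
      using lg[OF omega_eigen[of s, OF s]] c0 unfolding cs_def[symmetric] ls_def[symmetric] by simp
    hence B: "B s * omega_int Q 2 \<nu> x s = cs s powi l * g (cs s) (ls s) * (B s * omega_int Q 2 \<nu> Bl s)" by simp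
    show ?thesis unfolding A_def B unfolding B_def omega_Bl[of s, OF s] ..
  qed
  have AB: "omega_rational Q 2 \<nu> x A B"
    unfolding omega_rational_def
  proof (intro conjI allI impI lA lB)
    show "\<exists>s. B s \<noteq> 0" using B0[of "\<lambda>_. 0"] by auto
    fix s :: "nat \<Rightarrow> complex" assume "\<forall>i. 1 \<le> i \<and> i < 2 \<longrightarrow> 0 \<le> Re (s i)"
    thus "B s * omega_int Q 2 \<nu> x s = A s" by (intro om) simp
  qed
  let ?a = "\<lambda>z. of_nat q powr z 1 :: complex" and ?b = "\<lambda>z. of_nat q powr z 2 :: complex"
  define P where "P z = (?a z * ?b z) powi l * g (?a z * ?b z) (of_nat (card reps) * (?b z / of_nat q) + ?a z * of_nat q) *
       ((of_nat q - 1) * (?a z * ?b z))" for z :: "nat \<Rightarrow> complex"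
  have lab: "laurent_fun q 2 (\<lambda>z. ?a z * ?b z)" by (intro lin var) auto
  have iab: "inverse (?a z * ?b z) = of_nat q powr (- z 1) * of_nat q powr (- z 2)" for z
    by (simp add: powr_minus)
  have liab: "laurent_fun q 2 (\<lambda>z. inverse (?a z * ?b z))" unfolding iab by (intro lin var) auto
  have "laurent_fun q 2 (\<lambda>z. of_nat (card reps) * (?b z * (1 / of_nat q)) + ?a z * of_nat q)" by (intro lin var) auto
  hence llam: "laurent_fun q 2 (\<lambda>z. of_nat (card reps) * (?b z / of_nat q) + ?a z * of_nat q)" by simp
  have lP: "laurent_fun q 2 P" unfolding P_def by (intro lin lab liab llam laurent_g)
  have rel: "P z * B (s_of_z 2 z) =
    (\<Prod>j = 1..2. \<Prod>i = 1..<j. of_nat (resq Q) powr z j - of_nat (resq Q) powr (z i + 1)) * A (s_of_z 2 z)" for z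
  proof -
    have ab0: "?a z \<noteq> 0" "?b z \<noteq> 0" using qc by auto
    have X: "of_nat q powr (- s_of_z 2 z 1) = ?a z / ?b z * (of_nat q)\<^sup>2"
    proof -
      have "of_nat q powr (- s_of_z 2 z 1) = of_nat q powr (z 1 - z 2 + 2)" by (simp add: s_of_z_def algebra_simps numeral_2_eq_2)
      also have "\<dots> = ?a z / ?b z * (of_nat q)\<^sup>2" using qc by (simp add: powr_add powr_diff)
      finally show ?thesis .
    qed
    have Y: "of_nat q powr (- s_of_z 2 z 2) = ?b z / of_nat q"
      using qc by (simp add: s_of_z_def powr_diff)
    have c: "cs (s_of_z 2 z) = ?a z * ?b z" unfolding cs_def X Y using ab0 qc by (simp add: field_simps power2_eq_square)
    have lm: "ls (s_of_z 2 z) = of_nat (card reps) * (?b z / of_nat q) + ?a z * of_nat q"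
      unfolding ls_def X Y by (rule hecke_parameter_identity[OF ab0(2) qc])
    have "{1..2::nat} = {1, 2}" by auto
    hence pr: "(\<Prod>j = 1..2. \<Prod>i = 1..<j. of_nat (resq Q) powr z j - of_nat (resq Q) powr (z i + 1)) =
      ?b z - ?a z * of_nat q"
      using qc by (simp add: powr_add numeral_2_eq_2)
    show ?thesis
      unfolding pr A_def P_def c lm B_def X Y by (rule psi_factor_identity[OF ab0(2) qc])
  qed
  have psi: "Psi Q 2 \<nu> x = P"
    by (rule Psi_eqI[OF _ q0 lP AB _ rel]) (auto intro!: B0)
  show thesis by (rule that[of l g]) (use lg in blast, simp only: psi P_def)
qed

lemma spherical_two:
  assumes \<Phi>: "spherical_function Q 2 \<mu> \<Phi>"
  shows "\<exists>c z. \<forall>x\<in>HX. \<Phi> x = c * Psi Q 2 \<nu> x z"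
proof -
  obtain c lam where c: "c \<noteq> 0" and ev: "eigen \<Phi> c lam" using spherical_is_eigen[OF \<Phi>] .
  have "(of_nat q :: complex) \<noteq> of_nat 0" "(of_nat q :: complex) \<noteq> of_nat 1"
    using q_ge_3 by (auto simp only: of_nat_eq_iff)
  hence qc: "(of_nat q :: complex) \<noteq> 0" "(of_nat q :: complex) - 1 \<noteq> 0" by (simp_all only: of_nat_0 of_nat_1 right_minus_eq simp_thms)
  \<comment> \<open>T is to become q^(z1 + 1) and lam - T to become m q^(z2 - 1); their product must
    then be m c. Since m c is not 0, neither is T, so both powers of q have logarithms.\<close>
  obtain T where T: "T * (lam - T) = of_nat (card reps) * c" by (rule quadratic_root)
  with c card_reps_pos have T0: "T \<noteq> 0" by auto
  define a where "a = T / of_nat q"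
  define b where "b = c / a"
  have a0: "a \<noteq> 0" using T0 qc by (simp add: a_def)
  have b0: "b \<noteq> 0" using a0 c by (simp add: b_def)
  have ab: "a * b = c" using a0 by (simp add: b_def)
  have "lam - T = of_nat (card reps) * (b / of_nat q)"
    using T0 qc T by (simp add: b_def a_def nonzero_eq_divide_eq mult.commute)
  hence lam: "of_nat (card reps) * (b / of_nat q) + a * of_nat q = lam"
    using qc by (simp add: a_def diff_eq_eq)
  have q1: "1 < q" using q_ge_3 by simp
  obtain z1 where z1: "of_nat q powr z1 = a" using powr_surj[OF a0 q1] .
  obtain z2 where z2: "of_nat q powr z2 = b" using powr_surj[OF b0 q1] .
  define z where "z i = (if i = 1 then z1 else z2)" for i :: nat
  have z: "of_nat q powr z 1 = a" "of_nat q powr z 2 = b" by (simp_all add: z_def z1 z2)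
  \<comment> \<open>The constant is the ratio of the values at \<open>Bl\<close>, where \<Psi>
    equals (q - 1) c.\<close>
  have "\<Phi> x = \<Phi> Bl / ((of_nat q - 1) * c) * Psi Q 2 \<nu> x z" if x: "x \<in> HX" for x
  proof -
    obtain l g where lg: "\<And>F c lam. eigen F c lam \<Longrightarrow> c \<noteq> 0 \<Longrightarrow> F x = c powi l * g c lam * F Bl"
      "\<And>z. Psi Q 2 \<nu> x z = (of_nat q powr z 1 * of_nat q powr z 2) powi l *
       g (of_nat q powr z 1 * of_nat q powr z 2)
         (of_nat (card reps) * (of_nat q powr z 2 / of_nat q) + of_nat q powr z 1 * of_nat q) *
       ((of_nat q - 1) * (of_nat q powr z 1 * of_nat q powr z 2))"
      by (rule Psi_two[OF x]) blast
    have "Psi Q 2 \<nu> x z = c powi l * g c lam * ((of_nat q - 1) * c)" unfolding lg(2) z ab lam ..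
    moreover have "\<Phi> x = c powi l * g c lam * \<Phi> Bl" by (rule lg(1)[OF ev c])
    ultimately show ?thesis using c qc by simp
  qed
  thus ?thesis by blast
qed

end

section \<open>Rank one\<close>

locale quaternion_haar_one = quaternion_haar Q \<iota> \<tau> 1 \<mu> \<nu>
  for Q :: "('k :: field_char_0, 'd :: division_ring) quat_datum" and \<iota> \<tau> and \<mu> \<nu> :: "'d mat measure"
begin

declare One_nat_def [simp del]

definition sc :: "'d \<Rightarrow> 'd mat" where "sc a = Matrix.mat 1 1 (\<lambda>_. a)"

lemma sc_index [simp]: "sc a $$ (0, 0) = a"
  by (simp add: sc_def)

lemma sc_carrier [simp]: "sc a \<in> carrier_mat 1 1"
  by (simp add: sc_def)

lemma sc_cases: "A \<in> carrier_mat 1 1 \<Longrightarrow> A = sc (A $$ (0, 0))"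
  by (rule eq_matI) (auto simp: sc_def)

lemma sc_mult: "sc a * sc b = sc (a * b)"
  by (rule eq_matI) (auto simp: sc_def scalar_prod_def)

lemma sc_one: "1\<^sub>m 1 = sc 1"
  by (rule eq_matI) (auto simp: sc_def)

lemma act_sc: "act Q (sc u) (sc (em a)) = sc (em (N u * a))"
proof -
  have "ad (sc u) = sc (st u)" by (rule eq_matI) (auto simp: sc_def adj_def)
  moreover have "u * em a * st u = em (N u * a)"
    by (metis em_N em_commute em_mult mult.assoc)
  ultimately show ?thesis by (simp add: act_def sc_mult)
qed

lemma HX_one:
  assumes "x \<in> HX" obtains a where "a \<noteq> 0" "x = sc (em a)"
proof -
  have x: "x \<in> G" "ad x = x" using assms by (auto simp: X_iff)
  have xs: "x = sc (x $$ (0, 0))" by (rule sc_cases[OF G_carrier[OF x(1)]])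
  have "st (x $$ (0, 0)) = x $$ (0, 0)" using ad_index[OF G_carrier[OF x(1)], of 0 0] x(2) by simp
  then obtain a where a: "x $$ (0, 0) = em a" by (rule st_fixed)
  have "x * iv x = sc (em a * iv x $$ (0, 0))"
    using xs sc_cases[OF G_carrier[OF GL.inv_closed[OF x(1)]]] a sc_mult by metis
  hence "sc 1 = sc (em a * iv x $$ (0, 0))" using x(1) by (simp add: sc_one)
  hence "1 = em a * iv x $$ (0, 0)" by (metis sc_index)
  hence "a \<noteq> 0" by auto
  thus thesis using that xs a by simp
qed

lemma sc_inverse: "u \<noteq> 0 \<Longrightarrow> sc u \<in> G \<and> iv (sc u) = sc (inverse u)"
  by (rule iv_eqI) (simp_all add: sc_mult sc_one)

lemma sc_HX: "a \<noteq> 0 \<Longrightarrow> sc (em a) \<in> HX"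
  using sc_inverse[of "em a"] by (auto simp: X_iff adj_def sc_def)

lemma bd_sc: "bd r (sc u) \<longleftrightarrow> w u \<le> r"
  by (simp add: bd_def)

lemma K_one_iff: "h \<in> K \<longleftrightarrow> (\<exists>u. w u = 1 \<and> h = sc u)"
proof
  assume h: "h \<in> K"
  obtain u where u: "h = sc u" using sc_cases[OF G_carrier[OF K_G[OF h]]] by blast
  obtain v where v: "iv h = sc v" using sc_cases[OF G_carrier[OF K_G[OF K_iv[OF h]]]] by blast
  have "sc (u * v) = sc 1" using iv_mult(2)[OF K_G[OF h]] unfolding v by (simp add: u sc_mult sc_one)
  hence "u * v = 1" by (metis sc_index)
  hence uv: "w u * w v = 1" by (metis w_mult w_1)
  have le: "w u \<le> 1" "w v \<le> 1" using h K_iv[OF h] K_bd u v by (metis bd_sc)+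
  hence "w u * w v \<le> w u * 1" by (intro mult_left_mono) auto
  hence "w u = 1" using uv le by simp
  thus "\<exists>u. w u = 1 \<and> h = sc u" using u by blast
next
  assume "\<exists>u. w u = 1 \<and> h = sc u"
  then obtain u where u: "w u = 1" "h = sc u" by blast
  hence "u \<noteq> 0" by auto
  thus "h \<in> K" using sc_inverse[of u] u by (simp add: K_iff bd_sc w_inverse w_divide)
qed

lemma TT_one: "TT = sc \<tau>"
  by (rule eq_matI) (auto simp: TT_def sc_def)

text \<open>Units are norms, so the K-orbits on X are classified by the size of the entry and the
  operator of TT alone determines \<Phi>. The integrand of \<omega> is constant on K, so \<Psi>(x;
  z) is q^(m z) for an entry of size q^-m.\<close>

lemma spherical_one:
  assumes \<Phi>: "spherical_function Q 1 \<mu> \<Phi>"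
  shows "\<exists>c z. \<forall>x\<in>HX. \<Phi> x = c * Psi Q 1 \<nu> x z"
proof -
  obtain c where c: "c \<noteq> 0" "\<And>x. x \<in> HX \<Longrightarrow> \<Phi> (act Q TT x) = c * \<Phi> x" by (rule spherical_TT[OF \<Phi>]) blast
  have inv: "K_invariant \<Phi>" by (rule spherical_K_invariant[OF \<Phi>])
  have q0: "resq Q > 0" using q_pos by simp
  have qc: "(of_nat q :: complex) \<noteq> 0" using q_nz by simp
  have shift: "\<Phi> (sc (em (\<eta> powi m))) = c powi m * \<Phi> (sc 1)" for m
  proof -
    have "\<Phi> (sc (em (\<eta> powi (m + 1)))) = c * \<Phi> (sc (em (\<eta> powi m)))" for m
      using c(2)[OF sc_HX[of "\<eta> powi m"]] by (simp add: TT_one act_sc power_int_add_1')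
    from power_int_recurrence[OF c(1), of "\<lambda>m. \<Phi> (sc (em (\<eta> powi m)))", OF this] show ?thesis by simp
  qed
  have q1: "1 < q" using q_ge_3 by simp
  obtain z1 where z1: "of_nat q powr z1 = c" using powr_surj[OF c(1) q1] .
  have "\<Phi> x = \<Phi> (sc 1) * Psi Q 1 \<nu> x (\<lambda>_. z1)" if x: "x \<in> HX" for x
  proof -
    obtain a where a: "a \<noteq> 0" "x = sc (em a)" using x by (rule HX_one)
    obtain m' where "av a = real q powi m'" using a(1) by (rule av_values)
    then obtain m where m: "av a = real q powi (- m)" by (metis minus_minus)
    have aveta: "av (\<eta> powi m) = real q powi (- m)"
      by (simp add: av_power_int av_eta power_int_minus power_int_inverse divide_inverse)
    have "av (\<eta> powi m / a) = 1" using a(1) by (simp add: av_divide aveta flip: m)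
    then obtain u where u: "N u = \<eta> powi m / a" "w u = 1" by (rule norm_surj)
    have "sc u \<in> K" using u(2) K_one_iff by blast
    hence "\<Phi> (act Q (sc u) x) = \<Phi> x" using inv x by (simp add: K_invariant_def)
    moreover have "act Q (sc u) x = sc (em (\<eta> powi m))" using a by (simp add: act_sc u(1))
    ultimately have \<Phi>x: "\<Phi> x = c powi m * \<Phi> (sc 1)" using shift[of m] by simp
    have om: "omega_int Q 1 \<nu> x s = (of_nat q powr (- s 1)) powi m" for s
    proof -
      have "dpow Q 1 (act Q h x) s = (of_nat q powr (- s 1)) powi m" if "h \<in> K" for h
      proof -
        obtain v where v: "w v = 1" "h = sc v" using \<open>h \<in> K\<close> K_one_iff by blast
        have e: "act Q h x $$ (0, 0) = em (N v * a)" using v a by (simp add: act_sc)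
        have "N v * a \<noteq> 0" using v a by auto
        moreover have "av (N v * a) = real q powi (- m)" using v(1) m by (simp add: av_mult w_def)
        ultimately show ?thesis using dpf_1[OF e] complex_powr_av[of m "s 1"] by (simp add: dpow_def)
      qed
      hence "omega_int Q 1 \<nu> x s = (\<integral>h. (of_nat q powr (- s 1)) powi m \<partial>\<nu>)"
        unfolding omega_int_def by (intro Bochner_Integration.integral_cong) auto
      also have "\<dots> = (of_nat q powr (- s 1)) powi m" using prob_nu by (simp add: measure_def)
      finally show ?thesis .
    qed
    have lpow: "laurent_fun q 1 (\<lambda>z. (of_nat q powr z 1) powi m)" "laurent_fun q 1 (\<lambda>z. (of_nat q powr (- z 1)) powi m)"
      by (rule laurent_power_int[OF q0]; use laurent_var[OF q0, of 1 1] in \<open>simp add: powr_minus\<close>)+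
    have "Psi Q 1 \<nu> x = (\<lambda>z. (of_nat q powr z 1) powi m)"
    proof (rule Psi_eqI[where A = "\<lambda>s. (of_nat q powr (- s 1)) powi m" and B = "\<lambda>_. 1"])
      show "omega_rational Q 1 \<nu> x (\<lambda>s. (of_nat q powr (- s 1)) powi m) (\<lambda>_. 1)"
        unfolding omega_rational_def using om lpow laurent_const[OF q0] by simp
    qed (use q0 lpow in \<open>simp_all add: s_of_z_def\<close>)
    thus ?thesis by (simp add: \<Phi>x z1)
  qed
  thus ?thesis by blast
qed

end

theorem proposition5p2:
  fixes Q :: "('k :: field_char_0, 'd :: division_ring) quat_datum"
    and n :: nat
    and \<mu> \<nu> :: "'d mat measure"
    and \<Phi> :: "'d mat \<Rightarrow> complex"
  assumes "padic_quaternion Q"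
    and "n = 1 \<or> n = 2"
    and "haar_G Q n \<mu>"
    and "haar_K Q n \<nu>"
    and "spherical_function Q n \<mu> \<Phi>"
  shows "\<exists>(c :: complex) (z\<^sub>0 :: nat \<Rightarrow> complex). \<forall>x \<in> herm Q n. \<Phi> x = c * Psi Q n \<nu> x z\<^sub>0"
proof -
  interpret quaternion Q by unfold_locales (rule assms(1))
  obtain \<iota> \<tau> where basis: "anticommuting \<iota> \<tau>" "w \<iota> = 1" "w \<tau> = 1 / real (resq Q)"
    using standard_basis_exists by blast
  from assms(2) show ?thesis
  proof
    assume n: "n = 1"
    interpret quaternion_haar_one Q \<iota> \<tau> \<mu> \<nu>
      by unfold_locales (use basis assms(3,4) n in simp_all)
    show ?thesis using spherical_one assms(5) n by simp
  next
    assume n: "n = 2"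
    interpret quaternion_haar_two Q \<iota> \<tau> \<mu> \<nu>
      by unfold_locales (use basis assms(3,4) n in simp_all)
    show ?thesis using spherical_two assms(5) n by simp
  qed
qed

end
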